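(* Let $\varepsilon\in(0,1]$ and $\lambda>0$ be given. Then there exist $n_0$ and $\lambda'>0$ such that the following holds for all $n\geq n_0$ and all $p$ with $\lambda' n^{-3/5}\log n\leq p\leq \lambda n^{-1/2}$: let $G=G(n,p)$ and let the initial opinions $s_0(v)$, $v\in[n]$, be chosen independently and uniformly at random from $\{+1,-1\}$ (independently of $G$). Then with probability at least $1-\varepsilon$, the vertices of $G$ reach the unanimous state $\mathrm{sgn}\sum_{v} s_0(v)$ after six days, i.e. $s_6(v)=\mathrm{sgn}\sum_{u\in[n]} s_0(u)$ for every $v\in[n]$.
   Context: $G(n,p)$ is the Erdős–Rényi random graph on vertex set $[n]=\{1,\dots,n\}$ in which each pair is an edge independently with probability $p$. Majority dynamics on a graph $G$: given initial opinions $s_0:V(G)\to\{\pm1\}$, for $t\geq 1$ every vertex updates simultaneously by $s_t(v)=\mathrm{sgn}\sum_{u\sim v}s_{t-1}(u)$ if $\sum_{u\sim v}s_{t-1}(u)\neq 0$, and $s_t(v)=s_{t-1}(v)$ otherwise. Logarithms are natural. *)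

theory Defs
  imports "HOL-Probability.Probability"
begin

text \<open>A simple graph on \<open>{1..n}\<close> is given by its set of edges, each edge being a
  two-element subset of \<open>{1..n}\<close>.\<close>

definition vertex_pairs :: "nat \<Rightarrow> nat set set" where
  "vertex_pairs n = {e. e \<subseteq> {1..n} \<and> card e = 2}"

text \<open>\<^const>\<open>bernoulli_pmf\<close> truncates its parameter to \<open>[0, 1]\<close>, so the definition is the
  intended one only for \<open>0 \<le> p \<le> 1\<close>.\<close>

definition random_graph :: "nat \<Rightarrow> real \<Rightarrow> nat set set pmf" where
  "random_graph n p =
     map_pmf (\<lambda>X. {e \<in> vertex_pairs n. X e})
       (Pi_pmf (vertex_pairs n) False (\<lambda>_. bernoulli_pmf p))"

text \<open>Opinions outside \<open>{1..n}\<close> get the dummy value \<open>0\<close>; they never influence the dynamics,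
  since no edge leaves \<open>{1..n}\<close>.\<close>

definition random_opinions :: "nat \<Rightarrow> (nat \<Rightarrow> int) pmf" where
  "random_opinions n = Pi_pmf {1..n} 0 (\<lambda>_. pmf_of_set {1, -1})"

definition neighbours :: "'v set set \<Rightarrow> 'v \<Rightarrow> 'v set" where
  "neighbours E v = {u. u \<noteq> v \<and> {u, v} \<in> E}"

definition majority_step :: "'v set set \<Rightarrow> ('v \<Rightarrow> int) \<Rightarrow> 'v \<Rightarrow> int" where
  "majority_step E s v =
     (if (\<Sum>u\<in>neighbours E v. s u) \<noteq> 0 then sgn (\<Sum>u\<in>neighbours E v. s u) else s v)"

primrec majority_dynamics :: "'v set set \<Rightarrow> ('v \<Rightarrow> int) \<Rightarrow> nat \<Rightarrow> 'v \<Rightarrow> int" where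
  "majority_dynamics E s0 0 = s0"
| "majority_dynamics E s0 (Suc t) = majority_step E (majority_dynamics E s0 t)"

end

theory Submission
  imports Defs
begin

text \<open>
  Fix opinions \<open>s\<close> with \<open>\<bar>\<Sum> s\<bar>\<close> of order \<open>sqrt n\<close> and write \<open>M = n p\<close>. Once the neighbourhood \<open>U\<close> of a
  vertex \<open>v\<close> and the edges inside \<open>U\<close> are exposed, the first-day opinions on \<open>U\<close> are independent, so the
  second-day opinion of \<open>v\<close> is a threshold of a Poisson binomial variable. Local estimates for such
  variables give a second-day bias of expectation at least of order \<open>n sqrt n p\<close>: comparing \<open>s\<close> with
  the configuration in which \<open>\<Sum> s\<close> positive vertices are flipped, every first-day opinion is shifted
  by about \<open>sqrt p\<close> and every second-day opinion by about \<open>M sqrt p / sqrt M\<close>. By the Efron-Stein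
  inequality the variance of this bias is \<open>O(n M sqrt M)\<close>, which is smaller than the square of the
  expectation by a factor \<open>sqrt M\<close>. Finally, a union bound over all configurations shows that a bias
  \<open>S\<close> leaves at most \<open>O(n\<^sup>2 / (p S\<^sup>2))\<close> vertices in the minority on the next day. Hence the minority has
  size at most \<open>n / 8\<close> on day three, \<open>O(1 / p)\<close> on day four and \<open>O(ln n / (n p\<^sup>2))\<close> on day five, too few
  to outvote the majority in any neighbourhood on day six.
\<close>

section \<open>Expectations over random subsets\<close>

text \<open>Probabilities are kept as finite weighted sums \<open>rexp\<close> until the end, so
  exposing the graph in stages is plain algebra (\<open>rexp_union\<close>); probability mass
  functions enter only through \<open>expectation_random_graph\<close> and
  \<open>expectation_random_opinions\<close>. The obstacle is dependence. For fixed opinions, two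
  vertices have dependent first-day opinions only through the edge that joins them, so the danger
  lies in edges inside the exposed sets. The bound p \<le> lam n^(-1/2) keeps n p^2 bounded by a
  constant \<open>L\<close>. Hence O(M) vertices span only O(M) edges, most of them have boundedly
  many exposed neighbours, and an imbalance of order sqrt n + M moves the mean of a fresh
  neighbourhood sum by O(1) only. The lower bound on p serves two purposes: M tends to infinity,
  which makes the variance negligible, and n^2 p^3 beats constants and squared logarithms, which the
  expansion steps need. With p \<ge> n^(-3/5) ln n each of these requirements holds with a power of
  n^(1/5) to spare. This power absorbs all constants, and so \<open>lam' = 1\<close> works once n is
  large.\<close>

definition rexp :: "('a \<Rightarrow> real) \<Rightarrow> 'a set \<Rightarrow> ('a set \<Rightarrow> real) \<Rightarrow> real" where
  "rexp q I f = (\<Sum>S\<in>Pow I. (\<Prod>i\<in>S. q i) * (\<Prod>i\<in>I - S. 1 - q i) * f S)"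

lemma rexp_empty [simp]: "rexp q {} f = f {}"
  by (simp add: rexp_def)

lemma rexp_insert:
  assumes "finite I" "i \<notin> I"
  shows "rexp q (insert i I) f = (1 - q i) * rexp q I f + q i * rexp q I (\<lambda>S. f (insert i S))"
proof -
  have disj: "Pow I \<inter> insert i ` Pow I = {}" using assms by auto
  have inj: "inj_on (insert i) (Pow I)"
    using assms(2) by (auto simp: inj_on_def) 
  have a: "(\<Prod>j\<in>insert i I - S. 1 - q j) = (1 - q i) * (\<Prod>j\<in>I - S. 1 - q j)" if "S \<in> Pow I" for S
  proof -
    have "insert i I - S = insert i (I - S)" using that assms by auto
    then show ?thesis using assms by simp
  qed
  have b: "(\<Prod>j\<in>insert i S. q j) = q i * (\<Prod>j\<in>S. q j)" if "S \<in> Pow I" for S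
    using that assms by (subst prod.insert) (auto intro: finite_subset)
  have c: "insert i I - insert i S = I - S" if "S \<in> Pow I" for S
    using that assms by auto
  have c': "I - insert i S = I - S" for S using assms by auto
  have "rexp q (insert i I) f =
      (\<Sum>S\<in>Pow I. (\<Prod>j\<in>S. q j) * (\<Prod>j\<in>insert i I - S. 1 - q j) * f S) +
      (\<Sum>S\<in>Pow I. (\<Prod>j\<in>insert i S. q j) * (\<Prod>j\<in>insert i I - insert i S. 1 - q j) * f (insert i S))"
    unfolding rexp_def Pow_insert using assms disj
    by (subst sum.union_disjoint) (auto simp: sum.reindex[OF inj])
  also have "\<dots> = (1 - q i) * rexp q I f + q i * rexp q I (\<lambda>S. f (insert i S))"
    unfolding rexp_def sum_distrib_left
    by (intro arg_cong2[where f = "(+)"] sum.cong) (auto simp: a b c c')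
  finally show ?thesis .
qed

lemma rexp_cong:
  assumes "I = J" "\<And>i. i \<in> J \<Longrightarrow> q i = r i" "\<And>S. S \<subseteq> J \<Longrightarrow> f S = g S"
  shows "rexp q I f = rexp r J g"
  unfolding rexp_def assms(1)
  by (intro sum.cong refl arg_cong2[where f = "(*)"] prod.cong) (auto simp: assms)

lemma rexp_add: "rexp q I (\<lambda>S. f S + g S) = rexp q I f + rexp q I g"
  by (simp add: rexp_def sum.distrib algebra_simps)

lemma rexp_diff: "rexp q I (\<lambda>S. f S - g S) = rexp q I f - rexp q I g"
  by (simp add: rexp_def sum_subtractf algebra_simps)

lemma rexp_cmult: "rexp q I (\<lambda>S. c * f S) = c * rexp q I f"
  by (simp add: rexp_def sum_distrib_left algebra_simps)

lemma rexp_cdiv: "rexp q I (\<lambda>S. f S / c) = rexp q I f / c"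
  using rexp_cmult[of q I "1 / c" f] by simp

lemma rexp_uminus: "rexp q I (\<lambda>S. - f S) = - rexp q I f"
  using rexp_cmult[of q I "-1" f] by simp

lemma rexp_sum: "rexp q I (\<lambda>S. \<Sum>x\<in>X. f x S) = (\<Sum>x\<in>X. rexp q I (f x))"
  unfolding rexp_def sum_distrib_left by (rule sum.swap)

lemma rexp_const: 
  assumes "finite I"
  shows "rexp q I (\<lambda>_. c) = c"
  using assms by (induction I) (auto simp: rexp_insert algebra_simps)

lemma rexp_mono:
  assumes "\<And>i. i \<in> I \<Longrightarrow> 0 \<le> q i \<and> q i \<le> 1" "\<And>S. S \<subseteq> I \<Longrightarrow> f S \<le> g S"
  shows "rexp q I f \<le> rexp q I g"
  unfolding rexp_def using assms
  by (intro sum_mono mult_left_mono mult_nonneg_nonneg prod_nonneg) auto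

lemma rexp_nonneg:
  assumes "\<And>i. i \<in> I \<Longrightarrow> 0 \<le> q i \<and> q i \<le> 1" "\<And>S. S \<subseteq> I \<Longrightarrow> 0 \<le> f S"
  shows "0 \<le> rexp q I f"
  unfolding rexp_def using assms
  by (intro sum_nonneg mult_nonneg_nonneg prod_nonneg) auto

lemma rexp_le_const:
  assumes "finite I" "\<And>i. i \<in> I \<Longrightarrow> 0 \<le> q i \<and> q i \<le> 1" "\<And>S. S \<subseteq> I \<Longrightarrow> f S \<le> c"
  shows "rexp q I f \<le> c"
  using rexp_mono[of I q f "\<lambda>_. c"] rexp_const[OF assms(1)] assms by simp

lemma rexp_abs_le:
  assumes "\<And>i. i \<in> I \<Longrightarrow> 0 \<le> q i \<and> q i \<le> 1"
  shows "\<bar>rexp q I f\<bar> \<le> rexp q I (\<lambda>S. \<bar>f S\<bar>)"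
proof -
  have "rexp q I f \<le> rexp q I (\<lambda>S. \<bar>f S\<bar>)" "rexp q I (\<lambda>S. - f S) \<le> rexp q I (\<lambda>S. \<bar>f S\<bar>)"
    using assms by (intro rexp_mono; simp)+
  then show ?thesis by (simp add: rexp_uminus)
qed

text \<open>Disjoint blocks of coordinates are independent. Every exposure of edges in stages rests
  on this identity.\<close>

lemma rexp_union:
  assumes "finite I" "finite J" "I \<inter> J = {}"
  shows "rexp q (I \<union> J) f = rexp q I (\<lambda>A. rexp q J (\<lambda>B. f (A \<union> B)))"
  using assms(1,3)
proof (induction I arbitrary: f)
  case (insert i I)
  have "rexp q (insert i (I \<union> J)) f = (1 - q i) * rexp q (I \<union> J) f + q i * rexp q (I \<union> J) (\<lambda>S. f (insert i S))"
    using insert assms(2) by (intro rexp_insert) auto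
  then show ?case using insert by (simp add: rexp_insert)
qed simp

lemma rexp_swap:
  "rexp q I (\<lambda>A. rexp r J (\<lambda>B. f A B)) = rexp r J (\<lambda>B. rexp q I (\<lambda>A. f A B))"
proof -
  have "rexp q I (\<lambda>A. rexp r J (\<lambda>B. f A B)) = (\<Sum>A\<in>Pow I. \<Sum>B\<in>Pow J.
      ((\<Prod>i\<in>A. q i) * (\<Prod>i\<in>I - A. 1 - q i)) * ((\<Prod>i\<in>B. r i) * (\<Prod>i\<in>J - B. 1 - r i)) * f A B)"
    by (simp add: rexp_def sum_distrib_left mult_ac)
  also have "\<dots> = rexp r J (\<lambda>B. rexp q I (\<lambda>A. f A B))"
    by (subst sum.swap) (simp add: rexp_def sum_distrib_left mult_ac)
  finally show ?thesis .
qed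

lemma rexp_restrict:
  assumes "finite I" "J \<subseteq> I"
  shows "rexp q I (\<lambda>S. f (S \<inter> J)) = rexp q J f"
proof -
  have fin: "finite J" "finite (I - J)" using assms by (auto intro: finite_subset)
  have "rexp q (J \<union> (I - J)) (\<lambda>S. f (S \<inter> J)) = rexp q J (\<lambda>A. rexp q (I - J) (\<lambda>B. f ((A \<union> B) \<inter> J)))"
    using fin by (intro rexp_union) auto
  also have "\<dots> = rexp q J (\<lambda>A. rexp q (I - J) (\<lambda>B. f A))"
    by (intro rexp_cong refl arg_cong[where f = f]) auto
  also have "\<dots> = rexp q J f" by (simp add: rexp_const fin)
  finally show ?thesis using assms by (simp add: Un_absorb1)
qed

text \<open>Deleting the set \<open>F\<close> is the same as giving it weight zero. In this form the
  deletion can be compared with the original weights, one coordinate after the other.\<close>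

lemma rexp_zero:
  assumes "finite I" "\<And>i. i \<in> F \<Longrightarrow> q i = 0" "F \<subseteq> I"
  shows "rexp q I f = rexp q (I - F) f"
proof -
  have fF: "finite F" using assms finite_subset by auto
  have *: "rexp q F g = g {}" if "\<And>i. i \<in> F \<Longrightarrow> q i = 0" for g
    using fF that by (induction F arbitrary: g) (auto simp: rexp_insert)
  have "rexp q ((I - F) \<union> F) f = rexp q (I - F) (\<lambda>A. rexp q F (\<lambda>B. f (A \<union> B)))"
    using fF assms by (intro rexp_union) auto
  then show ?thesis using assms by (simp add: * Un_absorb2)
qed

lemma rexp_image:
  assumes "finite I" "inj_on h I"
  shows "rexp q (h ` I) f = rexp (\<lambda>i. q (h i)) I (\<lambda>S. f (h ` S))"
  using assms
  by (induction I arbitrary: f) (auto simp: rexp_insert)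

text \<open>Membership of \<open>i\<close> with probability \<open>q i\<close> is non-membership
  with probability \<open>1 - q i\<close>. Complementing on \<open>N\<close> later turns a sum of
  signs into a cardinality.\<close>

lemma rexp_flip:
  assumes "finite I" 
  shows "rexp q I f = rexp (\<lambda>i. if i \<in> N then 1 - q i else q i) I (\<lambda>S. f (S - N \<union> (I \<inter> N - S)))"
  using assms
proof (induction I arbitrary: f)
  case (insert i I)
  let ?r = "\<lambda>i. if i \<in> N then 1 - q i else q i"
  have a: "rexp ?r I (\<lambda>S. f (insert i S - N \<union> (insert i I \<inter> N - insert i S))) =
    (if i \<in> N then rexp q I f else rexp q I (\<lambda>S. f (insert i S)))"
  proof (cases "i \<in> N")
    case True
    have "rexp ?r I (\<lambda>S. f (insert i S - N \<union> (insert i I \<inter> N - insert i S))) =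
      rexp ?r I (\<lambda>S. f (S - N \<union> (I \<inter> N - S)))"
      using insert(2) True by (intro rexp_cong refl arg_cong[where f = f]) auto
    then show ?thesis using True insert(3)[of f] by simp
  next
    case False
    have "rexp ?r I (\<lambda>S. f (insert i S - N \<union> (insert i I \<inter> N - insert i S))) =
      rexp ?r I (\<lambda>S. f (insert i (S - N \<union> (I \<inter> N - S))))"
      using insert(2) False by (intro rexp_cong refl arg_cong[where f = f]) auto
    then show ?thesis using False insert(3)[of "\<lambda>S. f (insert i S)"] by simp
  qed
  have b: "rexp ?r I (\<lambda>S. f (S - N \<union> (insert i I \<inter> N - S))) =
    (if i \<in> N then rexp q I (\<lambda>S. f (insert i S)) else rexp q I f)"
  proof (cases "i \<in> N")
    case True
    have "rexp ?r I (\<lambda>S. f (S - N \<union> (insert i I \<inter> N - S))) =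
      rexp ?r I (\<lambda>S. f (insert i (S - N \<union> (I \<inter> N - S))))"
      using insert(2) True by (intro rexp_cong refl arg_cong[where f = f]) auto
    then show ?thesis using True insert(3)[of "\<lambda>S. f (insert i S)"] by simp
  next
    case False
    have "rexp ?r I (\<lambda>S. f (S - N \<union> (insert i I \<inter> N - S))) =
      rexp ?r I (\<lambda>S. f (S - N \<union> (I \<inter> N - S)))"
      using insert(2) False by (intro rexp_cong refl arg_cong[where f = f]) auto
    then show ?thesis using False insert(3)[of f] by simp
  qed
  show ?case using insert(1,2) by (simp add: rexp_insert a b)
qed simp

text \<open>Each \<open>u\<close> consults only its own block \<open>I u\<close> and the blocks are
  disjoint, so the set of successful \<open>u\<close> is again a random set with independent
  memberships. This is how first-day opinions become a Poisson binomial family.\<close>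

lemma rexp_indep:
  assumes "finite U" "\<And>u. u \<in> U \<Longrightarrow> finite (I u)" "disjoint_family_on I U"
  shows "rexp q (\<Union>u\<in>U. I u) (\<lambda>S. G {u\<in>U. Q u (S \<inter> I u)}) =
         rexp (\<lambda>u. rexp q (I u) (\<lambda>S. of_bool (Q u S))) U G"
  using assms
proof (induction U arbitrary: G)
  case (insert u U)
  let ?J = "\<Union>u\<in>U. I u"
  let ?X = "\<lambda>B. {x\<in>U. Q x (B \<inter> I x)}"
  have d: "I u \<inter> ?J = {}" "disjoint_family_on I U"
    using insert(2,5) by (auto simp: disjoint_family_on_def)
  have "rexp q (I u \<union> ?J) (\<lambda>S. G {x\<in>insert u U. Q x (S \<inter> I x)}) =
     rexp q (I u) (\<lambda>A. rexp q ?J (\<lambda>B. G {x\<in>insert u U. Q x ((A \<union> B) \<inter> I x)}))"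
    using insert d by (intro rexp_union) auto
  \<comment> \<open>The block \<open>A\<close> enters only through the truth value of
    \<open>Q u A\<close>, so the inner expectation is affine in that indicator and the outer one can
    be evaluated.\<close>
  also have "\<dots> = rexp q (I u) (\<lambda>A. rexp q ?J (\<lambda>B. G (?X B)) +
      of_bool (Q u A) * (rexp q ?J (\<lambda>B. G (insert u (?X B))) - rexp q ?J (\<lambda>B. G (?X B))))"
  proof (intro rexp_cong refl)
    fix A assume A: "A \<subseteq> I u"
    have e: "{x\<in>insert u U. Q x ((A \<union> B) \<inter> I x)} = (if Q u A then insert u (?X B) else ?X B)" if "B \<subseteq> ?J" for B
    proof -
      have "(A \<union> B) \<inter> I u = A" using A that d by auto
      moreover have "(A \<union> B) \<inter> I x = B \<inter> I x" if "x \<in> U" for x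
        using A d that by auto
      ultimately show ?thesis using insert(2) by auto
    qed
    have "rexp q ?J (\<lambda>B. G {x\<in>insert u U. Q x ((A \<union> B) \<inter> I x)}) = 
      rexp q ?J (\<lambda>B. G (if Q u A then insert u (?X B) else ?X B))"
      by (intro rexp_cong refl arg_cong[where f = G] e)
    then show "rexp q ?J (\<lambda>B. G {x\<in>insert u U. Q x ((A \<union> B) \<inter> I x)}) =
       rexp q ?J (\<lambda>B. G (?X B)) +
      of_bool (Q u A) * (rexp q ?J (\<lambda>B. G (insert u (?X B))) - rexp q ?J (\<lambda>B. G (?X B)))"
      by (cases "Q u A") auto
  qed
  also have "\<dots> = rexp q ?J (\<lambda>B. G (?X B)) + rexp q (I u) (\<lambda>A. of_bool (Q u A)) * 
     (rexp q ?J (\<lambda>B. G (insert u (?X B))) - rexp q ?J (\<lambda>B. G (?X B)))"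
    using insert by (simp add: rexp_add rexp_const rexp_cmult mult.commute[of "of_bool _"])
  finally show ?case using insert d 
    by (simp add: rexp_insert insert(3)[of G] insert(3)[of "\<lambda>S. G (insert u S)"] algebra_simps)
qed simp

lemma rexp_square_le:
  assumes "finite I" "\<And>i. i \<in> I \<Longrightarrow> 0 \<le> q i \<and> q i \<le> 1"
  shows "(rexp q I f)\<^sup>2 \<le> rexp q I (\<lambda>S. (f S)\<^sup>2)"
proof -
  define c where "c = rexp q I f"
  have "0 \<le> rexp q I (\<lambda>S. (f S - c)\<^sup>2)"
    using assms by (intro rexp_nonneg) auto
  also have "\<dots> = rexp q I (\<lambda>S. (f S)\<^sup>2 + (c\<^sup>2 - (2 * c) * f S))"
    by (intro rexp_cong refl) (simp add: power2_diff)
  also have "\<dots> = rexp q I (\<lambda>S. (f S)\<^sup>2) - c\<^sup>2"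
    using assms by (simp add: rexp_add rexp_diff rexp_const rexp_cmult flip: c_def) (simp add: power2_eq_square)
  finally show ?thesis by (simp add: c_def)
qed

section \<open>Variance, the Efron-Stein inequality and the basic tail inequalities\<close>

definition rvar :: "('a \<Rightarrow> real) \<Rightarrow> 'a set \<Rightarrow> ('a set \<Rightarrow> real) \<Rightarrow> real" where
  "rvar q I f = rexp q I (\<lambda>S. (f S)\<^sup>2) - (rexp q I f)\<^sup>2"

lemma rvar_alt:
  assumes "finite I"
  shows "rvar q I f = rexp q I (\<lambda>S. (f S - rexp q I f)\<^sup>2)"
proof -
  define c where "c = rexp q I f"
  have "rexp q I (\<lambda>S. (f S - c)\<^sup>2) = rexp q I (\<lambda>S. (f S)\<^sup>2 + (c\<^sup>2 - (2 * c) * f S))"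
    by (intro rexp_cong refl) (simp add: power2_diff)
  also have "\<dots> = rexp q I (\<lambda>S. (f S)\<^sup>2) - c\<^sup>2"
    using assms by (simp add: rexp_add rexp_diff rexp_const rexp_cmult flip: c_def) (simp add: power2_eq_square)
  finally show ?thesis by (simp add: c_def rvar_def)
qed

text \<open>Induction on the coordinates by the law of total variance. Conditioning on coordinate
  \<open>i\<close> leaves the two averaged conditional variances and \<open>q i * (1 - q i)\<close>
  times the squared difference of the conditional means. Jensen's inequality bounds that square by
  the mean squared effect of \<open>i\<close>, and \<open>1 - q i\<close> is estimated by 1.\<close>

lemma efron_stein:
  assumes "finite I" "\<And>i. i \<in> I \<Longrightarrow> 0 \<le> q i \<and> q i \<le> 1"
  shows "rvar q I f \<le> (\<Sum>i\<in>I. q i * rexp q (I - {i}) (\<lambda>S. (f (insert i S) - f S)\<^sup>2))"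
  using assms
proof (induction I arbitrary: f)
  case (insert i I)
  let ?D = "\<lambda>f J i. rexp q (J - {i}) (\<lambda>S. (f (insert i S) - f S)\<^sup>2)"
  define a where "a = rexp q I f"
  define b where "b = rexp q I (\<lambda>S. f (insert i S))"
  let ?g = "\<lambda>S. f (insert i S)"
  have q: "0 \<le> q i" "q i \<le> 1" using insert by auto
  have "rvar q (insert i I) f = (1 - q i) * rvar q I f + q i * rvar q I ?g + q i * (1 - q i) * (b - a)\<^sup>2"
    using insert(1,2) unfolding rvar_def a_def b_def
    by (simp add: rexp_insert power2_eq_square algebra_simps)
  also have "\<dots> \<le> (1 - q i) * (\<Sum>j\<in>I. q j * ?D f I j) + q i * (\<Sum>j\<in>I. q j * ?D ?g I j)
     + q i * 1 * ?D f (insert i I) i"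
  proof (intro add_mono mult_mono mult_left_mono)
    show "(b - a)\<^sup>2 \<le> ?D f (insert i I) i"
      using rexp_square_le[OF insert(1), of q "\<lambda>S. f (insert i S) - f S"] insert
      by (simp add: rexp_diff a_def b_def)
    show "0 \<le> rvar q I f" "0 \<le> rvar q I ?g"
      using insert by (auto simp: rvar_alt[OF insert(1)] intro!: rexp_nonneg)
  qed (use q insert in auto)
  also have "(1 - q i) * (\<Sum>j\<in>I. q j * ?D f I j) + q i * (\<Sum>j\<in>I. q j * ?D ?g I j) =
    (\<Sum>j\<in>I. q j * ?D f (insert i I) j)"
    unfolding sum_distrib_left sum.distrib[symmetric]
  proof (intro sum.cong refl)
    fix j assume j: "j \<in> I"
    have e: "insert i I - {j} = insert i (I - {j})" using insert j by auto
    show "(1 - q i) * (q j * ?D f I j) + q i * (q j * ?D ?g I j) = q j * ?D f (insert i I) j"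
      unfolding e using insert j
      by (subst rexp_insert) (auto simp: algebra_simps insert_commute)
  qed
  finally show ?case using insert(1,2) q by (simp add: add.commute)
qed (simp add: rvar_def)

lemma chebyshev_rexp:
  assumes "finite I" "\<And>i. i \<in> I \<Longrightarrow> 0 \<le> q i \<and> q i \<le> 1" "a > 0"
  shows "rexp q I (\<lambda>S. of_bool (a \<le> \<bar>f S - rexp q I f\<bar>)) \<le> rvar q I f / a\<^sup>2"
proof -
  have "rexp q I (\<lambda>S. of_bool (a \<le> \<bar>f S - rexp q I f\<bar>)) \<le> rexp q I (\<lambda>S. (1 / a\<^sup>2) * (f S - rexp q I f)\<^sup>2)"
  proof (intro rexp_mono assms)
    fix S
    have "a\<^sup>2 \<le> (f S - rexp q I f)\<^sup>2" if "a \<le> \<bar>f S - rexp q I f\<bar>"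
      using that assms(3) by (metis abs_le_square_iff abs_of_pos)
    then show "of_bool (a \<le> \<bar>f S - rexp q I f\<bar>) \<le> (1 / a\<^sup>2) * (f S - rexp q I f)\<^sup>2"
      using assms(3) by auto
  qed auto
  then show ?thesis by (simp add: rexp_cdiv rvar_alt[OF assms(1)])
qed

lemma markov_rexp:
  assumes "\<And>i. i \<in> I \<Longrightarrow> 0 \<le> q i \<and> q i \<le> 1" "a > 0" "\<And>S. S \<subseteq> I \<Longrightarrow> 0 \<le> f S"
  shows "rexp q I (\<lambda>S. of_bool (a \<le> f S)) \<le> rexp q I f / a"
proof -
  have "rexp q I (\<lambda>S. of_bool (a \<le> f S)) \<le> rexp q I (\<lambda>S. (1 / a) * f S)"
    using assms by (intro rexp_mono assms) auto
  then show ?thesis by (simp add: rexp_cdiv)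
qed

section \<open>Poisson binomial distributions\<close>

lemma rexp_card_insert:
  assumes "finite I" "i \<notin> I"
  shows "rexp q (insert i I) (\<lambda>S. f (card S)) =
    (1 - q i) * rexp q I (\<lambda>S. f (card S)) + q i * rexp q I (\<lambda>S. f (Suc (card S)))"
proof -
  have "rexp q I (\<lambda>S. f (card (insert i S))) = rexp q I (\<lambda>S. f (Suc (card S)))"
  proof (intro rexp_cong refl arg_cong[where f = f])
    fix S assume "S \<subseteq> I"
    then show "card (insert i S) = Suc (card S)"
      using assms finite_subset[of S I] by (subst card_insert_disjoint) auto
  qed
  then show ?thesis using assms by (simp add: rexp_insert)
qed

lemma rexp_card:
  assumes "finite I"
  shows "rexp q I (\<lambda>S. real (card S)) = (\<Sum>i\<in>I. q i)"
  using assms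
proof (induction I)
  case (insert i I)
  then show ?case
    using rexp_card_insert[of I i q real] 
    by (simp add: rexp_add rexp_const algebra_simps)
qed simp

lemma rvar_card:
  assumes "finite I"
  shows "rvar q I (\<lambda>S. real (card S)) = (\<Sum>i\<in>I. q i * (1 - q i))"
  using assms
proof (induction I)
  case empty
  show ?case by (simp add: rvar_def)
next
  case (insert i I)
  have sq: "rexp q I (\<lambda>S. (real (Suc (card S)))\<^sup>2) =
      rexp q I (\<lambda>S. (real (card S))\<^sup>2) + 2 * (\<Sum>i\<in>I. q i) + 1"
  proof -
    have "rexp q I (\<lambda>S. (real (Suc (card S)))\<^sup>2) = rexp q I (\<lambda>S. (real (card S))\<^sup>2 + (2 * real (card S) + 1))"
      by (intro rexp_cong refl) (simp add: power2_eq_square algebra_simps)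
    then show ?thesis using insert by (simp only: rexp_add rexp_const rexp_cmult rexp_card)
  qed
  define X m where "X = rexp q I (\<lambda>S. (real (card S))\<^sup>2)" and "m = (\<Sum>i\<in>I. q i)"
  have A: "rexp q (insert i I) (\<lambda>S. (real (card S))\<^sup>2) = (1 - q i) * X + q i * (X + 2 * m + 1)"
    using rexp_card_insert[OF insert(1,2), of q "\<lambda>x. (real x)\<^sup>2"] unfolding sq X_def m_def .
  have B: "X - m\<^sup>2 = (\<Sum>i\<in>I. q i * (1 - q i))"
    using insert(3) by (simp add: rvar_def X_def m_def rexp_card[OF insert(1)])
  have "(\<Sum>i\<in>insert i I. q i) = q i + m" using insert(1,2) by (simp add: m_def)
  then show ?case
    using insert(1,2) B by (simp add: rvar_def rexp_card A) (simp add: power2_eq_square algebra_simps)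
qed

text \<open>Discrete integration by parts: the centred cardinality is a sum of centred indicators,
  and averaging over the \<open>i\<close>-th indicator alone leaves the factor
  \<open>q i * (1 - q i)\<close> and a difference quotient of \<open>f\<close> with \<open>i\<close>
  left out.\<close>

lemma card_stein:
  fixes f :: "nat \<Rightarrow> real"
  assumes "finite I"
  shows "rexp q I (\<lambda>S. (real (card S) - (\<Sum>i\<in>I. q i)) * f (card S)) =
    (\<Sum>i\<in>I. q i * (1 - q i) * rexp q (I - {i}) (\<lambda>S. f (Suc (card S)) - f (card S)))"
proof -
  have "rexp q I (\<lambda>S. (real (card S) - (\<Sum>i\<in>I. q i)) * f (card S)) =
     rexp q I (\<lambda>S. \<Sum>i\<in>I. (of_bool (i \<in> S) - q i) * f (card S))"
  proof (intro rexp_cong refl)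
    fix S assume S: "S \<subseteq> I"
    have "real (card S) = (\<Sum>i\<in>I. of_bool (i \<in> S))"
      using assms S by (simp add: Int_absorb1 of_bool_def sum.If_cases)
    then show "(real (card S) - (\<Sum>i\<in>I. q i)) * f (card S) = (\<Sum>i\<in>I. (of_bool (i \<in> S) - q i) * f (card S))"
      by (simp add: sum_subtractf flip: sum_distrib_right)
  qed
  also have "\<dots> = (\<Sum>i\<in>I. rexp q I (\<lambda>S. (of_bool (i \<in> S) - q i) * f (card S)))"
    by (rule rexp_sum)
  also have "\<dots> = (\<Sum>i\<in>I. q i * (1 - q i) * rexp q (I - {i}) (\<lambda>S. f (Suc (card S)) - f (card S)))"
  proof (intro sum.cong refl)
    fix i assume i: "i \<in> I"
    let ?J = "I - {i}"
    have J: "finite ?J" "i \<notin> ?J" "insert i ?J = I" using assms i by auto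
    have "rexp q (insert i ?J) (\<lambda>S. (of_bool (i \<in> S) - q i) * f (card S)) =
      (1 - q i) * rexp q ?J (\<lambda>S. (- q i) * f (card S)) + q i * rexp q ?J (\<lambda>S. (1 - q i) * f (Suc (card S)))"
    proof -
      have "rexp q ?J (\<lambda>S. (of_bool (i \<in> S) - q i) * f (card S)) = rexp q ?J (\<lambda>S. (- q i) * f (card S))"
        by (intro rexp_cong) auto
      moreover have "rexp q ?J (\<lambda>S. (of_bool (i \<in> insert i S) - q i) * f (card (insert i S))) = 
         rexp q ?J (\<lambda>S. (1 - q i) * f (Suc (card S)))"
      proof (intro rexp_cong refl)
        fix S assume "S \<subseteq> ?J"
        then have "card (insert i S) = Suc (card S)"
          using J(1) finite_subset[of S ?J] by (subst card_insert_disjoint) auto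
        then show "(of_bool (i \<in> insert i S) - q i) * f (card (insert i S)) = (1 - q i) * f (Suc (card S))"
          by simp
      qed
      ultimately show ?thesis using rexp_insert[OF J(1,2)] by simp
    qed
    then show "rexp q I (\<lambda>S. (of_bool (i \<in> S) - q i) * f (card S)) =
       q i * (1 - q i) * rexp q ?J (\<lambda>S. f (Suc (card S)) - f (card S))"
      unfolding J(3) rexp_cmult rexp_diff by (simp add: algebra_simps)
  qed
  finally show ?thesis .
qed

text \<open>The argument is an integer, so that the recursion \<open>pcard_insert\<close> and all
  later shifts hold without a boundary case at 0.\<close>

definition pcard :: "('a \<Rightarrow> real) \<Rightarrow> 'a set \<Rightarrow> int \<Rightarrow> real" where
  "pcard q I k = rexp q I (\<lambda>S. of_bool (int (card S) = k))"

lemma pcard_insert: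
  assumes "finite I" "i \<notin> I"
  shows "pcard q (insert i I) k = (1 - q i) * pcard q I k + q i * pcard q I (k - 1)"
proof -
  have "(int (Suc n) = k) = (int n = k - 1)" for n by auto
  then show ?thesis unfolding pcard_def
    using rexp_card_insert[OF assms, of q "\<lambda>n. of_bool (int n = k)"] by simp
qed

lemma pcard_nonneg:
  assumes "\<And>i. i \<in> I \<Longrightarrow> 0 \<le> q i \<and> q i \<le> 1"
  shows "0 \<le> pcard q I k"
  unfolding pcard_def using assms by (intro rexp_nonneg) auto

lemma rexp_abs_dev_card:
  assumes "finite I" "\<And>i. i \<in> I \<Longrightarrow> 0 \<le> q i \<and> q i \<le> 1"
  shows "rexp q I (\<lambda>S. \<bar>real (card S) - (\<Sum>i\<in>I. q i)\<bar>) \<le> sqrt (\<Sum>i\<in>I. q i * (1 - q i))"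
proof -
  have "(rexp q I (\<lambda>S. \<bar>real (card S) - (\<Sum>i\<in>I. q i)\<bar>))\<^sup>2 \<le> (\<Sum>i\<in>I. q i * (1 - q i))"
    using rexp_square_le[OF assms, where f = "\<lambda>S. \<bar>real (card S) - (\<Sum>i\<in>I. q i)\<bar>"]
    by (simp add: rvar_card[OF assms(1), symmetric] rvar_alt[OF assms(1)] rexp_card[OF assms(1)])
  then show ?thesis by (rule real_le_rsqrt)
qed

text \<open>Evaluating Stein's identity \<open>card_stein\<close> at a step function bounds a weighted average of the
  point probabilities with one index left out.\<close>

lemma pcard_le:
  assumes "finite I" "\<And>i. i \<in> I \<Longrightarrow> 0 \<le> q i \<and> q i \<le> 1"
    and V: "V = (\<Sum>i\<in>I. q i * (1 - q i))" "V > 0"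
  shows "pcard q I k \<le> 2 / sqrt V"
proof -
  have step: "(\<Sum>i\<in>I. q i * (1 - q i) * pcard q (I - {i}) k) \<le> sqrt V" for k :: int
  proof -
    have "(\<Sum>i\<in>I. q i * (1 - q i) * pcard q (I - {i}) k) =
      (\<Sum>i\<in>I. q i * (1 - q i) * rexp q (I - {i}) (\<lambda>S. of_bool (int (Suc (card S)) > k) - of_bool (int (card S) > k)))"
      unfolding pcard_def
      by (intro sum.cong refl arg_cong2[where f = "(*)"] rexp_cong) auto
    also have "\<dots> = rexp q I (\<lambda>S. (real (card S) - (\<Sum>i\<in>I. q i)) * of_bool (int (card S) > k))"
      using card_stein[OF assms(1), of q "\<lambda>n. of_bool (int n > k)"] by simp
    also have "\<dots> \<le> rexp q I (\<lambda>S. \<bar>real (card S) - (\<Sum>i\<in>I. q i)\<bar>)"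
      using assms(2) by (intro rexp_mono) auto
    also have "\<dots> \<le> sqrt V" using rexp_abs_dev_card[OF assms(1,2)] V by simp
    finally show ?thesis .
  qed
  \<comment> \<open>Putting the index \<open>i\<close> back raises the cardinality by at most one,
    so the full point probability is at most the sum of the leave-one-out probabilities at
    \<open>k\<close> and \<open>k - 1\<close>. This is the origin of the factor 2.\<close>
  have "V * pcard q I k = (\<Sum>i\<in>I. q i * (1 - q i) * pcard q I k)"
    by (simp add: V sum_distrib_right)
  also have "\<dots> \<le> (\<Sum>i\<in>I. q i * (1 - q i) * (pcard q (I - {i}) k + pcard q (I - {i}) (k - 1)))"
  proof (intro sum_mono mult_left_mono)
    fix i assume i: "i \<in> I"
    have "pcard q (insert i (I - {i})) k = (1 - q i) * pcard q (I - {i}) k + q i * pcard q (I - {i}) (k - 1)"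
      using assms(1) by (intro pcard_insert) auto
    also have "\<dots> \<le> 1 * pcard q (I - {i}) k + 1 * pcard q (I - {i}) (k - 1)"
      using assms(2) i by (intro add_mono mult_right_mono pcard_nonneg) auto
    finally show "pcard q I k \<le> pcard q (I - {i}) k + pcard q (I - {i}) (k - 1)"
      using i by (simp add: insert_absorb)
  qed (use assms(2) in auto)
  also have "\<dots> \<le> sqrt V + sqrt V"
    unfolding distrib_left sum.distrib by (intro add_mono step)
  finally have "pcard q I k * (sqrt V * sqrt V) \<le> 2 * sqrt V" using V(2) by (simp add: mult.commute)
  then have "pcard q I k * sqrt V \<le> 2" using V(2)
    by (metis mult.assoc mult_le_cancel_right real_sqrt_gt_zero not_less less_le)
  then show ?thesis using V(2) by (simp add: field_simps)
qed

section \<open>Exponential tilting and lower bounds for tail probabilities\<close>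

definition tilt :: "real \<Rightarrow> real \<Rightarrow> real" where
  "tilt t x = x * exp t / (1 - x + x * exp t)"

lemma tilt_denom_pos: "0 \<le> x \<Longrightarrow> x \<le> 1 \<Longrightarrow> 0 < 1 - x + x * exp (t :: real)"
  by (cases "x = 0") (auto intro: add_nonneg_pos)

text \<open>Change of measure: the density \<open>exp (t * card S)\<close> multiplies the odds of
  every coordinate by \<open>exp t\<close>, and the product of the normalising factors is the moment
  generating function of the cardinality.\<close>

lemma rexp_tilt:
  assumes "finite I" "\<And>i. i \<in> I \<Longrightarrow> 0 \<le> q i \<and> q i \<le> 1"
  shows "(\<Prod>i\<in>I. 1 - q i + q i * exp t) * rexp (\<lambda>i. tilt t (q i)) I f =
    rexp q I (\<lambda>S. exp (t * card S) * f S)"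
  using assms
proof (induction I arbitrary: f)
  case (insert i I)
  let ?d = "1 - q i + q i * exp t" and ?P = "\<Prod>i\<in>I. 1 - q i + q i * exp t"
  have d: "?d > 0" using insert by (intro tilt_denom_pos) auto
  have t1: "?d * tilt t (q i) = q i * exp t" "?d * (1 - tilt t (q i)) = 1 - q i"
    using d by (auto simp: tilt_def field_simps)
  have e: "rexp q I (\<lambda>S. exp (t * card (insert i S)) * f (insert i S)) =
      exp t * rexp q I (\<lambda>S. exp (t * card S) * f (insert i S))"
    unfolding rexp_cmult[symmetric]
  proof (intro rexp_cong refl)
    fix S assume "S \<subseteq> I"
    then have "card (insert i S) = Suc (card S)"
      using insert finite_subset[of S I] by (subst card_insert_disjoint) auto
    then show "exp (t * card (insert i S)) * f (insert i S) = exp t * (exp (t * card S) * f (insert i S))"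
      by (simp add: exp_add algebra_simps)
  qed
  let ?r = "\<lambda>i. tilt t (q i)"
  have "(\<Prod>i\<in>insert i I. 1 - q i + q i * exp t) * rexp ?r (insert i I) f =
     (?d * (1 - ?r i)) * (?P * rexp ?r I f) + (?d * ?r i) * (?P * rexp ?r I (\<lambda>S. f (insert i S)))"
    using insert(1,2) by (simp add: rexp_insert algebra_simps)
  also have "\<dots> = (1 - q i) * rexp q I (\<lambda>S. exp (t * card S) * f S) + 
      q i * exp t * rexp q I (\<lambda>S. exp (t * card S) * f (insert i S))"
    unfolding t1 using insert by simp
  also have "\<dots> = rexp q (insert i I) (\<lambda>S. exp (t * card S) * f S)"
    using insert(1,2) by (simp add: rexp_insert e)
  finally show ?case .
qed simp

text \<open>With \<open>K = 2 * A + 8\<close> the exponent is \<open>K * (2 * K + 4)\<close>, a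
  bound for the logarithm of the density on the window used in \<open>upper_tail_ge\<close>. The
  factor 1/2 is the mass which Chebyshev's inequality leaves to that window.\<close>

definition tail_const :: "real \<Rightarrow> real" where
  "tail_const A = exp (- ((2 * A + 8) * (4 * A + 20))) / 2"

lemma exp_minus_one_bounds:
  fixes t :: real assumes "0 \<le> t" "t \<le> 1"
  shows "exp t - 1 \<le> 2 * t" "t / 2 \<le> 1 - exp (- t)"
proof -
  show "exp t - 1 \<le> 2 * t"
    using exp_bound[OF assms] mult_left_mono[OF assms(2,1)] by (simp add: power2_eq_square)
  have "1 + t \<le> exp t" by (rule exp_ge_add_one_self)
  then have "exp (- t) \<le> 1 / (1 + t)" using assms by (simp add: exp_minus field_simps)
  also have "\<dots> \<le> 1 - t / 2" using assms mult_left_mono[OF assms(2,1)] by (simp add: field_simps power2_eq_square)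
  finally show "t / 2 \<le> 1 - exp (- t)" by simp
qed

text \<open>Tilt the weights so that the mean moves past \<open>\<mu> + A \<sigma>\<close>, where Chebyshev's inequality applies.\<close>

lemma upper_tail_ge:
  assumes "finite I" and q: "\<And>i. i \<in> I \<Longrightarrow> 0 \<le> q i \<and> q i \<le> 1"
    and V: "V = (\<Sum>i\<in>I. q i * (1 - q i))" "V \<ge> (2 * A + 8)\<^sup>2" and A: "A \<ge> 0"
  shows "tail_const A \<le> rexp q I (\<lambda>S. of_bool ((\<Sum>i\<in>I. q i) + A * sqrt V \<le> card S))"
proof -
  \<comment> \<open>The tilt moves the mean up by at least \<open>K * s / 2 = A * s + 4 * s\<close>.
    This leaves a margin of four standard deviations of the original variable, enough for Chebyshev
    since the tilted variance is at most \<open>3 * V\<close>.\<close>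
  define K where "K = 2 * A + 8"
  define s where "s = sqrt V"
  define \<mu> where "\<mu> = (\<Sum>i\<in>I. q i)"
  define t where "t = K / s"
  have K: "K \<ge> 8" using A by (simp add: K_def)
  have s: "s \<ge> K" "s > 0" "s\<^sup>2 = V"
  proof -
    show "s \<ge> K" unfolding s_def K_def using V(2) by (rule real_le_rsqrt)
    then show "s > 0" using K by linarith
    show "s\<^sup>2 = V" unfolding s_def using V(2) by (simp add: order_trans[OF zero_le_power2])
  qed
  have t: "0 \<le> t" "t \<le> 1" "t * V = K * s" using s K by (auto simp: t_def field_simps power2_eq_square simp flip: s(3))
  let ?r = "\<lambda>i. tilt t (q i)"
  define \<nu> where "\<nu> = (\<Sum>i\<in>I. ?r i)"
  have rr: "0 \<le> ?r i \<and> ?r i \<le> 1" if "i \<in> I" for i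
    using tilt_denom_pos[of "q i" t] q[OF that] by (auto simp: tilt_def field_simps)
  have D: "1 \<le> 1 - q i + q i * exp t" "1 - q i + q i * exp t \<le> exp t" if "i \<in> I" for i
  proof -
    have "q i * 1 \<le> q i * exp t" using q[OF that] t by (intro mult_left_mono) auto
    then show "1 \<le> 1 - q i + q i * exp t" by simp
    have "(1 - q i) * 1 \<le> (1 - q i) * exp t" using q[OF that] t by (intro mult_left_mono) auto
    then show "1 - q i + q i * exp t \<le> exp t" by (simp add: algebra_simps)
  qed
  have r_diff: "?r i - q i = q i * (1 - q i) * ((exp t - 1) / (1 - q i + q i * exp t))" if "i \<in> I" for i
    using tilt_denom_pos[of "q i" t] q[OF that] unfolding tilt_def by (simp add: field_simps)
  have e: "exp t - 1 \<le> 2 * t" "t / 2 \<le> 1 - exp (-t)" using exp_minus_one_bounds t by auto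
  have lo: "q i * (1 - q i) * (t / 2) \<le> ?r i - q i" if "i \<in> I" for i
  proof -
    have "t / 2 \<le> (exp t - 1) / exp t" using e(2) by (simp add: exp_minus field_simps)
    also have "\<dots> \<le> (exp t - 1) / (1 - q i + q i * exp t)"
      using D[OF that] t by (intro divide_left_mono mult_pos_pos) auto
    finally show ?thesis unfolding r_diff[OF that] using q[OF that] by (intro mult_left_mono) auto
  qed
  have hi: "?r i - q i \<le> q i * (1 - q i) * (2 * t)" if "i \<in> I" for i
  proof -
    have "(exp t - 1) / (1 - q i + q i * exp t) \<le> (exp t - 1) / 1"
      using D[OF that] t by (intro divide_left_mono) auto
    also have "\<dots> \<le> 2 * t" using e by simp
    finally show ?thesis unfolding r_diff[OF that] using q[OF that] by (intro mult_left_mono) auto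
  qed
  have \<nu>lo: "\<mu> + K * s / 2 \<le> \<nu>"
  proof -
    have "(\<Sum>i\<in>I. q i * (1 - q i) * (t / 2)) \<le> (\<Sum>i\<in>I. ?r i - q i)" by (intro sum_mono lo)
    then show ?thesis unfolding sum_subtractf \<mu>_def[symmetric] \<nu>_def[symmetric] sum_distrib_right[symmetric] V(1)[symmetric]
      using t(3) by (simp add: mult.commute)
  qed
  have \<nu>hi: "\<nu> \<le> \<mu> + 2 * K * s"
  proof -
    have "(\<Sum>i\<in>I. ?r i - q i) \<le> (\<Sum>i\<in>I. q i * (1 - q i) * (2 * t))" by (intro sum_mono hi)
    then show ?thesis unfolding sum_subtractf \<mu>_def[symmetric] \<nu>_def[symmetric] sum_distrib_right[symmetric] V(1)[symmetric]
      using t(3) by (simp add: algebra_simps)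
  qed
  have var: "rvar ?r I (\<lambda>S. real (card S)) \<le> 3 * V"
  proof -
    have "?r i * (1 - ?r i) \<le> 3 * (q i * (1 - q i))" if "i \<in> I" for i
    proof -
      let ?D = "1 - q i + q i * exp t"
      have "?r i * (1 - ?r i) = q i * (1 - q i) * (exp t / (?D * ?D))"
        using tilt_denom_pos[of "q i" t] q[OF that] unfolding tilt_def by (simp add: field_simps)
      also have "\<dots> \<le> q i * (1 - q i) * 3"
      proof (intro mult_left_mono)
        have "exp t / (?D * ?D) \<le> exp t / 1"
          using D[OF that] mult_mono[of 1 ?D 1 ?D] by (intro divide_left_mono) auto
        also have "\<dots> \<le> exp 1" using t by simp
        also have "\<dots> \<le> 3" by (rule exp_le)
        finally show "exp t / (?D * ?D) \<le> 3" .
      qed (use q[OF that] in auto)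
      finally show ?thesis by simp
    qed
    then have "(\<Sum>i\<in>I. ?r i * (1 - ?r i)) \<le> (\<Sum>i\<in>I. 3 * (q i * (1 - q i)))" by (intro sum_mono)
    then show ?thesis by (simp add: rvar_card[OF assms(1)] V(1) sum_distrib_left)
  qed
  \<comment> \<open>The event is cut off from above because the density
    \<open>exp (t * card S)\<close> must be bounded on it when the tilt is undone.\<close>
  let ?E = "\<lambda>S. \<mu> + A * s \<le> real (card S) \<and> real (card S) \<le> \<mu> + (2 * K + 4) * s"
  have cheb: "1 / 2 \<le> rexp ?r I (\<lambda>S. of_bool (?E S))"
  proof -
    have "rexp ?r I (\<lambda>S. of_bool (4 * s \<le> \<bar>real (card S) - rexp ?r I (\<lambda>S. real (card S))\<bar>)) \<le> 
       rvar ?r I (\<lambda>S. real (card S)) / (4 * s)\<^sup>2"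
      using s by (intro chebyshev_rexp assms rr) auto
    also have "\<dots> \<le> 3 * V / (4 * s)\<^sup>2" using var by (intro divide_right_mono) auto
    also have "\<dots> \<le> 1 / 2" using s by (simp add: power_mult_distrib field_simps)
    finally have c: "rexp ?r I (\<lambda>S. of_bool (4 * s \<le> \<bar>real (card S) - \<nu>\<bar>)) \<le> 1 / 2"
      by (simp add: rexp_card[OF assms(1)] \<nu>_def)
    have "1 = rexp ?r I (\<lambda>_. 1)" using assms by (simp add: rexp_const)
    also have "\<dots> \<le> rexp ?r I (\<lambda>S. of_bool (4 * s \<le> \<bar>real (card S) - \<nu>\<bar>) + of_bool (?E S))"
    proof (intro rexp_mono rr)
      fix S
      have "?E S" if "\<not> 4 * s \<le> \<bar>real (card S) - \<nu>\<bar>"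
      proof -
        have "K * s / 2 = A * s + 4 * s" by (simp add: K_def algebra_simps)
        moreover have "(2 * K + 4) * s = 2 * K * s + 4 * s" by (simp add: algebra_simps)
        ultimately show ?thesis using that \<nu>lo \<nu>hi unfolding not_le abs_less_iff by linarith
      qed
      then show "1 \<le> of_bool (4 * s \<le> \<bar>real (card S) - \<nu>\<bar>) + (of_bool (?E S) :: real)" by auto
    qed auto
    also have "\<dots> \<le> 1 / 2 + rexp ?r I (\<lambda>S. of_bool (?E S))" using c by (simp add: rexp_add)
    finally show ?thesis by simp
  qed
  define M where "M = (\<Prod>i\<in>I. 1 - q i + q i * exp t)"
  \<comment> \<open>Convexity of \<open>exp\<close> in each factor. This bound cancels the
    contribution of the mean to the density, so that the final constant depends on \<open>A\<close>
    alone.\<close>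
  have M: "exp (t * \<mu>) \<le> M"
  proof -
    have "exp (t * q i) \<le> 1 - q i + q i * exp t" if "i \<in> I" for i
      using convex_onD[OF exp_convex, of "q i" 0 t] q[OF that] by (simp add: algebra_simps)
    then have "(\<Prod>i\<in>I. exp (t * q i)) \<le> M" unfolding M_def by (intro prod_mono) auto
    then show ?thesis using assms(1) by (simp add: \<mu>_def sum_distrib_left exp_sum)
  qed
  have div_exp: "exp (- x) / 2 \<le> y" if "1 / 2 \<le> exp x * y" for x y :: real
    using that by (simp add: exp_minus field_simps)
  have tk: "t * ((2 * K + 4) * s) = K * (2 * K + 4)" using s by (simp add: t_def)
  have "exp (t * \<mu>) * (1 / 2) \<le> M * rexp ?r I (\<lambda>S. of_bool (?E S))"
    using M cheb by (intro mult_mono) (auto intro: order_trans[OF _ M])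
  also have "\<dots> = rexp q I (\<lambda>S. exp (t * card S) * of_bool (?E S))"
    unfolding M_def using q by (intro rexp_tilt assms) auto
  also have "\<dots> \<le> rexp q I (\<lambda>S. exp (t * (\<mu> + (2 * K + 4) * s)) * of_bool (\<mu> + A * s \<le> card S))"
    using q t by (intro rexp_mono) (auto intro: mult_left_mono)
  also have "\<dots> = exp (t * \<mu>) * exp (K * (2 * K + 4)) * rexp q I (\<lambda>S. of_bool (\<mu> + A * s \<le> card S))"
    by (simp add: rexp_cmult distrib_left exp_add tk)
  finally have "1 / 2 \<le> exp (K * (2 * K + 4)) * rexp q I (\<lambda>S. of_bool (\<mu> + A * s \<le> card S))"
    by simp
  then have "exp (- (K * (2 * K + 4))) / 2 \<le> rexp q I (\<lambda>S. of_bool (\<mu> + A * s \<le> card S))"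
    by (rule div_exp)
  moreover have "tail_const A = exp (- (K * (2 * K + 4))) / 2"
    by (simp add: tail_const_def K_def algebra_simps)
  ultimately show ?thesis by (simp add: \<mu>_def s_def)
qed

lemma rexp_complement:
  assumes "finite I"
  shows "rexp q I f = rexp (\<lambda>i. 1 - q i) I (\<lambda>S. f (I - S))"
proof -
  have "rexp q I f = rexp (\<lambda>i. if i \<in> I then 1 - q i else q i) I (\<lambda>S. f (S - I \<union> (I \<inter> I - S)))"
    by (rule rexp_flip[OF assms])
  also have "\<dots> = rexp (\<lambda>i. 1 - q i) I (\<lambda>S. f (I - S))"
    by (intro rexp_cong refl arg_cong[where f = f]) auto
  finally show ?thesis .
qed

lemma lower_tail_ge:
  assumes "finite I" and q: "\<And>i. i \<in> I \<Longrightarrow> 0 \<le> q i \<and> q i \<le> 1"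
    and V: "V = (\<Sum>i\<in>I. q i * (1 - q i))" "V \<ge> (2 * A + 8)\<^sup>2" and A: "A \<ge> 0"
  shows "tail_const A \<le> rexp q I (\<lambda>S. of_bool (card S \<le> (\<Sum>i\<in>I. q i) - A * sqrt V))"
proof -
  have "tail_const A \<le> rexp (\<lambda>i. 1 - q i) I (\<lambda>S. of_bool ((\<Sum>i\<in>I. 1 - q i) + A * sqrt V \<le> card S))"
    using q V A by (intro upper_tail_ge assms(1)) (auto simp: mult.commute)
  also have "\<dots> = rexp (\<lambda>i. 1 - q i) I (\<lambda>S. of_bool (card (I - S) \<le> (\<Sum>i\<in>I. q i) - A * sqrt V))"
  proof (intro rexp_cong refl arg_cong[where f = of_bool])
    fix S assume "S \<subseteq> I"
    then have "card (I - S) + card S = card I"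
      using assms(1) by (simp add: card_Diff_subset finite_subset card_mono)
    then have "real (card (I - S)) = real (card I) - real (card S)" by linarith
    then show "((\<Sum>i\<in>I. 1 - q i) + A * sqrt V \<le> card S) = (card (I - S) \<le> (\<Sum>i\<in>I. q i) - A * sqrt V)"
      by (auto simp: sum_subtractf)
  qed
  also have "\<dots> = rexp q I (\<lambda>S. of_bool (card S \<le> (\<Sum>i\<in>I. q i) - A * sqrt V))"
    by (rule rexp_complement[OF assms(1), symmetric])
  finally show ?thesis .
qed

text \<open>Adding an index convolves the sequence with a two-point law, and log-concavity survives
  this convolution. The form with \<open>k \<le> l\<close> also says that there are no internal
  zeros, which the induction needs and which the adjacent inequality alone would not give.\<close>

lemma pcard_log_concave:
  assumes "finite I" "\<And>i. i \<in> I \<Longrightarrow> 0 \<le> q i \<and> q i \<le> 1" "k \<le> l"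
  shows "pcard q I (k - 1) * pcard q I (l + 1) \<le> pcard q I k * pcard q I l"
  using assms
proof (induction I arbitrary: k l)
  case empty
  then show ?case by (auto simp: pcard_def)
next
  case (insert i I)
  let ?a = "pcard q I"
  have q: "0 \<le> q i" "q i \<le> 1" using insert by auto
  have lc: "?a (k - 1) * ?a (l + 1) \<le> ?a k * ?a l" if "k \<le> l" for k l
    using insert that by auto
  have 1: "?a (k - 1) * ?a (l + 1) \<le> ?a k * ?a l" using lc insert(5) .
  have 2: "?a (k - 2) * ?a l \<le> ?a (k - 1) * ?a (l - 1)" using lc[of "k-1" "l-1"] insert(5) by (simp add: algebra_simps)
  \<comment> \<open>For the mixed terms: the product at \<open>k - 1\<close> and \<open>l\<close>
    occurs on both sides and cancels, and this comparison across two positions is what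
    remains.\<close>
  have 3: "?a (k - 2) * ?a (l + 1) \<le> ?a k * ?a (l - 1)"
  proof (cases "k = l")
    case True
    then show ?thesis using lc[of "k-1" "l"] by (simp add: algebra_simps)
  next
    case False
    then have "?a (k - 2) * ?a (l + 1) \<le> ?a (k - 1) * ?a l" using lc[of "k-1" "l"] insert(5) by (simp add: algebra_simps)
    also have "\<dots> \<le> ?a k * ?a (l - 1)" using lc[of k "l-1"] insert(5) False by simp
    finally show ?thesis .
  qed
  have "(1 - q i)\<^sup>2 * (?a (k - 1) * ?a (l + 1)) + (q i)\<^sup>2 * (?a (k - 2) * ?a l) + q i * (1 - q i) * (?a (k - 2) * ?a (l + 1))
    \<le> (1 - q i)\<^sup>2 * (?a k * ?a l) + (q i)\<^sup>2 * (?a (k - 1) * ?a (l - 1)) + q i * (1 - q i) * (?a k * ?a (l - 1))"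
    using q by (intro add_mono mult_left_mono 1 2 3) auto
  then show ?case unfolding pcard_insert[OF insert(1,2)]
    by (simp add: power2_eq_square algebra_simps)
qed

text \<open>A value below \<open>c\<close> at \<open>k\<close> would force a strict descent at some
  \<open>i < k\<close> and a strict ascent at some \<open>j \<ge> k\<close>, which contradicts
  log-concavity at \<open>i + 1 \<le> j\<close>.\<close>

lemma pcard_unimodal:
  assumes "finite I" "\<And>i. i \<in> I \<Longrightarrow> 0 \<le> q i \<and> q i \<le> 1" "k1 \<le> k" "k \<le> k2"
    "c \<le> pcard q I k1" "c \<le> pcard q I k2"
  shows "c \<le> pcard q I k"
proof (rule ccontr)
  assume less: "\<not> c \<le> pcard q I k"
  let ?a = "pcard q I"
  have nn: "0 \<le> ?a j" for j using assms(2) by (rule pcard_nonneg)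
  have "\<exists>i. k1 \<le> i \<and> i < k \<and> ?a (i + 1) < ?a i"
  proof (rule ccontr)
    assume "\<not> ?thesis"
    then have m: "?a i \<le> ?a (i + 1)" if "k1 \<le> i" "i < k" for i using that by force
    have "i \<le> k \<longrightarrow> ?a k1 \<le> ?a i" if "k1 \<le> i" for i
      using that
    proof (induction i rule: int_ge_induct)
      case (step i)
      then show ?case using m[of i] by force
    qed simp
    then show False using less assms by force
  qed
  then obtain i where i: "k1 \<le> i" "i < k" "?a (i + 1) < ?a i" by auto
  have "\<exists>j. k \<le> j \<and> j < k2 \<and> ?a j < ?a (j + 1)"
  proof (rule ccontr)
    assume "\<not> ?thesis"
    then have m: "?a (j + 1) \<le> ?a j" if "k \<le> j" "j < k2" for j using that by force
    have "j \<le> k2 \<longrightarrow> ?a j \<le> ?a k" if "k \<le> j" for j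
      using that
    proof (induction j rule: int_ge_induct)
      case (step j)
      then show ?case using m[of j] by force
    qed simp
    then show False using less assms by force
  qed
  then obtain j where j: "k \<le> j" "j < k2" "?a j < ?a (j + 1)" by auto
  have "?a i * ?a (j + 1) \<le> ?a (i + 1) * ?a j"
    using pcard_log_concave[OF assms(1,2), where k = "i+1" and l = j] i j by simp
  moreover have "?a (i + 1) * ?a j < ?a i * ?a (j + 1)"
    using i j nn by (intro mult_strict_mono) (auto intro: le_less_trans)
  ultimately show False by simp
qed

text \<open>A window of at most \<open>(A + B + 1) * sqrt V\<close> integers, with
  \<open>B = sqrt (2 / tail_const A)\<close>, carries mass at least \<open>tail_const A / 2\<close>.
  The quotient of the two numbers is \<open>local_const A / sqrt V\<close>. The choice of
  \<open>B\<close> makes Chebyshev cost exactly half of the tail.\<close>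

definition local_const :: "real \<Rightarrow> real" where
  "local_const A = tail_const A / (2 * (A + sqrt (2 / tail_const A) + 1))"

lemma tail_const_pos: "tail_const A > 0" by (simp add: tail_const_def)

lemma local_const_pos: "A \<ge> 0 \<Longrightarrow> local_const A > 0"
  unfolding local_const_def using tail_const_pos[of A]
  by (intro divide_pos_pos mult_pos_pos add_nonneg_pos) auto

text \<open>Pigeonhole over the \<open>b - a + 1\<close> integers of the window.\<close>

lemma rexp_card_window:
  assumes "finite I" "a \<le> b"
    and "c * real_of_int (b - a + 1) \<le> rexp q I (\<lambda>S. of_bool (a \<le> int (card S) \<and> int (card S) \<le> b))"
  shows "\<exists>k. a \<le> k \<and> k \<le> b \<and> c \<le> pcard q I k"
proof (rule ccontr)
  assume "\<not> ?thesis"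
  then have l: "pcard q I k < c" if "k \<in> {a..b}" for k using that by force
  have "rexp q I (\<lambda>S. of_bool (a \<le> int (card S) \<and> int (card S) \<le> b)) = 
    rexp q I (\<lambda>S. \<Sum>k\<in>{a..b}. of_bool (int (card S) = k))"
    by (intro rexp_cong refl) (simp add: of_bool_def)
  also have "\<dots> = (\<Sum>k\<in>{a..b}. pcard q I k)"
    unfolding pcard_def by (rule rexp_sum)
  also have "\<dots> < (\<Sum>k\<in>{a..b}. c)" using assms(2) l by (intro sum_strict_mono) auto
  finally show False using assms(2,3) by (simp add: mult.commute)
qed

text \<open>A local limit estimate without characteristic functions. The tail beyond
  \<open>A\<close> standard deviations has constant mass, and Chebyshev removes what lies further
  than \<open>B\<close> standard deviations; so there is a window of length O(sqrt V) above
  \<open>k\<close> and another below \<open>k\<close>, each of constant mass. Pigeonhole finds a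
  point of probability of order \<open>1 / sqrt V\<close> on either side, and unimodality transfers
  the bound to \<open>k\<close>.\<close>

lemma pcard_ge:
  assumes "finite I" and q: "\<And>i. i \<in> I \<Longrightarrow> 0 \<le> q i \<and> q i \<le> 1"
    and V: "V = (\<Sum>i\<in>I. q i * (1 - q i))" "V \<ge> (2 * A + 8)\<^sup>2" and A: "A \<ge> 0"
    and k: "\<bar>real_of_int k - (\<Sum>i\<in>I. q i)\<bar> \<le> A * sqrt V"
  shows "local_const A / sqrt V \<le> pcard q I k"
proof -
  define \<mu> where "\<mu> = (\<Sum>i\<in>I. q i)"
  define s where "s = sqrt V"
  define c where "c = tail_const A"
  define B where "B = sqrt (2 / c)"
  have c: "c > 0" by (simp add: c_def tail_const_pos)
  have B: "B > 0" "B\<^sup>2 = 2 / c" using c by (auto simp: B_def)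
  have "(2 * A + 8)\<^sup>2 \<ge> 8\<^sup>2" using A by (intro power_mono) auto
  then have V1: "V \<ge> 1" using V(2) by simp
  have s: "s \<ge> 1" "s\<^sup>2 = V" using V1 by (auto simp: s_def)
  have dev: "rexp q I (\<lambda>S. of_bool (B * s \<le> \<bar>real (card S) - \<mu>\<bar>)) \<le> c / 2"
  proof -
    have "rexp q I (\<lambda>S. of_bool (B * s \<le> \<bar>real (card S) - rexp q I (\<lambda>S. real (card S))\<bar>)) \<le> 
       rvar q I (\<lambda>S. real (card S)) / (B * s)\<^sup>2"
      using s B by (intro chebyshev_rexp assms) auto
    also have "\<dots> = V / (B\<^sup>2 * V)" by (simp add: rvar_card[OF assms(1)] V(1)[symmetric] power_mult_distrib s)
    also have "\<dots> = c / 2" using V1 c B by simp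
    finally show ?thesis by (simp add: rexp_card[OF assms(1)] \<mu>_def)
  qed
  have lc: "local_const A / s * real_of_int (b - a + 1) \<le> c / 2"
    if "real_of_int (b - a) \<le> (A + B) * s" for a b
  proof -
    have "real_of_int (b - a + 1) \<le> (A + B) * s + 1 * s" using that s by simp
    then have "local_const A / s * real_of_int (b - a + 1) \<le> local_const A / s * ((A + B + 1) * s)"
      using s local_const_pos[OF A] by (intro mult_left_mono) (auto simp: algebra_simps)
    also have "\<dots> = c / 2"
    proof -
      have "x / (2 * y) / s * (y * s) = x / 2" if "y > 0" for x y :: real
        using that s by (simp add: field_simps)
      from this[of "A + B + 1" c] show ?thesis
        using A B unfolding local_const_def c_def[symmetric] B_def[symmetric] by simp
    qed
    finally show ?thesis .
  qed
  have k': "real_of_int k \<le> \<mu> + A * s" "\<mu> - A * s \<le> real_of_int k"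
    using k by (auto simp: \<mu>_def s_def abs_if split: if_splits)
  have AB: "A * s \<ge> 0" "B * s > 0" using A B s by auto
  have "\<exists>k2. k \<le> k2 \<and> k2 \<le> k + \<lfloor>(A + B) * s\<rfloor> \<and> local_const A / s \<le> pcard q I k2"
  proof (rule rexp_card_window)
    let ?b = "k + \<lfloor>(A + B) * s\<rfloor>"
    show "k \<le> ?b" using AB by (simp add: distrib_right)
    have "real_of_int (?b - k) \<le> (A + B) * s" by simp
    then have "local_const A / s * real_of_int (?b - k + 1) \<le> c / 2" by (rule lc)
    also have "c / 2 \<le> rexp q I (\<lambda>S. of_bool (\<mu> + A * s \<le> card S)) - rexp q I (\<lambda>S. of_bool (B * s \<le> \<bar>real (card S) - \<mu>\<bar>))"
      using dev upper_tail_ge[OF assms(1) q V A] by (simp add: c_def \<mu>_def s_def)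
    also have "\<dots> \<le> rexp q I (\<lambda>S. of_bool (k \<le> int (card S) \<and> int (card S) \<le> ?b))"
      unfolding rexp_diff[symmetric]
    proof (intro rexp_mono q)
      fix S
      have "k \<le> int (card S) \<and> int (card S) \<le> ?b" 
        if h: "\<mu> + A * s \<le> card S" "\<not> B * s \<le> \<bar>real (card S) - \<mu>\<bar>"
      proof
        have "real_of_int k \<le> card S" using h k' by linarith
        then show "k \<le> int (card S)" by linarith
        have "real (card S) - real_of_int k \<le> (A + B) * s" using h k' by (simp add: distrib_right)
        then have "int (card S) - k \<le> \<lfloor>(A + B) * s\<rfloor>" by (simp add: le_floor_iff)
        then show "int (card S) \<le> ?b" by simp
      qed
      then show "of_bool (\<mu> + A * s \<le> card S) - of_bool (B * s \<le> \<bar>real (card S) - \<mu>\<bar>) \<le> 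
         (of_bool (k \<le> int (card S) \<and> int (card S) \<le> ?b) :: real)" by auto
    qed auto
    finally show "local_const A / s * real_of_int (?b - k + 1) \<le> rexp q I (\<lambda>S. of_bool (k \<le> int (card S) \<and> int (card S) \<le> ?b))" .
  qed (rule assms)
  then obtain k2 where k2: "k \<le> k2" "local_const A / s \<le> pcard q I k2" by auto
  have "\<exists>k1. k - \<lfloor>(A + B) * s\<rfloor> \<le> k1 \<and> k1 \<le> k \<and> local_const A / s \<le> pcard q I k1"
  proof (rule rexp_card_window)
    let ?b = "k - \<lfloor>(A + B) * s\<rfloor>"
    show "?b \<le> k" using AB by (simp add: distrib_right)
    have "real_of_int (k - ?b) \<le> (A + B) * s" by simp
    then have "local_const A / s * real_of_int (k - ?b + 1) \<le> c / 2" by (rule lc)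
    also have "c / 2 \<le> rexp q I (\<lambda>S. of_bool (card S \<le> \<mu> - A * s)) - rexp q I (\<lambda>S. of_bool (B * s \<le> \<bar>real (card S) - \<mu>\<bar>))"
      using dev lower_tail_ge[OF assms(1) q V A] by (simp add: c_def \<mu>_def s_def)
    also have "\<dots> \<le> rexp q I (\<lambda>S. of_bool (?b \<le> int (card S) \<and> int (card S) \<le> k))"
      unfolding rexp_diff[symmetric]
    proof (intro rexp_mono q)
      fix S
      have "?b \<le> int (card S) \<and> int (card S) \<le> k" 
        if h: "card S \<le> \<mu> - A * s" "\<not> B * s \<le> \<bar>real (card S) - \<mu>\<bar>"
      proof
        have "card S \<le> real_of_int k" using h k' by linarith
        then show "int (card S) \<le> k" by linarith
        have "real_of_int k - real (card S) \<le> (A + B) * s" using h k' by (simp add: distrib_right)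
        then have "k - int (card S) \<le> \<lfloor>(A + B) * s\<rfloor>" by (simp add: le_floor_iff)
        then show "?b \<le> int (card S)" by simp
      qed
      then show "of_bool (card S \<le> \<mu> - A * s) - of_bool (B * s \<le> \<bar>real (card S) - \<mu>\<bar>) \<le> 
         (of_bool (?b \<le> int (card S) \<and> int (card S) \<le> k) :: real)" by auto
    qed auto
    finally show "local_const A / s * real_of_int (k - ?b + 1) \<le> rexp q I (\<lambda>S. of_bool (?b \<le> int (card S) \<and> int (card S) \<le> k))" .
  qed (rule assms)
  then obtain k1 where k1: "k1 \<le> k" "local_const A / s \<le> pcard q I k1" by auto
  show ?thesis using pcard_unimodal[OF assms(1) q k1(1) k2(1) k1(2) k2(2)] by (simp add: s_def)
qed

text \<open>The weights are raised from \<open>r\<close> to \<open>q\<close> one coordinate at a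
  time. Raising coordinate \<open>i\<close> increases the tail at \<open>k\<close> by
  \<open>q i - r i\<close> times the probability that the other coordinates give exactly
  \<open>k - 1\<close>. Coordinates outside \<open>J\<close> contribute a nonnegative amount, so the
  local bound is demanded on \<open>J\<close> only, but for every mixture \<open>h\<close> of the
  two weights.\<close>

lemma card_tail_hybrid:
  fixes q r :: "'a \<Rightarrow> real"
  assumes "finite I" and le: "\<And>i. i \<in> I \<Longrightarrow> 0 \<le> r i \<and> r i \<le> q i \<and> q i \<le> 1"
    and "J \<subseteq> I"
    and c: "\<And>h i. i \<in> J \<Longrightarrow> (\<And>j. j \<in> I \<Longrightarrow> h j = q j \<or> h j = r j) \<Longrightarrow> c \<le> pcard h (I - {i}) (k - 1)"
  shows "c * (\<Sum>i\<in>J. q i - r i) \<le> rexp q I (\<lambda>S. of_bool (k \<le> int (card S))) - rexp r I (\<lambda>S. of_bool (k \<le> int (card S)))"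
proof -
  have "c * (\<Sum>i\<in>J \<inter> D. q i - r i) \<le> rexp (\<lambda>i. if i \<in> D then q i else r i) I (\<lambda>S. of_bool (k \<le> int (card S)))
      - rexp r I (\<lambda>S. of_bool (k \<le> int (card S)))" if "D \<subseteq> I" for D
    using finite_subset[OF that assms(1)] that
  proof (induction D)
    case empty
    then show ?case by simp
  next
    case (insert i D)
    define h where "h = (\<lambda>j. if j \<in> D then q j else r j)"
    let ?f = "\<lambda>S. of_bool (k \<le> int (card S)) :: real"
    have i: "i \<in> I" "i \<notin> D" using insert by auto
    have II: "insert i (I - {i}) = I" using i by auto
    have diff: "rexp q' I ?f = rexp h (I - {i}) ?f + q' i * pcard h (I - {i}) (k - 1)" 
      if "\<And>j. j \<in> I - {i} \<Longrightarrow> q' j = h j" for q'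
    proof -
      have "rexp q' (insert i (I - {i})) ?f = (1 - q' i) * rexp q' (I - {i}) ?f + q' i * rexp q' (I - {i}) (\<lambda>S. of_bool (k \<le> int (Suc (card S))))"
        using assms(1) rexp_card_insert[of "I - {i}" i q' "\<lambda>n. of_bool (k \<le> int n)"] by simp
      also have "rexp q' (I - {i}) (\<lambda>S. of_bool (k \<le> int (Suc (card S)))) = 
         rexp q' (I - {i}) (\<lambda>S. of_bool (k \<le> int (card S)) + of_bool (int (card S) = k - 1))"
        by (intro rexp_cong) auto
      finally have "rexp q' I ?f = rexp q' (I - {i}) ?f + q' i * pcard q' (I - {i}) (k - 1)"
        unfolding II rexp_add pcard_def by (simp add: algebra_simps)
      moreover have "rexp q' (I - {i}) ?f = rexp h (I - {i}) ?f" "pcard q' (I - {i}) (k - 1) = pcard h (I - {i}) (k - 1)"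
        unfolding pcard_def using that by (intro rexp_cong; simp)+
      ultimately show ?thesis by simp
    qed
    have 1: "rexp (\<lambda>j. if j \<in> insert i D then q j else r j) I ?f = rexp h (I - {i}) ?f + q i * pcard h (I - {i}) (k - 1)"
      by (subst diff) (auto simp: h_def)
    have 2: "rexp h I ?f = rexp h (I - {i}) ?f + r i * pcard h (I - {i}) (k - 1)"
      using i by (subst diff) (auto simp: h_def)
    have "c * (if i \<in> J then q i - r i else 0) \<le> (q i - r i) * pcard h (I - {i}) (k - 1)"
    proof (cases "i \<in> J")
      case True
      have "c \<le> pcard h (I - {i}) (k - 1)" by (intro c True) (auto simp: h_def)
      then show ?thesis using True le[OF i(1)] mult_left_mono[of c "pcard h (I - {i}) (k - 1)" "q i - r i"] by (simp add: mult.commute)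
    next
      case False
      have "0 \<le> pcard h (I - {i}) (k - 1)" using le by (intro pcard_nonneg) (auto simp: h_def intro: order_trans)
      then show ?thesis using False le[OF i(1)] by simp
    qed
    moreover have "(\<Sum>i\<in>J \<inter> insert i D. q i - r i) = (if i \<in> J then q i - r i else 0) + (\<Sum>i\<in>J \<inter> D. q i - r i)"
      using insert by simp
    ultimately show ?case using insert unfolding 1 h_def[symmetric] using 2
      by (simp add: algebra_simps h_def[symmetric])
  qed
  from this[of I] show ?thesis using \<open>J \<subseteq> I\<close>
    by (simp add: Int_absorb2 cong: rexp_cong)
qed

section \<open>Signed sums\<close>

lemma rexp_exp_card:
  assumes "finite I" "0 \<le> p" "p \<le> 1"
  shows "rexp (\<lambda>_. p) I (\<lambda>S. exp (t * real (card S))) = (1 - p + p * exp t) ^ card I"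
  using rexp_tilt[OF assms(1), of "\<lambda>_. p" t "\<lambda>_. 1"] assms by (simp add: rexp_const)

text \<open>Exponential Markov inequality with parameter 1; the factor 2 comes from
  \<open>exp 1 \<le> 3\<close>. The lower bound below uses the parameter -1 and
  \<open>exp (- 1) \<le> 1 / 2\<close>.\<close>

lemma chernoff_upper:
  assumes "finite I" "J \<subseteq> I" "0 \<le> p" "p \<le> 1"
  shows "rexp (\<lambda>_. p) I (\<lambda>S. of_bool (t \<le> real (card (S \<inter> J)))) \<le> exp (2 * p * card J - t)"
proof -
  have fJ: "finite J" using assms finite_subset by auto
  have "rexp (\<lambda>_. p) I (\<lambda>S. of_bool (t \<le> real (card (S \<inter> J)))) =
     rexp (\<lambda>_. p) J (\<lambda>S. of_bool (t \<le> real (card S)))"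
    by (rule rexp_restrict[OF assms(1,2)])
  also have "\<dots> \<le> rexp (\<lambda>_. p) J (\<lambda>S. exp (- t) * exp (1 * real (card S)))"
    using assms by (intro rexp_mono) (auto simp flip: exp_add)
  also have "\<dots> = exp (- t) * (1 - p + p * exp 1) ^ card J"
    using assms fJ by (simp only: rexp_cmult rexp_exp_card)
  also have "\<dots> \<le> exp (- t) * exp (2 * p) ^ card J"
  proof (intro mult_left_mono power_mono)
    have "1 - p + p * exp 1 \<le> 1 - p + p * 3"
      using assms exp_le by (intro add_mono mult_left_mono) auto
    also have "\<dots> = 1 + 2 * p" by simp
    also have "\<dots> \<le> exp (2 * p)" by (rule exp_ge_add_one_self)
    finally show "1 - p + p * exp 1 \<le> exp (2 * p)" .
  qed (use assms in auto)
  also have "\<dots> = exp (2 * p * card J - t)"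
    by (simp add: exp_of_nat_mult[symmetric] algebra_simps flip: exp_add)
  finally show ?thesis .
qed

lemma chernoff_lower:
  assumes "finite I" "J \<subseteq> I" "0 \<le> p" "p \<le> 1"
  shows "rexp (\<lambda>_. p) I (\<lambda>S. of_bool (real (card (S \<inter> J)) \<le> t)) \<le> exp (t - p * card J / 2)"
proof -
  have fJ: "finite J" using assms finite_subset by auto
  have "rexp (\<lambda>_. p) I (\<lambda>S. of_bool (real (card (S \<inter> J)) \<le> t)) =
     rexp (\<lambda>_. p) J (\<lambda>S. of_bool (real (card S) \<le> t))"
    by (rule rexp_restrict[OF assms(1,2)])
  also have "\<dots> \<le> rexp (\<lambda>_. p) J (\<lambda>S. exp t * exp ((- 1) * real (card S)))"
    using assms by (intro rexp_mono) (auto simp flip: exp_add)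
  also have "\<dots> = exp t * (1 - p + p * exp (- 1)) ^ card J"
    using assms fJ by (simp only: rexp_cmult rexp_exp_card)
  also have "\<dots> \<le> exp t * exp (- p / 2) ^ card J"
  proof (intro mult_left_mono power_mono)
    have "exp (- 1) \<le> (1 / 2 :: real)"
      using exp_ge_add_one_self[of 1] by (simp add: exp_minus field_simps)
    then have "1 - p + p * exp (- 1) \<le> 1 - p + p * (1 / 2)"
      using assms by (intro add_mono mult_left_mono) auto
    also have "\<dots> = 1 + (- p / 2)" by simp
    also have "\<dots> \<le> exp (- p / 2)" by (rule exp_ge_add_one_self)
    finally show "1 - p + p * exp (- 1) \<le> exp (- p / 2)" .
  qed (use assms in auto)
  also have "\<dots> = exp (t - p * card J / 2)"
    by (simp add: exp_of_nat_mult[symmetric] algebra_simps flip: exp_add)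
  finally show ?thesis .
qed

text \<open>An involution of the whole type is produced instead of a bijection, so that the same map
  relabels vertices and edges and no inverse has to be handled.\<close>

lemma swap_involution:
  assumes "finite P" "finite Q" "P \<inter> Q = {}" "card P = card Q"
  shows "\<exists>\<pi>. (\<forall>x. \<pi> (\<pi> x) = x) \<and> (\<forall>x\<in>P. \<pi> x \<in> Q) \<and> (\<forall>x\<in>Q. \<pi> x \<in> P) \<and> (\<forall>x. x \<notin> P \<longrightarrow> x \<notin> Q \<longrightarrow> \<pi> x = x)"
proof -
  obtain h where h: "bij_betw h P Q" using finite_same_card_bij[OF assms(1,2,4)] by auto
  define g where "g = inv_into P h"
  have gh: "g (h x) = x" if "x \<in> P" for x using h that by (simp add: g_def bij_betw_inv_into_left)
  have hg: "h (g x) = x" if "x \<in> Q" for x using h that by (simp add: g_def bij_betw_inv_into_right)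
  have hP: "h x \<in> Q" if "x \<in> P" for x using h that by (auto simp: bij_betw_def)
  have gQ: "g x \<in> P" if "x \<in> Q" for x using h that by (auto simp: g_def bij_betw_def intro: inv_into_into)
  define \<pi> where "\<pi> = (\<lambda>x. if x \<in> P then h x else if x \<in> Q then g x else x)"
  show ?thesis
    by (rule exI[of _ \<pi>]) (use assms(3) gh hg hP gQ in \<open>auto simp: \<pi>_def\<close>)
qed

text \<open>For a vertex whose edges to \<open>W\<close> are still unexposed, this is the
  probability that those edges contribute at least \<open>t\<close> to its neighbourhood
  sum.\<close>

definition sgn_tail :: "real \<Rightarrow> 'a set \<Rightarrow> ('a \<Rightarrow> int) \<Rightarrow> int \<Rightarrow> real" where
  "sgn_tail p W s t = rexp (\<lambda>_. p) W (\<lambda>S. of_bool (t \<le> (\<Sum>y\<in>S. s y)))"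

lemma sum_signs:
  assumes "finite S" "\<And>y. y \<in> S \<Longrightarrow> s y = 1 \<or> s y = (-1 :: int)"
  shows "(\<Sum>y\<in>S. s y) = int (card {y\<in>S. s y = 1}) - int (card {y\<in>S. s y = -1})"
    "card S = card {y\<in>S. s y = 1} + card {y\<in>S. s y = -1}"
proof -
  let ?P = "{y\<in>S. s y = 1}" and ?N = "{y\<in>S. s y = -1}"
  have S: "S = ?P \<union> ?N" "?P \<inter> ?N = {}" using assms by auto
  have "(\<Sum>y\<in>S. s y) = (\<Sum>y\<in>?P. s y) + (\<Sum>y\<in>?N. s y)"
    using assms(1) S by (metis (lifting) finite_Un sum.union_disjoint)
  then show "(\<Sum>y\<in>S. s y) = int (card ?P) - int (card ?N)" by simp
  show "card S = card ?P + card ?N"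
    using assms(1) S by (metis (lifting) finite_Un card_Un_disjoint)
qed

text \<open>Relative to the baseline \<open>- card N\<close>, a negative vertex counts 1 when it is
  absent and a positive vertex counts 1 when it is present. After the membership on \<open>N\<close>
  is flipped, the signed sum is a shifted cardinality. The variances \<open>p * (1 - p)\<close> are
  unaffected, so the Poisson binomial estimates apply.\<close>

lemma rexp_signed_sum:
  fixes s :: "'a \<Rightarrow> int" and p :: real
  assumes W: "finite W" "\<And>y. y \<in> W \<Longrightarrow> s y = 1 \<or> s y = -1" and N: "N = {y\<in>W. s y = -1}"
  shows "rexp q W (\<lambda>S. f (\<Sum>y\<in>S. s y)) =
    rexp (\<lambda>y. if y \<in> N then 1 - q y else q y) W (\<lambda>S. f (int (card S) - int (card N)))"
proof -
  have "rexp q W (\<lambda>S. f (\<Sum>y\<in>S. s y)) = 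
    rexp (\<lambda>y. if y \<in> N then 1 - q y else q y) W (\<lambda>S. f (\<Sum>y\<in>S - N \<union> (W \<inter> N - S). s y))"
    by (rule rexp_flip[OF W(1)])
  also have "\<dots> = rexp (\<lambda>y. if y \<in> N then 1 - q y else q y) W (\<lambda>S. f (int (card S) - int (card N)))"
  proof (intro rexp_cong refl arg_cong[where f = f])
    fix S assume S: "S \<subseteq> W"
    have fin: "finite S" "finite N" using S W N finite_subset by auto
    have WN: "W \<inter> N - S = N - S" using N by auto
    have "(\<Sum>y\<in>S - N \<union> (N - S). s y) = (\<Sum>y\<in>S - N. s y) + (\<Sum>y\<in>N - S. s y)"
      using fin by (intro sum.union_disjoint) auto
    also have "(\<Sum>y\<in>S - N. s y) = (\<Sum>y\<in>S - N. 1)"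
      using S W N by (intro sum.cong) auto
    also have "(\<Sum>y\<in>N - S. s y) = (\<Sum>y\<in>N - S. - 1)"
      using N by (intro sum.cong) auto
    finally have "(\<Sum>y\<in>S - N \<union> (N - S). s y) = int (card (S - N)) - int (card (N - S))" by simp
    moreover have "card (S - N) + card (S \<inter> N) = card S" "card (N - S) + card (S \<inter> N) = card N"
      using fin card_Int_Diff[of S N] card_Int_Diff[of N S] by (auto simp: Int_commute)
    ultimately show "(\<Sum>y\<in>S - N \<union> (W \<inter> N - S). s y) = int (card S) - int (card N)"
      unfolding WN by linarith
  qed
  finally show ?thesis .
qed

lemma signed_sum_eq_le:
  fixes s :: "'a \<Rightarrow> int" and p :: real
  assumes W: "finite W" "\<And>y. y \<in> W \<Longrightarrow> s y = 1 \<or> s y = -1" and p: "0 \<le> p" "p \<le> 1"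
    and pos: "0 < real (card W) * (p * (1 - p))"
  shows "rexp (\<lambda>_. p) W (\<lambda>S. of_bool ((\<Sum>y\<in>S. s y) = k)) \<le> 2 / sqrt (card W * (p * (1 - p)))"
proof -
  define N where "N = {y\<in>W. s y = -1}"
  have "rexp (\<lambda>_. p) W (\<lambda>S. of_bool ((\<Sum>y\<in>S. s y) = k)) = 
    rexp (\<lambda>y. if y \<in> N then 1 - p else p) W (\<lambda>S. of_bool (int (card S) - int (card N) = k))"
    by (rule rexp_signed_sum[where s = s, OF W N_def, where f = "\<lambda>z. of_bool (z = k)"])
  also have "\<dots> = pcard (\<lambda>y. if y \<in> N then 1 - p else p) W (k + int (card N))"
    unfolding pcard_def by (intro rexp_cong refl arg_cong[where f = of_bool]) auto
  also have "\<dots> \<le> 2 / sqrt (card W * (p * (1 - p)))"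
  proof (rule pcard_le[OF W(1)])
    have "(\<Sum>i\<in>W. (if i \<in> N then 1 - p else p) * (1 - (if i \<in> N then 1 - p else p))) = (\<Sum>i\<in>W. p * (1 - p))"
      by (intro sum.cong) auto
    then show "card W * (p * (1 - p)) = (\<Sum>i\<in>W. (if i \<in> N then 1 - p else p) * (1 - (if i \<in> N then 1 - p else p)))"
      by simp
  qed (use p pos in auto)
  finally show ?thesis .
qed

lemma signed_sum_range_le:
  fixes s :: "'a \<Rightarrow> int" and p :: real
  assumes W: "finite W" "\<And>y. y \<in> W \<Longrightarrow> s y = 1 \<or> s y = -1" and p: "0 \<le> p" "p \<le> 1"
    and pos: "0 < real (card W) * (p * (1 - p))" and "a \<le> b + 1"
  shows "rexp (\<lambda>_. p) W (\<lambda>S. of_bool (a \<le> (\<Sum>y\<in>S. s y) \<and> (\<Sum>y\<in>S. s y) \<le> b)) \<le> (b - a + 1) * (2 / sqrt (card W * (p * (1 - p))))"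
proof -
  have "rexp (\<lambda>_. p) W (\<lambda>S. of_bool (a \<le> (\<Sum>y\<in>S. s y) \<and> (\<Sum>y\<in>S. s y) \<le> b)) =
    rexp (\<lambda>_. p) W (\<lambda>S. \<Sum>k\<in>{a..b}. of_bool ((\<Sum>y\<in>S. s y) = k))"
    by (intro rexp_cong refl) (simp add: of_bool_def)
  also have "\<dots> = (\<Sum>k\<in>{a..b}. rexp (\<lambda>_. p) W (\<lambda>S. of_bool ((\<Sum>y\<in>S. s y) = k)))"
    by (rule rexp_sum)
  also have "\<dots> \<le> (\<Sum>k\<in>{a..b}. 2 / sqrt (card W * (p * (1 - p))))"
    by (intro sum_mono signed_sum_eq_le W p pos)
  finally show ?thesis using assms(6) by simp
qed

text \<open>An involution exchanging positive and negative vertices shows that the sum has a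
  symmetric law. The tail at \<open>t\<close> then differs from 1/2 by half of the mass of an
  integer interval symmetric about 0, of length at most \<open>2 * \<bar>t\<bar> + 1\<close>, and
  the bound for point probabilities finishes.\<close>

lemma sgn_tail_balanced:
  fixes s :: "'a \<Rightarrow> int" and p :: real
  assumes W: "finite W" "\<And>y. y \<in> W \<Longrightarrow> s y = 1 \<or> s y = -1" and p: "0 \<le> p" "p \<le> 1"
    and pos: "0 < real (card W) * (p * (1 - p))" and bal: "(\<Sum>y\<in>W. s y) = 0"
  shows "\<bar>sgn_tail p W s t - 1 / 2\<bar> \<le> (2 * \<bar>real_of_int t\<bar> + 1) / sqrt (card W * (p * (1 - p)))"
proof -
  define P N where "P = {y\<in>W. s y = 1}" and "N = {y\<in>W. s y = -1}"
  have "card P = card N" using sum_signs(1)[of W s, OF W] bal unfolding P_def N_def by linarith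
  moreover have "P \<inter> N = {}" "finite P" "finite N" using W(1) by (auto simp: P_def N_def)
  ultimately obtain \<pi> where \<pi>: "\<And>x. \<pi> (\<pi> x) = x" "\<And>x. x \<in> P \<Longrightarrow> \<pi> x \<in> N" "\<And>x. x \<in> N \<Longrightarrow> \<pi> x \<in> P"
    using swap_involution[of P N] by metis
  have inj: "inj_on \<pi> A" for A using \<pi>(1) by (metis inj_onI)
  have \<pi>W: "\<pi> x \<in> W" "s (\<pi> x) = - s x" if "x \<in> W" for x
    using \<pi>(2,3)[of x] W(2)[OF that] that by (auto simp: P_def N_def)
  have im: "\<pi> ` W = W"
  proof
    show "\<pi> ` W \<subseteq> W" using \<pi>W by auto
    show "W \<subseteq> \<pi> ` W" using \<pi>W(1) \<pi>(1) by (metis imageI subsetI)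
  qed
  let ?E = "\<lambda>Q. rexp (\<lambda>_. p) W (\<lambda>S. of_bool (Q (\<Sum>y\<in>S. s y)))"
  have sym: "?E Q = ?E (\<lambda>z. Q (- z))" for Q
  proof -
    have "?E Q = rexp (\<lambda>_. p) (\<pi> ` W) (\<lambda>S. of_bool (Q (\<Sum>y\<in>S. s y)))" by (simp add: im)
    also have "\<dots> = rexp (\<lambda>_. p) W (\<lambda>S. of_bool (Q (\<Sum>y\<in>\<pi> ` S. s y)))"
      by (rule rexp_image[OF W(1) inj])
    also have "\<dots> = ?E (\<lambda>z. Q (- z))"
    proof (intro rexp_cong refl arg_cong[where f = of_bool] arg_cong[where f = Q])
      fix S assume "S \<subseteq> W"
      then show "(\<Sum>y\<in>\<pi> ` S. s y) = - (\<Sum>y\<in>S. s y)"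
        unfolding sum.reindex[OF inj] sum_negf[symmetric] by (intro sum.cong) (auto simp: \<pi>W)
    qed
    finally show ?thesis .
  qed
  define r where "r = 2 / sqrt (card W * (p * (1 - p)))"
  have r: "r > 0" using pos by (simp add: r_def)
  have r2: "x * r / 2 = x / sqrt (card W * (p * (1 - p)))" for x by (simp add: r_def)
  have tot: "?E (\<lambda>z. t \<le> z) + ?E (\<lambda>z. z < t) = 1"
  proof -
    have "?E (\<lambda>z. t \<le> z) + ?E (\<lambda>z. z < t) = rexp (\<lambda>_. p) W (\<lambda>_. 1)"
      unfolding rexp_add[symmetric] by (intro rexp_cong refl) auto
    then show ?thesis using W(1) by (simp add: rexp_const)
  qed
  have s1: "?E (\<lambda>z. z < t) = ?E (\<lambda>z. 1 - t \<le> z)"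
  proof -
    have "?E (\<lambda>z. z < t) = ?E (\<lambda>z. - z < t)" by (rule sym)
    also have "\<dots> = ?E (\<lambda>z. 1 - t \<le> z)" by (intro rexp_cong refl arg_cong[where f = of_bool]) auto
    finally show ?thesis .
  qed
  show ?thesis
  proof (cases "1 \<le> t")
    case True
    have "?E (\<lambda>z. 1 - t \<le> z) = ?E (\<lambda>z. t \<le> z) + ?E (\<lambda>z. 1 - t \<le> z \<and> z \<le> t - 1)"
      unfolding rexp_add[symmetric] using True by (intro rexp_cong refl) auto
    moreover have "?E (\<lambda>z. 1 - t \<le> z \<and> z \<le> t - 1) \<le> (real_of_int (t - 1) - real_of_int (1 - t) + 1) * r"
      using signed_sum_range_le[of W s p "1 - t" "t - 1", OF W p pos] True by (simp add: r_def)
    moreover have "?E (\<lambda>z. 1 - t \<le> z \<and> z \<le> t - 1) \<ge> 0" using p by (intro rexp_nonneg) auto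
    moreover have "(real_of_int (t - 1) - real_of_int (1 - t) + 1) * r \<le> (2 * \<bar>real_of_int t\<bar> + 1) * r"
      using True r by (intro mult_right_mono) auto
    ultimately have "\<bar>?E (\<lambda>z. t \<le> z) - 1 / 2\<bar> \<le> (2 * \<bar>real_of_int t\<bar> + 1) * r / 2"
      using tot s1 by linarith
    then show ?thesis unfolding sgn_tail_def r2 .
  next
    case False
    have "?E (\<lambda>z. t \<le> z) = ?E (\<lambda>z. 1 - t \<le> z) + ?E (\<lambda>z. t \<le> z \<and> z \<le> - t)"
      unfolding rexp_add[symmetric] using False by (intro rexp_cong refl) auto
    moreover have "?E (\<lambda>z. t \<le> z \<and> z \<le> - t) \<le> (real_of_int (- t) - real_of_int t + 1) * r"
      using signed_sum_range_le[of W s p t "- t", OF W p pos] False by (simp add: r_def)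
    moreover have "?E (\<lambda>z. t \<le> z \<and> z \<le> - t) \<ge> 0" using p by (intro rexp_nonneg) auto
    moreover have "(real_of_int (- t) - real_of_int t + 1) * r \<le> (2 * \<bar>real_of_int t\<bar> + 1) * r"
      using False r by (intro mult_right_mono) auto
    ultimately have "\<bar>?E (\<lambda>z. t \<le> z) - 1 / 2\<bar> \<le> (2 * \<bar>real_of_int t\<bar> + 1) * r / 2"
      using tot s1 by linarith
    then show ?thesis unfolding sgn_tail_def r2 .
  qed
qed

text \<open>Splitting off a set \<open>X\<close> of \<open>d\<close> vertices of the prevailing sign
  leaves a balanced rest. The chosen part \<open>A\<close> of \<open>X\<close> moves the threshold
  by at most \<open>card A\<close>, whose mean is \<open>p * d\<close>; averaging over
  \<open>A\<close> gives the term \<open>2 * p * d\<close>.\<close>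

lemma sgn_tail_half:
  fixes s :: "'a \<Rightarrow> int" and p d :: real
  assumes W: "finite W" "\<And>y. y \<in> W \<Longrightarrow> s y = 1 \<or> s y = -1" and p: "0 \<le> p" "p \<le> 1"
    and d: "d = \<bar>real_of_int (\<Sum>y\<in>W. s y)\<bar>"
    and pos: "0 < (real (card W) - d) * (p * (1 - p))"
  shows "\<bar>sgn_tail p W s t - 1 / 2\<bar> \<le> (2 * \<bar>real_of_int t\<bar> + 2 * p * d + 1) / sqrt ((card W - d) * (p * (1 - p)))"
proof -
  define m where "m = nat \<bar>\<Sum>y\<in>W. s y\<bar>"
  define \<sigma> where "\<sigma> = (if (\<Sum>y\<in>W. s y) \<ge> 0 then 1 else -1 :: int)"
  have md: "real m = d" by (simp add: m_def d)
  have "m \<le> card {y\<in>W. s y = \<sigma>}"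
    using sum_signs(1)[of W s, OF W] by (auto simp: m_def \<sigma>_def)
  then obtain X where X: "X \<subseteq> {y\<in>W. s y = \<sigma>}" "card X = m"
    using obtain_subset_with_card_n by metis
  define W0 where "W0 = W - X"
  have fin: "finite X" "finite W0" "X \<union> W0 = W" "X \<inter> W0 = {}" "W0 \<subseteq> W"
    using X W(1) by (auto simp: W0_def intro: finite_subset)
  have cW0: "real (card W0) = card W - d"
    using fin X(2) md card_Un_disjoint[of X W0] by simp
  have "(\<Sum>y\<in>W. s y) = (\<Sum>y\<in>X. s y) + (\<Sum>y\<in>W0. s y)"
    using sum.union_disjoint[of X W0 s] fin by simp
  also have "(\<Sum>y\<in>X. s y) = (\<Sum>y\<in>X. \<sigma>)" using X(1) by (intro sum.cong) auto
  also have "\<dots> = (\<Sum>y\<in>W. s y)" by (simp add: X(2) m_def \<sigma>_def)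
  finally have bal: "(\<Sum>y\<in>W0. s y) = 0" by simp
  define r where "r = sqrt ((card W - d) * (p * (1 - p)))"
  have r: "r > 0" using pos by (simp add: r_def)
  have b0: "\<bar>sgn_tail p W0 s t' - 1 / 2\<bar> \<le> (2 * \<bar>real_of_int t'\<bar> + 1) / r" for t'
    using sgn_tail_balanced[OF fin(2) _ p _ bal, of t'] W(2) fin pos by (auto simp: cW0 r_def)
  have "sgn_tail p W s t = rexp (\<lambda>_. p) X (\<lambda>A. sgn_tail p W0 s (t - (\<Sum>y\<in>A. s y)))"
  proof -
    have "rexp (\<lambda>_. p) (X \<union> W0) (\<lambda>S. of_bool (t \<le> (\<Sum>y\<in>S. s y))) =
      rexp (\<lambda>_. p) X (\<lambda>A. rexp (\<lambda>_. p) W0 (\<lambda>B. of_bool (t \<le> (\<Sum>y\<in>A \<union> B. s y))))"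
      using fin by (intro rexp_union) auto
    also have "\<dots> = rexp (\<lambda>_. p) X (\<lambda>A. rexp (\<lambda>_. p) W0 (\<lambda>B. of_bool (t - (\<Sum>y\<in>A. s y) \<le> (\<Sum>y\<in>B. s y))))"
    proof (intro rexp_cong refl arg_cong[where f = of_bool])
      fix A B assume "A \<subseteq> X" "B \<subseteq> W0"
      then have "(\<Sum>y\<in>A \<union> B. s y) = (\<Sum>y\<in>A. s y) + (\<Sum>y\<in>B. s y)"
        using fin by (intro sum.union_disjoint) (auto intro: finite_subset)
      then show "(t \<le> (\<Sum>y\<in>A \<union> B. s y)) = (t - (\<Sum>y\<in>A. s y) \<le> (\<Sum>y\<in>B. s y))" by auto
    qed
    finally show ?thesis by (simp add: sgn_tail_def fin)
  qed
  then have "sgn_tail p W s t - 1 / 2 = rexp (\<lambda>_. p) X (\<lambda>A. sgn_tail p W0 s (t - (\<Sum>y\<in>A. s y)) - 1 / 2)"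
    using fin by (simp add: rexp_diff rexp_const)
  also have "\<bar>\<dots>\<bar> \<le> rexp (\<lambda>_. p) X (\<lambda>A. \<bar>sgn_tail p W0 s (t - (\<Sum>y\<in>A. s y)) - 1 / 2\<bar>)"
    using p by (intro rexp_abs_le) auto
  also have "\<dots> \<le> rexp (\<lambda>_. p) X (\<lambda>A. (2 * \<bar>real_of_int t\<bar> + 1) / r + (2 / r) * real (card A))"
  proof (intro rexp_mono)
    fix A assume A: "A \<subseteq> X"
    have "\<bar>\<Sum>y\<in>A. s y\<bar> \<le> (\<Sum>y\<in>A. 1)"
      using A X W(2) by (intro order_trans[OF sum_abs] sum_mono) (force simp: subset_iff)
    moreover define z where "z = (\<Sum>y\<in>A. s y)"
    ultimately have "\<bar>real_of_int (t - (\<Sum>y\<in>A. s y))\<bar> \<le> \<bar>real_of_int t\<bar> + real (card A)"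
      unfolding z_def[symmetric] by auto
    then have "(2 * \<bar>real_of_int (t - (\<Sum>y\<in>A. s y))\<bar> + 1) / r \<le> (2 * (\<bar>real_of_int t\<bar> + real (card A)) + 1) / r"
      using r by (intro divide_right_mono) auto
    then show "\<bar>sgn_tail p W0 s (t - (\<Sum>y\<in>A. s y)) - 1 / 2\<bar> \<le> (2 * \<bar>real_of_int t\<bar> + 1) / r + (2 / r) * real (card A)"
      using b0[of "t - (\<Sum>y\<in>A. s y)"] by (simp add: add_divide_distrib algebra_simps)
  qed (use p in auto)
  also have "\<dots> = (2 * \<bar>real_of_int t\<bar> + 2 * p * d + 1) / r"
    using fin X(2) md by (simp only: rexp_add rexp_cmult rexp_const rexp_card) (simp add: add_divide_distrib algebra_simps)
  finally show ?thesis by (simp add: r_def)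
qed

lemma sgn_tail_antimono:
  assumes "0 \<le> p" "p \<le> 1" "t \<le> t'" "\<And>y. y \<in> W \<Longrightarrow> s' y \<le> s y"
  shows "sgn_tail p W s' t' \<le> sgn_tail p W s t"
  unfolding sgn_tail_def
proof (intro rexp_mono)
  fix S assume "S \<subseteq> W"
  then have "(\<Sum>y\<in>S. s' y) \<le> (\<Sum>y\<in>S. s y)" using assms by (intro sum_mono) auto
  then show "of_bool (t' \<le> (\<Sum>y\<in>S. s' y)) \<le> (of_bool (t \<le> (\<Sum>y\<in>S. s y)) :: real)" using assms(3) by auto
qed (use assms in auto)

text \<open>The intermediate configuration, in which the vertices of \<open>F\<close> are removed, is compared with
  \<open>s\<close> by changing the inclusion probabilities of \<open>F\<close> from \<open>0\<close> to \<open>p\<close> one vertex at a time.\<close>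

lemma sgn_tail_gap:
  fixes s :: "'a \<Rightarrow> int" and p v :: real
  assumes W: "finite W" "\<And>y. y \<in> W \<Longrightarrow> s y = 1 \<or> s y = -1" and p: "0 \<le> p" "p \<le> 1"
    and F: "F \<subseteq> W" "\<And>y. y \<in> F \<Longrightarrow> s y = 1"
    and v: "v = (real (card W) - real (card F)) * (p * (1 - p))" "v \<ge> 100"
    and t: "\<bar>real_of_int t\<bar> + 1 + p * \<bar>real_of_int (\<Sum>y\<in>W. s y)\<bar> + 2 * p * card F \<le> sqrt v"
  shows "local_const 1 / sqrt (card W * p) * (p * card F)
    \<le> sgn_tail p W s t - sgn_tail p W (\<lambda>y. if y \<in> F then -1 else s y) t"
proof -
  define N where "N = {y\<in>W. s y = -1}"
  define P where "P = {y\<in>W. s y = 1}"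
  have FN: "F \<inter> N = {}" and FP: "F \<subseteq> P" using F by (auto simp: N_def P_def)
  have fin: "finite F" "finite N" "finite P" using F W by (auto simp: N_def P_def intro: finite_subset)
  define q where "q = (\<lambda>y. if y \<in> N then 1 - p else p)"
  define r where "r = (\<lambda>y. if y \<in> F then 0 else q y)"
  define k where "k = t + int (card N)"
  have st: "sgn_tail p W s t = rexp q W (\<lambda>S. of_bool (k \<le> int (card S)))"
  proof -
    have "sgn_tail p W s t = rexp q W (\<lambda>S. of_bool (t \<le> int (card S) - int (card N)))"
      unfolding sgn_tail_def q_def by (intro rexp_signed_sum[where f = "\<lambda>z. of_bool (t \<le> z)"] W N_def)
    also have "\<dots> = rexp q W (\<lambda>S. of_bool (k \<le> int (card S)))"
      unfolding k_def by (intro rexp_cong refl arg_cong[where f = of_bool]) auto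
    finally show ?thesis .
  qed
  define WF where "WF = W - F"
  have WF: "F \<union> WF = W" "F \<inter> WF = {}" "finite WF" using F W by (auto simp: WF_def)
  \<comment> \<open>In the flipped configuration every chosen vertex of \<open>F\<close> lowers the
    sum, so deleting \<open>F\<close> can only help; the deleted configuration is then
    \<open>s\<close> with weight zero on \<open>F\<close>.\<close>
  have "sgn_tail p W (\<lambda>y. if y \<in> F then -1 else s y) t \<le> sgn_tail p WF s t"
  proof -
    have "sgn_tail p W (\<lambda>y. if y \<in> F then -1 else s y) t = rexp (\<lambda>_. p) F (\<lambda>A. rexp (\<lambda>_. p) WF (\<lambda>B.
       of_bool (t \<le> (\<Sum>y\<in>A \<union> B. if y \<in> F then -1 else s y))))"
      unfolding sgn_tail_def WF(1)[symmetric] using fin WF by (intro rexp_union) auto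
    also have "\<dots> \<le> rexp (\<lambda>_. p) F (\<lambda>A. rexp (\<lambda>_. p) WF (\<lambda>B. of_bool (t \<le> (\<Sum>y\<in>B. s y))))"
    proof (intro rexp_mono)
      fix A B assume A: "A \<subseteq> F" and B: "B \<subseteq> WF"
      have "(\<Sum>y\<in>A \<union> B. if y \<in> F then -1 else s y) = 
         (\<Sum>y\<in>A. if y \<in> F then -1 else s y) + (\<Sum>y\<in>B. if y \<in> F then -1 else s y)"
        using A B WF fin by (intro sum.union_disjoint) (auto intro: finite_subset)
      also have "(\<Sum>y\<in>A. if y \<in> F then -1 else s y) = (\<Sum>y\<in>A. - 1)" using A by (intro sum.cong) auto
      also have "(\<Sum>y\<in>B. if y \<in> F then -1 else s y) = (\<Sum>y\<in>B. s y)" using B WF by (intro sum.cong) auto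
      finally show "of_bool (t \<le> (\<Sum>y\<in>A \<union> B. if y \<in> F then -1 else s y)) \<le> (of_bool (t \<le> (\<Sum>y\<in>B. s y)) :: real)"
        by auto
    qed (use p in auto)
    finally show ?thesis using fin by (simp add: sgn_tail_def rexp_const)
  qed
  also have "sgn_tail p WF s t = rexp r W (\<lambda>S. of_bool (k \<le> int (card S)))"
  proof -
    have NW: "N = {y\<in>WF. s y = -1}" using F by (auto simp: N_def WF_def)
    have "sgn_tail p WF s t = rexp q WF (\<lambda>S. of_bool (t \<le> int (card S) - int (card N)))"
      unfolding sgn_tail_def q_def using WF W
      by (intro rexp_signed_sum[where f = "\<lambda>z. of_bool (t \<le> z)"] NW) auto
    also have "\<dots> = rexp r WF (\<lambda>S. of_bool (k \<le> int (card S)))"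
      by (intro rexp_cong refl arg_cong[where f = of_bool]) (auto simp: r_def k_def WF_def)
    also have "\<dots> = rexp r W (\<lambda>S. of_bool (k \<le> int (card S)))"
      unfolding WF_def using F by (intro rexp_zero[symmetric] W) (auto simp: r_def)
    finally show ?thesis .
  qed
  also have "local_const 1 / sqrt (card W * p) * (\<Sum>i\<in>F. q i - r i) \<le>
     rexp q W (\<lambda>S. of_bool (k \<le> int (card S))) - rexp r W (\<lambda>S. of_bool (k \<le> int (card S)))"
  proof (rule card_tail_hybrid[OF W(1) _ F(1)])
    fix i assume "i \<in> W" then show "0 \<le> r i \<and> r i \<le> q i \<and> q i \<le> 1" using p by (auto simp: q_def r_def)
  next
    fix h i assume i: "i \<in> F" and h: "\<And>j. j \<in> W \<Longrightarrow> h j = q j \<or> h j = r j"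
    define V where "V = (\<Sum>j\<in>W - {i}. h j * (1 - h j))"
    have h1: "h j = (if j \<in> N then 1 - p else p)" if "j \<in> WF" for j
    proof -
      have "j \<in> W" "j \<notin> F" using that by (auto simp: WF_def)
      then show ?thesis using h[of j] by (auto simp: q_def r_def)
    qed
    have h2: "h j = p \<or> h j = 0" if "j \<in> F" for j
    proof -
      have "j \<in> W" "j \<notin> N" using that F FN by auto
      then show ?thesis using h[of j] by (auto simp: q_def r_def)
    qed
    have h01: "0 \<le> h j \<and> h j \<le> 1" if "j \<in> W" for j
      using h1[of j] h2[of j] that p WF by (cases "j \<in> F") (auto split: if_splits)
    have split: "W - {i} = WF \<union> (F - {i})" "WF \<inter> (F - {i}) = {}" using i WF by auto
    have hh: "h j * (1 - h j) = p * (1 - p)" if "j \<in> WF" for j using h1[OF that] by auto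
    have hF: "0 \<le> h j * (1 - h j) \<and> h j * (1 - h j) \<le> p * (1 - p)" if "j \<in> F" for j using h2[OF that] p by auto
    have cWF: "real (card WF) = real (card W) - real (card F)"
      using WF fin card_Un_disjoint[of F WF] by simp
    have VW: "V = (\<Sum>j\<in>WF. h j * (1 - h j)) + (\<Sum>j\<in>F - {i}. h j * (1 - h j))"
      unfolding V_def split(1) using fin WF split(2) by (intro sum.union_disjoint) auto
    have VWF: "(\<Sum>j\<in>WF. h j * (1 - h j)) = v" by (simp add: hh v cWF)
    have "0 \<le> (\<Sum>j\<in>F - {i}. h j * (1 - h j))" using hF by (intro sum_nonneg) auto
    then have V1: "v \<le> V" using VW VWF by simp
    have "(\<Sum>j\<in>F - {i}. h j * (1 - h j)) \<le> (\<Sum>j\<in>F - {i}. p * (1 - p))" using hF by (intro sum_mono) auto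
    also have "\<dots> = real (card (F - {i})) * (p * (1 - p))" by simp
    also have "\<dots> \<le> real (card F) * (p * (1 - p))" using p fin by (intro mult_right_mono) (auto intro: card_mono)
    finally have "V \<le> real (card W) * (p * (1 - p))" using VW VWF v by (simp add: algebra_simps)
    also have "\<dots> \<le> card W * p" using p by (intro mult_left_mono) (auto simp: algebra_simps)
    finally have V2: "V \<le> card W * p" .
    \<comment> \<open>Up to O(p * card F), the mean of the flipped cardinality is
      \<open>card N\<close> plus \<open>p\<close> times the imbalance. Hence
      \<open>k - 1 = t + card N - 1\<close> deviates from it by an amount that the hypothesis on
      \<open>t\<close> keeps below one standard deviation.\<close>
    have mean: "\<bar>real_of_int (k - 1) - (\<Sum>j\<in>W - {i}. h j)\<bar> \<le> 1 * sqrt V"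
    proof -
      have "(\<Sum>j\<in>W - {i}. h j) = (\<Sum>j\<in>WF. h j) + (\<Sum>j\<in>F - {i}. h j)"
        unfolding split(1) using fin WF split(2) by (intro sum.union_disjoint) auto
      also have "(\<Sum>j\<in>WF. h j) = (\<Sum>j\<in>N. h j) + (\<Sum>j\<in>P - F. h j)"
      proof -
        have "WF = N \<union> (P - F)" using W(2) FN by (auto simp: WF_def N_def P_def)
        then show ?thesis using fin by (simp only:) (intro sum.union_disjoint, auto simp: N_def P_def)
      qed
      also have "(\<Sum>j\<in>N. h j) = (\<Sum>j\<in>N. 1 - p)" 
      proof (intro sum.cong refl)
        fix j assume j: "j \<in> N"
        then have "j \<in> WF" using FN by (auto simp: WF_def N_def)
        then show "h j = 1 - p" using h1[of j] j by simp
      qed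
      also have "(\<Sum>j\<in>P - F. h j) = (\<Sum>j\<in>P - F. p)" 
      proof (intro sum.cong refl)
        fix j assume j: "j \<in> P - F"
        then have "j \<in> WF" "j \<notin> N" by (auto simp: WF_def N_def P_def)
        then show "h j = p" using h1[of j] by simp
      qed
      finally have m: "(\<Sum>j\<in>W - {i}. h j) = card N * (1 - p) + (real (card P) - card F) * p + (\<Sum>j\<in>F - {i}. h j)"
        using fin FP by (simp add: card_Diff_subset card_mono of_nat_diff)
      have "0 \<le> (\<Sum>j\<in>F - {i}. h j)" using h01 F by (intro sum_nonneg) auto
      moreover have "(\<Sum>j\<in>F - {i}. h j) \<le> p * card F"
      proof -
        have "(\<Sum>j\<in>F - {i}. h j) \<le> (\<Sum>j\<in>F - {i}. p)" using h2 p by (intro sum_mono) force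
        also have "\<dots> \<le> p * card F" using p fin by (auto simp: mult.commute intro!: mult_left_mono card_mono)
        finally show ?thesis .
      qed
      moreover have "\<bar>real_of_int t\<bar> + 1 + p * \<bar>real (card P) - card N\<bar> + 2 * (p * card F) \<le> sqrt v"
      proof -
        have "(\<Sum>y\<in>W. s y) = int (card P) - int (card N)"
          using sum_signs(1)[of W s, OF W] by (simp add: P_def N_def)
        then have "real_of_int (\<Sum>y\<in>W. s y) = real (card P) - card N" by linarith
        then show ?thesis using t by simp
      qed
      moreover have "real_of_int (k - 1) - (\<Sum>j\<in>W - {i}. h j) = real_of_int t - 1 - p * (real (card P) - card N)
          + p * card F - (\<Sum>j\<in>F - {i}. h j)"
        unfolding m k_def by (simp add: algebra_simps)
      moreover have "\<bar>p * (real (card P) - card N)\<bar> = p * \<bar>real (card P) - card N\<bar>" using p by (simp add: abs_mult)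
      moreover have "0 \<le> p * card F" using p by simp
      ultimately have "\<bar>real_of_int (k - 1) - (\<Sum>j\<in>W - {i}. h j)\<bar> \<le> sqrt v" by linarith
      then show ?thesis using V1 by (simp add: order_trans[OF _ real_sqrt_le_mono])
    qed
    have "local_const 1 / sqrt (card W * p) \<le> local_const 1 / sqrt V"
      using V1 V2 v(2) local_const_pos[of 1] by (intro divide_left_mono mult_pos_pos real_sqrt_le_mono) auto
    also have "\<dots> \<le> pcard h (W - {i}) (k - 1)"
      using W(1) h01 V_def V1 v(2) mean by (intro pcard_ge) auto
    finally show "local_const 1 / sqrt (card W * p) \<le> pcard h (W - {i}) (k - 1)" .
  qed
  moreover have "(\<Sum>i\<in>F. q i - r i) = p * card F"
    using FN by (simp add: q_def r_def disjoint_iff mult.commute cong: sum.cong)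
  ultimately show ?thesis using st by simp
qed

section \<open>Majority dynamics on a partially exposed graph\<close>

definition all_pairs :: "'v set \<Rightarrow> 'v set set" where
  "all_pairs V = {e. e \<subseteq> V \<and> card e = 2}"

definition cross :: "'v \<Rightarrow> 'v set \<Rightarrow> 'v set set" where
  "cross x W = (\<lambda>y. {x, y}) ` W"

text \<open>The least neighbourhood sum that makes a vertex of opinion \<open>\<sigma>\<close>
  positive on the next day. It encodes the tie rule: a positive vertex survives a tie, a negative
  one needs a strict majority.\<close>

definition thr :: "int \<Rightarrow> int" where
  "thr \<sigma> = (if \<sigma> = 1 then 0 else 1)"

lemma finite_all_pairs [simp]: "finite V \<Longrightarrow> finite (all_pairs V)"
  unfolding all_pairs_def by (rule finite_subset[of _ "Pow V"]) auto

lemma finite_cross [simp]: "finite W \<Longrightarrow> finite (cross x W)"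
  by (simp add: cross_def)

lemma pair_in_all_pairs [simp]: "{x, y} \<in> all_pairs V \<longleftrightarrow> x \<in> V \<and> y \<in> V \<and> x \<noteq> y"
  by (auto simp: all_pairs_def card_insert_if)

lemma in_cross_iff: "{x, y} \<in> cross z W \<longleftrightarrow> (x = z \<and> y \<in> W) \<or> (y = z \<and> x \<in> W)"
  by (auto simp: cross_def doubleton_eq_iff)

lemma inj_on_cross: "inj_on (\<lambda>y. {x, y}) W"
  by (auto simp: inj_on_def doubleton_eq_iff)

lemma neighbours_subset: "A \<subseteq> all_pairs V \<Longrightarrow> neighbours A v \<subseteq> V"
  using pair_in_all_pairs by (fastforce simp: neighbours_def)

lemma finite_neighbours: "finite V \<Longrightarrow> A \<subseteq> all_pairs V \<Longrightarrow> finite (neighbours A v)"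
  using neighbours_subset finite_subset by metis

lemma majority_step_iff:
  assumes "s v = 1 \<or> s v = -1"
  shows "majority_step A s v = 1 \<longleftrightarrow> thr (s v) \<le> (\<Sum>u\<in>neighbours A v. s u)"
    "majority_step A s v = 1 \<or> majority_step A s v = -1"
  using assms by (auto simp: majority_step_def thr_def sgn_if)

lemma majority_step_eq:
  assumes "s v = 1 \<or> s v = -1"
  shows "majority_step A s v = (if thr (s v) \<le> (\<Sum>u\<in>neighbours A v. s u) then 1 else -1)"
  using majority_step_iff[of s v A] assms by auto

lemma majority_step_uminus: "majority_step A (\<lambda>x. - s x) v = - majority_step A s v"
  by (simp add: majority_step_def sum_negf sgn_if)

lemma majority_step_cong:
  assumes "s v = s' v" "\<And>u. u \<in> neighbours A v \<Longrightarrow> s u = s' u"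
  shows "majority_step A s v = majority_step A s' v"
  using assms by (simp add: majority_step_def cong: sum.cong)

lemma majority_step_mono:
  assumes "s' v \<le> s v" "\<And>u. u \<in> neighbours A v \<Longrightarrow> s' u \<le> s u"
    and "s v = 1 \<or> s v = -1" "s' v = 1 \<or> s' v = -1"
  shows "majority_step A s' v \<le> majority_step A s v"
proof -
  have "(\<Sum>u\<in>neighbours A v. s' u) \<le> (\<Sum>u\<in>neighbours A v. s u)" using assms by (intro sum_mono) auto
  moreover have "thr (s v) \<le> thr (s' v)" using assms by (auto simp: thr_def)
  ultimately show ?thesis 
    unfolding majority_step_eq[of s v, OF assms(3)] majority_step_eq[of s' v, OF assms(4)] by auto
qed

section \<open>Two days of the dynamics: monotonicity and symmetry\<close>

definition maj2 :: "'v set set \<Rightarrow> ('v \<Rightarrow> int) \<Rightarrow> 'v \<Rightarrow> int" where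
  "maj2 A s = majority_step A (majority_step A s)"

lemma maj2_values:
  assumes "s v = 1 \<or> s v = -1"
  shows "maj2 A s v = 1 \<or> maj2 A s v = -1"
  unfolding maj2_def using assms by (intro majority_step_iff)

lemma maj2_mono:
  assumes "A \<subseteq> all_pairs V" "\<And>x. x \<in> V \<Longrightarrow> s x = 1 \<or> s x = -1" "\<And>x. x \<in> V \<Longrightarrow> s' x = 1 \<or> s' x = -1"
    "\<And>x. x \<in> V \<Longrightarrow> s' x \<le> s x" "v \<in> V"
  shows "maj2 A s' v \<le> maj2 A s v"
proof -
  have N: "neighbours A x \<subseteq> V" for x by (rule neighbours_subset[OF assms(1)])
  have m1: "majority_step A s' x \<le> majority_step A s x" if "x \<in> V" for x
    
    by (rule majority_step_mono) (use assms that N[of x] in auto)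
  show ?thesis unfolding maj2_def
    by (rule majority_step_mono) (use assms(2,3,5) N[of v] m1 in \<open>auto intro!: majority_step_iff(2)\<close>)
qed

lemma neighbours_image:
  assumes "\<And>x. \<pi> (\<pi> x) = x"
  shows "neighbours ((`) \<pi> ` A) (\<pi> v) = \<pi> ` neighbours A v"
proof -
  have inj: "inj \<pi>" using assms by (metis injI)
  have im: "\<pi> ` X = {y. \<pi> y \<in> X}" for X using assms by (auto simp: image_iff) metis
  have "{u, \<pi> v} \<in> (`) \<pi> ` A \<longleftrightarrow> {\<pi> u, v} \<in> A" for u
  proof -
    have e: "{u, \<pi> v} = \<pi> ` {\<pi> u, v}" using assms by simp
    show ?thesis
    proof
      assume "{u, \<pi> v} \<in> (`) \<pi> ` A"
      then obtain e where "e \<in> A" "{u, \<pi> v} = \<pi> ` e" by blast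
      moreover from this(2) have "{\<pi> u, v} = e" unfolding e by (simp only: inj_image_eq_iff[OF inj])
      ultimately show "{\<pi> u, v} \<in> A" by simp
    next
      assume "{\<pi> u, v} \<in> A"
      then show "{u, \<pi> v} \<in> (`) \<pi> ` A" unfolding e by (rule imageI)
    qed
  qed
  moreover have "u \<noteq> \<pi> v \<longleftrightarrow> \<pi> u \<noteq> v" for u using assms by metis
  ultimately show ?thesis unfolding im neighbours_def by simp
qed

lemma majority_step_image:
  assumes "\<And>x. \<pi> (\<pi> x) = x"
  shows "majority_step ((`) \<pi> ` A) s (\<pi> v) = majority_step A (\<lambda>x. s (\<pi> x)) v"
proof -
  have "inj_on \<pi> (neighbours A v)" using assms by (metis inj_onI)
  then have "(\<Sum>u\<in>\<pi> ` neighbours A v. s u) = (\<Sum>u\<in>neighbours A v. s (\<pi> u))"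
    by (simp add: sum.reindex)
  then show ?thesis unfolding majority_step_def neighbours_image[of \<pi>, OF assms] by simp
qed

lemma maj2_image:
  assumes "\<And>x. \<pi> (\<pi> x) = x"
  shows "maj2 ((`) \<pi> ` A) s (\<pi> v) = maj2 A (\<lambda>x. s (\<pi> x)) v"
proof -
  have "majority_step ((`) \<pi> ` A) s' (\<pi> x) = majority_step A (\<lambda>x. s' (\<pi> x)) x" for s' x
    by (rule majority_step_image) (rule assms)
  then show ?thesis by (simp only: maj2_def)
qed

section \<open>Fresh edges and the parameter regime\<close>

lemma neighbours_cross_union:
  assumes "X \<inter> W = {}" "A \<subseteq> (\<Union>x\<in>X. cross x W)" "x \<in> X"
  shows "neighbours (B \<union> A) x = neighbours B x \<union> {y\<in>W. {x, y} \<in> A}"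
proof -
  have "{u, x} \<in> A \<longleftrightarrow> u \<in> W \<and> {x, u} \<in> A" if "u \<noteq> x" for u
  proof -
    have "u \<in> W" if "{u, x} \<in> A"
      using assms that by (auto simp: in_cross_iff dest!: subsetD)
    then show ?thesis by (auto simp: insert_commute)
  qed
  moreover have "x \<notin> W" using assms by auto
  ultimately show ?thesis by (auto simp: neighbours_def insert_commute)
qed

text \<open>The vertices of \<open>X\<close> use pairwise disjoint sets of fresh edges into
  \<open>W\<close>, and the opinions on \<open>W\<close> are fixed. Their next opinions are
  therefore independent, each positive with the probability that the fresh edges make up what the
  exposed neighbours leave missing.\<close>

lemma rexp_cross_step:
  fixes p :: real
  assumes X: "finite X" "finite W" "X \<inter> W = {}"
    and fB: "\<And>x. x \<in> X \<Longrightarrow> finite (neighbours B x)"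
    and BW: "\<And>x y. x \<in> X \<Longrightarrow> y \<in> W \<Longrightarrow> {x, y} \<notin> B"
    and s: "\<And>x. x \<in> X \<Longrightarrow> s x = 1 \<or> s x = -1"
  shows "rexp (\<lambda>_. p) (\<Union>x\<in>X. cross x W) (\<lambda>A. G {x\<in>X. majority_step (B \<union> A) s x = 1}) =
    rexp (\<lambda>x. sgn_tail p W s (thr (s x) - (\<Sum>u\<in>neighbours B x. s u))) X G"
proof -
  define Q where "Q = (\<lambda>x S. thr (s x) - (\<Sum>u\<in>neighbours B x. s u) \<le> (\<Sum>y\<in>{y\<in>W. {x, y} \<in> S}. s y))"
  have disj: "disjoint_family_on (\<lambda>x. cross x W) X"
    using X(3) by (auto simp: disjoint_family_on_def cross_def doubleton_eq_iff)
  have "rexp (\<lambda>_. p) (\<Union>x\<in>X. cross x W) (\<lambda>A. G {x\<in>X. majority_step (B \<union> A) s x = 1}) =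
    rexp (\<lambda>_. p) (\<Union>x\<in>X. cross x W) (\<lambda>A. G {x\<in>X. Q x (A \<inter> cross x W)})"
  proof (intro rexp_cong refl arg_cong[where f = G] Collect_cong conj_cong)
    fix A x assume A: "A \<subseteq> (\<Union>x\<in>X. cross x W)" and x: "x \<in> X"
    have e: "{y\<in>W. {x, y} \<in> A} = {y\<in>W. {x, y} \<in> A \<inter> cross x W}" by (auto simp: cross_def)
    have "neighbours B x \<inter> {y\<in>W. {x, y} \<in> A} = {}"
      using BW[OF x] by (auto simp: neighbours_def insert_commute)
    then have "(\<Sum>u\<in>neighbours (B \<union> A) x. s u) = (\<Sum>u\<in>neighbours B x. s u) + (\<Sum>y\<in>{y\<in>W. {x, y} \<in> A}. s y)"
      unfolding neighbours_cross_union[OF X(3) A x] using fB[OF x] X(2) by (intro sum.union_disjoint) auto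
    then show "(majority_step (B \<union> A) s x = 1) = Q x (A \<inter> cross x W)"
      unfolding majority_step_iff(1)[of s x, OF s[OF x]] Q_def e[symmetric] by auto
  qed
  also have "\<dots> = rexp (\<lambda>x. rexp (\<lambda>_. p) (cross x W) (\<lambda>S. of_bool (Q x S))) X G"
    using X disj by (intro rexp_indep) auto
  also have "\<dots> = rexp (\<lambda>x. sgn_tail p W s (thr (s x) - (\<Sum>u\<in>neighbours B x. s u))) X G"
  proof (intro rexp_cong refl)
    fix x assume x: "x \<in> X"
    have "rexp (\<lambda>_. p) (cross x W) (\<lambda>S. of_bool (Q x S)) = rexp (\<lambda>_. p) W (\<lambda>S. of_bool (Q x ((\<lambda>y. {x, y}) ` S)))"
      unfolding cross_def by (rule rexp_image[OF X(2) inj_on_cross])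
    also have "\<dots> = rexp (\<lambda>_. p) W (\<lambda>S. of_bool (thr (s x) - (\<Sum>u\<in>neighbours B x. s u) \<le> (\<Sum>y\<in>S. s y)))"
    proof (intro rexp_cong refl arg_cong[where f = of_bool])
      fix S assume "S \<subseteq> W"
      then have "{y\<in>W. {x, y} \<in> (\<lambda>y. {x, y}) ` S} = S"
        using x X(3) by (auto simp: doubleton_eq_iff)
      then show "Q x ((\<lambda>y. {x, y}) ` S) = (thr (s x) - (\<Sum>u\<in>neighbours B x. s u) \<le> (\<Sum>y\<in>S. s y))"
        by (simp add: Q_def)
    qed
    finally show "rexp (\<lambda>_. p) (cross x W) (\<lambda>S. of_bool (Q x S)) = sgn_tail p W s (thr (s x) - (\<Sum>u\<in>neighbours B x. s u))"
      by (simp add: sgn_tail_def)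
  qed
  finally show ?thesis .
qed

text \<open>\<open>m\<close> is a lower bound for the mean degree and stands for "sufficiently
  large", \<open>L\<close> bounds \<open>n p^2\<close>, and \<open>C\<close> bounds the initial
  imbalance in units of \<open>sqrt n\<close>. The constants found below depend on \<open>L\<close>
  and \<open>C\<close> but not on \<open>m\<close>.\<close>

definition regime :: "real \<Rightarrow> real \<Rightarrow> real \<Rightarrow> 'v set \<Rightarrow> ('v \<Rightarrow> int) \<Rightarrow> real \<Rightarrow> bool" where
  "regime m L C V s p \<longleftrightarrow> finite V \<and> (\<forall>x\<in>V. s x = 1 \<or> s x = -1) \<and> 0 < p \<and> p \<le> 1 \<and>
     m \<le> real (card V) * p \<and> real (card V) * p\<^sup>2 \<le> L \<and> \<bar>real_of_int (\<Sum>x\<in>V. s x)\<bar> \<le> C * sqrt (card V)"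

text \<open>All the smallness comes from \<open>m * p \<le> n * p * p \<le> L\<close>, which makes
  \<open>p\<close> small, and from \<open>m \<le> n\<close>, which makes \<open>sqrt n\<close> small
  against \<open>n\<close>.\<close>

lemma regime_bounds:
  fixes m L C p \<delta> :: real
  assumes "regime m L C V s p" "0 < \<delta>" "L / \<delta> \<le> m" "1 / \<delta>\<^sup>2 \<le> m" "1 \<le> L" "1 \<le> m"
  shows "p \<le> \<delta>" "card V * p \<le> \<delta> * card V" "sqrt (card V) \<le> \<delta> * card V" "p * sqrt (card V) \<le> L"
    "p * (card V * p) \<le> L" "1 \<le> real (card V)" "m \<le> real (card V)"
proof -
  define n where "n = real (card V)"
  have r: "0 < p" "p \<le> 1" "m \<le> n * p" "n * p\<^sup>2 \<le> L" using assms(1) by (auto simp: regime_def n_def)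
  have n0: "n \<ge> 0" by (simp add: n_def)
  have nm: "m \<le> n" using r mult_left_mono[OF r(2) n0] by simp
  then show "1 \<le> real (card V)" "m \<le> real (card V)" using assms by (auto simp: n_def)
  have "p * m \<le> p * (n * p)" using r by (intro mult_left_mono) auto
  moreover have "p * (n * p) = n * p\<^sup>2" by (simp add: power2_eq_square)
  ultimately have pm: "p * m \<le> L" "p * (n * p) \<le> L" using r by linarith+
  then show "p * (card V * p) \<le> L" by (simp add: n_def)
  have "p * (L / \<delta>) \<le> p * m" using assms r by (intro mult_left_mono) auto
  then have "p * (L / \<delta>) \<le> L" using pm by linarith
  then have "p * L \<le> \<delta> * L" using assms(2) by (simp add: field_simps)
  then show "p \<le> \<delta>" using assms by auto
  then show "card V * p \<le> \<delta> * card V" by (simp add: mult.commute mult_right_mono)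
  have "1 / \<delta>\<^sup>2 \<le> n" using assms(4) nm by linarith
  then have "1 \<le> \<delta>\<^sup>2 * n" using assms(2) by (simp add: field_simps)
  then have "sqrt 1 \<le> sqrt (\<delta>\<^sup>2 * n)" by (rule real_sqrt_le_mono)
  then have "1 \<le> \<delta> * sqrt n" using assms by (simp add: real_sqrt_mult)
  then have "1 * sqrt n \<le> \<delta> * sqrt n * sqrt n" using n0 by (intro mult_right_mono) auto
  then show "sqrt (card V) \<le> \<delta> * card V" using n0 by (simp add: n_def mult.assoc)
  have "(p * sqrt n)\<^sup>2 = n * p\<^sup>2" using n0 by (simp add: power_mult_distrib)
  then have A: "(p * sqrt n)\<^sup>2 \<le> L" using r(4) by (rule ord_eq_le_trans)
  have B: "L \<le> L\<^sup>2" using assms(5) by (rule self_le_power) simp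
  have "p * sqrt n \<le> L"
    by (rule power2_le_imp_le[OF order_trans[OF A B]]) (use assms(5) in linarith)
  then show "p * sqrt (card V) \<le> L" by (simp add: n_def)
qed

text \<open>The requirements of \<open>regime_bounds\<close> for the choice
  \<open>\<delta> = 1 / (100 * (C + 1))\<close>.\<close>

definition regime_min :: "real \<Rightarrow> real \<Rightarrow> real" where
  "regime_min L C = Max {1, L * (100 * (C + 1)), (100 * (C + 1))\<^sup>2}"

text \<open>\<open>W\<close> is the set of untouched vertices. The allowance \<open>7 * M\<close>
  for the touched ones covers two neighbourhoods of size at most \<open>3 * M\<close> and a few
  special vertices. Their removal changes the imbalance by at most \<open>7 * M\<close>, and
  \<open>p * M \<le> L\<close>, so the mean of a fresh sum stays bounded and half of all vertices
  remain even after the imbalance is subtracted.\<close>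

lemma regime_fresh:
  fixes m L C p :: real
  assumes reg: "regime m L C V s p" and m: "regime_min L C \<le> m" and LC: "1 \<le> L" "1 \<le> C"
    and W: "W \<subseteq> V" "real (card (V - W)) \<le> 7 * (card V * p)"
  shows "\<bar>real_of_int (\<Sum>y\<in>W. s y)\<bar> \<le> C * sqrt (card V) + 7 * (card V * p)"
    "p * \<bar>real_of_int (\<Sum>y\<in>W. s y)\<bar> \<le> (C + 7) * L"
    "card V / 2 \<le> card W - \<bar>real_of_int (\<Sum>y\<in>W. s y)\<bar>"
    "p \<le> 1 / 100" "C * sqrt (card V) \<le> card V / 100" "card V * p \<le> card V / 100" "p * (card V * p) \<le> L"
    "p * sqrt (card V) \<le> L" "1 \<le> real (card V)"
proof -
  define \<delta> where "\<delta> = 1 / (100 * (C + 1))"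
  have \<delta>: "0 < \<delta>" "L / \<delta> = L * (100 * (C + 1))" "1 / \<delta>\<^sup>2 = (100 * (C + 1))\<^sup>2"
    using LC by (auto simp: \<delta>_def power_divide)
  have m': "1 \<le> m" "L / \<delta> \<le> m" "1 / \<delta>\<^sup>2 \<le> m" using m unfolding \<delta>(2,3) regime_min_def by auto
  note b = regime_bounds[OF reg \<delta>(1) m'(2,3) LC(1) m'(1)]
  have fin: "finite V" "finite W" using reg W finite_subset by (auto simp: regime_def)
  have sV: "\<bar>real_of_int (\<Sum>x\<in>V. s x)\<bar> \<le> C * sqrt (card V)" "0 < p" using reg by (auto simp: regime_def)
  have \<delta>1: "\<delta> \<le> 1 / 100" "C * \<delta> \<le> 1 / 100" using LC by (auto simp: \<delta>_def field_simps)
  show 1: "p \<le> 1 / 100" using b(1) \<delta>1 by simp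
  show 2: "C * sqrt (card V) \<le> card V / 100"
  proof -
    have "C * sqrt (card V) \<le> C * (\<delta> * card V)" using b(3) LC by (intro mult_left_mono) auto
    also have "\<dots> = (C * \<delta>) * card V" by simp
    also have "\<dots> \<le> 1 / 100 * card V" using \<delta>1 by (intro mult_right_mono) auto
    finally show ?thesis by simp
  qed
  show 3: "card V * p \<le> card V / 100"
    using mult_left_mono[OF 1, of "real (card V)"] by simp
  show "p * (card V * p) \<le> L" "p * sqrt (card V) \<le> L" "1 \<le> real (card V)" by (rule b)+
  have "(\<Sum>x\<in>V. s x) = (\<Sum>x\<in>W. s x) + (\<Sum>x\<in>V - W. s x)"
    using fin W by (metis add.commute sum.subset_diff)
  moreover have "\<bar>\<Sum>x\<in>V - W. s x\<bar> \<le> (\<Sum>x\<in>V - W. 1)"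
    using reg by (intro order_trans[OF sum_abs] sum_mono) (force simp: regime_def)
  ultimately have "\<bar>\<Sum>y\<in>W. s y\<bar> \<le> \<bar>\<Sum>x\<in>V. s x\<bar> + int (card (V - W))" by simp
  then have "real_of_int \<bar>\<Sum>y\<in>W. s y\<bar> \<le> real_of_int (\<bar>\<Sum>x\<in>V. s x\<bar> + int (card (V - W)))"
    by (simp only: of_int_le_iff)
  then have "\<bar>real_of_int (\<Sum>y\<in>W. s y)\<bar> \<le> \<bar>real_of_int (\<Sum>x\<in>V. s x)\<bar> + real (card (V - W))"
    by (simp only: of_int_add of_int_abs of_int_of_nat_eq)
  then show d: "\<bar>real_of_int (\<Sum>y\<in>W. s y)\<bar> \<le> C * sqrt (card V) + 7 * (card V * p)"
    using sV W by linarith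
  have "p * \<bar>real_of_int (\<Sum>y\<in>W. s y)\<bar> \<le> p * (C * sqrt (card V) + 7 * (card V * p))"
    using d sV by (intro mult_left_mono) auto
  also have "\<dots> = C * (p * sqrt (card V)) + 7 * (p * (card V * p))" by (simp add: algebra_simps)
  also have "\<dots> \<le> C * L + 7 * L" using b LC by (intro add_mono mult_left_mono) auto
  finally show "p * \<bar>real_of_int (\<Sum>y\<in>W. s y)\<bar> \<le> (C + 7) * L" by (simp add: algebra_simps)
  have "card V = card W + card (V - W)" using W fin by (metis card_mono card_Diff_subset le_add_diff_inverse)
  then have "real (card V) = real (card W) + real (card (V - W))" by simp
  then show "card V / 2 \<le> card W - \<bar>real_of_int (\<Sum>y\<in>W. s y)\<bar>"
    using d 2 3 W b(6) by linarith
qed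

text \<open>The fresh sum has variance at least \<open>M / 4\<close>, so a first-day opinion is a
  fair coin up to an error of order \<open>(1 + \<bar>t\<bar>) / sqrt M\<close>.\<close>

lemma sgn_tail_regime:
  fixes m L C p :: real
  assumes reg: "regime m L C V s p" and m: "regime_min L C \<le> m" and LC: "1 \<le> L" "1 \<le> C"
    and W: "W \<subseteq> V" "real (card (V - W)) \<le> 7 * (card V * p)"
  shows "\<bar>sgn_tail p W s t - 1 / 2\<bar> \<le> (6 + 4 * (C + 7) * L) * (1 + \<bar>real_of_int t\<bar>) / sqrt (card V * p)"
proof -
  note f = regime_fresh[OF assms]
  define d where "d = \<bar>real_of_int (\<Sum>y\<in>W. s y)\<bar>"
  have p: "0 < p" "p \<le> 1" "\<And>y. y \<in> W \<Longrightarrow> s y = 1 \<or> s y = -1" "finite W"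
    using reg W finite_subset by (auto simp: regime_def)
  have low: "card V * p / 4 \<le> (card W - d) * (p * (1 - p))"
  proof -
    have "card V * p / 4 = (card V / 2) * (p * (1 / 2))" by simp
    also have "\<dots> \<le> (card W - d) * (p * (1 - p))"
      using f p unfolding d_def by (intro mult_mono) auto
    finally show ?thesis .
  qed
  have Vp: "0 < card V * p" using f(9) p by simp
  have "sqrt (card V * p) / 2 = sqrt (card V * p / 4)" by (simp add: real_sqrt_divide)
  also have "\<dots> \<le> sqrt ((card W - d) * (p * (1 - p)))" using low by simp
  finally have sq: "sqrt (card V * p) / 2 \<le> sqrt ((card W - d) * (p * (1 - p)))" .
  define T where "T = \<bar>real_of_int t\<bar>"
  have T: "T \<ge> 0" by (simp add: T_def)
  have "\<bar>sgn_tail p W s t - 1 / 2\<bar> \<le> (2 * T + 2 * p * d + 1) / sqrt ((card W - d) * (p * (1 - p)))"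
    unfolding T_def using p low Vp by (intro sgn_tail_half d_def) (auto intro: less_le_trans[OF _ low])
  also have "\<dots> \<le> (2 * T + 2 * p * d + 1) / (sqrt (card V * p) / 2)"
  proof (intro divide_left_mono sq)
    have "0 < sqrt (card V * p) / 2" using Vp by simp
    then show "0 < sqrt ((card W - d) * (p * (1 - p))) * (sqrt (card V * p) / 2)"
      using sq by (intro mult_pos_pos) linarith+
  qed (use p T in \<open>simp add: d_def\<close>)
  also have "\<dots> = 2 * (2 * T + 2 * (p * d) + 1) / sqrt (card V * p)" by simp
  also have "\<dots> \<le> ((6 + 4 * (C + 7) * L) * (1 + T)) / sqrt (card V * p)"
  proof (intro divide_right_mono)
    have "p * d \<le> (C + 7) * L" using f(2) by (simp add: d_def)
    moreover have "0 \<le> (C + 7) * L * T" using LC T by simp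
    ultimately show "2 * (2 * T + 2 * (p * d) + 1) \<le> (6 + 4 * (C + 7) * L) * (1 + T)"
      using T by (simp add: algebra_simps)
  qed (use Vp in auto)
  finally show ?thesis by (simp add: T_def)
qed

text \<open>About \<open>p * c * sqrt n\<close> flipped vertices are met by fresh edges, and each
  shifts the tail by a point probability of order \<open>1 / sqrt (n * p)\<close>; the product is of
  order \<open>c * sqrt p\<close>.\<close>

lemma sgn_tail_gap_regime:
  fixes m L C p c K :: real
  assumes reg: "regime m L C V s p" and m: "regime_min L C \<le> m" and LC: "1 \<le> L" "1 \<le> C"
    and W: "W \<subseteq> V" "real (card (V - W)) \<le> 7 * (card V * p)"
    and F: "F \<subseteq> V" "\<And>y. y \<in> F \<Longrightarrow> s y = 1" "real (card F) \<le> C * sqrt (card V)"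
    and c: "0 \<le> c" "c * sqrt (card V) \<le> real (card (F \<inter> W))"
    and t: "\<bar>real_of_int t\<bar> \<le> K" "400 + 4 * (K + 1 + (3 * C + 7) * L)\<^sup>2 \<le> m"
  shows "local_const 1 * c * sqrt p \<le> sgn_tail p W s t - sgn_tail p W (\<lambda>y. if y \<in> F then -1 else s y) t"
proof -
  note f = regime_fresh[OF reg m LC W]
  have p: "0 < p" "p \<le> 1" "\<And>y. y \<in> W \<Longrightarrow> s y = 1 \<or> s y = -1" "finite W" "m \<le> card V * p" "finite V"
    using reg W finite_subset by (auto simp: regime_def)
  define v where "v = (real (card W) - real (card (F \<inter> W))) * (p * (1 - p))"
  have FW: "real (card (F \<inter> W)) \<le> real (card F)" using p F by (auto intro!: card_mono finite_subset[OF F(1)])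
  have "real (card W) \<le> real (card V)" using W p by (simp add: card_mono)
  moreover have "card V = card W + card (V - W)" using W p by (metis card_mono card_Diff_subset le_add_diff_inverse)
  then have "real (card V) = real (card W) + real (card (V - W))" by simp
  ultimately have cW: "card V / 2 \<le> real (card W) - real (card (F \<inter> W))"
    using f F FW W by linarith
  have low: "card V * p / 4 \<le> v"
  proof -
    have "card V * p / 4 = (card V / 2) * (p * (1 / 2))" by simp
    also have "\<dots> \<le> v" unfolding v_def
      using f p cW by (intro mult_mono) auto
    finally show ?thesis .
  qed
  have v100: "100 \<le> v" using low p(5) t(2) zero_le_power2[of "K + 1 + (3 * C + 7) * L"] by linarith
  have gap: "local_const 1 / sqrt (card W * p) * (p * card (F \<inter> W))
    \<le> sgn_tail p W s t - sgn_tail p W (\<lambda>y. if y \<in> F \<inter> W then -1 else s y) t"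
  proof (rule sgn_tail_gap[OF p(4) p(3) _ p(2) _ _ v_def v100])
    have "p * card (F \<inter> W) \<le> p * (C * sqrt (card V))" using F FW p by (intro mult_left_mono) auto
    also have "\<dots> = C * (p * sqrt (card V))" by simp
    also have "\<dots> \<le> C * L" using f LC by (intro mult_left_mono) auto
    finally have "p * card (F \<inter> W) \<le> C * L" .
    then have "\<bar>real_of_int t\<bar> + 1 + p * \<bar>real_of_int (\<Sum>y\<in>W. s y)\<bar> + 2 * p * card (F \<inter> W) \<le> K + 1 + (3 * C + 7) * L"
      using f(2) t(1) by (simp add: algebra_simps)
    also have "\<dots> \<le> sqrt v"
      using low p(5) t(2) by (intro real_le_rsqrt) linarith
    finally show "\<bar>real_of_int t\<bar> + 1 + p * \<bar>real_of_int (\<Sum>y\<in>W. s y)\<bar> + 2 * p * card (F \<inter> W) \<le> sqrt v" .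
  qed (use p F in auto)
  have "sgn_tail p W (\<lambda>y. if y \<in> F \<inter> W then -1 else s y) t = sgn_tail p W (\<lambda>y. if y \<in> F then -1 else s y) t"
    unfolding sgn_tail_def
    by (intro rexp_cong refl arg_cong[where f = of_bool] arg_cong2[where f = "(\<le>)"] sum.cong) auto
  moreover have "local_const 1 * c * sqrt p \<le> local_const 1 / sqrt (card W * p) * (p * card (F \<inter> W))"
  proof -
    have W0: "0 < real (card W)" using cW f(9) FW by linarith
    have "c * sqrt (card W) \<le> c * sqrt (card V)" using W p c by (intro mult_left_mono) (auto simp: card_mono)
    then have "c * sqrt (card W) \<le> card (F \<inter> W)" using c by linarith
    then have "(sqrt p / sqrt (card W)) * (c * sqrt (card W)) \<le> (sqrt p / sqrt (card W)) * card (F \<inter> W)"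
      using p by (intro mult_left_mono) auto
    moreover have "(sqrt p / sqrt (card W)) * (c * sqrt (card W)) = c * sqrt p" using W0 by simp
    moreover have "(sqrt p / sqrt (card W)) * card (F \<inter> W) = p * card (F \<inter> W) / sqrt (card W * p)"
    proof -
      have "a * a * x / (w * a) = a / w * x" if "a > 0" for a w x :: real
        using that by simp
      from this[of "sqrt p"] have "p * card (F \<inter> W) / (sqrt (card W) * sqrt p) = (sqrt p / sqrt (card W)) * card (F \<inter> W)"
        using p by simp
      then show ?thesis by (simp add: real_sqrt_mult)
    qed
    ultimately have "c * sqrt p \<le> p * card (F \<inter> W) / sqrt (card W * p)" by simp
    then have "local_const 1 * (c * sqrt p) \<le> local_const 1 * (p * card (F \<inter> W) / sqrt (card W * p))"
      using local_const_pos[of 1] by (intro mult_left_mono) auto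
    then show ?thesis by simp
  qed
  ultimately show ?thesis using gap by simp
qed

section \<open>The bias after two days\<close>

lemma sum_card_neighbours_le:
  assumes "finite X" "finite B" "\<And>e. e \<in> B \<Longrightarrow> card e = 2"
  shows "(\<Sum>x\<in>X. card (neighbours B x)) \<le> 2 * card B"
proof -
  have "card (neighbours B x) \<le> card {e\<in>B. x \<in> e}" for x
  proof (rule card_inj_on_le[where f = "\<lambda>u. {u, x}"])
    show "inj_on (\<lambda>u. {u, x}) (neighbours B x)" by (auto simp: inj_on_def doubleton_eq_iff)
  qed (use assms in \<open>auto simp: neighbours_def\<close>)
  then have "(\<Sum>x\<in>X. card (neighbours B x)) \<le> (\<Sum>x\<in>X. card {e\<in>B. x \<in> e})" by (intro sum_mono)
  also have "\<dots> = (\<Sum>x\<in>X. \<Sum>e\<in>B. if x \<in> e then 1 else 0)"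
    using assms(2) by (simp add: sum.If_cases Int_def)
  also have "\<dots> = (\<Sum>e\<in>B. \<Sum>x\<in>X. if x \<in> e then 1 else 0)" by (rule sum.swap)
  also have "\<dots> \<le> (\<Sum>e\<in>B. 2)"
  proof (rule sum_mono)
    fix e assume e: "e \<in> B"
    have "finite e" using assms(3)[OF e] by (metis card.infinite zero_neq_numeral)
    have "(\<Sum>x\<in>X. if x \<in> e then 1 else 0) = card (X \<inter> e)"
      using assms(1) by (simp add: sum.If_cases Int_def)
    also have "\<dots> \<le> card e" using \<open>finite e\<close> by (intro card_mono) auto
    finally show "(\<Sum>x\<in>X. if x \<in> e then 1 else 0) \<le> (2 :: nat)" using assms(3)[OF e] by simp
  qed
  finally show ?thesis by simp
qed

lemma card_all_pairs_le:
  assumes "finite U" shows "card (all_pairs U) \<le> card U * card U"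
proof -
  have "all_pairs U \<subseteq> (\<lambda>(a, b). {a, b}) ` (U \<times> U)"
    by (auto simp: all_pairs_def card_2_iff image_iff)
  then have "card (all_pairs U) \<le> card ((\<lambda>(a, b). {a, b}) ` (U \<times> U))"
    using assms by (intro card_mono) auto
  also have "\<dots> \<le> card (U \<times> U)" using assms by (intro card_image_le) auto
  finally show ?thesis by (simp add: card_cartesian_product)
qed

lemma all_pairs_remove:
  assumes "v \<in> V"
  shows "all_pairs V = cross v (V - {v}) \<union> all_pairs (V - {v})"
    "cross v (V - {v}) \<inter> all_pairs (V - {v}) = {}"
  using assms by (auto simp: all_pairs_def cross_def card_2_iff image_iff doubleton_eq_iff)

lemma all_pairs_union:
  assumes "U \<inter> W = {}"
  shows "all_pairs (U \<union> W) = (all_pairs U \<union> all_pairs W) \<union> (\<Union>x\<in>U. cross x W)"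
    "(all_pairs U \<union> all_pairs W) \<inter> (\<Union>x\<in>U. cross x W) = {}"
proof -
  show "all_pairs (U \<union> W) = (all_pairs U \<union> all_pairs W) \<union> (\<Union>x\<in>U. cross x W)"
  proof (intro equalityI subsetI)
    fix e assume "e \<in> all_pairs (U \<union> W)"
    then obtain a b where "e = {a, b}" "a \<noteq> b" "a \<in> U \<union> W" "b \<in> U \<union> W"
      by (auto simp: all_pairs_def card_2_iff)
    then show "e \<in> (all_pairs U \<union> all_pairs W) \<union> (\<Union>x\<in>U. cross x W)"
      by (auto simp: in_cross_iff)
  next
    fix e assume "e \<in> (all_pairs U \<union> all_pairs W) \<union> (\<Union>x\<in>U. cross x W)"
    then show "e \<in> all_pairs (U \<union> W)"
      using assms by (auto simp: all_pairs_def cross_def card_insert_if)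
  qed
  show "(all_pairs U \<union> all_pairs W) \<inter> (\<Union>x\<in>U. cross x W) = {}"
    using assms by (auto simp: all_pairs_def cross_def)
qed

text \<open>Three stages: the neighbourhood \<open>U\<close> of \<open>v\<close>, then all edges
  inside \<open>U\<close> and inside the remainder, and last the edges between the two. Only the
  last stage is treated as random when first-day opinions are studied, and there the vertices of
  \<open>U\<close> are independent.\<close>

lemma rexp_graph_split:
  assumes "finite V" "v \<in> V"
  shows "rexp (\<lambda>_. p) (all_pairs V) f = rexp (\<lambda>_. p) (V - {v}) (\<lambda>U.
    rexp (\<lambda>_. p) (all_pairs U \<union> all_pairs (V - {v} - U)) (\<lambda>B.
      rexp (\<lambda>_. p) (\<Union>x\<in>U. cross x (V - {v} - U)) (\<lambda>A. f (cross v U \<union> B \<union> A))))"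
proof -
  let ?V = "V - {v}"
  have "rexp (\<lambda>_. p) (all_pairs V) f =
    rexp (\<lambda>_. p) (cross v ?V) (\<lambda>S. rexp (\<lambda>_. p) (all_pairs ?V) (\<lambda>B. f (S \<union> B)))"
    unfolding all_pairs_remove(1)[OF assms(2)]
    using assms all_pairs_remove(2)[OF assms(2)] by (intro rexp_union) auto
  also have "\<dots> = rexp (\<lambda>_. p) ?V (\<lambda>U. rexp (\<lambda>_. p) (all_pairs ?V) (\<lambda>B. f (cross v U \<union> B)))"
  proof -
    have "rexp (\<lambda>_. p) (cross v ?V) g = rexp (\<lambda>_. p) ?V (\<lambda>S. g (cross v S))" for g
      using assms(1) rexp_image[OF _ inj_on_cross, of ?V "\<lambda>_. p" v g] by (simp add: cross_def)
    then show ?thesis .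
  qed
  also have "\<dots> = rexp (\<lambda>_. p) ?V (\<lambda>U. rexp (\<lambda>_. p) (all_pairs U \<union> all_pairs (?V - U)) (\<lambda>B.
      rexp (\<lambda>_. p) (\<Union>x\<in>U. cross x (?V - U)) (\<lambda>A. f (cross v U \<union> B \<union> A))))"
  proof (rule rexp_cong[OF refl refl])
    fix U assume U: "U \<subseteq> ?V"
    then have fin: "finite U" "finite (?V - U)" using assms(1) finite_subset by auto
    have e: "U \<union> (?V - U) = ?V" "U \<inter> (?V - U) = {}" using U by auto
    note ap = all_pairs_union[OF e(2), unfolded e(1)]
    have "rexp (\<lambda>_. p) (all_pairs ?V) (\<lambda>B. f (cross v U \<union> B)) =
      rexp (\<lambda>_. p) (all_pairs U \<union> all_pairs (?V - U)) (\<lambda>B.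
      rexp (\<lambda>_. p) (\<Union>x\<in>U. cross x (?V - U)) (\<lambda>A. f (cross v U \<union> (B \<union> A))))"
      unfolding ap(1) using fin ap(2) by (intro rexp_union) auto
    then show "rexp (\<lambda>_. p) (all_pairs ?V) (\<lambda>B. f (cross v U \<union> B)) =
      rexp (\<lambda>_. p) (all_pairs U \<union> all_pairs (?V - U)) (\<lambda>B.
      rexp (\<lambda>_. p) (\<Union>x\<in>U. cross x (?V - U)) (\<lambda>A. f (cross v U \<union> B \<union> A)))"
      by (simp add: Un_assoc)
  qed
  finally show ?thesis .
qed

lemma maj2_cong:
  assumes "A \<subseteq> all_pairs V" "\<And>x. x \<in> V \<Longrightarrow> s x = s' x" "v \<in> V"
  shows "maj2 A s v = maj2 A s' v"
proof -
  have *: "majority_step A s x = majority_step A s' x" if "x \<in> V" for x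
    by (rule majority_step_cong) (use neighbours_subset[OF assms(1), of x] assms(2) that in auto)
  show ?thesis unfolding maj2_def
    by (rule majority_step_cong) (use neighbours_subset[OF assms(1), of v] assms(3) * in auto)
qed

lemma maj2_uminus: "maj2 A (\<lambda>x. - s x) v = - maj2 A s v"
  unfolding maj2_def majority_step_uminus ..

text \<open>What the fresh edges of a neighbour \<open>x\<close> of \<open>v\<close> still have to
  contribute: the tie threshold minus the opinions of \<open>v\<close> and of the exposed neighbours
  inside \<open>U\<close>.\<close>

definition first_thr :: "('v \<Rightarrow> int) \<Rightarrow> 'v \<Rightarrow> 'v set \<Rightarrow> 'v set set \<Rightarrow> 'v \<Rightarrow> int" where
  "first_thr s v U B x = thr (s x) - s v - (\<Sum>u\<in>neighbours B x. s u)"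

text \<open>If \<open>k\<close> vertices of \<open>U\<close> are positive on day one,
  \<open>v\<close> sees the sum \<open>2 k - card U\<close>, and it turns positive when this reaches
  the tie threshold given by its own first-day opinion. That opinion is already determined by
  \<open>U\<close>. The summand 1 before \<open>div 2\<close> rounds up.\<close>

definition second_thr :: "('v \<Rightarrow> int) \<Rightarrow> 'v \<Rightarrow> 'v set \<Rightarrow> int" where
  "second_thr s v U = (int (card U) + thr (if thr (s v) \<le> (\<Sum>u\<in>U. s u) then 1 else -1) + 1) div 2"

lemma rexp_maj2_given:
  fixes p :: real
  assumes V: "finite V" "v \<in> V" "U \<subseteq> V - {v}" "W = V - {v} - U"
    and s: "\<And>x. x \<in> V \<Longrightarrow> s x = 1 \<or> s x = -1"
    and B: "B \<subseteq> all_pairs U \<union> all_pairs W"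
  shows "rexp (\<lambda>_. p) (\<Union>x\<in>U. cross x W) (\<lambda>A. of_bool (maj2 (cross v U \<union> B \<union> A) s v = 1)) =
    rexp (\<lambda>x. sgn_tail p W s (first_thr s v U B x)) U (\<lambda>S. of_bool (second_thr s v U \<le> int (card S)))"
proof -
  have fin: "finite U" "finite W" using V finite_subset by auto
  have UW: "U \<inter> W = {}" "v \<notin> U" "v \<notin> W" using V by auto
  define E where "E = cross v U \<union> B"
  have NE: "neighbours E x = insert v (neighbours B x)" "v \<notin> neighbours B x" "neighbours B x \<subseteq> U" if "x \<in> U" for x
  proof -
    have "{u, x} \<in> B \<Longrightarrow> u \<in> U" for u using B UW that by (auto dest!: subsetD)
    then show "neighbours B x \<subseteq> U" by (auto simp: neighbours_def)
    then show "v \<notin> neighbours B x" using UW by auto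
    show "neighbours E x = insert v (neighbours B x)"
      using that UW by (auto simp: neighbours_def E_def in_cross_iff)
  qed
  have thr_x: "thr (s x) - (\<Sum>u\<in>neighbours E x. s u) = first_thr s v U B x" if "x \<in> U" for x
    using NE[OF that] fin finite_subset[of "neighbours B x" U] by (simp add: first_thr_def)
  have EW: "{x, y} \<notin> E" if "x \<in> U" "y \<in> W" for x y
    using that B UW by (auto simp: E_def in_cross_iff dest!: subsetD)
  have "rexp (\<lambda>_. p) (\<Union>x\<in>U. cross x W) (\<lambda>A. of_bool (maj2 (E \<union> A) s v = 1)) =
    rexp (\<lambda>_. p) (\<Union>x\<in>U. cross x W) (\<lambda>A. of_bool (second_thr s v U \<le> int (card {x\<in>U. majority_step (E \<union> A) s x = 1})))"
  proof (intro rexp_cong refl arg_cong[where f = of_bool])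
    fix A assume A: "A \<subseteq> (\<Union>x\<in>U. cross x W)"
    have Nv: "neighbours (E \<union> A) v = U"
    proof -
      have "{u, v} \<notin> B" for u using B UW V by (auto dest!: subsetD)
      moreover have "{u, v} \<notin> A" for u using A UW by (auto simp: in_cross_iff dest!: subsetD)
      ultimately show ?thesis using UW by (auto simp: neighbours_def E_def in_cross_iff)
    qed
    define t where "t = majority_step (E \<union> A) s"
    have tU: "t x = 1 \<or> t x = -1" if "x \<in> U" for x
      unfolding t_def using V s that by (intro majority_step_iff) auto
    have tv: "t v = (if thr (s v) \<le> (\<Sum>u\<in>U. s u) then 1 else -1)"
      using majority_step_eq[of s v "E \<union> A"] s[OF V(2)] unfolding t_def Nv by simp
    have sumt: "(\<Sum>u\<in>U. t u) = 2 * int (card {x\<in>U. t x = 1}) - int (card U)"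
      using sum_signs[of U t] fin tU by auto
    have "(majority_step (E \<union> A) t v = 1) = (thr (t v) \<le> (\<Sum>u\<in>U. t u))"
      using majority_step_iff(1)[of t v "E \<union> A"] tv unfolding Nv by auto
    also have "\<dots> = (second_thr s v U \<le> int (card {x\<in>U. t x = 1}))"
      unfolding sumt second_thr_def tv by linarith
    finally show "(maj2 (E \<union> A) s v = 1) = (second_thr s v U \<le> int (card {x\<in>U. majority_step (E \<union> A) s x = 1}))"
      by (simp add: maj2_def t_def)
  qed
  also have "\<dots> = rexp (\<lambda>x. sgn_tail p W s (thr (s x) - (\<Sum>u\<in>neighbours E x. s u))) U (\<lambda>S. of_bool (second_thr s v U \<le> int (card S)))"
  proof (rule rexp_cross_step[where G = "\<lambda>S. of_bool (second_thr s v U \<le> int (card S))"])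
    show "finite (neighbours E x)" if "x \<in> U" for x
      using NE[OF that] fin finite_subset[of "neighbours B x" U] by simp
    show "s x = 1 \<or> s x = -1" if "x \<in> U" for x using s V that by auto
  qed (use fin UW EW in auto)
  also have "\<dots> = rexp (\<lambda>x. sgn_tail p W s (first_thr s v U B x)) U (\<lambda>S. of_bool (second_thr s v U \<le> int (card S)))"
    by (intro rexp_cong refl) (simp add: thr_x)
  finally show ?thesis by (simp add: E_def)
qed

section \<open>The effect of flipping \<open>F\<close> under a fixed exposure\<close>

lemma sgn_tail_01:
  assumes "finite W" "0 \<le> p" "p \<le> (1 :: real)"
  shows "0 \<le> sgn_tail p W s t" "sgn_tail p W s t \<le> 1"
  unfolding sgn_tail_def using assms by (auto intro!: rexp_nonneg rexp_le_const)

definition half_const :: "real \<Rightarrow> real \<Rightarrow> real" where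
  "half_const L C = 6 + 4 * (C + 7) * L"

text \<open>The first-day probabilities deviate from 1/2 by at most
  \<open>3 * half_const L C * (3 + K) * sqrt M\<close> in total, and rounding and one missing index
  cost 2 more. The factor 10 expresses this in standard deviations, which are at least
  \<open>sqrt M / 10\<close>.\<close>

definition spread_const :: "real \<Rightarrow> real \<Rightarrow> real \<Rightarrow> real" where
  "spread_const L C K = 10 * (3 * half_const L C * (3 + K) + 2)"

text \<open>Lower bounds for \<open>m\<close> are added rather than maximised: the summands are
  nonnegative, so each single requirement follows by linear arithmetic.\<close>

definition gap_min :: "real \<Rightarrow> real \<Rightarrow> real \<Rightarrow> real" where
  "gap_min L C K = regime_min L C + 400 + 4 * (2 + 2 * K + 1 + (3 * C + 7) * L)\<^sup>2 +
     100 * (2 * spread_const L C K + 8)\<^sup>2 + (4 * half_const L C * (3 + 2 * K))\<^sup>2"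

text \<open>The local bound at distance \<open>spread_const\<close> times the first-day gap. The 16
  collects the at least \<open>M / 8\<close> neighbours with a gap and the estimate
  \<open>sqrt (3 * M) \<le> 2 * sqrt M\<close>.\<close>

definition gap_const :: "real \<Rightarrow> real \<Rightarrow> real \<Rightarrow> real \<Rightarrow> real" where
  "gap_const L C K c = local_const (spread_const L C K) * (local_const 1 * c) / 16"

lemma regime_min_ge: "1 \<le> regime_min L C" 
  unfolding regime_min_def by auto

text \<open>At least half of the neighbours of \<open>v\<close> have at most \<open>2 * K\<close>
  exposed neighbours, and for these the flip of \<open>F\<close> lowers the probability of a
  positive first-day opinion by order \<open>c * sqrt p\<close>; for the others it cannot raise it.
  Changing the probabilities one neighbour at a time converts the total decrease, of order
  \<open>M * c * sqrt p\<close>, into a decrease of the second-day tail by a factor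
  \<open>1 / sqrt M\<close>. Since \<open>sqrt M * sqrt p = sqrt n * p\<close>, this is the claimed
  gap.\<close>

lemma maj2_gap_given:
  fixes m L C p c K :: real
  assumes reg: "regime m L C V s p" and m: "gap_min L C K \<le> m" and LC: "1 \<le> L" "1 \<le> C" and K: "0 < K"
    and F: "F \<subseteq> V" "\<And>y. y \<in> F \<Longrightarrow> s y = 1" "real (card F) \<le> C * sqrt (real (card V))"
    and reg': "regime m L C V s' p" and s': "s' = (\<lambda>y. if y \<in> F then -1 else s y)"
    and v: "v \<in> V - F" and U: "U \<subseteq> V - {v}" and W: "W = V - {v} - U"
    and cU: "real (card V) * p / 4 \<le> real (card U)" "real (card U) \<le> 3 * (real (card V) * p)"
    and c: "0 \<le> c" "c * sqrt (real (card V)) \<le> real (card (F \<inter> W))"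
    and B: "B \<subseteq> all_pairs U \<union> all_pairs W" "real (\<Sum>x\<in>U. card (neighbours B x)) \<le> K * real (card U)"
  shows "gap_const L C K c * (sqrt (real (card V)) * p)
    \<le> rexp (\<lambda>_. p) (\<Union>x\<in>U. cross x W) (\<lambda>A. of_bool (maj2 (cross v U \<union> B \<union> A) s v = 1))
      - rexp (\<lambda>_. p) (\<Union>x\<in>U. cross x W) (\<lambda>A. of_bool (maj2 (cross v U \<union> B \<union> A) s' v = 1))"
proof -
  define M where "M = real (card V) * p"
  define H where "H = half_const L C"
  define A where "A = spread_const L C K"
  have H: "H \<ge> 6" using LC by (simp add: H_def half_const_def)
  have A: "A = 10 * (3 * H * (3 + K) + 2)" by (simp add: A_def spread_const_def H_def)
  have A0: "A \<ge> 0" using H K unfolding A by auto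
  have Mm: "m \<le> M" and p: "0 < p" "p \<le> 1" and fV: "finite V"
    and sV: "\<And>x. x \<in> V \<Longrightarrow> s x = 1 \<or> s x = -1" and s'V: "\<And>x. x \<in> V \<Longrightarrow> s' x = 1 \<or> s' x = -1"
    using reg reg' unfolding regime_def M_def by auto
  have big: "regime_min L C \<le> m" "400 \<le> M" "100 * (2 * A + 8)\<^sup>2 \<le> M" "(4 * H * (3 + 2 * K))\<^sup>2 \<le> M"
    "400 + 4 * (2 + 2 * K + 1 + (3 * C + 7) * L)\<^sup>2 \<le> m"
    using m Mm regime_min_ge[of L C] zero_le_power2[of "2 + 2 * K + 1 + (3 * C + 7) * L"]
      zero_le_power2[of "2 * A + 8"] zero_le_power2[of "4 * H * (3 + 2 * K)"]
    unfolding gap_min_def A_def[symmetric] H_def[symmetric] by linarith+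
  have fin: "finite U" "finite W" using fV U W finite_subset by auto
  have WV: "W \<subseteq> V" using W by auto
  have VW: "real (card (V - W)) \<le> 7 * (real (card V) * p)"
  proof -
    have "V - W = insert v U" using U W v by auto
    then have "card (V - W) \<le> card U + 1" using fin by (simp add: card_insert_if)
    then have "real (card (V - W)) \<le> real (card U) + 1" by linarith
    then show ?thesis using cU big(2) unfolding M_def by linarith
  qed
  define q where "q = (\<lambda>x. sgn_tail p W s (first_thr s v U B x))"
  define r where "r = (\<lambda>x. sgn_tail p W s' (first_thr s' v U B x))"
  define d where "d = (\<lambda>x. real (card (neighbours B x)))"
  have NB: "neighbours B x \<subseteq> U" if "x \<in> U" for x
  proof -
    have "{u, x} \<in> B \<Longrightarrow> u \<in> U" for u using B(1) W that by (auto dest!: subsetD)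
    then show ?thesis by (auto simp: neighbours_def)
  qed
  have ft_bound: "\<bar>real_of_int (first_thr t v U B x)\<bar> \<le> 2 + d x"
    if "x \<in> U" "\<And>x. x \<in> V \<Longrightarrow> t x = 1 \<or> t x = -1" for t x
  proof -
    have "\<bar>\<Sum>u\<in>neighbours B x. t u\<bar> \<le> (\<Sum>u\<in>neighbours B x. 1)"
      using NB[OF that(1)] U that(2) by (intro order_trans[OF sum_abs] sum_mono) force
    then have "\<bar>\<Sum>u\<in>neighbours B x. t u\<bar> \<le> int (card (neighbours B x))" by simp
    moreover have "\<bar>thr (t x)\<bar> \<le> 1" by (simp add: thr_def)
    moreover have "\<bar>t v\<bar> \<le> 1" using that(2)[of v] v by auto
    ultimately have "\<bar>first_thr t v U B x\<bar> \<le> 2 + int (card (neighbours B x))"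
      unfolding first_thr_def by linarith
    then have "real_of_int \<bar>first_thr t v U B x\<bar> \<le> real_of_int (2 + int (card (neighbours B x)))"
      by (simp only: of_int_le_iff)
    then show ?thesis by (simp add: d_def)
  qed
  have half: "\<bar>q x - 1 / 2\<bar> \<le> H * (3 + d x) / sqrt M" "\<bar>r x - 1 / 2\<bar> \<le> H * (3 + d x) / sqrt M" if "x \<in> U" for x
  proof -
    have "H * (1 + \<bar>real_of_int (first_thr s v U B x)\<bar>) / sqrt M \<le> H * (3 + d x) / sqrt M"
      using ft_bound[where t = s and x = x, OF that sV] H big(2) by (intro divide_right_mono mult_left_mono) auto
    then show "\<bar>q x - 1 / 2\<bar> \<le> H * (3 + d x) / sqrt M"
      using sgn_tail_regime[OF reg big(1) LC WV VW, of "first_thr s v U B x"]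
      unfolding q_def M_def H_def half_const_def by linarith
    have "H * (1 + \<bar>real_of_int (first_thr s' v U B x)\<bar>) / sqrt M \<le> H * (3 + d x) / sqrt M"
      using ft_bound[where t = s' and x = x, OF that s'V] H big(2) by (intro divide_right_mono mult_left_mono) auto
    then show "\<bar>r x - 1 / 2\<bar> \<le> H * (3 + d x) / sqrt M"
      using sgn_tail_regime[OF reg' big(1) LC WV VW, of "first_thr s' v U B x"]
      unfolding r_def M_def H_def half_const_def by linarith
  qed
  have le: "s' x \<le> s x" if "x \<in> V" for x using sV[OF that] by (auto simp: s')
  have ft_mono: "first_thr s v U B x \<le> first_thr s' v U B x" if "x \<in> U" for x
  proof -
    have "x \<in> V" using that U by auto
    have "(\<Sum>u\<in>neighbours B x. s' u) \<le> (\<Sum>u\<in>neighbours B x. s u)"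
      using NB[OF that] U by (intro sum_mono le) auto
    moreover have "thr (s x) \<le> thr (s' x)" using sV[OF \<open>x \<in> V\<close>] by (auto simp: thr_def s')
    moreover have "s' v = s v" using v by (simp add: s')
    ultimately show ?thesis unfolding first_thr_def by linarith
  qed
  have q01: "0 \<le> q x" "q x \<le> 1" and r0: "0 \<le> r x" and r1: "r x \<le> 1" for x
    unfolding q_def r_def using sgn_tail_01[OF fin(2), of p] p by auto
  have rq: "r x \<le> q x" if "x \<in> U" for x
    unfolding q_def r_def using p ft_mono[OF that] le WV by (intro sgn_tail_antimono) auto
  \<comment> \<open>Markov's inequality: the average exposed degree is at most \<open>K\<close>, so
    at least half of \<open>U\<close> belongs to \<open>J\<close>. On \<open>J\<close> the first-day
    probabilities lie within 1/4 of 1/2, which also supplies the variance.\<close>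
  define J where "J = {x\<in>U. d x \<le> 2 * K}"
  have JU: "J \<subseteq> U" "finite J" using fin by (auto simp: J_def)
  have cJ: "real (card U) / 2 \<le> real (card J)"
  proof -
    have "2 * K * real (card (U - J)) = (\<Sum>x\<in>U - J. 2 * K)" by simp
    also have "\<dots> \<le> (\<Sum>x\<in>U - J. d x)" by (intro sum_mono) (auto simp: J_def)
    also have "\<dots> \<le> (\<Sum>x\<in>U. d x)" using fin by (intro sum_mono2) (auto simp: d_def)
    also have "\<dots> \<le> K * real (card U)" using B(2) by (simp add: d_def)
    finally have "real (card (U - J)) \<le> real (card U) / 2" using K by (simp add: field_simps)
    moreover have "card U = card J + card (U - J)"
      using fin JU by (metis card_Diff_subset card_mono le_add_diff_inverse)
    ultimately show ?thesis by linarith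
  qed
  have gapJ: "local_const 1 * c * sqrt p \<le> q x - r x" if "x \<in> J" for x
  proof -
    have x: "x \<in> U" "d x \<le> 2 * K" using that by (auto simp: J_def)
    have "\<bar>real_of_int (first_thr s v U B x)\<bar> \<le> 2 + 2 * K" using ft_bound[where t = s and x = x, OF x(1) sV] x(2) by linarith
    then have "local_const 1 * c * sqrt p \<le> sgn_tail p W s (first_thr s v U B x) - sgn_tail p W (\<lambda>y. if y \<in> F then -1 else s y) (first_thr s v U B x)"
      by (intro sgn_tail_gap_regime[OF reg big(1) LC WV VW F c _ big(5)])
    moreover have "r x \<le> sgn_tail p W (\<lambda>y. if y \<in> F then -1 else s y) (first_thr s v U B x)"
      unfolding r_def s'[symmetric] using p ft_mono[OF x(1)] by (intro sgn_tail_antimono) auto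
    ultimately show ?thesis unfolding q_def by linarith
  qed
  define k where "k = second_thr s v U"
  have k: "real (card U) / 2 \<le> real_of_int k" "real_of_int k \<le> real (card U) / 2 + 1"
  proof -
    define \<sigma> where "\<sigma> = thr (if thr (s v) \<le> (\<Sum>u\<in>U. s u) then 1 else -1)"
    have "\<sigma> = 0 \<or> \<sigma> = 1" by (simp add: \<sigma>_def thr_def)
    then have "int (card U) \<le> 2 * k" "2 * k \<le> int (card U) + 2"
      unfolding k_def second_thr_def \<sigma>_def[symmetric] by auto
    then have "real_of_int (int (card U)) \<le> real_of_int (2 * k)" "real_of_int (2 * k) \<le> real_of_int (int (card U) + 2)"
      by (simp_all only: of_int_le_iff)
    then show "real (card U) / 2 \<le> real_of_int k" "real_of_int k \<le> real (card U) / 2 + 1" by simp_all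
  qed
  have kk': "k \<le> second_thr s' v U"
  proof -
    have "(\<Sum>u\<in>U. s' u) \<le> (\<Sum>u\<in>U. s u)" using U by (intro sum_mono le) auto
    moreover have "s' v = s v" using v by (simp add: s')
    ultimately show ?thesis unfolding k_def second_thr_def by (intro zdiv_mono1) (auto simp: thr_def)
  qed
  have sM: "sqrt M \<ge> 20" using big(2) by (intro real_le_rsqrt) simp
  have dsum: "(\<Sum>x\<in>U. H * (3 + d x) / sqrt M) \<le> 3 * H * (3 + K) * sqrt M"
  proof -
    have "(\<Sum>x\<in>U. H * (3 + d x) / sqrt M) = (H / sqrt M) * (3 * real (card U) + (\<Sum>x\<in>U. d x))"
      by (simp add: sum_distrib_left sum.distrib distrib_left sum_divide_distrib add_divide_distrib)
    also have "\<dots> \<le> (H / sqrt M) * (3 * real (card U) + K * real (card U))"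
      using B(2) H big(2) by (intro mult_left_mono) (auto simp: d_def)
    also have "\<dots> = (H / sqrt M) * ((3 + K) * real (card U))" by (simp add: algebra_simps)
    also have "\<dots> \<le> (H / sqrt M) * ((3 + K) * (3 * M))"
      using cU(2) H K big(2) by (intro mult_left_mono) (auto simp: M_def)
    also have "\<dots> = 3 * H * (3 + K) * (M / sqrt M)" by simp
    also have "M / sqrt M = sqrt M" using big(2) by (simp add: real_div_sqrt)
    finally show ?thesis .
  qed
  have "local_const A / sqrt (3 * M) * (\<Sum>i\<in>J. q i - r i) \<le>
    rexp q U (\<lambda>S. of_bool (k \<le> int (card S))) - rexp r U (\<lambda>S. of_bool (k \<le> int (card S)))"
  proof (rule card_tail_hybrid[OF fin(1) _ JU(1)])
    fix i assume "i \<in> U" then show "0 \<le> r i \<and> r i \<le> q i \<and> q i \<le> 1" using rq q01 r0 by auto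
  next
    fix h i assume i: "i \<in> J" and h: "\<And>j. j \<in> U \<Longrightarrow> h j = q j \<or> h j = r j"
    define Vh where "Vh = (\<Sum>j\<in>U - {i}. h j * (1 - h j))"
    have h01: "0 \<le> h j" "h j \<le> 1" if "j \<in> U" for j
      using h[OF that] q01[of j] r0[of j] rq[OF that] by auto
    have hhalf: "\<bar>h j - 1 / 2\<bar> \<le> H * (3 + d j) / sqrt M" if "j \<in> U" for j
      using h[OF that] half[OF that] by auto
    have hJ: "3 / 16 \<le> h j * (1 - h j)" if "j \<in> J" for j
    proof -
      have j: "j \<in> U" "d j \<le> 2 * K" using that by (auto simp: J_def)
      have b4: "4 * (H * (3 + 2 * K)) \<le> sqrt M" using real_le_rsqrt[OF big(4)] by (simp only: mult.assoc)
      have "x / z \<le> 1 / 4" if "4 * x \<le> z" "20 \<le> z" for x z :: real using that by (simp add: field_simps)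
      from this[OF b4 sM] have "H * (3 + 2 * K) / sqrt M \<le> 1 / 4" .
      moreover have "H * (3 + d j) / sqrt M \<le> H * (3 + 2 * K) / sqrt M"
        using j H big(2) by (intro divide_right_mono mult_left_mono) auto
      ultimately have a: "\<bar>h j - 1 / 2\<bar> \<le> 1 / 4" using hhalf[OF j(1)] by linarith
      have "(h j - 1 / 2)\<^sup>2 \<le> (1 / 4)\<^sup>2" using a by (metis abs_le_square_iff abs_of_nonneg zero_le_divide_1_iff zero_le_numeral)
      then show ?thesis by (simp add: power2_eq_square algebra_simps)
    qed
    have V1: "M / 100 \<le> Vh"
    proof -
      have "3 / 16 * (real (card U) / 2 - 1) \<le> 3 / 16 * real (card (J - {i}))"
        using cJ i JU by (intro mult_left_mono) (auto simp: card_Diff_singleton of_nat_diff Suc_le_eq card_gt_0_iff)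
      also have "\<dots> = (\<Sum>j\<in>J - {i}. 3 / 16)" by simp
      also have "\<dots> \<le> (\<Sum>j\<in>J - {i}. h j * (1 - h j))" by (intro sum_mono hJ) auto
      also have "\<dots> \<le> Vh" unfolding Vh_def using fin JU h01 by (intro sum_mono2) auto
      finally have "3 / 16 * (real (card U) / 2 - 1) \<le> Vh" .
      moreover have "M / 4 \<le> real (card U)" using cU(1) by (simp add: M_def)
      ultimately show ?thesis using big(2) by (simp add: field_simps)
    qed
    have V2: "Vh \<le> 3 * M"
    proof -
      have "Vh \<le> (\<Sum>j\<in>U - {i}. 1)" unfolding Vh_def
        using h01 by (intro sum_mono mult_le_one) auto
      also have "\<dots> \<le> real (card U)" using fin by (auto intro!: card_mono)
      finally show ?thesis using cU(2) by (simp add: M_def)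
    qed
    \<comment> \<open>\<open>k\<close> is within 1 of \<open>card U / 2\<close>, and so is the mean
      of any hybrid up to O(sqrt M). The threshold therefore lies in the bulk, where
      \<open>pcard_ge\<close> applies.\<close>
    have mean: "\<bar>real_of_int (k - 1) - (\<Sum>j\<in>U - {i}. h j)\<bar> \<le> A * sqrt Vh"
    proof -
      have iU: "i \<in> U" using i JU by auto
      have "(\<Sum>j\<in>U. h j) = h i + (\<Sum>j\<in>U - {i}. h j)" using fin iU by (simp add: sum.remove)
      moreover have "(\<Sum>j\<in>U. h j - 1 / 2) = (\<Sum>j\<in>U. h j) - real (card U) / 2" by (simp add: sum_subtractf)
      moreover have "\<bar>\<Sum>j\<in>U. h j - 1 / 2\<bar> \<le> (\<Sum>j\<in>U. H * (3 + d j) / sqrt M)"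
        by (intro order_trans[OF sum_abs] sum_mono hhalf)
      ultimately have "\<bar>real_of_int (k - 1) - (\<Sum>j\<in>U - {i}. h j)\<bar> \<le> 3 * H * (3 + K) * sqrt M + 2"
        using dsum k h01[OF iU] unfolding of_int_diff of_int_1 by linarith
      also have "\<dots> \<le> 3 * H * (3 + K) * sqrt M + 2 * sqrt M" using sM by linarith
      also have "\<dots> = A * (sqrt M / 10)" unfolding A by (simp add: algebra_simps)
      also have "sqrt M / 10 = sqrt (M / 100)" by (simp add: real_sqrt_divide)
      also have "A * sqrt (M / 100) \<le> A * sqrt Vh" using V1 A0 by (intro mult_left_mono) auto
      finally show ?thesis .
    qed
    have "local_const A / sqrt (3 * M) \<le> local_const A / sqrt Vh"
      using V1 V2 big(2) local_const_pos[OF A0] by (intro divide_left_mono mult_pos_pos real_sqrt_le_mono) auto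
    also have "\<dots> \<le> pcard h (U - {i}) (k - 1)"
      using fin(1) h01 Vh_def V1 big(3) mean A0 by (intro pcard_ge) auto
    finally show "local_const A / sqrt (3 * M) \<le> pcard h (U - {i}) (k - 1)" .
  qed
  moreover have "rexp r U (\<lambda>S. of_bool (k \<le> int (card S))) \<ge> rexp r U (\<lambda>S. of_bool (second_thr s' v U \<le> int (card S)))"
    using kk' r0 r1 by (intro rexp_mono) auto
  ultimately have main: "local_const A / sqrt (3 * M) * (\<Sum>i\<in>J. q i - r i) \<le>
    rexp q U (\<lambda>S. of_bool (k \<le> int (card S))) - rexp r U (\<lambda>S. of_bool (second_thr s' v U \<le> int (card S)))"
    by linarith
  have "gap_const L C K c * (sqrt (real (card V)) * p) \<le> local_const A / sqrt (3 * M) * (M / 8 * (local_const 1 * c * sqrt p))"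
  proof -
    have pos: "0 \<le> local_const A" "0 \<le> local_const 1" "0 < M" using local_const_pos A0 big(2) by (auto intro: less_imp_le)
    have "sqrt 3 \<le> (2 :: real)" by (rule real_le_lsqrt) auto
    then have "sqrt (3 * M) \<le> 2 * sqrt M" using pos by (simp add: real_sqrt_mult mult_right_mono)
    then have "M / (2 * sqrt M) \<le> M / sqrt (3 * M)" using pos by (intro divide_left_mono) auto
    moreover have "M / (2 * sqrt M) = sqrt M / 2" using pos by (simp add: real_div_sqrt flip: divide_divide_eq_left')
    ultimately have "sqrt M / 2 \<le> M / sqrt (3 * M)" by simp
    then have "local_const A * (local_const 1 * c * sqrt p) / 8 * (sqrt M / 2) \<le> local_const A * (local_const 1 * c * sqrt p) / 8 * (M / sqrt (3 * M))"
      using pos c p by (intro mult_left_mono) auto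
    moreover have "sqrt p * sqrt M = sqrt (real (card V)) * p"
      unfolding M_def using p by (simp add: real_sqrt_mult)
    ultimately show ?thesis unfolding gap_const_def A_def[symmetric] by (simp add: mult_ac) (metis (no_types, lifting) mult.assoc mult.commute)
  qed
  also have "\<dots> \<le> local_const A / sqrt (3 * M) * (\<Sum>i\<in>J. q i - r i)"
  proof (intro mult_left_mono)
    have "M / 8 * (local_const 1 * c * sqrt p) \<le> real (card J) * (local_const 1 * c * sqrt p)"
      using cJ cU(1) local_const_pos[of 1] c p unfolding M_def by (intro mult_right_mono) auto
    also have "\<dots> = (\<Sum>i\<in>J. local_const 1 * c * sqrt p)" by simp
    also have "\<dots> \<le> (\<Sum>i\<in>J. q i - r i)" by (intro sum_mono gapJ)
    finally show "M / 8 * (local_const 1 * c * sqrt p) \<le> (\<Sum>i\<in>J. q i - r i)" .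
  qed (use local_const_pos[OF A0] big(2) in auto)
  also note main
  also have "rexp q U (\<lambda>S. of_bool (k \<le> int (card S))) = 
     rexp (\<lambda>_. p) (\<Union>x\<in>U. cross x W) (\<lambda>A. of_bool (maj2 (cross v U \<union> B \<union> A) s v = 1))"
    unfolding q_def k_def using fV v U W sV B(1) by (intro rexp_maj2_given[symmetric]) auto
  also have "rexp r U (\<lambda>S. of_bool (second_thr s' v U \<le> int (card S))) = 
     rexp (\<lambda>_. p) (\<Union>x\<in>U. cross x W) (\<lambda>A. of_bool (maj2 (cross v U \<union> B \<union> A) s' v = 1))"
    unfolding r_def using fV v U W s'V B(1) by (intro rexp_maj2_given[symmetric]) auto
  finally show ?thesis .
qed

section \<open>Typical exposures and the expected bias\<close>

lemma exp_minus_le: "0 \<le> x \<Longrightarrow> exp (- x) \<le> 1 / (1 + x)" for x :: real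
  using exp_ge_add_one_self[of x] by (simp add: exp_minus field_simps)

text \<open>The expected number of edges inside \<open>U\<close> is at most
  \<open>p * card U * card U \<le> 3 * L * card U\<close>. The Chernoff bound doubles this and adds
  \<open>card U\<close>; the outer 2 counts both ends of an edge.\<close>

definition edge_const :: "real \<Rightarrow> real" where
  "edge_const L = 2 * (6 * L + 1)"

lemma sparse_inside_prob:
  fixes p L :: real
  assumes "finite U" "finite W" "0 \<le> p" "p \<le> 1" "U \<inter> W = {}" "real (card U) * p \<le> 3 * L" "1 \<le> card U" 
  shows "rexp (\<lambda>_. p) (all_pairs U \<union> all_pairs W)
    (\<lambda>B. of_bool (\<not> real (\<Sum>x\<in>U. card (neighbours B x)) \<le> edge_const L * real (card U))) \<le> 1 / 2"
proof -
  let ?I = "all_pairs U \<union> all_pairs W"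
  have "rexp (\<lambda>_. p) ?I (\<lambda>B. of_bool (\<not> real (\<Sum>x\<in>U. card (neighbours B x)) \<le> edge_const L * real (card U)))
    \<le> rexp (\<lambda>_. p) ?I (\<lambda>B. of_bool ((6 * L + 1) * real (card U) \<le> real (card (B \<inter> all_pairs U))))"
  proof (rule rexp_mono)
    fix B assume B: "B \<subseteq> ?I"
    have "neighbours B x = neighbours (B \<inter> all_pairs U) x" if "x \<in> U" for x
    proof -
      have "{u, x} \<in> B \<longleftrightarrow> {u, x} \<in> B \<inter> all_pairs U" if "u \<noteq> x" for u
        using subsetD[OF B, of "{u, x}"] \<open>x \<in> U\<close> assms(5) by auto
      then show ?thesis by (auto simp: neighbours_def)
    qed
    then have "(\<Sum>x\<in>U. card (neighbours B x)) = (\<Sum>x\<in>U. card (neighbours (B \<inter> all_pairs U) x))" by simp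
    also have "\<dots> \<le> 2 * card (B \<inter> all_pairs U)"
      using assms(1) by (intro sum_card_neighbours_le) (auto simp: all_pairs_def)
    finally have "real (\<Sum>x\<in>U. card (neighbours B x)) \<le> 2 * real (card (B \<inter> all_pairs U))" by linarith
    then show "of_bool (\<not> real (\<Sum>x\<in>U. card (neighbours B x)) \<le> edge_const L * real (card U))
      \<le> (of_bool ((6 * L + 1) * real (card U) \<le> real (card (B \<inter> all_pairs U))) :: real)"
    proof -
      assume a: "real (\<Sum>x\<in>U. card (neighbours B x)) \<le> 2 * real (card (B \<inter> all_pairs U))"
      have "edge_const L * real (card U) = 2 * ((6 * L + 1) * real (card U))" by (simp add: edge_const_def algebra_simps)
      then have "(6 * L + 1) * real (card U) \<le> real (card (B \<inter> all_pairs U))"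
        if "\<not> real (\<Sum>x\<in>U. card (neighbours B x)) \<le> edge_const L * real (card U)"
        using that a by linarith
      then show ?thesis by auto
    qed
  qed (use assms in auto)
  also have "\<dots> \<le> exp (2 * p * real (card (all_pairs U)) - (6 * L + 1) * real (card U))"
    using assms by (intro chernoff_upper) auto
  also have "\<dots> \<le> exp (- 1)"
  proof -
    have "real (card (all_pairs U)) \<le> real (card U * card U)"
      using card_all_pairs_le[OF assms(1)] by (simp only: of_nat_le_iff)
    then have "2 * p * real (card (all_pairs U)) \<le> 2 * p * (real (card U) * real (card U))"
      using assms by (intro mult_left_mono) auto
    also have "\<dots> = 2 * (real (card U) * p) * real (card U)" by simp
    also have "\<dots> \<le> 2 * (3 * L) * real (card U)" using assms(6) by (intro mult_right_mono mult_left_mono) auto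
    finally show ?thesis using assms(7) by (simp add: algebra_simps)
  qed
  also have "\<dots> \<le> 1 / 2" using exp_minus_le[of 1] by simp
  finally show ?thesis .
qed

text \<open>Three failures of probability at most 1/16 each. The last condition keeps half of
  \<open>F\<close> outside the neighbourhood, where fresh edges can still meet it.\<close>

lemma typical_degree_prob:
  fixes p M :: real
  assumes "finite V'" "0 < p" "p \<le> 1 / 100" "F \<subseteq> V'" "F \<noteq> {}"
    and M: "M = (real (card V') + 1) * p" "100 \<le> M"
  shows "3 / 4 \<le> rexp (\<lambda>_. p) V' (\<lambda>U. of_bool (M / 4 \<le> real (card U) \<and> real (card U) \<le> 3 * M \<and> real (card (F \<inter> U)) \<le> real (card F) / 2))"
proof -
  have "finite F" using assms(1,4) finite_subset by auto
  then have fF: "finite F" "card F > 0" using assms(5) by (auto simp: card_gt_0_iff)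
  have p01: "0 \<le> p" "p \<le> 1" using assms by auto
  have lo: "rexp (\<lambda>_. p) V' (\<lambda>U. of_bool (real (card (U \<inter> V')) \<le> M / 4)) \<le> 1 / 16"
  proof -
    have "rexp (\<lambda>_. p) V' (\<lambda>U. of_bool (real (card (U \<inter> V')) \<le> M / 4)) \<le> exp (M / 4 - p * real (card V') / 2)"
      using assms by (intro chernoff_lower) auto
    also have "M / 4 - p * real (card V') / 2 = - (M / 4 - p / 2)" by (simp add: M algebra_simps)
    also have "exp (- (M / 4 - p / 2)) \<le> 1 / (1 + (M / 4 - p / 2))" using M(2) assms(3) by (intro exp_minus_le) linarith
    also have "\<dots> \<le> 1 / 16"
    proof -
      have "16 \<le> 1 + (M / 4 - p / 2)" using M(2) assms(3) by linarith
      then show ?thesis by (simp add: field_simps)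
    qed
    finally show ?thesis .
  qed
  have hi: "rexp (\<lambda>_. p) V' (\<lambda>U. of_bool (3 * M \<le> real (card (U \<inter> V')))) \<le> 1 / 16"
  proof -
    have "rexp (\<lambda>_. p) V' (\<lambda>U. of_bool (3 * M \<le> real (card (U \<inter> V')))) \<le> exp (2 * p * real (card V') - 3 * M)"
      using assms by (intro chernoff_upper) auto
    also have "\<dots> \<le> exp (- M)" using assms by (simp add: M algebra_simps)
    also have "\<dots> \<le> 1 / (1 + M)" using M(2) by (intro exp_minus_le) linarith
    also have "\<dots> \<le> 1 / 16" using M(2) by (intro divide_left_mono) auto
    finally show ?thesis .
  qed
  have F: "rexp (\<lambda>_. p) V' (\<lambda>U. of_bool (real (card F) / 2 \<le> real (card (U \<inter> F)))) \<le> 1 / 16"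
  proof -
    have "rexp (\<lambda>_. p) V' (\<lambda>U. of_bool (real (card F) / 2 \<le> real (card (U \<inter> F)))) \<le> rexp (\<lambda>_. p) V' (\<lambda>U. real (card (U \<inter> F))) / (real (card F) / 2)"
      using fF p01 by (intro markov_rexp) auto
    also have "rexp (\<lambda>_. p) V' (\<lambda>U. real (card (U \<inter> F))) = real (card F) * p"
      using rexp_restrict[OF assms(1,4), of "\<lambda>_. p" "\<lambda>S. real (card S)"] fF by (simp add: rexp_card)
    also have "real (card F) * p / (real (card F) / 2) = 2 * p" using fF assms(5) by simp
    also have "\<dots> \<le> 1 / 16" using assms by simp
    finally show ?thesis .
  qed
  have "1 = rexp (\<lambda>_. p) V' (\<lambda>_. 1)" using assms(1) by (simp add: rexp_const)
  also have "\<dots> \<le> rexp (\<lambda>_. p) V' (\<lambda>U. of_bool (M / 4 \<le> real (card U) \<and> real (card U) \<le> 3 * M \<and> real (card (F \<inter> U)) \<le> real (card F) / 2) +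
     (of_bool (real (card (U \<inter> V')) \<le> M / 4) + (of_bool (3 * M \<le> real (card (U \<inter> V'))) + of_bool (real (card F) / 2 \<le> real (card (U \<inter> F))))))"
    using p01 by (intro rexp_mono) (auto simp: Int_absorb2 Int_commute)
  finally show ?thesis unfolding rexp_add using lo hi F by linarith
qed

text \<open>Averaging the conditional gap \<open>\<kappa>\<close> over the exposure: the
  neighbourhood is typical with probability at least 3/4 and its inside is sparse with probability
  at least 1/2. On all other exposures the difference is nonnegative by monotonicity, so at least
  \<open>3 * \<kappa> / 8\<close> survives.\<close>

lemma maj2_gap:
  fixes m L C p c :: real
  assumes reg: "regime m L C V s p" and m: "gap_min L C (edge_const L) \<le> m" and LC: "1 \<le> L" "1 \<le> C"
    and F: "F \<subseteq> V" "\<And>y. y \<in> F \<Longrightarrow> s y = 1" "real (card F) \<le> C * sqrt (real (card V))"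
    and reg': "regime m L C V s' p" and s': "s' = (\<lambda>y. if y \<in> F then -1 else s y)"
    and v: "v \<in> V - F" and c: "0 < c" "c * sqrt (real (card V)) \<le> real (card F)"
  shows "gap_const L C (edge_const L) (c / 2) * (sqrt (real (card V)) * p) / 4
    \<le> rexp (\<lambda>_. p) (all_pairs V) (\<lambda>A. of_bool (maj2 A s v = 1)) - rexp (\<lambda>_. p) (all_pairs V) (\<lambda>A. of_bool (maj2 A s' v = 1))"
proof -
  define K where "K = edge_const L"
  define M where "M = real (card V) * p"
  define \<kappa> where "\<kappa> = gap_const L C K (c / 2) * (sqrt (real (card V)) * p)"
  let ?V = "V - {v}"
  have K: "0 < K" using LC by (simp add: K_def edge_const_def)
  have p: "0 < p" "p \<le> 1" "m \<le> M" and fV: "finite V"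
    and sV: "\<And>x. x \<in> V \<Longrightarrow> s x = 1 \<or> s x = -1" and s'V: "\<And>x. x \<in> V \<Longrightarrow> s' x = 1 \<or> s' x = -1"
    using reg reg' unfolding regime_def M_def by auto
  have m': "regime_min L C \<le> m" "400 \<le> m"
    using m regime_min_ge[of L C] zero_le_power2[of "2 + 2 * K + 1 + (3 * C + 7) * L"]
      zero_le_power2[of "2 * spread_const L C K + 8"] zero_le_power2[of "4 * half_const L C * (3 + 2 * K)"]
    unfolding gap_min_def K_def[symmetric] by linarith+
  have VV: "V \<subseteq> V" "real (card (V - V)) \<le> 7 * (real (card V) * p)" using p by auto
  note f = regime_fresh[OF reg m'(1) LC VV]
  have cV: "real (card ?V) + 1 = real (card V)" using v fV f(9) by (simp add: card_Diff_singleton of_nat_diff)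
  have \<kappa>0: "0 \<le> \<kappa>"
  proof -
    have "0 \<le> half_const L C" using LC by (simp add: half_const_def)
    then have "0 \<le> spread_const L C K" using K unfolding spread_const_def by simp
    then have "0 \<le> gap_const L C K (c / 2)" unfolding gap_const_def
      using local_const_pos[of "spread_const L C K"] local_const_pos[of 1] c by simp
    then show ?thesis using p unfolding \<kappa>_def by simp
  qed
  define D where "D = (\<lambda>U B. rexp (\<lambda>_. p) (\<Union>x\<in>U. cross x (?V - U)) (\<lambda>A. of_bool (maj2 (cross v U \<union> B \<union> A) s v = 1))
      - rexp (\<lambda>_. p) (\<Union>x\<in>U. cross x (?V - U)) (\<lambda>A. of_bool (maj2 (cross v U \<union> B \<union> A) s' v = 1)))"
  have s'_le: "s' x \<le> s x" if "x \<in> V" for x using sV[OF that] by (auto simp: s')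
  define gU where "gU = (\<lambda>U. M / 4 \<le> real (card U) \<and> real (card U) \<le> 3 * M \<and> real (card (F \<inter> U)) \<le> real (card F) / 2)"
  define gB where "gB = (\<lambda>(U :: 'a set) B. real (\<Sum>x\<in>U. card (neighbours B x)) \<le> K * real (card U))"
  have D0: "0 \<le> D U B" if "U \<subseteq> ?V" "B \<subseteq> all_pairs U \<union> all_pairs (?V - U)" for U B
  proof -
    have "rexp (\<lambda>_. p) (\<Union>x\<in>U. cross x (?V - U)) (\<lambda>A. of_bool (maj2 (cross v U \<union> B \<union> A) s' v = 1))
      \<le> rexp (\<lambda>_. p) (\<Union>x\<in>U. cross x (?V - U)) (\<lambda>A. of_bool (maj2 (cross v U \<union> B \<union> A) s v = 1))"
    proof (rule rexp_mono)
      fix A assume A: "A \<subseteq> (\<Union>x\<in>U. cross x (?V - U))"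
      have sub: "cross v U \<union> B \<union> A \<subseteq> all_pairs V"
      proof -
        have "cross v U \<subseteq> all_pairs V" using that(1) v by (auto simp: cross_def)
        moreover have "B \<subseteq> all_pairs V" using that by (auto simp: all_pairs_def)
        moreover have "A \<subseteq> all_pairs V" using A that(1) by (auto simp: cross_def dest!: subsetD)
        ultimately show ?thesis by auto
      qed
      have "maj2 (cross v U \<union> B \<union> A) s' v \<le> maj2 (cross v U \<union> B \<union> A) s v"
        using v by (intro maj2_mono[OF sub sV s'V] s'_le) auto
      then show "of_bool (maj2 (cross v U \<union> B \<union> A) s' v = 1) \<le> (of_bool (maj2 (cross v U \<union> B \<union> A) s v = 1) :: real)"
        using maj2_values[of s v "cross v U \<union> B \<union> A"] sV[of v] v by auto
    qed (use p in auto)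
    then show ?thesis by (simp add: D_def)
  qed
  have Dgood: "\<kappa> \<le> D U B" if "U \<subseteq> ?V" "B \<subseteq> all_pairs U \<union> all_pairs (?V - U)" "gU U" "gB U B" for U B
  proof -
    have "F = (F \<inter> U) \<union> (F \<inter> (?V - U))" "(F \<inter> U) \<inter> (F \<inter> (?V - U)) = {}" using F v by auto
    then have "card F = card (F \<inter> U) + card (F \<inter> (?V - U))"
      using F(1) fV by (metis card_Un_disjoint finite_Un finite_subset)
    then have "real (card F) = real (card (F \<inter> U)) + real (card (F \<inter> (?V - U)))" by simp
    then have "c / 2 * sqrt (real (card V)) \<le> real (card (F \<inter> (?V - U)))"
      using that(3) c unfolding gU_def by linarith
    then show ?thesis unfolding D_def \<kappa>_def
      using that c unfolding gU_def gB_def M_def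
      by (intro maj2_gap_given[OF reg _ LC K F reg' s' v _ refl]) (auto simp: m K_def simp del: of_nat_sum)
  qed
  have inner: "\<kappa> / 2 * of_bool (gU U) \<le> rexp (\<lambda>_. p) (all_pairs U \<union> all_pairs (?V - U)) (D U)" if U: "U \<subseteq> ?V" for U
  proof (cases "gU U")
    case True
    have fin: "finite U" "finite (?V - U)" using fV U finite_subset by auto
    have "real (card U) * p \<le> 3 * M * p" using True p by (intro mult_right_mono) (auto simp: gU_def)
    also have "\<dots> \<le> 3 * L" using f(7) by (simp add: M_def mult_ac)
    finally have "rexp (\<lambda>_. p) (all_pairs U \<union> all_pairs (?V - U)) (\<lambda>B. of_bool (\<not> gB U B)) \<le> 1 / 2"
      unfolding gB_def K_def using True fin p m'(2) by (intro sparse_inside_prob) (auto simp: gU_def)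
    moreover have "rexp (\<lambda>_. p) (all_pairs U \<union> all_pairs (?V - U)) (\<lambda>B. \<kappa> - \<kappa> * of_bool (\<not> gB U B)) \<le>
      rexp (\<lambda>_. p) (all_pairs U \<union> all_pairs (?V - U)) (D U)"
      using D0[OF U] Dgood[OF U _ True] p by (intro rexp_mono) auto
    moreover have "rexp (\<lambda>_. p) (all_pairs U \<union> all_pairs (?V - U)) (\<lambda>B. \<kappa> - \<kappa> * of_bool (\<not> gB U B)) =
      \<kappa> - \<kappa> * rexp (\<lambda>_. p) (all_pairs U \<union> all_pairs (?V - U)) (\<lambda>B. of_bool (\<not> gB U B))"
      using fin unfolding rexp_diff rexp_cmult by (subst rexp_const) auto
    moreover have "\<kappa> * rexp (\<lambda>_. p) (all_pairs U \<union> all_pairs (?V - U)) (\<lambda>B. of_bool (\<not> gB U B)) \<le> \<kappa> * (1 / 2)"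
      using \<kappa>0 calculation(1) by (intro mult_left_mono)
    ultimately show ?thesis using True by simp
  next
    case False
    then show ?thesis using D0[OF U] p by (auto intro!: rexp_nonneg)
  qed
  have "\<kappa> / 4 \<le> \<kappa> / 2 * (3 / 4)" using \<kappa>0 by simp
  also have "\<dots> \<le> \<kappa> / 2 * rexp (\<lambda>_. p) ?V (\<lambda>U. of_bool (gU U))"
  proof (intro mult_left_mono)
    have "0 < c * sqrt (real (card V))" using c f(9) by simp
    then have "F \<noteq> {}" using c(2) by auto
    then show "3 / 4 \<le> rexp (\<lambda>_. p) ?V (\<lambda>U. of_bool (gU U))"
      unfolding gU_def using fV p(3) F(1) v m'(2)
      by (intro typical_degree_prob[OF _ p(1) f(4)]) (auto simp only: cV M_def)
  qed (use \<kappa>0 in auto)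
  also have "\<dots> = rexp (\<lambda>_. p) ?V (\<lambda>U. \<kappa> / 2 * of_bool (gU U))" by (rule rexp_cmult[symmetric])
  also have "\<dots> \<le> rexp (\<lambda>_. p) ?V (\<lambda>U. rexp (\<lambda>_. p) (all_pairs U \<union> all_pairs (?V - U)) (D U))"
    using inner p by (intro rexp_mono) auto
  also have "\<dots> = rexp (\<lambda>_. p) (all_pairs V) (\<lambda>A. of_bool (maj2 A s v = 1)) - rexp (\<lambda>_. p) (all_pairs V) (\<lambda>A. of_bool (maj2 A s' v = 1))"
    using v by (simp only: D_def rexp_diff rexp_graph_split[OF fV, of v] Diff_iff)
  finally show ?thesis by (simp add: \<kappa>_def K_def)
qed

lemma rexp_graph_image:
  fixes p :: real
  assumes "finite V" "\<And>x. \<pi> (\<pi> x) = x" "\<pi> ` V = V"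
  shows "rexp (\<lambda>_. p) (all_pairs V) f = rexp (\<lambda>_. p) (all_pairs V) (\<lambda>A. f ((`) \<pi> ` A))"
proof -
  have inj: "inj \<pi>" using assms(2) by (metis injI)
  have sub: "\<pi> ` e \<in> all_pairs V" if "e \<in> all_pairs V" for e
    using that assms(3) inj by (auto simp: all_pairs_def card_image inj_on_subset)
  have "(`) \<pi> ` all_pairs V = all_pairs V"
  proof
    show "(`) \<pi> ` all_pairs V \<subseteq> all_pairs V" using sub by auto
    show "all_pairs V \<subseteq> (`) \<pi> ` all_pairs V"
    proof
      fix e assume "e \<in> all_pairs V"
      then have "\<pi> ` e \<in> all_pairs V" by (rule sub)
      moreover have "e = \<pi> ` (\<pi> ` e)" using assms(2) by (simp add: image_image)
      ultimately show "e \<in> (`) \<pi> ` all_pairs V" by blast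
    qed
  qed
  moreover have "rexp (\<lambda>_. p) ((`) \<pi> ` all_pairs V) f = rexp (\<lambda>_. p) (all_pairs V) (\<lambda>A. f ((`) \<pi> ` A))"
    using assms(1) inj by (intro rexp_image) (auto simp: inj_on_def inj_image_eq_iff)
  ultimately show ?thesis by simp
qed

text \<open>Of the factor 8, a 4 is lost in \<open>maj2_gap\<close>, and a 2 because that gap is
  counted only for the at least n/2 vertices outside \<open>F\<close>.\<close>

definition mean_const :: "real \<Rightarrow> real \<Rightarrow> real \<Rightarrow> real" where
  "mean_const L C c = gap_const L C (edge_const L) (c / 2) / 8"

text \<open>Flipping a set \<open>F\<close> of \<open>\<Sum> s\<close> positive vertices turns \<open>s\<close> into \<open>- s\<close> up to a permutation of the
  vertices, so half of the change of the expectation is the expectation itself.\<close>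

lemma maj2_mean:
  fixes m L C p c :: real
  assumes reg: "regime m L C V s p" and m: "gap_min L C (edge_const L) \<le> m" and LC: "1 \<le> L" "1 \<le> C"
    and c: "0 < c" "c * sqrt (real (card V)) \<le> real_of_int (\<Sum>x\<in>V. s x)"
  shows "mean_const L C c * (real (card V) * (sqrt (real (card V)) * p))
    \<le> rexp (\<lambda>_. p) (all_pairs V) (\<lambda>A. real_of_int (\<Sum>v\<in>V. maj2 A s v))"
proof -
  have p: "0 < p" "p \<le> 1" "m \<le> real (card V) * p" and fV: "finite V"
    and sV: "\<And>x. x \<in> V \<Longrightarrow> s x = 1 \<or> s x = -1" and sumC: "\<bar>real_of_int (\<Sum>x\<in>V. s x)\<bar> \<le> C * sqrt (real (card V))"
    using reg unfolding regime_def by auto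
  define n where "n = real (card V)"
  define P N where "P = {x\<in>V. s x = 1}" and "N = {x\<in>V. s x = -1}"
  have fPN: "finite P" "finite N" using fV by (auto simp: P_def N_def)
  have S: "(\<Sum>x\<in>V. s x) = int (card P) - int (card N)"
    using sum_signs(1)[of V s] fV sV by (simp add: P_def N_def)
  have "0 \<le> c * sqrt (real (card V))" using c by simp
  then have S0: "0 \<le> (\<Sum>x\<in>V. s x)" using c(2) by linarith
  then have "card P - card N \<le> card P" "card N \<le> card P" using S by auto
  then obtain F where F: "F \<subseteq> P" "card F = card P - card N"
    using obtain_subset_with_card_n by metis
  have fF: "finite F" using F fPN finite_subset by auto
  have cF: "int (card F) = (\<Sum>x\<in>V. s x)" using F S \<open>card N \<le> card P\<close> by simp
  then have cFr: "real (card F) = real_of_int (\<Sum>x\<in>V. s x)" by (metis of_int_of_nat_eq)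
  have "card (P - F) = card N" using F fF \<open>card N \<le> card P\<close> by (simp add: card_Diff_subset)
  moreover have "(P - F) \<inter> N = {}" by (auto simp: P_def N_def)
  ultimately obtain \<pi> where \<pi>: "\<And>x. \<pi> (\<pi> x) = x" "\<And>x. x \<in> P - F \<Longrightarrow> \<pi> x \<in> N" "\<And>x. x \<in> N \<Longrightarrow> \<pi> x \<in> P - F"
      "\<And>x. x \<notin> P - F \<Longrightarrow> x \<notin> N \<Longrightarrow> \<pi> x = x"
    using swap_involution[of "P - F" N] fPN by (metis finite_Diff)
  define s' where "s' = (\<lambda>y. if y \<in> F then -1 else s y)"
  have FV: "F \<subseteq> V" and F1: "\<And>y. y \<in> F \<Longrightarrow> s y = 1" using F(1) by (auto simp: P_def)
  have \<pi>V: "\<pi> x \<in> V" if "x \<in> V" for x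
    using \<pi>(2,3,4)[of x] that by (cases "x \<in> P - F"; cases "x \<in> N") (auto simp: P_def N_def)
  have im: "\<pi> ` V = V" using \<pi>V \<pi>(1) by (metis image_subsetI imageI subsetI subset_antisym)
  have inj: "inj_on \<pi> V" using \<pi>(1) by (metis inj_onI)
  have s's: "s' x = - s (\<pi> x)" if "x \<in> V" for x
  proof -
    note xV = that
    consider "x \<in> F" | "x \<in> P - F" | "x \<in> N" using sV[OF xV] xV by (auto simp: P_def N_def)
    then show ?thesis
    proof cases
      case 1
      then have "\<pi> x = x" using F(1) \<pi>(4)[of x] by (auto simp: P_def N_def)
      then show ?thesis using 1 F1 by (simp add: s'_def)
    next
      case 2
      then show ?thesis using \<pi>(2)[OF 2] by (auto simp: s'_def P_def N_def)
    next
      case 3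
      then have "\<pi> x \<in> P" "x \<notin> F" using \<pi>(3)[OF 3] F1 by (auto simp: N_def)
      then show ?thesis using 3 by (auto simp: s'_def P_def N_def)
    qed
  qed
  have sum_s': "(\<Sum>x\<in>V. s' x) = - (\<Sum>x\<in>V. s x)"
  proof -
    have "(\<Sum>x\<in>V. s' x) = (\<Sum>x\<in>V. - s (\<pi> x))" using s's by simp
    also have "\<dots> = - (\<Sum>x\<in>V. s (\<pi> x))" by (rule sum_negf)
    also have "(\<Sum>x\<in>V. s (\<pi> x)) = (\<Sum>x\<in>\<pi> ` V. s x)" by (simp add: sum.reindex[OF inj])
    finally show ?thesis unfolding im .
  qed
  have reg': "regime m L C V s' p"
    using reg sV unfolding regime_def sum_s' by (auto simp: s'_def)
  define E where "E = (\<lambda>f. rexp (\<lambda>_. p) (all_pairs V) f)"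
  have sym: "E (\<lambda>A. real_of_int (\<Sum>v\<in>V. maj2 A s' v)) = - E (\<lambda>A. real_of_int (\<Sum>v\<in>V. maj2 A s v))"
  proof -
    have "E (\<lambda>A. real_of_int (\<Sum>v\<in>V. maj2 A s' v)) = E (\<lambda>A. - real_of_int (\<Sum>v\<in>V. maj2 ((`) \<pi> ` A) s v))"
      unfolding E_def
    proof (intro rexp_cong refl)
      fix A assume A: "A \<subseteq> all_pairs V"
      have "(\<Sum>v\<in>V. maj2 A s' v) = (\<Sum>v\<in>V. maj2 A (\<lambda>x. - s (\<pi> x)) v)"
        by (intro sum.cong refl maj2_cong[OF A] s's)
      also have "\<dots> = - (\<Sum>v\<in>V. maj2 A (\<lambda>x. s (\<pi> x)) v)" unfolding maj2_uminus by (rule sum_negf)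
      also have "(\<Sum>v\<in>V. maj2 A (\<lambda>x. s (\<pi> x)) v) = (\<Sum>v\<in>V. maj2 ((`) \<pi> ` A) s (\<pi> v))"
        by (simp only: maj2_image[of \<pi>, OF \<pi>(1)])
      also have "\<dots> = (\<Sum>v\<in>\<pi> ` V. maj2 ((`) \<pi> ` A) s v)" by (simp add: sum.reindex[OF inj])
      finally show "real_of_int (\<Sum>v\<in>V. maj2 A s' v) = - real_of_int (\<Sum>v\<in>V. maj2 ((`) \<pi> ` A) s v)"
        unfolding im by (simp del: of_int_sum)
    qed
    also have "\<dots> = - E (\<lambda>A. real_of_int (\<Sum>v\<in>V. maj2 ((`) \<pi> ` A) s v))" unfolding E_def by (rule rexp_uminus)
    also have "E (\<lambda>A. real_of_int (\<Sum>v\<in>V. maj2 ((`) \<pi> ` A) s v)) = E (\<lambda>A. real_of_int (\<Sum>v\<in>V. maj2 A s v))"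
      unfolding E_def
      by (rule rexp_graph_image[of V \<pi> p "\<lambda>A. real_of_int (\<Sum>v\<in>V. maj2 A s v)", OF fV \<pi>(1) im, symmetric])
    finally show ?thesis .
  qed
  define \<Delta> where "\<Delta> = (\<lambda>v. E (\<lambda>A. of_bool (maj2 A s v = 1)) - E (\<lambda>A. of_bool (maj2 A s' v = 1)))"
  define \<kappa> where "\<kappa> = gap_const L C (edge_const L) (c / 2) * (sqrt (real (card V)) * p) / 4"
  have val: "real_of_int (maj2 A t v) = 2 * of_bool (maj2 A t v = 1) - 1" if "t v = 1 \<or> t v = -1" for A t v
    using maj2_values[of t v A] that by auto
  have E1: "E (\<lambda>A. real_of_int (\<Sum>v\<in>V. maj2 A t v)) = (\<Sum>v\<in>V. 2 * E (\<lambda>A. of_bool (maj2 A t v = 1)) - 1)"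
    if t: "\<And>x. x \<in> V \<Longrightarrow> t x = 1 \<or> t x = -1" for t
  proof -
    have "E (\<lambda>A. real_of_int (\<Sum>v\<in>V. maj2 A t v)) = E (\<lambda>A. \<Sum>v\<in>V. 2 * of_bool (maj2 A t v = 1) - 1)"
      unfolding E_def of_int_sum by (intro rexp_cong refl sum.cong val t)
    also have "\<dots> = (\<Sum>v\<in>V. 2 * E (\<lambda>A. of_bool (maj2 A t v = 1)) - 1)"
      unfolding E_def rexp_sum rexp_diff rexp_cmult using fV by (simp add: rexp_const)
    finally show ?thesis .
  qed
  have "E (\<lambda>A. real_of_int (\<Sum>v\<in>V. maj2 A s v)) - E (\<lambda>A. real_of_int (\<Sum>v\<in>V. maj2 A s' v)) = (\<Sum>v\<in>V. 2 * \<Delta> v)"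
    using sV reg' by (subst (1 2) E1) (auto simp: regime_def \<Delta>_def sum_subtractf[symmetric] algebra_simps)
  then have main: "E (\<lambda>A. real_of_int (\<Sum>v\<in>V. maj2 A s v)) = (\<Sum>v\<in>V. \<Delta> v)"
    unfolding sym sum_distrib_left[symmetric] by simp
  have s'_le: "s' x \<le> s x" if "x \<in> V" for x using sV[OF that] by (auto simp: s'_def)
  have \<Delta>0: "0 \<le> \<Delta> v" if "v \<in> V" for v
  proof -
    have "E (\<lambda>A. of_bool (maj2 A s' v = 1)) \<le> E (\<lambda>A. of_bool (maj2 A s v = 1))"
      unfolding E_def
    proof (rule rexp_mono)
      fix A assume A: "A \<subseteq> all_pairs V"
      have "maj2 A s' v \<le> maj2 A s v" using reg' that
        by (intro maj2_mono[OF A sV _ s'_le]) (auto simp: regime_def)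
      then show "of_bool (maj2 A s' v = 1) \<le> (of_bool (maj2 A s v = 1) :: real)"
        using maj2_values[of s v A] sV[OF that] by auto
    qed (use p in auto)
    then show ?thesis by (simp add: \<Delta>_def)
  qed
  have \<Delta>1: "\<kappa> \<le> \<Delta> v" if "v \<in> V - F" for v
    unfolding \<kappa>_def \<Delta>_def E_def
    by (rule maj2_gap[OF reg m LC FV F1 _ reg' s'_def that c(1)]) (use c sumC cFr in auto)
  have m': "regime_min L C \<le> m" "0 \<le> \<kappa>"
  proof -
    define K where "K = edge_const L"
    have K: "0 < K" using LC by (simp add: K_def edge_const_def)
    show "regime_min L C \<le> m"
    using m zero_le_power2[of "2 + 2 * K + 1 + (3 * C + 7) * L"]
      zero_le_power2[of "2 * spread_const L C K + 8"] zero_le_power2[of "4 * half_const L C * (3 + 2 * K)"]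
    unfolding gap_min_def K_def[symmetric] by linarith+
    have "0 \<le> half_const L C" using LC by (simp add: half_const_def)
    then have "0 \<le> spread_const L C K" using K unfolding spread_const_def by simp
    then have "0 \<le> gap_const L C K (c / 2)" unfolding gap_const_def
      using local_const_pos[of "spread_const L C K"] local_const_pos[of 1] c by simp
    then show "0 \<le> \<kappa>" using p unfolding \<kappa>_def K_def by simp
  qed
  have VV: "V \<subseteq> V" "real (card (V - V)) \<le> 7 * (real (card V) * p)" using p by auto
  note f = regime_fresh[OF reg m'(1) LC VV]
  have "real (card V) / 2 \<le> real (card (V - F))"
    using FV fF fV f(5) sumC cFr card_mono[OF fV FV] by (simp add: card_Diff_subset of_nat_diff)
  then have "real (card V) / 2 * \<kappa> \<le> real (card (V - F)) * \<kappa>" using m' by (intro mult_right_mono)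
  also have "\<dots> = (\<Sum>v\<in>V - F. \<kappa>)" by simp
  also have "\<dots> \<le> (\<Sum>v\<in>V - F. \<Delta> v)" by (intro sum_mono \<Delta>1)
  also have "\<dots> \<le> (\<Sum>v\<in>V. \<Delta> v)" using fV \<Delta>0 by (intro sum_mono2) auto
  also note main[symmetric]
  finally show ?thesis by (simp add: E_def \<kappa>_def mean_const_def mult_ac)
qed

section \<open>Concentration of the bias\<close>

definition nsum :: "'v set set \<Rightarrow> ('v \<Rightarrow> int) \<Rightarrow> 'v \<Rightarrow> int" where
  "nsum A s v = (\<Sum>u\<in>neighbours A v. s u)"

lemma card_window_le:
  fixes q :: "'a \<Rightarrow> real" and c :: int
  assumes "finite I" "\<And>i. i \<in> I \<Longrightarrow> 0 \<le> q i \<and> q i \<le> 1"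
    and V: "0 < V" "V \<le> (\<Sum>i\<in>I. q i * (1 - q i))"
  shows "rexp q I (\<lambda>S. of_bool (\<bar>2 * int (card S) + c\<bar> \<le> 4)) \<le> 10 / sqrt V"
proof -
  \<comment> \<open>This is (-4 - c) / 2 rounded up, the least cardinality in the window. An
    interval of length 8 for \<open>2 * card S\<close> holds at most five of its values.\<close>
  define k where "k = (- 3 - c) div 2"
  have "rexp q I (\<lambda>S. of_bool (\<bar>2 * int (card S) + c\<bar> \<le> 4)) \<le> rexp q I (\<lambda>S. \<Sum>j\<in>{k..k+4}. of_bool (int (card S) = j))"
  proof (rule rexp_mono[OF assms(2)])
    fix S
    have "k \<le> int (card S) \<and> int (card S) \<le> k + 4" if "\<bar>2 * int (card S) + c\<bar> \<le> 4"
      using that unfolding k_def by linarith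
    moreover have "(\<Sum>j\<in>{k..k+4}. of_bool (int (card S) = j)) = (of_bool (int (card S) \<in> {k..k+4}) :: real)"
      by (simp add: of_bool_def)
    ultimately show "of_bool (\<bar>2 * int (card S) + c\<bar> \<le> 4) \<le> (\<Sum>j\<in>{k..k+4}. of_bool (int (card S) = j) :: real)"
      by auto
  qed
  also have "\<dots> = (\<Sum>j\<in>{k..k+4}. pcard q I j)" unfolding pcard_def by (rule rexp_sum)
  also have "\<dots> \<le> (\<Sum>j\<in>{k..k+4}. 2 / sqrt V)"
  proof (rule sum_mono)
    fix j
    have "pcard q I j \<le> 2 / sqrt (\<Sum>i\<in>I. q i * (1 - q i))"
      using V by (intro pcard_le[OF assms(1,2) refl]) auto
    also have "\<dots> \<le> 2 / sqrt V" using V by (intro divide_left_mono) auto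
    finally show "pcard q I j \<le> 2 / sqrt V" .
  qed
  finally show ?thesis by simp
qed

lemma signed_sum_window_le:
  fixes s :: "'a \<Rightarrow> int" and p M :: real
  assumes W: "finite W" "\<And>y. y \<in> W \<Longrightarrow> s y = 1 \<or> s y = -1" and p: "0 \<le> p" "p \<le> 1"
    and M: "0 < M" "M / 4 \<le> real (card W) * (p * (1 - p))"
  shows "rexp (\<lambda>_. p) W (\<lambda>S. of_bool (\<bar>c + (\<Sum>y\<in>S. s y)\<bar> \<le> 1)) \<le> 12 / sqrt M"
proof -
  have "rexp (\<lambda>_. p) W (\<lambda>S. of_bool (\<bar>c + (\<Sum>y\<in>S. s y)\<bar> \<le> 1)) =
    rexp (\<lambda>_. p) W (\<lambda>S. of_bool (- 1 - c \<le> (\<Sum>y\<in>S. s y) \<and> (\<Sum>y\<in>S. s y) \<le> 1 - c))"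
    by (intro rexp_cong refl arg_cong[where f = of_bool]) auto
  also have "\<dots> \<le> (real_of_int (1 - c) - real_of_int (- 1 - c) + 1) * (2 / sqrt (real (card W) * (p * (1 - p))))"
    using M by (intro signed_sum_range_le[of W s p] W p) auto
  also have "\<dots> = 6 / sqrt (real (card W) * (p * (1 - p)))" by simp
  also have "\<dots> \<le> 6 / (sqrt M / 2)"
  proof (intro divide_left_mono)
    have "sqrt M / 2 = sqrt (M / 4)" by (simp add: real_sqrt_divide)
    also have "\<dots> \<le> sqrt (real (card W) * (p * (1 - p)))" using M(2) by simp
    finally show a: "sqrt M / 2 \<le> sqrt (real (card W) * (p * (1 - p)))" .
    show "0 < sqrt (real (card W) * (p * (1 - p))) * (sqrt M / 2)"
      using M by (intro mult_pos_pos) auto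
  qed auto
  finally show ?thesis by simp
qed

lemma neighbours_union_disjoint:
  assumes "\<And>y. {y, x} \<notin> A"
  shows "neighbours (B \<union> A) x = neighbours B x"
  using assms by (auto simp: neighbours_def)

text \<open>Each of the three events below has probability of order \<open>1 / sqrt M\<close>. Using only two of them would
  bound the variance of the second-day bias by its squared mean up to a constant, which is not enough.\<close>

lemma near_tie_pair_given:
  fixes m L C p K M :: real
  assumes reg: "regime m L C V s p" and m: "regime_min L C \<le> m" and LC: "1 \<le> L" "1 \<le> C"
    and M: "M = real (card V) * p" "100 \<le> M" "(4 * half_const L C * (3 + 16 * K))\<^sup>2 \<le> M" and K: "0 < K"
    and sets: "W \<subseteq> V" "U1 \<subseteq> V" "U2 \<subseteq> V" "U1 \<inter> U2 = {}" "U1 \<inter> W = {}" "U2 \<inter> W = {}"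
      "u \<in> V" "u \<notin> U1" "u \<notin> U2" "u \<notin> W" "v1 \<notin> insert u (U1 \<union> U2 \<union> W)" "v2 \<notin> insert u (U1 \<union> U2 \<union> W)" 
      "v1 \<in> V" "v2 \<in> V"
    and W: "real (card (V - W)) \<le> 7 * M"
    and cU: "M / 8 \<le> real (card U1)" "M / 8 \<le> real (card U2)"
    and B: "B \<subseteq> all_pairs V" "\<And>x y. x \<in> insert u (U1 \<union> U2) \<Longrightarrow> y \<in> W \<Longrightarrow> {x, y} \<notin> B"
    and N1: "U1 \<subseteq> neighbours B v1" "neighbours B v1 \<inter> (U2 \<union> W) = {}"
    and N2: "U2 \<subseteq> neighbours B v2" "neighbours B v2 \<inter> (U1 \<union> W) = {}"
    and deg: "real (\<Sum>x\<in>U1 \<union> U2. card (neighbours B x)) \<le> K * M"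
  shows "rexp (\<lambda>_. p) (\<Union>x\<in>insert u (U1 \<union> U2). cross x W) (\<lambda>A. of_bool (\<bar>nsum (B \<union> A) s u\<bar> \<le> 1 \<and>
      \<bar>nsum (B \<union> A) (majority_step (B \<union> A) s) v1\<bar> \<le> 4 \<and> \<bar>nsum (B \<union> A) (majority_step (B \<union> A) s) v2\<bar> \<le> 4))
    \<le> 120000 / (M * sqrt M)"
proof -
  define H where "H = half_const L C"
  have H: "H \<ge> 6" using LC by (simp add: H_def half_const_def)
  have p: "0 < p" "p \<le> 1" and fV: "finite V" and sV: "\<And>x. x \<in> V \<Longrightarrow> s x = 1 \<or> s x = -1"
    using reg unfolding regime_def by auto
  have fin: "finite U1" "finite U2" "finite W" using sets fV finite_subset by auto
  have VW: "real (card (V - W)) \<le> 7 * (real (card V) * p)" using W M by simp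
  note f = regime_fresh[OF reg m LC sets(1) VW]
  have finN: "finite (neighbours B x)" for x using finite_neighbours[OF fV B(1)] .
  let ?X = "U1 \<union> U2"
  have uX: "u \<notin> ?X" using sets by auto
  have un: "(\<Union>x\<in>insert u ?X. cross x W) = cross u W \<union> (\<Union>x\<in>?X. cross x W)" by auto
  have dis: "cross u W \<inter> (\<Union>x\<in>?X. cross x W) = {}"
    using sets by (auto simp: cross_def doubleton_eq_iff)
  \<comment> \<open>By Markov at most \<open>M / 16\<close> vertices have more than
    \<open>16 * K\<close> exposed neighbours. The others, at least \<open>M / 16\<close> of them,
    have a first-day probability within 1/4 of 1/2 and hence variance at least 3/16.\<close>
  have q14: "M / 100 \<le> (\<Sum>x\<in>U. sgn_tail p W s (\<tau> x) * (1 - sgn_tail p W s (\<tau> x)))"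
    if U: "U \<subseteq> ?X" "M / 8 \<le> real (card U)" and \<tau>: "\<And>x. x \<in> U \<Longrightarrow> \<bar>\<tau> x\<bar> \<le> 1 + int (card (neighbours B x))" for U \<tau>
  proof -
    define J where "J = {x\<in>U. real (card (neighbours B x)) \<le> 16 * K}"
    have fU: "finite U" "finite J" "J \<subseteq> U" using U fin by (auto simp: J_def intro: finite_subset)
    have cJ: "M / 16 \<le> real (card J)"
    proof -
      have "16 * K * real (card (U - J)) = (\<Sum>x\<in>U - J. 16 * K)" by simp
      also have "\<dots> \<le> (\<Sum>x\<in>U - J. real (card (neighbours B x)))" by (intro sum_mono) (auto simp: J_def)
      also have "\<dots> \<le> (\<Sum>x\<in>?X. real (card (neighbours B x)))" using fin U by (intro sum_mono2) auto
      also have "\<dots> \<le> K * M" using deg by simp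
      finally have "K * (16 * real (card (U - J))) \<le> K * M" by simp
      then have "16 * real (card (U - J)) \<le> M" using K by (simp only: mult_le_cancel_left_pos)
      moreover have "card U = card J + card (U - J)"
        using fU by (metis card_Diff_subset card_mono le_add_diff_inverse)
      then have "real (card U) = real (card J) + real (card (U - J))" by simp
      ultimately show ?thesis using U(2) by linarith
    qed
    let ?q = "\<lambda>x. sgn_tail p W s (\<tau> x)"
    have q01: "0 \<le> ?q x" "?q x \<le> 1" for x using sgn_tail_01[OF fin(3)] p by auto
    have qJ: "3 / 16 \<le> ?q x * (1 - ?q x)" if "x \<in> J" for x
    proof -
      have x: "x \<in> U" "real (card (neighbours B x)) \<le> 16 * K" using that by (auto simp: J_def)
      have "real_of_int \<bar>\<tau> x\<bar> \<le> real_of_int (1 + int (card (neighbours B x)))" using \<tau>[OF x(1)] by (simp only: of_int_le_iff)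
      then have t: "1 + \<bar>real_of_int (\<tau> x)\<bar> \<le> 3 + 16 * K" using x(2) by simp
      have "\<bar>?q x - 1 / 2\<bar> \<le> H * (1 + \<bar>real_of_int (\<tau> x)\<bar>) / sqrt M"
        using sgn_tail_regime[OF reg m LC sets(1) VW, of "\<tau> x"] unfolding H_def half_const_def M(1) .
      also have "\<dots> \<le> H * (3 + 16 * K) / sqrt M" using t H M(2) by (intro divide_right_mono mult_left_mono) auto
      also have "\<dots> \<le> 1 / 4"
      proof -
        have b4: "4 * (H * (3 + 16 * K)) \<le> sqrt M" using real_le_rsqrt[OF M(3)] by (simp only: mult.assoc H_def)
        have "x / z \<le> 1 / 4" if "4 * x \<le> z" "0 < z" for x z :: real using that by (simp add: field_simps)
        from this[OF b4] show ?thesis using M(2) by simp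
      qed
      finally have a: "\<bar>?q x - 1 / 2\<bar> \<le> 1 / 4" .
      have "(?q x - 1 / 2)\<^sup>2 \<le> (1 / 4)\<^sup>2" using a by (metis abs_le_square_iff abs_of_nonneg zero_le_divide_1_iff zero_le_numeral)
      then show ?thesis by (simp add: power2_eq_square algebra_simps)
    qed
    have "M / 100 \<le> 3 / 16 * real (card J)" using cJ M(2) by simp
    also have "\<dots> = (\<Sum>x\<in>J. 3 / 16)" by simp
    also have "\<dots> \<le> (\<Sum>x\<in>J. ?q x * (1 - ?q x))" by (intro sum_mono qJ)
    also have "\<dots> \<le> (\<Sum>x\<in>U. ?q x * (1 - ?q x))" using fU q01 by (intro sum_mono2) auto
    finally show ?thesis .
  qed
  \<comment> \<open>With the edges of \<open>u\<close> fixed, the sums at \<open>v1\<close> and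
    \<open>v2\<close> depend on the disjoint sets \<open>U1\<close> and \<open>U2\<close>, so two
    window probabilities of at most \<open>10 / sqrt (M / 100)\<close> multiply.\<close>
  have inner: "rexp (\<lambda>_. p) (\<Union>x\<in>?X. cross x W) (\<lambda>A. of_bool (
      \<bar>nsum (B \<union> Au \<union> A) (majority_step (B \<union> Au \<union> A) s) v1\<bar> \<le> 4 \<and> \<bar>nsum (B \<union> Au \<union> A) (majority_step (B \<union> Au \<union> A) s) v2\<bar> \<le> 4))
    \<le> 10000 / M" if Au: "Au \<subseteq> cross u W" for Au
  proof -
    define E where "E = B \<union> Au"
    define t where "t = majority_step E s"
    define r1 r2 where "r1 = (\<Sum>x\<in>neighbours B v1 - U1. t x)" and "r2 = (\<Sum>x\<in>neighbours B v2 - U2. t x)"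
    define G where "G = (\<lambda>S. of_bool (\<bar>2 * int (card (S \<inter> U1)) + (r1 - int (card U1))\<bar> \<le> 4) *
       (of_bool (\<bar>2 * int (card (S \<inter> U2)) + (r2 - int (card U2))\<bar> \<le> 4) :: real))"
    define \<tau> where "\<tau> = (\<lambda>x. thr (s x) - (\<Sum>u\<in>neighbours E x. s u))"
    have Ecard: "neighbours E x = neighbours B x" if "x \<in> ?X" for x
      unfolding E_def using Au that sets by (intro neighbours_union_disjoint) (auto simp: in_cross_iff dest!: subsetD)
    have EX: "{x, y} \<notin> E" if "x \<in> ?X" "y \<in> W" for x y
      using B(2)[of x y] that Au sets by (auto simp: E_def in_cross_iff dest!: subsetD)
    \<comment> \<open>A neighbour of \<open>v\<close> outside \<open>U\<close> lies in neither
      \<open>U1\<close>, \<open>U2\<close> nor \<open>W\<close>. No edge exposed last touches it, so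
      its first-day opinion is a constant that merely shifts the window.\<close>
    have split_sum: "nsum (E \<union> A) (majority_step (E \<union> A) s) v =
        2 * int (card ({x\<in>?X. majority_step (E \<union> A) s x = 1} \<inter> U)) - int (card U) + (\<Sum>x\<in>neighbours B v - U. t x)"
      if A: "A \<subseteq> (\<Union>x\<in>?X. cross x W)" and v: "v \<notin> insert u (U1 \<union> U2 \<union> W)" and U: "U \<subseteq> ?X" "U \<subseteq> neighbours B v"
        "neighbours B v \<inter> (?X - U \<union> W) = {}" for A v U
    proof -
      have "{y, v} \<notin> Au \<union> A" for y using v Au A by (auto simp: in_cross_iff dest!: subsetD)
      then have Nv: "neighbours (E \<union> A) v = neighbours B v"
        unfolding E_def Un_assoc by (intro neighbours_union_disjoint) auto
      have fU: "finite U" by (rule finite_subset[OF U(1)]) (use fin in auto)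
      have "nsum (E \<union> A) (majority_step (E \<union> A) s) v = (\<Sum>x\<in>neighbours B v - U. majority_step (E \<union> A) s x) + (\<Sum>x\<in>U. majority_step (E \<union> A) s x)"
        unfolding nsum_def Nv using sum.subset_diff[OF U(2) finN] .
      also have "(\<Sum>x\<in>neighbours B v - U. majority_step (E \<union> A) s x) = (\<Sum>x\<in>neighbours B v - U. t x)"
      proof (intro sum.cong refl)
        fix x assume "x \<in> neighbours B v - U"
        then have "x \<notin> ?X" "x \<notin> W" using U(3) by auto
        then have "{y, x} \<notin> A" for y using A by (auto simp: in_cross_iff dest!: subsetD)
        then have "neighbours (E \<union> A) x = neighbours E x" by (rule neighbours_union_disjoint)
        then show "majority_step (E \<union> A) s x = t x" by (simp add: t_def majority_step_def)
      qed
      also have "(\<Sum>x\<in>U. majority_step (E \<union> A) s x) = 2 * int (card ({x\<in>?X. majority_step (E \<union> A) s x = 1} \<inter> U)) - int (card U)"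
      proof -
        have sg: "majority_step (E \<union> A) s x = 1 \<or> majority_step (E \<union> A) s x = -1" if "x \<in> U" for x
        proof -
          have "x \<in> V" using that U(1) sets by auto
          then show ?thesis by (intro majority_step_iff(2) sV)
        qed
        have "{x\<in>?X. majority_step (E \<union> A) s x = 1} \<inter> U = {x\<in>U. majority_step (E \<union> A) s x = 1}" using U(1) by auto
        then show ?thesis using sum_signs[of U "majority_step (E \<union> A) s", OF fU sg] by simp
      qed
      finally show ?thesis by simp
    qed
    have d1: "neighbours B v1 \<inter> (?X - U1 \<union> W) = {}" using N1(2) by auto
    have d2: "neighbours B v2 \<inter> (?X - U2 \<union> W) = {}" using N2(2) by auto
    have "rexp (\<lambda>_. p) (\<Union>x\<in>?X. cross x W) (\<lambda>A. of_bool (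
      \<bar>nsum (E \<union> A) (majority_step (E \<union> A) s) v1\<bar> \<le> 4 \<and> \<bar>nsum (E \<union> A) (majority_step (E \<union> A) s) v2\<bar> \<le> 4)) =
      rexp (\<lambda>_. p) (\<Union>x\<in>?X. cross x W) (\<lambda>A. G {x\<in>?X. majority_step (E \<union> A) s x = 1})"
    proof (intro rexp_cong refl)
      fix A assume A: "A \<subseteq> (\<Union>x\<in>?X. cross x W)"
      have "nsum (E \<union> A) (majority_step (E \<union> A) s) v1 = 2 * int (card ({x\<in>?X. majority_step (E \<union> A) s x = 1} \<inter> U1)) + (r1 - int (card U1))"
        unfolding r1_def using split_sum[OF A sets(11) _ N1(1) d1] by simp
      moreover have "nsum (E \<union> A) (majority_step (E \<union> A) s) v2 = 2 * int (card ({x\<in>?X. majority_step (E \<union> A) s x = 1} \<inter> U2)) + (r2 - int (card U2))"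
        unfolding r2_def using split_sum[OF A sets(12) _ N2(1) d2] by simp
      ultimately show "of_bool (\<bar>nsum (E \<union> A) (majority_step (E \<union> A) s) v1\<bar> \<le> 4 \<and> \<bar>nsum (E \<union> A) (majority_step (E \<union> A) s) v2\<bar> \<le> 4)
        = G {x\<in>?X. majority_step (E \<union> A) s x = 1}"
        unfolding G_def by (simp only: of_bool_conj)
    qed
    also have "\<dots> = rexp (\<lambda>x. sgn_tail p W s (\<tau> x)) ?X G"
      unfolding \<tau>_def
    proof (rule rexp_cross_step)
      show "finite (neighbours E x)" if "x \<in> ?X" for x using Ecard[OF that] finN by simp
      show "s x = 1 \<or> s x = -1" if "x \<in> ?X" for x
        by (rule sV) (use that sets in auto)
    qed (use fin sets EX in auto)
    also have "\<dots> = rexp (\<lambda>x. sgn_tail p W s (\<tau> x)) U1 (\<lambda>S. of_bool (\<bar>2 * int (card S) + (r1 - int (card U1))\<bar> \<le> 4)) *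
       rexp (\<lambda>x. sgn_tail p W s (\<tau> x)) U2 (\<lambda>S. of_bool (\<bar>2 * int (card S) + (r2 - int (card U2))\<bar> \<le> 4))"
    proof -
      have "rexp (\<lambda>x. sgn_tail p W s (\<tau> x)) ?X G = rexp (\<lambda>x. sgn_tail p W s (\<tau> x)) U1 (\<lambda>S1. rexp (\<lambda>x. sgn_tail p W s (\<tau> x)) U2 (\<lambda>S2. G (S1 \<union> S2)))"
        using fin sets(4) by (intro rexp_union) auto
      also have "\<dots> = rexp (\<lambda>x. sgn_tail p W s (\<tau> x)) U1 (\<lambda>S1. rexp (\<lambda>x. sgn_tail p W s (\<tau> x)) U2 (\<lambda>S2.
        of_bool (\<bar>2 * int (card S1) + (r1 - int (card U1))\<bar> \<le> 4) * of_bool (\<bar>2 * int (card S2) + (r2 - int (card U2))\<bar> \<le> 4)))"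
      proof (intro rexp_cong refl)
        fix S1 S2 assume "S1 \<subseteq> U1" "S2 \<subseteq> U2"
        then have "(S1 \<union> S2) \<inter> U1 = S1" "(S1 \<union> S2) \<inter> U2 = S2" using sets(4) by auto
        then show "G (S1 \<union> S2) = of_bool (\<bar>2 * int (card S1) + (r1 - int (card U1))\<bar> \<le> 4) * of_bool (\<bar>2 * int (card S2) + (r2 - int (card U2))\<bar> \<le> 4)"
          by (simp only: G_def)
      qed
      also have "\<dots> = rexp (\<lambda>x. sgn_tail p W s (\<tau> x)) U1 (\<lambda>S1. rexp (\<lambda>x. sgn_tail p W s (\<tau> x)) U2
          (\<lambda>S2. of_bool (\<bar>2 * int (card S2) + (r2 - int (card U2))\<bar> \<le> 4)) * of_bool (\<bar>2 * int (card S1) + (r1 - int (card U1))\<bar> \<le> 4))"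
        by (rule rexp_cong[OF refl refl]) (simp only: rexp_cmult mult.commute)
      finally show ?thesis by (simp only: rexp_cmult) (simp only: mult.commute)
    qed
    also have "\<dots> \<le> (10 / sqrt (M / 100)) * (10 / sqrt (M / 100))"
    proof (intro mult_mono card_window_le)
      have \<tau>: "\<bar>\<tau> x\<bar> \<le> 1 + int (card (neighbours B x))" if "x \<in> ?X" for x
      proof -
        have "\<bar>\<Sum>u\<in>neighbours B x. s u\<bar> \<le> (\<Sum>u\<in>neighbours B x. 1)"
          using neighbours_subset[OF B(1), of x] sV by (intro order_trans[OF sum_abs] sum_mono) force
        then have "\<bar>\<Sum>u\<in>neighbours B x. s u\<bar> \<le> int (card (neighbours B x))" by simp
        moreover have "\<bar>thr (s x)\<bar> \<le> 1" by (simp add: thr_def)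
        ultimately show ?thesis unfolding \<tau>_def Ecard[OF that] by linarith
      qed
      show "M / 100 \<le> (\<Sum>i\<in>U1. sgn_tail p W s (\<tau> i) * (1 - sgn_tail p W s (\<tau> i)))"
        using \<tau> by (intro q14 cU) auto
      show "M / 100 \<le> (\<Sum>i\<in>U2. sgn_tail p W s (\<tau> i) * (1 - sgn_tail p W s (\<tau> i)))"
        using \<tau> by (intro q14 cU) auto
    qed (use fin M(2) sgn_tail_01[OF fin(3), of p] p in \<open>auto intro!: rexp_nonneg\<close>)
    also have "\<dots> = 10000 / M" using M(2) by (simp add: real_sqrt_divide)
    finally show ?thesis by (simp add: E_def)
  qed
  have "rexp (\<lambda>_. p) (\<Union>x\<in>insert u ?X. cross x W) (\<lambda>A. of_bool (\<bar>nsum (B \<union> A) s u\<bar> \<le> 1 \<and>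
      \<bar>nsum (B \<union> A) (majority_step (B \<union> A) s) v1\<bar> \<le> 4 \<and> \<bar>nsum (B \<union> A) (majority_step (B \<union> A) s) v2\<bar> \<le> 4))
    = rexp (\<lambda>_. p) (cross u W) (\<lambda>Au. rexp (\<lambda>_. p) (\<Union>x\<in>?X. cross x W) (\<lambda>A. of_bool (\<bar>nsum (B \<union> (Au \<union> A)) s u\<bar> \<le> 1 \<and>
      \<bar>nsum (B \<union> (Au \<union> A)) (majority_step (B \<union> (Au \<union> A)) s) v1\<bar> \<le> 4 \<and> \<bar>nsum (B \<union> (Au \<union> A)) (majority_step (B \<union> (Au \<union> A)) s) v2\<bar> \<le> 4)))"
    unfolding un using fin dis by (intro rexp_union) auto
  also have "\<dots> \<le> rexp (\<lambda>_. p) (cross u W) (\<lambda>Au. (10000 / M) * of_bool (\<bar>nsum B s u + (\<Sum>y\<in>{y\<in>W. {u, y} \<in> Au}. s y)\<bar> \<le> 1))"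
  proof (rule rexp_mono)
    fix Au assume Au: "Au \<subseteq> cross u W"
    \<comment> \<open>The sum at \<open>u\<close> is determined by the edges at \<open>u\<close>,
      which makes the first near tie independent of the other two.\<close>
    have Z: "nsum (B \<union> (Au \<union> A)) s u = nsum B s u + (\<Sum>y\<in>{y\<in>W. {u, y} \<in> Au}. s y)" if A: "A \<subseteq> (\<Union>x\<in>?X. cross x W)" for A
    proof -
      have "neighbours (B \<union> Au \<union> A) u = neighbours (B \<union> Au) u"
        using A sets by (intro neighbours_union_disjoint) (auto simp: in_cross_iff dest!: subsetD)
      also have "\<dots> = neighbours B u \<union> {y\<in>W. {u, y} \<in> Au}"
        using Au sets by (intro neighbours_cross_union[of "{u}"]) auto
      finally have N: "neighbours (B \<union> (Au \<union> A)) u = neighbours B u \<union> {y\<in>W. {u, y} \<in> Au}" by (simp add: Un_assoc)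
      have "neighbours B u \<inter> {y\<in>W. {u, y} \<in> Au} = {}"
        using B(2)[of u] by (auto simp: neighbours_def insert_commute)
      then show ?thesis unfolding nsum_def N using finN fin by (intro sum.union_disjoint) auto
    qed
    define P where "P = (\<bar>nsum B s u + (\<Sum>y\<in>{y\<in>W. {u, y} \<in> Au}. s y)\<bar> \<le> 1)"
    have "rexp (\<lambda>_. p) (\<Union>x\<in>?X. cross x W) (\<lambda>A. of_bool (\<bar>nsum (B \<union> (Au \<union> A)) s u\<bar> \<le> 1 \<and>
      \<bar>nsum (B \<union> (Au \<union> A)) (majority_step (B \<union> (Au \<union> A)) s) v1\<bar> \<le> 4 \<and> \<bar>nsum (B \<union> (Au \<union> A)) (majority_step (B \<union> (Au \<union> A)) s) v2\<bar> \<le> 4))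
      = rexp (\<lambda>_. p) (\<Union>x\<in>?X. cross x W) (\<lambda>A. of_bool P * of_bool (
      \<bar>nsum (B \<union> Au \<union> A) (majority_step (B \<union> Au \<union> A) s) v1\<bar> \<le> 4 \<and> \<bar>nsum (B \<union> Au \<union> A) (majority_step (B \<union> Au \<union> A) s) v2\<bar> \<le> 4))"
      by (intro rexp_cong refl) (simp only: Z P_def of_bool_conj Un_assoc)
    also have "\<dots> = of_bool P * rexp (\<lambda>_. p) (\<Union>x\<in>?X. cross x W) (\<lambda>A. of_bool (
      \<bar>nsum (B \<union> Au \<union> A) (majority_step (B \<union> Au \<union> A) s) v1\<bar> \<le> 4 \<and> \<bar>nsum (B \<union> Au \<union> A) (majority_step (B \<union> Au \<union> A) s) v2\<bar> \<le> 4))"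
      by (rule rexp_cmult)
    also have "\<dots> \<le> of_bool P * (10000 / M)" by (intro mult_left_mono inner[OF Au]) auto
    finally show "rexp (\<lambda>_. p) (\<Union>x\<in>?X. cross x W) (\<lambda>A. of_bool (\<bar>nsum (B \<union> (Au \<union> A)) s u\<bar> \<le> 1 \<and>
      \<bar>nsum (B \<union> (Au \<union> A)) (majority_step (B \<union> (Au \<union> A)) s) v1\<bar> \<le> 4 \<and> \<bar>nsum (B \<union> (Au \<union> A)) (majority_step (B \<union> (Au \<union> A)) s) v2\<bar> \<le> 4))
      \<le> (10000 / M) * of_bool (\<bar>nsum B s u + (\<Sum>y\<in>{y\<in>W. {u, y} \<in> Au}. s y)\<bar> \<le> 1)"
      unfolding P_def by (simp only: mult.commute)
  qed (use p in auto)
  also have "\<dots> = (10000 / M) * rexp (\<lambda>_. p) (cross u W) (\<lambda>Au. of_bool (\<bar>nsum B s u + (\<Sum>y\<in>{y\<in>W. {u, y} \<in> Au}. s y)\<bar> \<le> 1))"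
    by (rule rexp_cmult)
  also have "rexp (\<lambda>_. p) (cross u W) (\<lambda>Au. of_bool (\<bar>nsum B s u + (\<Sum>y\<in>{y\<in>W. {u, y} \<in> Au}. s y)\<bar> \<le> 1)) =
    rexp (\<lambda>_. p) W (\<lambda>S. of_bool (\<bar>nsum B s u + (\<Sum>y\<in>{y\<in>W. {u, y} \<in> (\<lambda>y. {u, y}) ` S}. s y)\<bar> \<le> 1))"
    unfolding cross_def by (rule rexp_image[OF fin(3) inj_on_cross])
  also have "\<dots> = rexp (\<lambda>_. p) W (\<lambda>S. of_bool (\<bar>nsum B s u + (\<Sum>y\<in>S. s y)\<bar> \<le> 1))"
  proof (rule rexp_cong[OF refl refl])
    fix S assume "S \<subseteq> W"
    then have "{y\<in>W. {u, y} \<in> (\<lambda>y. {u, y}) ` S} = S"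
      using sets by (auto simp: doubleton_eq_iff)
    then show "of_bool (\<bar>nsum B s u + (\<Sum>y\<in>{y\<in>W. {u, y} \<in> (\<lambda>y. {u, y}) ` S}. s y)\<bar> \<le> 1) = (of_bool (\<bar>nsum B s u + (\<Sum>y\<in>S. s y)\<bar> \<le> 1) :: real)"
      by simp
  qed
  also have "(10000 / M) * rexp (\<lambda>_. p) W (\<lambda>S. of_bool (\<bar>nsum B s u + (\<Sum>y\<in>S. s y)\<bar> \<le> 1)) \<le> (10000 / M) * (12 / sqrt M)"
  proof (intro mult_left_mono signed_sum_window_le)
    have "M / 4 = (real (card V) / 2) * (p * (1 / 2))" by (simp add: M)
    also have "\<dots> \<le> real (card W) * (p * (1 - p))"
      using f(3,4) p by (intro mult_mono) auto
    finally show "M / 4 \<le> real (card W) * (p * (1 - p))" .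
  qed (use fin sV sets p M(2) in auto)
  finally show ?thesis by simp
qed

text \<open>The bounds are those for a single edge change: a new edge at \<open>u\<close> alters its
  sum by 1, and the two endpoints of the edge may each change their first-day opinion by 2, which
  alters the sum at \<open>v\<close> by at most 4.\<close>

definition near_tie :: "'v set set \<Rightarrow> ('v \<Rightarrow> int) \<Rightarrow> 'v \<Rightarrow> 'v \<Rightarrow> bool" where
  "near_tie A s u v \<longleftrightarrow> \<bar>nsum A s u\<bar> \<le> 1 \<and> \<bar>nsum A (majority_step A s) v\<bar> \<le> 4"

lemma neighbours_insert:
  assumes "u \<noteq> w"
  shows "neighbours (insert {u, w} A) u = insert w (neighbours A u)"
    "neighbours (insert {u, w} A) w = insert u (neighbours A w)"
    "x \<noteq> u \<Longrightarrow> x \<noteq> w \<Longrightarrow> neighbours (insert {u, w} A) x = neighbours A x"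
  using assms by (auto simp: neighbours_def doubleton_eq_iff)

lemma majority_step_insert_edge:
  assumes "finite (neighbours A u)" "u \<noteq> w" "{u, w} \<notin> A" "s u = 1 \<or> s u = -1" "s w = 1 \<or> s w = -1"
    and "majority_step (insert {u, w} A) s u \<noteq> majority_step A s u"
  shows "\<bar>nsum A s u\<bar> \<le> 1"
proof -
  have "w \<notin> neighbours A u" using assms(3) by (auto simp: neighbours_def insert_commute)
  then have "nsum (insert {u, w} A) s u = s w + nsum A s u"
    using assms(1,2) by (simp add: nsum_def neighbours_insert)
  then show ?thesis
    using assms(5,6) unfolding majority_step_eq[of s u, OF assms(4)] nsum_def[symmetric]
    by (auto simp: thr_def split: if_splits)
qed

text \<open>Only the endpoints of the new edge can change their opinion on day one, and only when
  almost tied. Another vertex notices this on day two only if it is adjacent to a changed endpoint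
  and its own sum on day one is within 4 of zero.\<close>

lemma maj2_insert_edge_vertex:
  assumes A: "A \<subseteq> all_pairs V" "{u, w} \<notin> A" and V: "finite V" "u \<in> V" "w \<in> V" "u \<noteq> w"
    and s: "\<And>x. x \<in> V \<Longrightarrow> s x = 1 \<or> s x = -1" and v: "v \<in> V" "v \<noteq> u" "v \<noteq> w"
  shows "\<bar>maj2 (insert {u, w} A) s v - maj2 A s v\<bar> \<le>
    2 * (of_bool ({u, v} \<in> A \<and> near_tie A s u v) + of_bool ({w, v} \<in> A \<and> near_tie A s w v))"
proof (cases "maj2 (insert {u, w} A) s v = maj2 A s v")
  case False
  let ?A = "insert {u, w} A"
  define t t' where "t = majority_step A s" and "t' = majority_step ?A s"
  have finN: "finite (neighbours A x)" for x using finite_neighbours[OF V(1) A(1)] .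
  have NV: "neighbours A x \<subseteq> V" for x using neighbours_subset[OF A(1)] .
  have N: "neighbours ?A x = neighbours A x" if "x \<noteq> u" "x \<noteq> w" for x
    using neighbours_insert(3)[OF V(4)] that by blast
  have tx: "t' x = t x" if "x \<noteq> u" "x \<noteq> w" for x
    unfolding t_def t'_def majority_step_def N[OF that] ..
  have t1: "t x = 1 \<or> t x = -1" "t' x = 1 \<or> t' x = -1" if "x \<in> V" for x
    unfolding t_def t'_def using s[OF that] by (auto intro!: majority_step_iff(2))
  have u1: "\<bar>nsum A s u\<bar> \<le> 1" if "t' u \<noteq> t u"
    using majority_step_insert_edge[OF finN V(4) A(2) s[OF V(2)] s[OF V(3)]] that unfolding t_def t'_def by blast
  have w1: "\<bar>nsum A s w\<bar> \<le> 1" if "t' w \<noteq> t w"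
  proof (rule majority_step_insert_edge[OF finN V(4)[symmetric] _ s[OF V(3)] s[OF V(2)]])
    show "{w, u} \<notin> A" using A(2) by (simp add: insert_commute)
    show "majority_step (insert {w, u} A) s w \<noteq> majority_step A s w"
      using that unfolding t_def t'_def by (simp add: insert_commute)
  qed
  have diff: "\<bar>(\<Sum>x\<in>neighbours A v. t' x) - (\<Sum>x\<in>neighbours A v. t x)\<bar> \<le>
     2 * of_bool ({u, v} \<in> A \<and> t' u \<noteq> t u) + 2 * of_bool ({w, v} \<in> A \<and> t' w \<noteq> t w)"
  proof -
    have "(\<Sum>x\<in>neighbours A v. t' x) - (\<Sum>x\<in>neighbours A v. t x) = (\<Sum>x\<in>neighbours A v. t' x - t x)"
      by (simp add: sum_subtractf)
    also have "\<dots> = (\<Sum>x\<in>neighbours A v \<inter> {u, w}. t' x - t x)"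
      using finN tx by (intro sum.mono_neutral_right) auto
    also have "\<bar>\<dots>\<bar> \<le> (\<Sum>x\<in>neighbours A v \<inter> {u, w}. \<bar>t' x - t x\<bar>)" by (rule sum_abs)
    also have "\<dots> \<le> (\<Sum>x\<in>neighbours A v \<inter> {u, w}. 2 * of_bool (t' x \<noteq> t x))"
    proof (rule sum_mono)
      fix x assume "x \<in> neighbours A v \<inter> {u, w}"
      then have "x \<in> V" using NV by auto
      then show "\<bar>t' x - t x\<bar> \<le> 2 * of_bool (t' x \<noteq> t x)" using t1[of x] by auto
    qed
    also have "\<dots> = (\<Sum>x\<in>{u, w}. if x \<in> neighbours A v then 2 * of_bool (t' x \<noteq> t x) else 0)"
      by (subst sum.inter_restrict[symmetric]) (auto simp: Int_commute)
    also have "\<dots> = 2 * of_bool ({u, v} \<in> A \<and> t' u \<noteq> t u) + 2 * of_bool ({w, v} \<in> A \<and> t' w \<noteq> t w)"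
      using V(4) v by (simp add: neighbours_def)
    finally show ?thesis .
  qed
  have m: "maj2 ?A s v = (if thr (t v) \<le> (\<Sum>x\<in>neighbours A v. t' x) then 1 else -1)"
     "maj2 A s v = (if thr (t v) \<le> nsum A t v then 1 else -1)"
    unfolding maj2_def t_def[symmetric] t'_def[symmetric] nsum_def
    using majority_step_eq[of t v A, OF t1(1)[OF v(1)]] majority_step_eq[of t' v ?A, OF t1(2)[OF v(1)]] tx[OF v(2,3)] N[OF v(2,3)]
    by auto
  have th: "thr (t v) = 0 \<or> thr (t v) = 1" by (simp add: thr_def)
  have tie: "\<bar>nsum A t v\<bar> \<le> 4" "({u, v} \<in> A \<and> t' u \<noteq> t u) \<or> ({w, v} \<in> A \<and> t' w \<noteq> t w)"
    using False diff th unfolding m nsum_def[symmetric] by (auto split: if_splits simp: of_bool_def)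
  then have "({u, v} \<in> A \<and> near_tie A s u v) \<or> ({w, v} \<in> A \<and> near_tie A s w v)"
    using u1 w1 unfolding near_tie_def t_def by blast
  moreover have "\<bar>maj2 ?A s v - maj2 A s v\<bar> \<le> 2"
    using maj2_values[of s v A, OF s[OF v(1)]] maj2_values[of s v ?A, OF s[OF v(1)]] by auto
  ultimately show ?thesis by (auto simp: of_bool_def)
qed simp

definition ties :: "'v set \<Rightarrow> ('v \<Rightarrow> int) \<Rightarrow> 'v \<Rightarrow> 'v \<Rightarrow> 'v set set \<Rightarrow> real" where
  "ties V s u w A = (\<Sum>v\<in>V - {u, w}. of_bool ({u, v} \<in> A \<and> near_tie A s u v))"

text \<open>The endpoints themselves contribute at most 4 to the change of the bias, all other
  vertices at most twice the two counts \<open>ties\<close>. The three terms are then squared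
  separately at the price of a factor 3.\<close>

lemma maj2_sum_insert_edge:
  assumes A: "A \<subseteq> all_pairs V" "{u, w} \<notin> A" and V: "finite V" "u \<in> V" "w \<in> V" "u \<noteq> w"
    and s: "\<And>x. x \<in> V \<Longrightarrow> s x = 1 \<or> s x = -1"
  shows "(real_of_int (\<Sum>v\<in>V. maj2 (insert {u, w} A) s v) - real_of_int (\<Sum>v\<in>V. maj2 A s v))\<^sup>2
    \<le> 48 + 12 * (ties V s u w A)\<^sup>2 + 12 * (ties V s w u A)\<^sup>2"
proof -
  define d where "d = (\<lambda>v. maj2 (insert {u, w} A) s v - maj2 A s v)"
  define D where "D = real_of_int (\<Sum>v\<in>V. maj2 (insert {u, w} A) s v) - real_of_int (\<Sum>v\<in>V. maj2 A s v)"
  define a b where "a = ties V s u w A" and "b = ties V s w u A"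
  have d2: "\<bar>d v\<bar> \<le> 2" if "v \<in> V" for v
    using maj2_values[of s v A, OF s[OF that]] maj2_values[of s v "insert {u, w} A", OF s[OF that]] unfolding d_def by auto
  have "V = {u, w} \<union> (V - {u, w})" using V by auto
  have "D = real_of_int (\<Sum>v\<in>V. d v)" unfolding D_def d_def by (simp add: sum_subtractf)
  also have "(\<Sum>v\<in>V. d v) = (\<Sum>v\<in>V - {u, w}. d v) + (\<Sum>v\<in>{u, w}. d v)"
    using V by (intro sum.subset_diff) auto
  finally have "\<bar>D\<bar> \<le> real_of_int (\<bar>\<Sum>v\<in>V - {u, w}. d v\<bar> + \<bar>\<Sum>v\<in>{u, w}. d v\<bar>)" by simp
  also have "\<dots> \<le> real_of_int ((\<Sum>v\<in>V - {u, w}. 2 * (of_bool ({u, v} \<in> A \<and> near_tie A s u v) + of_bool ({w, v} \<in> A \<and> near_tie A s w v))) + 4)"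
    unfolding of_int_le_iff
  proof (intro add_mono)
    show "\<bar>\<Sum>v\<in>V - {u, w}. d v\<bar> \<le> (\<Sum>v\<in>V - {u, w}. 2 * (of_bool ({u, v} \<in> A \<and> near_tie A s u v) + of_bool ({w, v} \<in> A \<and> near_tie A s w v)))"
      unfolding d_def by (intro order_trans[OF sum_abs] sum_mono maj2_insert_edge_vertex[OF A V s]) auto
    show "\<bar>\<Sum>v\<in>{u, w}. d v\<bar> \<le> 4" using V d2[of u] d2[of w] by simp
  qed
  also have "\<dots> = 4 + 2 * a + 2 * b"
    unfolding a_def b_def ties_def by (simp add: sum.distrib sum_distrib_left insert_commute algebra_simps)
  finally have "\<bar>D\<bar> \<le> 4 + 2 * a + 2 * b" .
  moreover have "0 \<le> a" "0 \<le> b" by (auto simp: a_def b_def ties_def intro!: sum_nonneg)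
  ultimately have "D\<^sup>2 \<le> (4 + 2 * a + 2 * b)\<^sup>2" using power_mono[of "\<bar>D\<bar>" "4 + 2 * a + 2 * b" 2] by simp
  also have "\<dots> \<le> 48 + 12 * a\<^sup>2 + 12 * b\<^sup>2"
  proof -
    have "0 \<le> (4 - 2 * a)\<^sup>2 + (4 - 2 * b)\<^sup>2 + (2 * a - 2 * b)\<^sup>2" by simp
    then show ?thesis by (simp add: power2_eq_square algebra_simps)
  qed
  finally show ?thesis by (simp add: D_def a_def b_def)
qed

section \<open>Second moment of the number of near ties\<close>

lemma rexp_member:
  assumes "finite I" "a \<in> I"
  shows "rexp q I (\<lambda>A. of_bool (a \<in> A) * f A) = q a * rexp q (I - {a}) (\<lambda>A. f (insert a A))"
proof -
  have "rexp q (insert a (I - {a})) (\<lambda>A. of_bool (a \<in> A) * f A) =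
    (1 - q a) * rexp q (I - {a}) (\<lambda>A. of_bool (a \<in> A) * f A) + q a * rexp q (I - {a}) (\<lambda>A. of_bool (a \<in> insert a A) * f (insert a A))"
    using assms by (intro rexp_insert) auto
  also have "rexp q (I - {a}) (\<lambda>A. of_bool (a \<in> A) * f A) = rexp q (I - {a}) (\<lambda>A. 0)"
    by (intro rexp_cong) auto
  finally show ?thesis using assms by (simp add: insert_absorb rexp_const)
qed

text \<open>The diagonal case of the second moment. All edges from \<open>u\<close> to the vertices
  other than \<open>w\<close> and \<open>v\<close> are still fresh, so the sum at \<open>u\<close>
  hits three prescribed values with probability of order \<open>1 / sqrt M\<close>.\<close>

lemma tie_given_edge:
  fixes m L C p M :: real
  assumes reg: "regime m L C V s p" and m: "regime_min L C \<le> m" and LC: "1 \<le> L" "1 \<le> C"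
    and M: "M = real (card V) * p" "100 \<le> M" 
    and d: "u \<in> V" "w \<in> V" "v \<in> V" "u \<noteq> w" "u \<noteq> v" "v \<noteq> w"
  shows "rexp (\<lambda>_. p) (all_pairs V - {{u, w}} - {{u, v}}) (\<lambda>A. of_bool (\<bar>nsum (insert {u, v} A) s u\<bar> \<le> 1)) \<le> 12 / sqrt M"
proof -
  define W where "W = V - {u, w, v}"
  let ?I = "all_pairs V - {{u, w}} - {{u, v}}"
  have p: "0 < p" "p \<le> 1" and fV: "finite V" and sV: "\<And>x. x \<in> V \<Longrightarrow> s x = 1 \<or> s x = -1"
    using reg unfolding regime_def by auto
  have fW: "finite W" "W \<subseteq> V" "u \<notin> W" "w \<notin> W" "v \<notin> W" using fV by (auto simp: W_def)
  have VWeq: "V - W = {u, w, v}" using d by (auto simp: W_def)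
  have VW: "real (card (V - W)) \<le> 7 * (real (card V) * p)"
    using d M unfolding VWeq by simp
  note f = regime_fresh[OF reg m LC fW(2) VW]
  have sub: "cross u W \<subseteq> ?I" using d fW by (auto simp: cross_def doubleton_eq_iff)
  have "rexp (\<lambda>_. p) ?I (\<lambda>A. of_bool (\<bar>nsum (insert {u, v} A) s u\<bar> \<le> 1)) =
     rexp (\<lambda>_. p) ?I (\<lambda>A. of_bool (\<bar>s v + (\<Sum>y\<in>{y\<in>W. {u, y} \<in> A \<inter> cross u W}. s y)\<bar> \<le> 1))"
  proof (rule rexp_cong[OF refl refl])
    fix A assume A: "A \<subseteq> ?I"
    have "neighbours A u = {y\<in>W. {u, y} \<in> A \<inter> cross u W}"
    proof (intro set_eqI)
      fix y
      show "y \<in> neighbours A u \<longleftrightarrow> y \<in> {y\<in>W. {u, y} \<in> A \<inter> cross u W}"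
        using subsetD[OF A, of "{y, u}"] fW(3) by (auto simp: neighbours_def W_def insert_commute in_cross_iff)
    qed
    moreover have "v \<notin> neighbours A u" using subsetD[OF A, of "{v, u}"] by (auto simp: neighbours_def insert_commute)
    ultimately have "nsum (insert {u, v} A) s u = s v + (\<Sum>y\<in>{y\<in>W. {u, y} \<in> A \<inter> cross u W}. s y)"
      unfolding nsum_def neighbours_insert(1)[OF d(5)] using fW(1) by simp
    then show "of_bool (\<bar>nsum (insert {u, v} A) s u\<bar> \<le> 1) = (of_bool (\<bar>s v + (\<Sum>y\<in>{y\<in>W. {u, y} \<in> A \<inter> cross u W}. s y)\<bar> \<le> 1) :: real)"
      by simp
  qed
  also have "\<dots> = rexp (\<lambda>_. p) (cross u W) (\<lambda>A. of_bool (\<bar>s v + (\<Sum>y\<in>{y\<in>W. {u, y} \<in> A}. s y)\<bar> \<le> 1))"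
    using fV sub by (intro rexp_restrict[where f = "\<lambda>A. of_bool (\<bar>s v + (\<Sum>y\<in>{y\<in>W. {u, y} \<in> A}. s y)\<bar> \<le> 1)"]) auto
  also have "\<dots> = rexp (\<lambda>_. p) W (\<lambda>S. of_bool (\<bar>s v + (\<Sum>y\<in>{y\<in>W. {u, y} \<in> (\<lambda>y. {u, y}) ` S}. s y)\<bar> \<le> 1))"
    unfolding cross_def by (rule rexp_image[OF fW(1) inj_on_cross])
  also have "\<dots> = rexp (\<lambda>_. p) W (\<lambda>S. of_bool (\<bar>s v + (\<Sum>y\<in>S. s y)\<bar> \<le> 1))"
  proof (rule rexp_cong[OF refl refl])
    fix S assume "S \<subseteq> W"
    then have "{y\<in>W. {u, y} \<in> (\<lambda>y. {u, y}) ` S} = S"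
      using fW by (auto simp: doubleton_eq_iff)
    then show "of_bool (\<bar>s v + (\<Sum>y\<in>{y\<in>W. {u, y} \<in> (\<lambda>y. {u, y}) ` S}. s y)\<bar> \<le> 1) = (of_bool (\<bar>s v + (\<Sum>y\<in>S. s y)\<bar> \<le> 1) :: real)"
      by simp
  qed
  also have "\<dots> \<le> 12 / sqrt M"
  proof (intro signed_sum_window_le)
    have "M / 4 = (real (card V) / 2) * (p * (1 / 2))" by (simp add: M)
    also have "\<dots> \<le> real (card W) * (p * (1 - p))"
      using f(3,4) p by (intro mult_mono) auto
    finally show "M / 4 \<le> real (card W) * (p * (1 - p))" .
  qed (use fW sV p M(2) in auto)
  finally show ?thesis .
qed

text \<open>Lets the Chernoff errors disappear in a bound of order
  \<open>1 / (M * sqrt M)\<close>.\<close>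

lemma exp_quarter_le:
  fixes M :: real assumes "1 \<le> M"
  shows "exp (- (M / 4)) \<le> 32 / (M * sqrt M)"
proof -
  have "(M / 4)\<^sup>2 / 2 \<le> exp (M / 4)" using exp_lower_Taylor_quadratic[of "M / 4"] assms by simp
  then have "exp (- (M / 4)) \<le> 1 / ((M / 4)\<^sup>2 / 2)"
    using assms unfolding exp_minus inverse_eq_divide by (intro divide_left_mono) auto
  also have "\<dots> = 32 / (M * M)" by (simp add: power2_eq_square)
  also have "\<dots> \<le> 32 / (M * sqrt M)"
  proof (intro divide_left_mono mult_left_mono)
    show "sqrt M \<le> M" using assms by (intro real_le_lsqrt) (auto simp: power2_eq_square)
  qed (use assms in auto)
  finally show ?thesis .
qed

text \<open>This is \<open>6 + 2 * (84 * L + 1)\<close>: at most \<open>6 * M\<close> private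
  neighbours each have at most one edge to \<open>v1\<close> or \<open>v2\<close>, and their other
  exposed edges number at most \<open>(84 * L + 1) * M\<close>, counted twice.\<close>

definition nbhd_const :: "real \<Rightarrow> real" where
  "nbhd_const L = 168 * L + 8"

definition triple_min :: "real \<Rightarrow> real \<Rightarrow> real" where
  "triple_min L C = regime_min L C + 100 + (4 * half_const L C * (3 + 16 * nbhd_const L))\<^sup>2"

text \<open>The edges from \<open>u\<close> and from the private neighbours \<open>M1 - M2\<close> and \<open>M2 - M1\<close> of \<open>v1\<close> and \<open>v2\<close> to the
  untouched vertices are exposed last, so that the three sums are independent.\<close>

lemma triple_exposed:
  fixes m L C p M :: real
  assumes reg: "regime m L C V s p" and m: "triple_min L C \<le> m" and LC: "1 \<le> L" "1 \<le> C"
    and M: "M = real (card V) * p"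
    and d: "u \<in> V" "w \<in> V" "v1 \<in> V" "v2 \<in> V" "u \<noteq> w" "u \<noteq> v1" "u \<noteq> v2" "v1 \<noteq> w" "v2 \<noteq> w" "v1 \<noteq> v2"
    and Y: "Y = V - {u, w, v1, v2}" and M12: "M1 \<subseteq> Y" "M2 \<subseteq> Y"
    and Rest: "Rest = all_pairs V - {{u, w}} - {{u, v1}} - {{u, v2}} - cross v1 Y - cross v2 Y"
    and cM: "real (card M1) \<le> 3 * M" "real (card M2) \<le> 3 * M" "M / 8 \<le> real (card (M1 - M2))" "M / 8 \<le> real (card (M2 - M1))"
    and Q: "Q = (\<lambda>G. \<bar>nsum G s u\<bar> \<le> 1 \<and> \<bar>nsum G (majority_step G s) v1\<bar> \<le> 4 \<and> \<bar>nsum G (majority_step G s) v2\<bar> \<le> 4)"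
  shows "rexp (\<lambda>_. p) Rest (\<lambda>R. of_bool (Q ({{u, v1}, {u, v2}} \<union> cross v1 M1 \<union> cross v2 M2 \<union> R))) \<le> 120000 / (M * sqrt M) + exp (- M)"
proof -
  define U1 U2 W where "U1 = M1 - M2" and "U2 = M2 - M1" and "W = Y - M1 - M2"
  define D3 where "D3 = (\<Union>x\<in>insert u (U1 \<union> U2). cross x W)"
  define Rs where "Rs = Rest - D3"
  have p: "0 < p" "p \<le> 1" "m \<le> M" and fV: "finite V" and sV: "\<And>x. x \<in> V \<Longrightarrow> s x = 1 \<or> s x = -1"
    using reg M unfolding regime_def by auto
  have m': "regime_min L C \<le> m" "100 \<le> M" "(4 * half_const L C * (3 + 16 * nbhd_const L))\<^sup>2 \<le> M"
    using m p(3) regime_min_ge[of L C] zero_le_power2[of "4 * half_const L C * (3 + 16 * nbhd_const L)"]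
    unfolding triple_min_def by linarith+
  have fY: "finite Y" using fV by (simp add: Y)
  have fM: "finite M1" "finite M2" using M12 fY finite_subset by auto
  have fin: "finite Y" "finite M1" "finite M2" "finite W" "finite U1" "finite U2" "finite Rest" "finite Rs" "finite D3"
    using fV fY fM by (auto simp: U1_def U2_def W_def Rest Rs_def D3_def)
  have sub3: "D3 \<subseteq> Rest"
    unfolding D3_def Rest W_def U1_def U2_def using d M12 by (auto simp: cross_def Y doubleton_eq_iff)
  have Rest_split: "Rest = Rs \<union> D3" "Rs \<inter> D3 = {}" using sub3 by (auto simp: Rs_def)
  have pM: "p * M \<le> L"
    using regime_fresh(7)[OF reg m'(1) LC order_refl] p M by simp
  have VW: "real (card (V - W)) \<le> 7 * M"
  proof -
    have "V - W \<subseteq> {u, w, v1, v2} \<union> M1 \<union> M2" by (auto simp: W_def Y)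
    then have "card (V - W) \<le> card ({u, w, v1, v2} \<union> M1 \<union> M2)" using fin by (intro card_mono) auto
    also have "\<dots> \<le> card ({u, w, v1, v2} \<union> M1) + card M2" by (rule card_Un_le)
    also have "card ({u, w, v1, v2} \<union> M1) \<le> card {u, w, v1, v2} + card M1" by (rule card_Un_le)
    also have "card {u, w, v1, v2} \<le> 4" by (simp add: card_insert_if)
    finally have "real (card (V - W)) \<le> 4 + real (card M1) + real (card M2)" by linarith
    then show ?thesis using cM m'(2) by linarith
  qed
  let ?U = "U1 \<union> U2"
  \<comment> \<open>The pairs between private neighbours and touched vertices. There are at most
    \<open>42 * M * M\<close> of them, and \<open>p * M \<le> L\<close> makes O(M) present edges
    typical.\<close>
  define J where "J = Rs \<inter> (\<Union>x\<in>?U. cross x (V - W))"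
  define B where "B = (\<lambda>R. {{u, v1}, {u, v2}} \<union> cross v1 M1 \<union> cross v2 M2 \<union> R)"
  define good where "good = (\<lambda>R. real (card (R \<inter> J)) \<le> (84 * L + 1) * M)"
  have cU: "real (card ?U) \<le> 6 * M"
  proof -
    have "card ?U \<le> card (M1 \<union> M2)" using fin by (intro card_mono) (auto simp: U1_def U2_def)
    also have "\<dots> \<le> card M1 + card M2" by (rule card_Un_le)
    finally show ?thesis using cM by linarith
  qed
  have cJ: "real (card J) \<le> 42 * M * M"
  proof -
    have "card J \<le> card (\<Union>x\<in>?U. cross x (V - W))" using fin fV by (intro card_mono) (auto simp: J_def)
    also have "\<dots> \<le> (\<Sum>x\<in>?U. card (cross x (V - W)))" using fin by (intro card_UN_le) auto
    also have "\<dots> \<le> (\<Sum>x\<in>?U. card (V - W))" unfolding cross_def using fV by (intro sum_mono card_image_le) auto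
    finally have "card J \<le> card ?U * card (V - W)" by simp
    then have "real (card J) \<le> real (card ?U * card (V - W))" by (simp only: of_nat_le_iff)
    also have "\<dots> \<le> (6 * M) * (7 * M)" unfolding of_nat_mult using cU VW m'(2) by (intro mult_mono) auto
    finally show ?thesis by simp
  qed
  have bad: "rexp (\<lambda>_. p) Rs (\<lambda>R. of_bool (\<not> good R)) \<le> exp (- M)"
  proof -
    have "rexp (\<lambda>_. p) Rs (\<lambda>R. of_bool (\<not> good R)) \<le> rexp (\<lambda>_. p) Rs (\<lambda>R. of_bool ((84 * L + 1) * M \<le> real (card (R \<inter> J))))"
      using p by (intro rexp_mono) (auto simp: good_def)
    also have "\<dots> \<le> exp (2 * p * real (card J) - (84 * L + 1) * M)"
      using fin p by (intro chernoff_upper) (auto simp: J_def)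
    also have "\<dots> \<le> exp (- M)"
    proof -
      have "2 * p * real (card J) \<le> 2 * p * (42 * M * M)" using cJ p by (intro mult_left_mono) auto
      also have "\<dots> = 84 * M * (p * M)" by simp
      also have "\<dots> \<le> 84 * M * L" using pM m'(2) by (intro mult_left_mono) auto
      finally show ?thesis by (simp add: algebra_simps)
    qed
    finally show ?thesis .
  qed
  have given: "rexp (\<lambda>_. p) D3 (\<lambda>A. of_bool (Q (B R \<union> A))) \<le> 120000 / (M * sqrt M)"
    if R: "R \<subseteq> Rs" and g: "good R" for R
  proof -
    have RR: "R \<subseteq> all_pairs V" "\<And>x y. {x, y} \<in> R \<Longrightarrow> {x, y} \<notin> cross v1 Y \<and> {x, y} \<notin> cross v2 Y \<and> {x, y} \<notin> D3"
      using that(1) by (auto simp: Rs_def Rest)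
    have Bsub: "B R \<subseteq> all_pairs V"
      using d M12 RR(1) by (auto simp: B_def cross_def Y)
    have v12: "v1 \<notin> Y" "v2 \<notin> Y" "u \<notin> Y" "w \<notin> Y" by (auto simp: Y)
    have UY: "U1 \<subseteq> M1" "U2 \<subseteq> M2" "U1 \<inter> M2 = {}" "U2 \<inter> M1 = {}" "W \<subseteq> Y" "W \<inter> M1 = {}" "W \<inter> M2 = {}"
      by (auto simp: U1_def U2_def W_def)
    \<comment> \<open>\<open>x\<close> is a private neighbour, so it is joined to exactly one of
      \<open>v1\<close> and \<open>v2\<close>; every other exposed edge at \<open>x\<close> lies in
      \<open>J\<close>.\<close>
    have degB: "card (neighbours (B R) x) \<le> 1 + card (neighbours (R \<inter> J) x)" if x: "x \<in> ?U" for x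
    proof -
      define v where "v = (if x \<in> U1 then v1 else v2)"
      have "neighbours (B R) x \<subseteq> insert v (neighbours (R \<inter> J) x)"
      proof
        fix y assume "y \<in> neighbours (B R) x"
        then have y: "y \<noteq> x" "{y, x} \<in> B R" by (auto simp: neighbours_def)
        have xY: "x \<in> Y" "x \<noteq> u" "x \<noteq> v1" "x \<noteq> v2" using x UY M12 v12 by auto
        show "y \<in> insert v (neighbours (R \<inter> J) x)"
        proof (cases "{y, x} \<in> R")
          case True
          have "y \<in> V" using RR(1) True by auto
          moreover have "y \<notin> W"
          proof
            assume "y \<in> W"
            then have "{y, x} \<in> D3" using x by (auto simp: D3_def in_cross_iff)
            then show False using RR(2)[OF True] by simp
          qed
          ultimately have "{y, x} \<in> J" using True R x by (auto simp: J_def in_cross_iff)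
          then show ?thesis using True y(1) by (simp add: neighbours_def)
        next
          case False
          then have "{y, x} \<in> cross v1 M1 \<or> {y, x} \<in> cross v2 M2"
            using y(2) xY by (auto simp: B_def doubleton_eq_iff)
          then show ?thesis using xY x UY by (auto simp: in_cross_iff v_def)
        qed
      qed
      moreover have "finite (neighbours (R \<inter> J) x)" using finite_neighbours[OF fV] RR(1) by blast
      moreover from this have "card (insert v (neighbours (R \<inter> J) x)) \<le> 1 + card (neighbours (R \<inter> J) x)"
        by (simp add: card_insert_if)
      ultimately show ?thesis by (meson card_mono finite_insert order_trans)
    qed
    have deg: "real (\<Sum>x\<in>?U. card (neighbours (B R) x)) \<le> nbhd_const L * M"
    proof -
      have "(\<Sum>x\<in>?U. card (neighbours (B R) x)) \<le> (\<Sum>x\<in>?U. 1 + card (neighbours (R \<inter> J) x))"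
        by (intro sum_mono degB)
      also have "\<dots> = card ?U + (\<Sum>x\<in>?U. card (neighbours (R \<inter> J) x))" by (subst sum.distrib) simp
      also have "(\<Sum>x\<in>?U. card (neighbours (R \<inter> J) x)) \<le> 2 * card (R \<inter> J)"
        using fin RR(1) by (intro sum_card_neighbours_le) (auto simp: all_pairs_def J_def)
      finally have "real (\<Sum>x\<in>?U. card (neighbours (B R) x)) \<le> real (card ?U) + 2 * real (card (R \<inter> J))" by linarith
      also have "\<dots> \<le> 6 * M + 2 * ((84 * L + 1) * M)" using cU g by (simp add: good_def)
      finally show ?thesis by (simp add: nbhd_const_def algebra_simps)
    qed
    have BW: "{x, y} \<notin> B R" if x: "x \<in> insert u ?U" and y: "y \<in> W" for x y
    proof -
      have yY: "y \<in> Y" "y \<noteq> u" "y \<noteq> v1" "y \<noteq> v2" "y \<notin> M1" "y \<notin> M2" using y UY v12 by auto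
      have x12: "x \<noteq> v1" "x \<noteq> v2" using x UY M12 v12 d by auto
      have "{x, y} \<in> D3" using x y by (auto simp: D3_def in_cross_iff)
      then have "{x, y} \<notin> R" using RR(2) by blast
      then show ?thesis using yY x12 by (auto simp: B_def in_cross_iff doubleton_eq_iff)
    qed
    have Nv: "U1 \<subseteq> neighbours (B R) v1" "neighbours (B R) v1 \<inter> (U2 \<union> W) = {}"
      "U2 \<subseteq> neighbours (B R) v2" "neighbours (B R) v2 \<inter> (U1 \<union> W) = {}"
    proof -
      show "U1 \<subseteq> neighbours (B R) v1" "U2 \<subseteq> neighbours (B R) v2"
        using UY M12 v12 by (auto simp: neighbours_def B_def in_cross_iff)
      show "neighbours (B R) v1 \<inter> (U2 \<union> W) = {}"
      proof -
        have "{y, v1} \<notin> B R" if "y \<in> U2 \<union> W" for y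
        proof -
          have y: "y \<in> Y" "y \<notin> M1" "y \<noteq> u" "y \<noteq> v1" "y \<noteq> v2" using that UY M12 v12 by auto
          then have "{y, v1} \<notin> R" using RR(2)[of y v1] by (auto simp: in_cross_iff)
          then show ?thesis using y d(6,7,10) v12 M12 by (auto simp: B_def in_cross_iff doubleton_eq_iff)
        qed
        then show ?thesis by (auto simp: neighbours_def)
      qed
      show "neighbours (B R) v2 \<inter> (U1 \<union> W) = {}"
      proof -
        have "{y, v2} \<notin> B R" if "y \<in> U1 \<union> W" for y
        proof -
          have y: "y \<in> Y" "y \<notin> M2" "y \<noteq> u" "y \<noteq> v1" "y \<noteq> v2" using that UY M12 v12 by auto
          then have "{y, v2} \<notin> R" using RR(2)[of y v2] by (auto simp: in_cross_iff)
          then show ?thesis using y d(6,7,10) v12 M12 by (auto simp: B_def in_cross_iff doubleton_eq_iff)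
        qed
        then show ?thesis by (auto simp: neighbours_def)
      qed
    qed
    show ?thesis unfolding D3_def Q
    proof (rule near_tie_pair_given[OF reg m'(1) LC M m'(2,3) _ _ _ _ _ _ _ _ _ _ _ _ _ _ _ VW _ _ Bsub BW Nv deg])
      show "0 < nbhd_const L" using LC by (simp add: nbhd_const_def)
      show "M / 8 \<le> real (card U1)" "M / 8 \<le> real (card U2)" using cM by (auto simp: U1_def U2_def)
    qed (use UY M12 v12 d in \<open>auto simp: Y U1_def U2_def\<close>)
  qed
  have "rexp (\<lambda>_. p) Rest (\<lambda>R. of_bool (Q (B R))) = rexp (\<lambda>_. p) Rs (\<lambda>R. rexp (\<lambda>_. p) D3 (\<lambda>A. of_bool (Q (B (R \<union> A)))))"
    unfolding Rest_split(1) using fin Rest_split(2) by (intro rexp_union)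
  also have "\<dots> = rexp (\<lambda>_. p) Rs (\<lambda>R. rexp (\<lambda>_. p) D3 (\<lambda>A. of_bool (Q (B R \<union> A))))"
    by (simp add: B_def Un_assoc)
  also have "\<dots> \<le> rexp (\<lambda>_. p) Rs (\<lambda>R. 120000 / (M * sqrt M) + of_bool (\<not> good R))"
  proof (rule rexp_mono)
    fix R assume R: "R \<subseteq> Rs"
    have "rexp (\<lambda>_. p) D3 (\<lambda>A. of_bool (Q (B R \<union> A))) \<le> 1" using fin p by (intro rexp_le_const) auto
    then have "rexp (\<lambda>_. p) D3 (\<lambda>A. of_bool (Q (B R \<union> A))) \<le> 120000 / (M * sqrt M) + 1"
      using m'(2) by (intro add_increasing) auto
    then show "rexp (\<lambda>_. p) D3 (\<lambda>A. of_bool (Q (B R \<union> A))) \<le> 120000 / (M * sqrt M) + of_bool (\<not> good R)"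
      using given[OF R] by (cases "good R") simp_all
  qed (use p in auto)
  also have "\<dots> \<le> 120000 / (M * sqrt M) + exp (- M)"
    unfolding rexp_add using bad fin by (simp add: rexp_const)
  finally show ?thesis by (simp add: B_def)
qed

text \<open>The neighbourhoods \<open>M1\<close> and \<open>M2\<close> of \<open>v1\<close> and
  \<open>v2\<close> are exposed before the rest. Unless one is too large or its private part too
  small, \<open>triple_exposed\<close> applies. Each of the four exceptions has probability at most
  \<open>exp (- (M / 4))\<close>, which is absorbed.\<close>

lemma triple_tie:
  fixes m L C p M :: real
  assumes reg: "regime m L C V s p" and m: "triple_min L C \<le> m" and LC: "1 \<le> L" "1 \<le> C"
    and M: "M = real (card V) * p"
    and d: "u \<in> V" "w \<in> V" "v1 \<in> V" "v2 \<in> V" "u \<noteq> w" "u \<noteq> v1" "u \<noteq> v2" "v1 \<noteq> w" "v2 \<noteq> w" "v1 \<noteq> v2"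
  shows "rexp (\<lambda>_. p) (all_pairs V - {{u, w}} - {{u, v1}} - {{u, v2}})
    (\<lambda>A. of_bool (near_tie (insert {u, v1} (insert {u, v2} A)) s u v1 \<and> near_tie (insert {u, v1} (insert {u, v2} A)) s u v2))
    \<le> 130000 / (M * sqrt M)"
proof -
  define Y where "Y = V - {u, w, v1, v2}"
  define Rest where "Rest = all_pairs V - {{u, w}} - {{u, v1}} - {{u, v2}} - cross v1 Y - cross v2 Y"
  define Q where "Q = (\<lambda>G. \<bar>nsum G s u\<bar> \<le> 1 \<and> \<bar>nsum G (majority_step G s) v1\<bar> \<le> 4 \<and> \<bar>nsum G (majority_step G s) v2\<bar> \<le> 4)"
  let ?I = "all_pairs V - {{u, w}} - {{u, v1}} - {{u, v2}}"
  let ?E = "\<lambda>f. rexp (\<lambda>_. p) Y f"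
  have p: "0 < p" "p \<le> 1" "m \<le> M" and fV: "finite V"
    using reg M unfolding regime_def by auto
  have m': "regime_min L C \<le> m" "100 \<le> M"
    using m p(3) regime_min_ge[of L C] zero_le_power2[of "4 * half_const L C * (3 + 16 * nbhd_const L)"]
    unfolding triple_min_def by linarith+
  have p01: "0 \<le> p" "p \<le> 1" using p by auto
  have VV: "V \<subseteq> V" "real (card (V - V)) \<le> 7 * (real (card V) * p)" using p by auto
  note f = regime_fresh[OF reg m'(1) LC VV]
  have fin: "finite Y" "finite Rest" using fV by (auto simp: Y_def Rest_def)
  have YV: "Y \<subseteq> V" by (auto simp: Y_def)
  have cY: "real (card V) - 4 \<le> real (card Y)" "real (card Y) \<le> real (card V)"
  proof -
    have "card {u, w, v1, v2} \<le> 4" by (simp add: card_insert_if)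
    moreover have "card V - card {u, w, v1, v2} \<le> card Y" unfolding Y_def by (rule diff_card_le_card_Diff) simp
    ultimately show "real (card V) - 4 \<le> real (card Y)" by linarith
    show "real (card Y) \<le> real (card V)" using YV fV by (simp add: card_mono)
  qed
  have pY: "p * real (card Y) \<le> M" unfolding M using cY(2) p by (simp add: mult.commute mult_left_mono)
  have I: "?I = cross v1 Y \<union> (cross v2 Y \<union> Rest)" "cross v1 Y \<inter> (cross v2 Y \<union> Rest) = {}" "cross v2 Y \<inter> Rest = {}"
  proof -
    have "cross v1 Y \<subseteq> ?I" "cross v2 Y \<subseteq> ?I" using d by (auto simp: cross_def Y_def doubleton_eq_iff)
    then show "?I = cross v1 Y \<union> (cross v2 Y \<union> Rest)" by (auto simp: Rest_def)
    have "cross v1 Y \<inter> cross v2 Y = {}" using d by (auto simp: cross_def Y_def doubleton_eq_iff)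
    then show "cross v1 Y \<inter> (cross v2 Y \<union> Rest) = {}" "cross v2 Y \<inter> Rest = {}" by (auto simp: Rest_def)
  qed
  define \<Phi> where "\<Phi> = (\<lambda>M1 M2. rexp (\<lambda>_. p) Rest (\<lambda>R. of_bool (Q ({{u, v1}, {u, v2}} \<union> cross v1 M1 \<union> cross v2 M2 \<union> R))) :: real)"
  have "rexp (\<lambda>_. p) ?I (\<lambda>A. of_bool (near_tie (insert {u, v1} (insert {u, v2} A)) s u v1 \<and> near_tie (insert {u, v1} (insert {u, v2} A)) s u v2))
    = rexp (\<lambda>_. p) ?I (\<lambda>A. of_bool (Q ({{u, v1}, {u, v2}} \<union> A)))"
    by (intro rexp_cong refl arg_cong[where f = of_bool]) (auto simp: Q_def near_tie_def)
  also have "\<dots> = rexp (\<lambda>_. p) (cross v1 Y) (\<lambda>A1. rexp (\<lambda>_. p) (cross v2 Y) (\<lambda>A2. rexp (\<lambda>_. p) Rest (\<lambda>R. of_bool (Q ({{u, v1}, {u, v2}} \<union> A1 \<union> A2 \<union> R)))))"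
  proof -
    have "rexp (\<lambda>_. p) ?I (\<lambda>A. of_bool (Q ({{u, v1}, {u, v2}} \<union> A))) =
      rexp (\<lambda>_. p) (cross v1 Y) (\<lambda>A1. rexp (\<lambda>_. p) (cross v2 Y \<union> Rest) (\<lambda>A. of_bool (Q ({{u, v1}, {u, v2}} \<union> (A1 \<union> A)))))"
      unfolding I(1) using fin I(2) by (intro rexp_union) auto
    also have "\<dots> = rexp (\<lambda>_. p) (cross v1 Y) (\<lambda>A1. rexp (\<lambda>_. p) (cross v2 Y) (\<lambda>A2. rexp (\<lambda>_. p) Rest (\<lambda>R. of_bool (Q ({{u, v1}, {u, v2}} \<union> (A1 \<union> (A2 \<union> R)))))))"
      using fin I(3) by (intro rexp_cong[OF refl refl] rexp_union) auto
    finally show ?thesis by (simp add: Un_assoc)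
  qed
  also have "\<dots> = ?E (\<lambda>M1. ?E (\<lambda>M2. \<Phi> M1 M2))"
  proof -
    have c: "rexp (\<lambda>_. p) (cross v Y) g = ?E (\<lambda>S. g (cross v S))" for v g
      using rexp_image[OF fin(1) inj_on_cross, of "\<lambda>_. p" v g] by (simp add: cross_def)
    show ?thesis by (simp only: c \<Phi>_def)
  qed
  also have "\<dots> \<le> ?E (\<lambda>M1. ?E (\<lambda>M2. (120000 / (M * sqrt M) + exp (- M)) + (of_bool (3 * M \<le> real (card (M1 \<inter> Y))) +
     (of_bool (3 * M \<le> real (card (M2 \<inter> Y))) + (of_bool (real (card M2) \<le> 3 * M \<and> real (card (M1 \<inter> (Y - M2))) \<le> M / 8) +
      of_bool (real (card M1) \<le> 3 * M \<and> real (card (M2 \<inter> (Y - M1))) \<le> M / 8))))))"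
  proof (intro rexp_mono)
    fix M1 M2 assume M12: "M1 \<subseteq> Y" "M2 \<subseteq> Y"
    define bad where "bad \<longleftrightarrow> 3 * M \<le> real (card (M1 \<inter> Y)) \<or> 3 * M \<le> real (card (M2 \<inter> Y)) \<or>
      (real (card M2) \<le> 3 * M \<and> real (card (M1 \<inter> (Y - M2))) \<le> M / 8) \<or> (real (card M1) \<le> 3 * M \<and> real (card (M2 \<inter> (Y - M1))) \<le> M / 8)"
    have "\<Phi> M1 M2 \<le> (120000 / (M * sqrt M) + exp (- M)) + of_bool bad"
    proof (cases bad)
      case True
      have "\<Phi> M1 M2 \<le> 1" unfolding \<Phi>_def using fin p01 by (intro rexp_le_const) auto
      moreover have "0 \<le> 120000 / (M * sqrt M) + exp (- M)" using m'(2) by (intro add_nonneg_nonneg) auto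
      ultimately show ?thesis using True by (simp add: add_increasing)
    next
      case False
      have e: "M1 \<inter> Y = M1" "M2 \<inter> Y = M2" "M1 \<inter> (Y - M2) = M1 - M2" "M2 \<inter> (Y - M1) = M2 - M1" using M12 by auto
      have "\<Phi> M1 M2 \<le> 120000 / (M * sqrt M) + exp (- M)" unfolding \<Phi>_def
        by (rule triple_exposed[OF reg m LC M d Y_def M12 Rest_def _ _ _ _ Q_def]) (use False in \<open>auto simp: bad_def e\<close>)
      then show ?thesis using False by simp
    qed
    also have "of_bool bad \<le> (of_bool (3 * M \<le> real (card (M1 \<inter> Y))) +
     (of_bool (3 * M \<le> real (card (M2 \<inter> Y))) + (of_bool (real (card M2) \<le> 3 * M \<and> real (card (M1 \<inter> (Y - M2))) \<le> M / 8) +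
      of_bool (real (card M1) \<le> 3 * M \<and> real (card (M2 \<inter> (Y - M1))) \<le> M / 8))) :: real)"
      by (auto simp: bad_def)
    finally show "\<Phi> M1 M2 \<le> (120000 / (M * sqrt M) + exp (- M)) + (of_bool (3 * M \<le> real (card (M1 \<inter> Y))) +
     (of_bool (3 * M \<le> real (card (M2 \<inter> Y))) + (of_bool (real (card M2) \<le> 3 * M \<and> real (card (M1 \<inter> (Y - M2))) \<le> M / 8) +
      of_bool (real (card M1) \<le> 3 * M \<and> real (card (M2 \<inter> (Y - M1))) \<le> M / 8))))" by simp
  qed (use p01 in auto)
  also have "\<dots> = (120000 / (M * sqrt M) + exp (- M)) + (?E (\<lambda>M1. of_bool (3 * M \<le> real (card (M1 \<inter> Y)))) +
     (?E (\<lambda>M2. of_bool (3 * M \<le> real (card (M2 \<inter> Y)))) +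
      (?E (\<lambda>M1. ?E (\<lambda>M2. of_bool (real (card M2) \<le> 3 * M \<and> real (card (M1 \<inter> (Y - M2))) \<le> M / 8))) +
       ?E (\<lambda>M1. ?E (\<lambda>M2. of_bool (real (card M1) \<le> 3 * M \<and> real (card (M2 \<inter> (Y - M1))) \<le> M / 8))))))"
    unfolding rexp_add by (simp only: rexp_const[OF fin(1)])
  also have "\<dots> \<le> (120000 / (M * sqrt M) + exp (- (M / 4))) + (exp (- (M / 4)) + (exp (- (M / 4)) + (exp (- (M / 4)) + exp (- (M / 4)))))"
  proof (intro add_mono order_refl)
    show "exp (- M) \<le> exp (- (M / 4))" using m'(2) by simp
    have hi: "?E (\<lambda>M1. of_bool (3 * M \<le> real (card (M1 \<inter> Y)))) \<le> exp (- (M / 4))"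
    proof -
      have "?E (\<lambda>M1. of_bool (3 * M \<le> real (card (M1 \<inter> Y)))) \<le> exp (2 * p * real (card Y) - 3 * M)"
        using fin p01 by (intro chernoff_upper) auto
      also have "\<dots> \<le> exp (- (M / 4))" using pY m'(2) by simp
      finally show ?thesis .
    qed
    then show "?E (\<lambda>M1. of_bool (3 * M \<le> real (card (M1 \<inter> Y)))) \<le> exp (- (M / 4))" .
    show "?E (\<lambda>M2. of_bool (3 * M \<le> real (card (M2 \<inter> Y)))) \<le> exp (- (M / 4))" by (rule hi)
    \<comment> \<open>For a fixed \<open>T\<close> with at most \<open>3 * M\<close> elements the
      private part has mean \<open>p * card (Y - T) \<ge> 3 / 4 * M\<close>, so falling to
      \<open>M / 8\<close> has probability at most \<open>exp (M / 8 - 3 * M / 8)\<close>.\<close>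
    have lo: "?E (\<lambda>S. of_bool (real (card T) \<le> 3 * M \<and> real (card (S \<inter> (Y - T))) \<le> M / 8)) \<le> exp (- (M / 4))" if T: "T \<subseteq> Y" for T
    proof (cases "real (card T) \<le> 3 * M")
      case True
      have "?E (\<lambda>S. of_bool (real (card (S \<inter> (Y - T))) \<le> M / 8)) \<le> exp (M / 8 - p * real (card (Y - T)) / 2)"
        using fin p01 by (intro chernoff_lower) auto
      also have "\<dots> \<le> exp (- (M / 4))"
      proof -
        have "card (Y - T) = card Y - card T" using T fin finite_subset by (intro card_Diff_subset) auto
        then have "real (card V) - 4 - 3 * M \<le> real (card (Y - T))" using True cY by linarith
        then have "p * (real (card V) - 4 - 3 * M) \<le> p * real (card (Y - T))" using p01 by (intro mult_left_mono)
        moreover have "p * (real (card V) - 4 - 3 * M) = M - 4 * p - 3 * (p * M)" by (simp add: M algebra_simps)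
        moreover have "p * M \<le> 1 / 100 * M" using f(4) m'(2) by (intro mult_right_mono) auto
        ultimately have "3 / 4 * M \<le> p * real (card (Y - T))" using f(4) m'(2) by linarith
        then show ?thesis by simp
      qed
      finally show ?thesis using True by simp
    next
      case False
      then show ?thesis using fin by (simp add: rexp_const)
    qed
    show "?E (\<lambda>M1. ?E (\<lambda>M2. of_bool (real (card M1) \<le> 3 * M \<and> real (card (M2 \<inter> (Y - M1))) \<le> M / 8))) \<le> exp (- (M / 4))"
      by (rule rexp_le_const[OF fin(1)]) (use p01 lo in auto)
    show "?E (\<lambda>M1. ?E (\<lambda>M2. of_bool (real (card M2) \<le> 3 * M \<and> real (card (M1 \<inter> (Y - M2))) \<le> M / 8))) \<le> exp (- (M / 4))"
      by (subst rexp_swap, rule rexp_le_const[OF fin(1)]) (use p01 lo in auto)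
  qed
  also have "\<dots> = 120000 / (M * sqrt M) + 5 * exp (- (M / 4))" by simp
  also have "\<dots> \<le> 120000 / (M * sqrt M) + 5 * (32 / (M * sqrt M))"
    using m'(2) by (intro add_mono mult_left_mono exp_quarter_le) auto
  also have "\<dots> \<le> 130000 / (M * sqrt M)" using m'(2) by (simp add: field_simps)
  finally show ?thesis .
qed

text \<open>Diagonal terms give \<open>n * p / sqrt M\<close>, and the off-diagonal ones
  \<open>(n * p)^2 / (M * sqrt M)\<close>. Both are of order \<open>sqrt M\<close>, and the second
  one needs all three near ties.\<close>

lemma ties_second_moment:
  fixes m L C p M :: real
  assumes reg: "regime m L C V s p" and m: "triple_min L C \<le> m" and LC: "1 \<le> L" "1 \<le> C"
    and M: "M = real (card V) * p" and d: "u \<in> V" "w \<in> V" "u \<noteq> w"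
  shows "rexp (\<lambda>_. p) (all_pairs V - {{u, w}}) (\<lambda>A. (ties V s u w A)\<^sup>2) \<le> 131000 * sqrt M"
proof -
  define n where "n = real (card V)"
  let ?I = "all_pairs V - {{u, w}}"
  let ?E = "\<lambda>f. rexp (\<lambda>_. p) ?I f"
  let ?X = "V - {u, w}"
  have p: "0 < p" "p \<le> 1" "m \<le> M" and fV: "finite V"
    using reg M unfolding regime_def by auto
  have m': "regime_min L C \<le> m" "100 \<le> M"
    using m p(3) regime_min_ge[of L C] zero_le_power2[of "4 * half_const L C * (3 + 16 * nbhd_const L)"]
    unfolding triple_min_def by linarith+
  define y where "y = (\<lambda>v A. of_bool ({u, v} \<in> A \<and> near_tie A s u v) :: real)"
  have sq: "(ties V s u w A)\<^sup>2 = (\<Sum>v\<in>?X. \<Sum>v'\<in>?X. y v A * y v' A)" for A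
    unfolding ties_def y_def power2_eq_square by (rule sum_product)
  have sM: "0 < sqrt M" "0 \<le> M" using m'(2) by auto
  have diag: "?E (\<lambda>A. y v A * y v A) \<le> p * (12 / sqrt M)" if v: "v \<in> ?X" for v
  proof -
    have "?E (\<lambda>A. y v A * y v A) \<le> ?E (\<lambda>A. of_bool ({u, v} \<in> A) * of_bool (\<bar>nsum A s u\<bar> \<le> 1))"
      using p by (intro rexp_mono) (auto simp: y_def near_tie_def)
    also have "\<dots> = p * rexp (\<lambda>_. p) (?I - {{u, v}}) (\<lambda>A. of_bool (\<bar>nsum (insert {u, v} A) s u\<bar> \<le> 1))"
      using fV d v by (intro rexp_member) (auto simp: doubleton_eq_iff)
    also have "\<dots> \<le> p * (12 / sqrt M)"
      using p d v m'(2) by (intro mult_left_mono tie_given_edge[OF reg m'(1) LC M]) auto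
    finally show ?thesis .
  qed
  have off: "?E (\<lambda>A. y v A * y v' A) \<le> p * (p * (130000 / (M * sqrt M)))" if v: "v \<in> ?X" "v' \<in> ?X" "v \<noteq> v'" for v v'
  proof -
    have "?E (\<lambda>A. y v A * y v' A) = ?E (\<lambda>A. of_bool ({u, v} \<in> A) * (of_bool ({u, v'} \<in> A) * of_bool (near_tie A s u v \<and> near_tie A s u v')))"
      by (intro rexp_cong refl) (auto simp: y_def)
    also have "\<dots> = p * rexp (\<lambda>_. p) (?I - {{u, v}}) (\<lambda>A. of_bool ({u, v'} \<in> insert {u, v} A) * of_bool (near_tie (insert {u, v} A) s u v \<and> near_tie (insert {u, v} A) s u v'))"
      using fV d v by (intro rexp_member) (auto simp: doubleton_eq_iff)
    also have "rexp (\<lambda>_. p) (?I - {{u, v}}) (\<lambda>A. of_bool ({u, v'} \<in> insert {u, v} A) * of_bool (near_tie (insert {u, v} A) s u v \<and> near_tie (insert {u, v} A) s u v'))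
      = rexp (\<lambda>_. p) (?I - {{u, v}}) (\<lambda>A. of_bool ({u, v'} \<in> A) * of_bool (near_tie (insert {u, v} A) s u v \<and> near_tie (insert {u, v} A) s u v'))"
      using v by (intro rexp_cong refl) (auto simp: doubleton_eq_iff)
    also have "\<dots> = p * rexp (\<lambda>_. p) (?I - {{u, v}} - {{u, v'}}) (\<lambda>A. of_bool (near_tie (insert {u, v} (insert {u, v'} A)) s u v \<and> near_tie (insert {u, v} (insert {u, v'} A)) s u v'))"
      using fV d v by (intro rexp_member) (auto simp: doubleton_eq_iff)
    also have "p * \<dots> \<le> p * (p * (130000 / (M * sqrt M)))"
      using p d v by (intro mult_left_mono triple_tie[OF reg m LC M]) auto
    finally show ?thesis .
  qed
  have cX: "real (card ?X) \<le> n" using fV by (auto simp: n_def intro!: card_mono)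
  have "?E (\<lambda>A. (ties V s u w A)\<^sup>2) = (\<Sum>v\<in>?X. \<Sum>v'\<in>?X. ?E (\<lambda>A. y v A * y v' A))"
    unfolding sq rexp_sum ..
  also have "\<dots> \<le> (\<Sum>v\<in>?X. \<Sum>v'\<in>?X. (if v' = v then p * (12 / sqrt M) else 0) + p * (p * (130000 / (M * sqrt M))))"
  proof (intro sum_mono)
    fix v v' assume v: "v \<in> ?X" "v' \<in> ?X"
    have "0 \<le> p * (p * (130000 / (M * sqrt M)))" using p sM by simp
    then show "?E (\<lambda>A. y v A * y v' A) \<le> (if v' = v then p * (12 / sqrt M) else 0) + p * (p * (130000 / (M * sqrt M)))"
      using diag[OF v(1)] off[OF v] by (cases "v' = v") auto
  qed
  also have "\<dots> = real (card ?X) * (p * (12 / sqrt M)) + real (card ?X) * (real (card ?X) * (p * (p * (130000 / (M * sqrt M)))))"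
    using fV by (simp add: sum.distrib distrib_left)
  also have "\<dots> \<le> n * (p * (12 / sqrt M)) + n * (n * (p * (p * (130000 / (M * sqrt M)))))"
    using cX p sM by (intro add_mono mult_right_mono mult_mono) auto
  also have "\<dots> = 12 * (M / sqrt M) + 130000 * (M * M / (M * sqrt M))" by (simp add: M n_def)
  also have "\<dots> = 130012 * (M / sqrt M)" using sM m'(2) by simp
  also have "\<dots> = 130012 * sqrt M" by (simp add: real_div_sqrt sM)
  also have "\<dots> \<le> 131000 * sqrt M" using sM by simp
  finally show ?thesis .
qed

text \<open>Efron-Stein over fewer than \<open>n^2\<close> pairs of weight \<open>p\<close>, each
  with a mean squared effect of order \<open>sqrt M\<close>; the product is
  \<open>n * M * sqrt M\<close>.\<close>

lemma maj2_variance: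
  fixes m L C p M :: real
  assumes reg: "regime m L C V s p" and m: "triple_min L C \<le> m" and LC: "1 \<le> L" "1 \<le> C"
    and M: "M = real (card V) * p"
  shows "rvar (\<lambda>_. p) (all_pairs V) (\<lambda>A. real_of_int (\<Sum>v\<in>V. maj2 A s v)) \<le> 3200000 * (real (card V) * M * sqrt M)"
proof -
  define n where "n = real (card V)"
  define f where "f = (\<lambda>A. real_of_int (\<Sum>v\<in>V. maj2 A s v))"
  have p: "0 < p" "p \<le> 1" "m \<le> M" and fV: "finite V" and sV: "\<And>x. x \<in> V \<Longrightarrow> s x = 1 \<or> s x = -1"
    using reg M unfolding regime_def by auto
  have M100: "100 \<le> M"
    using m p(3) regime_min_ge[of L C] zero_le_power2[of "4 * half_const L C * (3 + 16 * nbhd_const L)"]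
    unfolding triple_min_def by linarith
  have sM: "1 \<le> sqrt M" using M100 by simp
  have edge: "rexp (\<lambda>_. p) (all_pairs V - {e}) (\<lambda>A. (f (insert e A) - f A)\<^sup>2) \<le> 3200000 * sqrt M"
    if ee: "e \<in> all_pairs V" for e
  proof -
    obtain u w where uw: "e = {u, w}" "u \<noteq> w" using ee unfolding all_pairs_def card_2_iff by blast
    then have e: "e = {u, w}" "u \<noteq> w" "u \<in> V" "w \<in> V" using ee by simp_all
    have "rexp (\<lambda>_. p) (all_pairs V - {e}) (\<lambda>A. (f (insert e A) - f A)\<^sup>2) \<le>
      rexp (\<lambda>_. p) (all_pairs V - {e}) (\<lambda>A. 48 + 12 * (ties V s u w A)\<^sup>2 + 12 * (ties V s w u A)\<^sup>2)"
      unfolding f_def e(1) using p e fV sV by (intro rexp_mono maj2_sum_insert_edge) auto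
    also have "\<dots> = 48 + 12 * rexp (\<lambda>_. p) (all_pairs V - {{u, w}}) (\<lambda>A. (ties V s u w A)\<^sup>2)
       + 12 * rexp (\<lambda>_. p) (all_pairs V - {{w, u}}) (\<lambda>A. (ties V s w u A)\<^sup>2)"
      unfolding rexp_add rexp_cmult e(1) using fV by (simp add: rexp_const insert_commute)
    also have "\<dots> \<le> 48 + 12 * (131000 * sqrt M) + 12 * (131000 * sqrt M)"
      using e by (intro add_mono mult_left_mono ties_second_moment[OF reg m LC M]) auto
    also have "\<dots> \<le> 3200000 * sqrt M" using sM by linarith
    finally show ?thesis .
  qed
  have "rvar (\<lambda>_. p) (all_pairs V) f \<le> (\<Sum>e\<in>all_pairs V. p * rexp (\<lambda>_. p) (all_pairs V - {e}) (\<lambda>A. (f (insert e A) - f A)\<^sup>2))"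
    using fV p by (intro efron_stein) auto
  also have "\<dots> \<le> (\<Sum>e\<in>all_pairs V. p * (3200000 * sqrt M))"
    using p by (intro sum_mono mult_left_mono edge) auto
  also have "\<dots> = real (card (all_pairs V)) * (p * (3200000 * sqrt M))" by simp
  also have "\<dots> \<le> (n * n) * (p * (3200000 * sqrt M))"
  proof (intro mult_right_mono)
    have "real (card (all_pairs V)) \<le> real (card V * card V)"
      using card_all_pairs_le[OF fV] by (simp only: of_nat_le_iff)
    then show "real (card (all_pairs V)) \<le> n * n" by (simp add: n_def)
  qed (use p sM in auto)
  also have "\<dots> = 3200000 * (n * M * sqrt M)" by (simp add: M n_def)
  finally show ?thesis by (simp add: f_def n_def)
qed

section \<open>Expansion and unanimity\<close>

lemma rexp_exp_sum:
  assumes "finite I"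
  shows "rexp q I (\<lambda>A. exp (\<Sum>e\<in>A. g e)) = (\<Prod>e\<in>I. 1 - q e + q e * exp (g e))"
  using assms
proof (induction I)
  case (insert i I)
  have "rexp q I (\<lambda>A. exp (\<Sum>e\<in>insert i A. g e)) = rexp q I (\<lambda>A. exp (g i) * exp (\<Sum>e\<in>A. g e))"
  proof (rule rexp_cong[OF refl refl])
    fix A assume "A \<subseteq> I"
    then have "finite A" "i \<notin> A" using insert finite_subset by auto
    then show "exp (\<Sum>e\<in>insert i A. g e) = exp (g i) * exp (\<Sum>e\<in>A. g e)" by (simp add: exp_add)
  qed
  then show ?case using insert by (simp add: rexp_insert rexp_cmult algebra_simps)
qed simp

lemma exp_le_quadratic:
  fixes x :: real assumes "\<bar>x\<bar> \<le> 1"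
  shows "exp x \<le> 1 + x + x\<^sup>2"
proof (cases "0 \<le> x")
  case True
  then show ?thesis using exp_bound[of x] assms by simp
next
  case False
  define y where "y = - x"
  have y: "0 \<le> y" using False by (simp add: y_def)
  have e: "1 + y + y\<^sup>2 / 2 \<le> exp y" by (rule exp_lower_Taylor_quadratic[OF y])
  have pos: "0 < 1 + y + y\<^sup>2 / 2" using y by (simp add: add_pos_nonneg)
  have "1 \<le> (1 + y + y\<^sup>2 / 2) * (1 - y + y\<^sup>2)"
  proof -
    have "(1 + y + y\<^sup>2 / 2) * (1 - y + y\<^sup>2) = 1 + y\<^sup>2 / 2 + y ^ 3 / 2 + y ^ 4 / 2"
      by (simp add: field_simps power2_eq_square power3_eq_cube power4_eq_xxxx)
    then show ?thesis using y by simp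
  qed
  then have "1 / (1 + y + y\<^sup>2 / 2) \<le> 1 - y + y\<^sup>2" using pos by (simp add: field_simps)
  moreover have "exp (- y) \<le> 1 / (1 + y + y\<^sup>2 / 2)"
    using e pos unfolding exp_minus inverse_eq_divide by (intro divide_left_mono) auto
  ultimately show ?thesis by (simp add: y_def)
qed

text \<open>The coefficient of the edge \<open>e\<close> in the sum of the neighbourhood sums over
  \<open>B\<close>: each end of \<open>e\<close> in \<open>B\<close> receives the opinion of the
  other end.\<close>

definition pair_weight :: "'v set \<Rightarrow> ('v \<Rightarrow> int) \<Rightarrow> 'v set \<Rightarrow> int" where
  "pair_weight B s e = (\<Sum>v\<in>B \<inter> e. \<Sum>x\<in>e - {v}. s x)"

text \<open>Double counting makes the total a linear function of the edge indicators, so its moment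
  generating function is a product over pairs.\<close>

lemma sum_nsum_eq:
  assumes "finite V" "A \<subseteq> all_pairs V" "B \<subseteq> V"
  shows "(\<Sum>v\<in>B. nsum A s v) = (\<Sum>e\<in>A. pair_weight B s e)"
proof -
  have fin: "finite A" "finite B" using assms finite_subset finite_all_pairs by metis+
  have "nsum A s v = (\<Sum>e\<in>{e\<in>A. v \<in> e}. \<Sum>x\<in>e - {v}. s x)" for v
  proof -
    have "(\<Sum>e\<in>{e\<in>A. v \<in> e}. \<Sum>x\<in>e - {v}. s x) = (\<Sum>e\<in>(\<lambda>x. {x, v}) ` neighbours A v. \<Sum>x\<in>e - {v}. s x)"
    proof (rule sum.cong[OF _ refl])
      show "{e\<in>A. v \<in> e} = (\<lambda>x. {x, v}) ` neighbours A v"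
      proof (intro equalityI subsetI)
        fix e assume e: "e \<in> {e\<in>A. v \<in> e}"
        then have "card e = 2" using assms(2) by (auto simp: all_pairs_def)
        then obtain x where "e = {x, v}" "x \<noteq> v" using e by (auto simp: card_2_iff)
        then show "e \<in> (\<lambda>x. {x, v}) ` neighbours A v" using e by (auto simp: neighbours_def)
      qed (auto simp: neighbours_def)
    qed
    also have "\<dots> = (\<Sum>x\<in>neighbours A v. \<Sum>y\<in>{x, v} - {v}. s y)"
      by (subst sum.reindex) (auto simp: inj_on_def doubleton_eq_iff)
    also have "\<dots> = (\<Sum>x\<in>neighbours A v. s x)"
      by (intro sum.cong refl) (auto simp: neighbours_def insert_Diff_if)
    finally show ?thesis by (simp add: nsum_def)
  qed
  then have "(\<Sum>v\<in>B. nsum A s v) = (\<Sum>v\<in>B. \<Sum>e\<in>{e\<in>A. v \<in> e}. \<Sum>x\<in>e - {v}. s x)" by simp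
  also have "\<dots> = (\<Sum>e\<in>A. \<Sum>v\<in>{v\<in>B. v \<in> e}. \<Sum>x\<in>e - {v}. s x)"
    using fin by (intro sum.swap_restrict)
  finally show ?thesis by (simp add: pair_weight_def Int_def)
qed

text \<open>Exponential Markov for a linear function of the edges. Over all pairs the coefficients
  sum to at least \<open>b * S / 2\<close>, while their absolute values are at most 2 and sum to at
  most \<open>b * n\<close>. A second-order bound for \<open>exp\<close> then gives the exponent
  \<open>p * (- \<theta> * b * S / 2 + 2 * \<theta>^2 * b * n)\<close>.\<close>

lemma expander_prob:
  fixes p :: real and S :: real
  assumes V: "finite V" "B \<subseteq> V" and s: "\<And>x. x \<in> V \<Longrightarrow> s x = 1 \<or> s x = (-1 :: int)"
    and p: "0 \<le> p" "p \<le> 1" and S: "S = real_of_int (\<Sum>x\<in>V. s x)" "2 \<le> S"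
  shows "rexp (\<lambda>_. p) (all_pairs V) (\<lambda>A. of_bool ((\<Sum>v\<in>B. nsum A s v) \<le> 0)) \<le> exp (- (p * real (card B) * S\<^sup>2 / (32 * real (card V))))"
proof -
  define n where "n = real (card V)"
  define b where "b = real (card B)"
  have fB: "finite B" using V finite_subset by auto
  have Sn: "S \<le> n"
  proof -
    have "(\<Sum>x\<in>V. s x) \<le> (\<Sum>x\<in>V. 1)" using s by (intro sum_mono) force
    then have "real_of_int (\<Sum>x\<in>V. s x) \<le> real_of_int (int (card V))" unfolding of_int_le_iff by simp
    then show ?thesis by (simp add: S(1) n_def)
  qed
  have n0: "0 < n" using Sn S(2) by linarith
  \<comment> \<open>The minimiser of the quadratic exponent.\<close>
  define \<theta> where "\<theta> = S / (8 * n)"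
  have \<theta>: "0 \<le> \<theta>" "\<theta> \<le> 1 / 8" using S(2) Sn n0 by (auto simp: \<theta>_def field_simps)
  define c where "c = (\<lambda>e. real_of_int (pair_weight B s e))"
  define k where "k = (\<lambda>e. real_of_int (pair_weight B (\<lambda>_. 1) e))"
  have k: "\<bar>c e\<bar> \<le> k e" "0 \<le> k e" "k e \<le> 2" if e: "e \<in> all_pairs V" for e
  proof -
    have fe: "finite e" "card e = 2" "e \<subseteq> V" using e V finite_subset by (auto simp: all_pairs_def)
    have "\<bar>pair_weight B s e\<bar> \<le> (\<Sum>v\<in>B \<inter> e. \<Sum>x\<in>e - {v}. \<bar>s x\<bar>)"
      unfolding pair_weight_def by (intro order_trans[OF sum_abs] sum_mono sum_abs)
    also have "\<dots> \<le> (\<Sum>v\<in>B \<inter> e. \<Sum>x\<in>e - {v}. 1)"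
      using s fe by (intro sum_mono) force
    finally have "\<bar>pair_weight B s e\<bar> \<le> pair_weight B (\<lambda>_. 1) e" by (simp add: pair_weight_def)
    then have "real_of_int \<bar>pair_weight B s e\<bar> \<le> k e" unfolding k_def of_int_le_iff .
    then show "\<bar>c e\<bar> \<le> k e" by (simp add: c_def)
    then show "0 \<le> k e" by linarith
    have "pair_weight B (\<lambda>_. 1) e = (\<Sum>v\<in>B \<inter> e. 1)"
      unfolding pair_weight_def using fe by (intro sum.cong refl) (simp add: card_Diff_singleton)
    also have "\<dots> \<le> 2"
    proof -
      have "card (B \<inter> e) \<le> card e" using fe by (intro card_mono) auto
      then show ?thesis using fe(2) by simp
    qed
    finally show "k e \<le> 2" by (simp add: k_def)
  qed
  have full: "neighbours (all_pairs V) v = V - {v}" if "v \<in> V" for v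
    using that by (auto simp: neighbours_def)
  \<comment> \<open>A vertex does not see its own opinion, which costs at most 1 per vertex. Since
    \<open>2 \<le> S\<close>, half of \<open>S\<close> is left.\<close>
  have c_sum: "b * S / 2 \<le> (\<Sum>e\<in>all_pairs V. c e)"
  proof -
    have "(\<Sum>e\<in>all_pairs V. pair_weight B s e) = (\<Sum>v\<in>B. (\<Sum>x\<in>V. s x) - s v)"
      unfolding sum_nsum_eq[OF V(1) order_refl V(2), symmetric] nsum_def
    proof (rule sum.cong[OF refl])
      fix v assume "v \<in> B"
      then have "v \<in> V" using V by auto
      then show "(\<Sum>u\<in>neighbours (all_pairs V) v. s u) = (\<Sum>x\<in>V. s x) - s v"
        unfolding full[OF \<open>v \<in> V\<close>] using V by (simp add: sum_diff1)
    qed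
    then have "(\<Sum>e\<in>all_pairs V. c e) = (\<Sum>v\<in>B. S - real_of_int (s v))"
      unfolding c_def of_int_sum[symmetric] S(1) by simp
    moreover have "(\<Sum>v\<in>B. S / 2) \<le> (\<Sum>v\<in>B. S - real_of_int (s v))"
    proof (rule sum_mono)
      fix v assume "v \<in> B"
      then have "s v = 1 \<or> s v = -1" using s V by auto
      then show "S / 2 \<le> S - real_of_int (s v)" using S(2) by auto
    qed
    ultimately show ?thesis by (simp add: b_def)
  qed
  have k_sum: "(\<Sum>e\<in>all_pairs V. k e) \<le> b * n"
  proof -
    have "(\<Sum>e\<in>all_pairs V. pair_weight B (\<lambda>_. 1) e) = (\<Sum>v\<in>B. int (card (V - {v})))"
      unfolding sum_nsum_eq[OF V(1) order_refl V(2), symmetric] nsum_def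
      using full V(2) by (intro sum.cong refl) auto
    also have "\<dots> \<le> (\<Sum>v\<in>B. int (card V))" using V by (intro sum_mono) (auto intro!: card_mono)
    finally have "real_of_int (\<Sum>e\<in>all_pairs V. pair_weight B (\<lambda>_. 1) e) \<le> real_of_int (int (card B) * int (card V))"
      unfolding of_int_le_iff by simp
    then show ?thesis by (simp add: k_def b_def n_def)
  qed
  have "rexp (\<lambda>_. p) (all_pairs V) (\<lambda>A. of_bool ((\<Sum>v\<in>B. nsum A s v) \<le> 0)) \<le> rexp (\<lambda>_. p) (all_pairs V) (\<lambda>A. exp (\<Sum>e\<in>A. - \<theta> * c e))"
  proof (rule rexp_mono)
    fix A assume A: "A \<subseteq> all_pairs V"
    have "(\<Sum>e\<in>A. - \<theta> * c e) = - \<theta> * real_of_int (\<Sum>v\<in>B. nsum A s v)"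
      unfolding sum_nsum_eq[OF V(1) A V(2)] c_def by (simp add: sum_distrib_left sum_negf)
    moreover have "0 \<le> - \<theta> * real_of_int (\<Sum>v\<in>B. nsum A s v)" if "(\<Sum>v\<in>B. nsum A s v) \<le> 0"
    proof -
      have "real_of_int (\<Sum>v\<in>B. nsum A s v) \<le> 0" using that by (simp only: of_int_le_0_iff)
      then show ?thesis using \<theta>(1) by (simp only: mult_minus_left neg_0_le_iff_le mult_nonneg_nonpos)
    qed
    ultimately show "of_bool ((\<Sum>v\<in>B. nsum A s v) \<le> 0) \<le> exp (\<Sum>e\<in>A. - \<theta> * c e)"
      by (cases "(\<Sum>v\<in>B. nsum A s v) \<le> 0") simp_all
  qed (use p in auto)
  also have "\<dots> = (\<Prod>e\<in>all_pairs V. 1 - p + p * exp (- \<theta> * c e))"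
    using V by (intro rexp_exp_sum) auto
  also have "\<dots> \<le> (\<Prod>e\<in>all_pairs V. exp (p * (- \<theta> * c e + 2 * \<theta>\<^sup>2 * k e)))"
  proof (intro prod_mono conjI)
    fix e assume e: "e \<in> all_pairs V"
    show "0 \<le> 1 - p + p * exp (- \<theta> * c e)" using p by (intro add_nonneg_nonneg) auto
    have "\<bar>- \<theta> * c e\<bar> \<le> 1 / 8 * 2" unfolding abs_mult using k[OF e] \<theta> by (intro mult_mono) auto
    then have "exp (- \<theta> * c e) \<le> 1 + (- \<theta> * c e) + (- \<theta> * c e)\<^sup>2" by (intro exp_le_quadratic) auto
    also have "(- \<theta> * c e)\<^sup>2 \<le> 2 * \<theta>\<^sup>2 * k e"
    proof -
      have "(c e)\<^sup>2 = \<bar>c e\<bar> * \<bar>c e\<bar>" by (simp add: power2_eq_square)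
      also have "\<dots> \<le> 2 * k e" using k[OF e] by (intro mult_mono) auto
      finally have "\<theta>\<^sup>2 * (c e)\<^sup>2 \<le> \<theta>\<^sup>2 * (2 * k e)" by (intro mult_left_mono) auto
      then show ?thesis by (simp add: power_mult_distrib)
    qed
    finally have "p * exp (- \<theta> * c e) \<le> p * (1 + (- \<theta> * c e) + 2 * \<theta>\<^sup>2 * k e)" using p by (intro mult_left_mono) auto
    then have "1 - p + p * exp (- \<theta> * c e) \<le> 1 + p * (- \<theta> * c e + 2 * \<theta>\<^sup>2 * k e)" by (simp add: algebra_simps)
    also have "\<dots> \<le> exp (p * (- \<theta> * c e + 2 * \<theta>\<^sup>2 * k e))" by (rule exp_ge_add_one_self)
    finally show "1 - p + p * exp (- \<theta> * c e) \<le> exp (p * (- \<theta> * c e + 2 * \<theta>\<^sup>2 * k e))" .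
  qed
  also have "\<dots> = exp (p * (- \<theta> * (\<Sum>e\<in>all_pairs V. c e) + 2 * \<theta>\<^sup>2 * (\<Sum>e\<in>all_pairs V. k e)))"
  proof -
    have "(\<Sum>e\<in>all_pairs V. p * (- \<theta> * c e + 2 * \<theta>\<^sup>2 * k e)) = p * (- \<theta> * (\<Sum>e\<in>all_pairs V. c e) + 2 * \<theta>\<^sup>2 * (\<Sum>e\<in>all_pairs V. k e))"
      by (simp only: sum_distrib_left[symmetric] sum.distrib)
    then show ?thesis using V by (simp only: exp_sum[symmetric] finite_all_pairs)
  qed
  also have "\<dots> \<le> exp (p * (- \<theta> * (b * S / 2) + 2 * \<theta>\<^sup>2 * (b * n)))"
  proof -
    have "\<theta> * (b * S / 2) \<le> \<theta> * (\<Sum>e\<in>all_pairs V. c e)" using \<theta>(1) c_sum by (rule mult_left_mono[rotated])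
    moreover have "2 * \<theta>\<^sup>2 * (\<Sum>e\<in>all_pairs V. k e) \<le> 2 * \<theta>\<^sup>2 * (b * n)" using k_sum by (intro mult_left_mono) auto
    ultimately have "- \<theta> * (\<Sum>e\<in>all_pairs V. c e) + 2 * \<theta>\<^sup>2 * (\<Sum>e\<in>all_pairs V. k e) \<le> - \<theta> * (b * S / 2) + 2 * \<theta>\<^sup>2 * (b * n)"
      by simp
    then show ?thesis unfolding exp_le_cancel_iff using p(1) by (rule mult_left_mono)
  qed
  also have "p * (- \<theta> * (b * S / 2) + 2 * \<theta>\<^sup>2 * (b * n)) = - (p * b * S\<^sup>2 / (32 * n))"
    using n0 by (simp add: \<theta>_def power2_eq_square field_simps)
  finally show ?thesis by (simp add: b_def n_def)
qed

section \<open>Union bounds over all configurations\<close>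

lemma sum_power_card:
  fixes z :: real
  assumes "finite V"
  shows "(\<Sum>B\<in>Pow V. z ^ card B) = (1 + z) ^ card V"
  using prod_add[OF assms, of "\<lambda>_. z" "\<lambda>_. 1"] by (simp add: add.commute)

lemma sum_Pow_Diff:
  assumes "finite V"
  shows "(\<Sum>P\<in>Pow V. f (card (V - P))) = (\<Sum>P\<in>Pow V. f (card P))"
  by (rule sum.reindex_bij_witness[of _ "\<lambda>P. V - P" "\<lambda>P. V - P"]) (auto simp: double_diff)

text \<open>A configuration is represented by its set of positive vertices, so that the union bound
  over configurations is a sum over \<open>Pow V\<close>.\<close>

definition spin :: "'v set \<Rightarrow> 'v \<Rightarrow> int" where
  "spin P x = (if x \<in> P then 1 else -1)"

text \<open>A set \<open>B\<close> on which the neighbourhood sums add up to at most zero although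
  the configuration \<open>P\<close> favours 1. Ranging over all \<open>P\<close> allows the
  statement to be applied to opinions that depend on the graph.\<close>

definition sparse_fail :: "'v set \<Rightarrow> ('v set \<Rightarrow> 'v set \<Rightarrow> bool) \<Rightarrow> 'v set set \<Rightarrow> bool" where
  "sparse_fail V cond A \<longleftrightarrow> (\<exists>P B. P \<subseteq> V \<and> B \<subseteq> V \<and> cond P B \<and> (\<Sum>v\<in>B. nsum A (spin P) v) \<le> 0)"

lemma spin_sum_card:
  assumes V: "finite V" "P \<subseteq> V"
  shows "(\<Sum>x\<in>V. spin P x) = 2 * int (card P) - int (card V)"
proof -
  have fP: "finite P" using V finite_subset by auto
  have "(\<Sum>x\<in>V. spin P x) = (\<Sum>x\<in>V - P. spin P x) + (\<Sum>x\<in>P. spin P x)" using V by (intro sum.subset_diff)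
  also have "\<dots> = - int (card (V - P)) + int (card P)" by (simp add: spin_def)
  moreover have "card V = card P + card (V - P)" using V fP by (metis card_Diff_subset card_mono le_add_diff_inverse)
  ultimately show ?thesis by simp
qed

lemma spin_sum:
  assumes V: "finite V" "P \<subseteq> V"
  shows "real_of_int (\<Sum>x\<in>V. spin P x) = real (card V) - 2 * real (card (V - P))"
proof -
  have "card V = card P + card (V - P)"
    using V by (metis card_Diff_subset card_mono finite_subset le_add_diff_inverse)
  then show ?thesis unfolding spin_sum_card[OF V] by simp
qed

lemma sparse_fail_prob:
  fixes p :: real and \<beta> :: "'v set \<Rightarrow> 'v set \<Rightarrow> real"
  assumes V: "finite V" and p: "0 \<le> p" "p \<le> 1"
    and cond: "\<And>P B. P \<subseteq> V \<Longrightarrow> B \<subseteq> V \<Longrightarrow> cond P B \<Longrightarrow> 2 \<le> real_of_int (\<Sum>x\<in>V. spin P x) \<and>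
      exp (- (p * real (card B) * (real_of_int (\<Sum>x\<in>V. spin P x))\<^sup>2 / (32 * real (card V)))) \<le> \<beta> P B"
    and \<beta>: "\<And>P B. 0 \<le> \<beta> P B"
  shows "rexp (\<lambda>_. p) (all_pairs V) (\<lambda>A. of_bool (sparse_fail V cond A)) \<le> (\<Sum>P\<in>Pow V. \<Sum>B\<in>Pow V. \<beta> P B)"
proof -
  have "rexp (\<lambda>_. p) (all_pairs V) (\<lambda>A. of_bool (sparse_fail V cond A)) \<le>
    rexp (\<lambda>_. p) (all_pairs V) (\<lambda>A. \<Sum>P\<in>Pow V. \<Sum>B\<in>Pow V. of_bool (cond P B \<and> (\<Sum>v\<in>B. nsum A (spin P) v) \<le> 0))"
  proof (rule rexp_mono)
    fix A
    show "of_bool (sparse_fail V cond A) \<le> (\<Sum>P\<in>Pow V. \<Sum>B\<in>Pow V. of_bool (cond P B \<and> (\<Sum>v\<in>B. nsum A (spin P) v) \<le> 0) :: real)"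
    proof (cases "sparse_fail V cond A")
      case True
      then obtain P B where PB: "P \<in> Pow V" "B \<in> Pow V" "cond P B" "(\<Sum>v\<in>B. nsum A (spin P) v) \<le> 0"
        unfolding sparse_fail_def by blast
      have "1 = (of_bool (cond P B \<and> (\<Sum>v\<in>B. nsum A (spin P) v) \<le> 0) :: real)" using PB by simp
      also have "\<dots> \<le> (\<Sum>B\<in>Pow V. of_bool (cond P B \<and> (\<Sum>v\<in>B. nsum A (spin P) v) \<le> 0))"
        using V PB(2) by (intro member_le_sum) auto
      also have "\<dots> \<le> (\<Sum>P\<in>Pow V. \<Sum>B\<in>Pow V. of_bool (cond P B \<and> (\<Sum>v\<in>B. nsum A (spin P) v) \<le> 0))"
        using V PB(1) by (intro member_le_sum[where f = "\<lambda>P. \<Sum>B\<in>Pow V. of_bool (cond P B \<and> (\<Sum>v\<in>B. nsum A (spin P) v) \<le> 0)"] sum_nonneg) auto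
      finally show ?thesis by (simp add: True)
    next
      case False
      then show ?thesis by (simp add: sum_nonneg)
    qed
  qed (use p in auto)
  also have "\<dots> = (\<Sum>P\<in>Pow V. \<Sum>B\<in>Pow V. rexp (\<lambda>_. p) (all_pairs V) (\<lambda>A. of_bool (cond P B \<and> (\<Sum>v\<in>B. nsum A (spin P) v) \<le> 0)))"
    unfolding rexp_sum ..
  also have "\<dots> \<le> (\<Sum>P\<in>Pow V. \<Sum>B\<in>Pow V. \<beta> P B)"
  proof (intro sum_mono)
    fix P B assume PB: "P \<in> Pow V" "B \<in> Pow V"
    show "rexp (\<lambda>_. p) (all_pairs V) (\<lambda>A. of_bool (cond P B \<and> (\<Sum>v\<in>B. nsum A (spin P) v) \<le> 0)) \<le> \<beta> P B"
    proof (cases "cond P B")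
      case True
      have c: "2 \<le> real_of_int (\<Sum>x\<in>V. spin P x)"
        "exp (- (p * real (card B) * (real_of_int (\<Sum>x\<in>V. spin P x))\<^sup>2 / (32 * real (card V)))) \<le> \<beta> P B"
        using cond[OF _ _ True] PB by auto
      have "rexp (\<lambda>_. p) (all_pairs V) (\<lambda>A. of_bool ((\<Sum>v\<in>B. nsum A (spin P) v) \<le> 0)) \<le>
         exp (- (p * real (card B) * (real_of_int (\<Sum>x\<in>V. spin P x))\<^sup>2 / (32 * real (card V))))"
        using V PB p c(1) by (intro expander_prob) (auto simp: spin_def)
      then show ?thesis using True c(2) by simp
    next
      case False
      then show ?thesis using V \<beta> by (simp add: rexp_const)
    qed
  qed
  finally show ?thesis .
qed

text \<open>Makes the exponent in \<open>expander_prob\<close> at least \<open>3 * n\<close>, which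
  beats the \<open>4 ^ n\<close> choices of the pair \<open>P\<close>, \<open>B\<close>.\<close>

definition dense_cond :: "'v set \<Rightarrow> real \<Rightarrow> 'v set \<Rightarrow> 'v set \<Rightarrow> bool" where
  "dense_cond V p P B \<longleftrightarrow> 2 \<le> real_of_int (\<Sum>x\<in>V. spin P x) \<and>
     100 * (real (card V))\<^sup>2 \<le> p * real (card B) * (real_of_int (\<Sum>x\<in>V. spin P x))\<^sup>2"

text \<open>For small minorities the number of choices is only about \<open>n\<close> to the power
  \<open>card B + card (V - P)\<close>. Since the bias is at least \<open>n / 2\<close>, the
  exponent is at least \<open>p * n * card B / 128\<close>, and the condition makes it exceed the
  logarithm of that number.\<close>

definition few_cond :: "'v set \<Rightarrow> real \<Rightarrow> 'v set \<Rightarrow> 'v set \<Rightarrow> bool" where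
  "few_cond V p P B \<longleftrightarrow> 4 * real (card (V - P)) \<le> real (card V) \<and>
     1000 * (real (card B) + real (card (V - P)) + 1) * ln (real (card V)) \<le> p * real (card V) * real (card B)"

lemma dense_fail_prob:
  fixes p :: real
  assumes V: "finite V" "V \<noteq> {}" and p: "0 \<le> p" "p \<le> 1"
  shows "rexp (\<lambda>_. p) (all_pairs V) (\<lambda>A. of_bool (sparse_fail V (dense_cond V p) A)) \<le> exp (- real (card V))"
proof -
  define n where "n = card V"
  have n0: "n > 0" using V by (simp add: n_def card_gt_0_iff)
  have "rexp (\<lambda>_. p) (all_pairs V) (\<lambda>A. of_bool (sparse_fail V (dense_cond V p) A)) \<le> (\<Sum>P\<in>Pow V. \<Sum>B\<in>Pow V. exp (- (3 * real n)))"
  proof (rule sparse_fail_prob[OF V(1) p])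
    fix P B assume c: "dense_cond V p P B"
    define S where "S = real_of_int (\<Sum>x\<in>V. spin P x)"
    have "100 * (real n)\<^sup>2 \<le> p * real (card B) * S\<^sup>2" using c by (simp add: dense_cond_def S_def n_def)
    then have "100 * (real n)\<^sup>2 / (32 * real n) \<le> p * real (card B) * S\<^sup>2 / (32 * real n)" by (intro divide_right_mono) auto
    moreover have "3 * real n \<le> 100 * (real n)\<^sup>2 / (32 * real n)" using n0 by (simp add: power2_eq_square)
    ultimately show "2 \<le> real_of_int (\<Sum>x\<in>V. spin P x) \<and> exp (- (p * real (card B) * (real_of_int (\<Sum>x\<in>V. spin P x))\<^sup>2 / (32 * real (card V)))) \<le> exp (- (3 * real n))"
      using c unfolding dense_cond_def S_def[symmetric] n_def[symmetric] by auto
  qed auto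
  also have "\<dots> = 2 ^ n * (2 ^ n * exp (- (3 * real n)))" using V(1) by (simp add: card_Pow n_def)
  also have "\<dots> \<le> exp (- real n)"
  proof -
    have "(2::real) \<le> exp 1" using exp_ge_add_one_self[of 1] by simp
    then have "(2::real) ^ n \<le> exp 1 ^ n" by (intro power_mono) auto
    then have e: "(2::real) ^ n \<le> exp (real n)" by (simp add: exp_of_nat_mult[symmetric])
    have "2 ^ n * (2 ^ n * exp (- (3 * real n))) \<le> exp (real n) * (exp (real n) * exp (- (3 * real n)))"
      using e by (intro mult_mono) auto
    also have "\<dots> = exp (- real n)" by (simp flip: exp_add)
    finally show ?thesis .
  qed
  finally show ?thesis by (simp add: n_def)
qed

lemma few_fail_prob:
  fixes p :: real
  assumes V: "finite V" "4 \<le> card V" and p: "0 \<le> p" "p \<le> 1"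
  shows "rexp (\<lambda>_. p) (all_pairs V) (\<lambda>A. of_bool (sparse_fail V (few_cond V p) A)) \<le> 9 / real (card V)"
proof -
  define n where "n = real (card V)"
  have n: "4 \<le> n" using V by (simp add: n_def)
  \<comment> \<open>Each element of \<open>B\<close> and of \<open>V - P\<close> carries the weight
    \<open>1 / n\<close>, and one further factor \<open>z\<close> remains. The union bound sums to
    \<open>z * (1 + z) ^ (2 * card V) \<le> 9 * z\<close> without sorting the sets by size.\<close>
  define z where "z = 1 / n"
  have z: "0 < z" "z = exp (- ln n)" using n by (auto simp: z_def exp_minus inverse_eq_divide)
  have "rexp (\<lambda>_. p) (all_pairs V) (\<lambda>A. of_bool (sparse_fail V (few_cond V p) A)) \<le> (\<Sum>P\<in>Pow V. \<Sum>B\<in>Pow V. z * (z ^ card (V - P) * z ^ card B))"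
  proof (rule sparse_fail_prob[OF V(1) p])
    fix P B assume P: "P \<subseteq> V" and c: "few_cond V p P B"
    define S where "S = real_of_int (\<Sum>x\<in>V. spin P x)"
    define b h where "b = real (card B)" and "h = real (card (V - P))"
    have S: "S = n - 2 * h" unfolding S_def n_def h_def by (rule spin_sum[OF V(1) P])
    have h: "4 * h \<le> n" "1000 * (b + h + 1) * ln n \<le> p * n * b" using c by (auto simp: few_cond_def h_def b_def n_def)
    have S2: "n / 2 \<le> S" using S h by linarith
    have ln0: "0 \<le> ln n" using n by simp
    have bh: "0 \<le> b" "0 \<le> h" by (auto simp: b_def h_def)
    have "(b + h + 1) * ln n \<le> p * b * S\<^sup>2 / (32 * n)"
    proof -
      have "(n / 2)\<^sup>2 \<le> S\<^sup>2" using S2 n by (intro power_mono) auto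
      then have "p * b * (n / 2)\<^sup>2 / (32 * n) \<le> p * b * S\<^sup>2 / (32 * n)"
        using p bh n by (intro divide_right_mono mult_left_mono) auto
      moreover have "p * b * (n / 2)\<^sup>2 / (32 * n) = p * n * b / 128" using n by (simp add: power2_eq_square field_simps)
      moreover have "0 \<le> (b + h + 1) * ln n" using bh ln0 by simp
      moreover have "1000 * ((b + h + 1) * ln n) \<le> p * n * b" using h(2) by (simp only: mult.assoc)
      ultimately show ?thesis by linarith
    qed
    then have "exp (- (p * b * S\<^sup>2 / (32 * n))) \<le> exp (- ((b + h + 1) * ln n))" by simp
    also have "\<dots> = exp (- ln n) * (exp (- ln n) ^ card (V - P) * exp (- ln n) ^ card B)"
      by (simp add: exp_of_nat_mult[symmetric] b_def h_def algebra_simps flip: exp_add)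
    finally show "2 \<le> real_of_int (\<Sum>x\<in>V. spin P x) \<and> exp (- (p * real (card B) * (real_of_int (\<Sum>x\<in>V. spin P x))\<^sup>2 / (32 * real (card V)))) \<le> z * (z ^ card (V - P) * z ^ card B)"
      using S2 n unfolding S_def[symmetric] b_def[symmetric] n_def[symmetric] z(2)[symmetric] by auto
  qed (use z in auto)
  also have "\<dots> = z * ((\<Sum>P\<in>Pow V. z ^ card (V - P)) * (\<Sum>B\<in>Pow V. z ^ card B))"
    unfolding sum_distrib_right by (simp only: sum_distrib_left)
  also have "\<dots> = z * ((1 + z) ^ card V * (1 + z) ^ card V)"
    unfolding sum_Pow_Diff[OF V(1), of "\<lambda>k. z ^ k"] sum_power_card[OF V(1)] ..
  also have "\<dots> \<le> z * (3 * 3)"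
  proof -
    have "(1 + z) ^ card V \<le> exp z ^ card V" using z exp_ge_add_one_self[of z] by (intro power_mono) auto
    also have "\<dots> = exp (n * z)" by (simp add: exp_of_nat_mult[symmetric] n_def)
    also have "n * z = 1" using n by (simp add: z_def)
    also have "exp 1 \<le> (3 :: real)" by (rule exp_le)
    finally show ?thesis using z by (intro mult_left_mono mult_mono) auto
  qed
  finally show ?thesis by (simp add: z_def n_def)
qed

lemma majority_step_bad_set:
  assumes A: "A \<subseteq> all_pairs V" "finite V" and t: "\<forall>x\<in>V. t x = 1 \<or> t x = -1"
    and P: "P = {x\<in>V. t x = 1}" and B: "B = {v\<in>V. nsum A t v \<le> 0}"
  shows "(\<Sum>x\<in>V. spin P x) = (\<Sum>x\<in>V. t x)" "C \<subseteq> B \<Longrightarrow> (\<Sum>v\<in>C. nsum A (spin P) v) \<le> 0"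
    "{x\<in>V. majority_step A t x \<noteq> 1} \<subseteq> B"
proof -
  have e: "spin P x = t x" if "x \<in> V" for x using t that by (auto simp: spin_def P)
  then show "(\<Sum>x\<in>V. spin P x) = (\<Sum>x\<in>V. t x)" by simp
  have "nsum A (spin P) v = nsum A t v" for v
    unfolding nsum_def using neighbours_subset[OF A(1), of v] e by (intro sum.cong) auto
  then show "(\<Sum>v\<in>C. nsum A (spin P) v) \<le> 0" if "C \<subseteq> B" using that by (intro sum_nonpos) (auto simp: B)
  show "{x\<in>V. majority_step A t x \<noteq> 1} \<subseteq> B"
  proof
    fix x assume x: "x \<in> {x\<in>V. majority_step A t x \<noteq> 1}"
    then have "\<not> thr (t x) \<le> nsum A t x" using majority_step_iff(1)[of t x A] t by (auto simp: nsum_def)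
    then show "x \<in> B" using x by (auto simp: B thr_def split: if_splits)
  qed
qed

text \<open>Each day the vertices that do not become 1 lie in the set \<open>B t\<close> of
  nonpositive sums, so a bound for that set is a bound for the next minority. \<open>dense\<close>
  is used twice, the second time with bias at least \<open>3 / 4 * n\<close>; \<open>few\<close>
  takes over once the minority is below \<open>n / 4\<close>. In \<open>q\<close> the number 402000
  is 2000 * 201.\<close>

lemma unanimity:
  fixes p Lo q :: real
  assumes A: "A \<subseteq> all_pairs V" and V: "finite V" "4 \<le> card V"
    and f1: "\<not> sparse_fail V (dense_cond V p) A" and f2: "\<not> sparse_fail V (few_cond V p) A"
    and t: "\<forall>x\<in>V. t x = 1 \<or> t x = -1"
    and p: "0 < p" "p \<le> 1" and Lo: "2 \<le> Lo" "Lo \<le> real_of_int (\<Sum>x\<in>V. t x)" "800 * real (card V) \<le> p * Lo\<^sup>2"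
    and n: "800 \<le> p * real (card V)" "2000 * ln (real (card V)) \<le> p * real (card V)"
    and q: "q = 402000 * ln (real (card V)) / (p * (p * real (card V)))" "4 * q \<le> real (card V)" "1000 * (2 + q) * ln (real (card V)) < p * real (card V)"
    and v: "v \<in> V"
  shows "majority_step A (majority_step A (majority_step A (majority_step A t))) v = 1"
proof -
  define n where "n = real (card V)"
  have n4: "4 \<le> n" using V by (simp add: n_def)
  have ln0: "0 < ln n" using n4 by simp
  define t3 t4 t5 where "t3 = majority_step A t" and "t4 = majority_step A t3" and "t5 = majority_step A t4"
  define P where "P = (\<lambda>t :: 'a \<Rightarrow> int. {x\<in>V. t x = 1})"
  define B where "B = (\<lambda>t :: 'a \<Rightarrow> int. {v\<in>V. nsum A t v \<le> 0})"
  have pm: "\<forall>x\<in>V. t3 x = 1 \<or> t3 x = -1" "\<forall>x\<in>V. t4 x = 1 \<or> t4 x = -1" "\<forall>x\<in>V. t5 x = 1 \<or> t5 x = -1"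
    unfolding t3_def t4_def t5_def using t by (auto intro!: majority_step_iff(2))
  have BV: "B t \<subseteq> V" "finite (B t)" "P t \<subseteq> V" for t using V by (auto simp: B_def P_def)
  have PB_eq: "P t = {x\<in>V. t x = 1}" "B t = {v\<in>V. nsum A t v \<le> 0}" for t by (simp_all add: P_def B_def)
  have VP: "real (card (V - P (majority_step A t))) \<le> real (card (B t))" if "\<forall>x\<in>V. t x = 1 \<or> t x = -1" for t
  proof -
    have "V - P (majority_step A t) \<subseteq> B t"
      using majority_step_bad_set(3)[of A V t, OF A V(1) that refl refl] by (auto simp: P_def B_def)
    then show ?thesis using BV by (simp add: card_mono)
  qed
  have dense: "p * real (card (B t)) * (real_of_int (\<Sum>x\<in>V. t x))\<^sup>2 < 100 * n\<^sup>2"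
    if t: "\<forall>x\<in>V. t x = 1 \<or> t x = -1" and S: "2 \<le> real_of_int (\<Sum>x\<in>V. t x)" for t
  proof (rule ccontr)
    note b = majority_step_bad_set[of A V t "P t" "B t", OF A V(1) t PB_eq]
    assume "\<not> ?thesis"
    moreover have "(\<Sum>x\<in>V. spin (P t) x) = (\<Sum>x\<in>V. t x)"
      by (rule b(1))
    ultimately have "dense_cond V p (P t) (B t)" using S unfolding dense_cond_def by (simp add: n_def del: of_int_sum)
    then have "sparse_fail V (dense_cond V p) A"
      unfolding sparse_fail_def using BV(1,3) b(2)[OF order_refl] by (intro exI[of _ "P t"] exI[of _ "B t"]) simp
    then show False using f1 by simp
  qed
  have few: "p * n * real (card C) < 1000 * (real (card C) + real (card (V - P t)) + 1) * ln n"
    if t: "\<forall>x\<in>V. t x = 1 \<or> t x = -1" and S: "4 * real (card (V - P t)) \<le> n" and C: "C \<subseteq> B t" for t C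
  proof (rule ccontr)
    note b = majority_step_bad_set[of A V t "P t" "B t", OF A V(1) t PB_eq]
    assume "\<not> ?thesis"
    then have "few_cond V p (P t) C" using S unfolding few_cond_def by (simp add: n_def)
    moreover have "C \<subseteq> V" using C BV(1) by (rule order_trans)
    ultimately have "sparse_fail V (few_cond V p) A"
      unfolding sparse_fail_def using BV(3) b(2)[OF C] by (intro exI[of _ "P t"] exI[of _ C]) simp
    then show False using f2 by simp
  qed
  have sumP: "real_of_int (\<Sum>x\<in>V. t x) = n - 2 * real (card (V - P t))" if t: "\<forall>x\<in>V. t x = 1 \<or> t x = -1" for t
    using spin_sum[OF V(1) BV(3), of t] majority_step_bad_set(1)[of A V t "P t" "B t", OF A V(1) t PB_eq] by (simp add: n_def)
  define b2 b3 b4 where "b2 = real (card (B t))" and "b3 = real (card (B t3))" and "b4 = real (card (B t4))"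
  have b2: "b2 < n / 8"
  proof -
    have "p * Lo\<^sup>2 \<le> p * (real_of_int (\<Sum>x\<in>V. t x))\<^sup>2" using Lo p by (intro mult_left_mono power_mono) auto
    then have "800 * n \<le> p * (real_of_int (\<Sum>x\<in>V. t x))\<^sup>2" using Lo(3) by (simp add: n_def)
    then have "b2 * (800 * n) \<le> b2 * (p * (real_of_int (\<Sum>x\<in>V. t x))\<^sup>2)" by (intro mult_left_mono) (auto simp: b2_def)
    also have "\<dots> = p * b2 * (real_of_int (\<Sum>x\<in>V. t x))\<^sup>2" by simp
    also have "\<dots> < 100 * n\<^sup>2" unfolding b2_def using Lo by (intro dense[OF t]) auto
    finally have "(b2 * 8) * (100 * n) < n * (100 * n)" by (simp add: power2_eq_square mult_ac)
    then show ?thesis using n4 by (simp add: mult_less_cancel_right_pos)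
  qed
  have b3: "p * b3 < 200"
  proof -
    have S: "3 / 4 * n \<le> real_of_int (\<Sum>x\<in>V. t3 x)"
      using sumP[OF pm(1)] VP[OF t] b2 unfolding t3_def[symmetric] b2_def by linarith
    have "p * b3 * (3 / 4 * n)\<^sup>2 \<le> p * b3 * (real_of_int (\<Sum>x\<in>V. t3 x))\<^sup>2"
      using S n4 p by (intro mult_left_mono power_mono) (auto simp: b3_def)
    also have "\<dots> < 100 * n\<^sup>2" unfolding b3_def using S n4 by (intro dense pm(1)) auto
    finally have "(p * b3 * 9) * n\<^sup>2 < 1600 * n\<^sup>2" by (simp add: power_mult_distrib power_divide)
    then have "p * b3 * 9 < 1600" by (rule mult_right_less_imp_less) simp
    then show ?thesis by simp
  qed
  have b4: "b4 \<le> q"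
  proof -
    have "p * (4 * b3) \<le> p * n" using b3 n(1) by (simp add: n_def)
    then have S: "4 * b3 \<le> n" using p by simp
    have h: "real (card (V - P t4)) \<le> b3" using VP[OF pm(1)] unfolding t4_def[symmetric] b3_def .
    have "p * n * b4 < 1000 * (b4 + real (card (V - P t4)) + 1) * ln n"
      unfolding b4_def using S h by (intro few pm(2)) auto
    also have "\<dots> \<le> 1000 * (b4 + b3 + 1) * ln n" using h ln0 by (intro mult_right_mono mult_left_mono) auto
    also have "\<dots> = 1000 * ln n * b4 + 1000 * (b3 + 1) * ln n" by (simp add: algebra_simps)
    \<comment> \<open>Half of the left-hand side absorbs the part of the logarithmic term that is
      proportional to \<open>b4\<close>; this is the purpose of
      \<open>2000 * ln n \<le> p * n\<close>.\<close>
    also have "1000 * ln n * b4 \<le> p * n / 2 * b4" using n(2) by (intro mult_right_mono) (auto simp: n_def b4_def)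
    finally have "p * n * b4 < p * n / 2 * b4 + 1000 * (b3 + 1) * ln n" by simp
    moreover have "p * n / 2 * b4 = p * n * b4 / 2" "2000 * (b3 + 1) * ln n = 2 * (1000 * (b3 + 1) * ln n)" by simp_all
    ultimately have "p * n * b4 < 2000 * (b3 + 1) * ln n" by linarith
    then have "p * (p * n * b4) \<le> p * (2000 * (b3 + 1) * ln n)" using p by (intro mult_left_mono) auto
    also have "\<dots> = 2000 * (p * b3 + p) * ln n" by (simp add: algebra_simps)
    also have "\<dots> \<le> 2000 * 201 * ln n" using b3 p ln0 by (intro mult_right_mono mult_left_mono) auto
    finally have "p * (p * n) * b4 \<le> 402000 * ln n" by (simp add: mult_ac)
    moreover have "0 < p * (p * n)" using p n4 by simp
    ultimately show ?thesis unfolding q(1) n_def[symmetric] by (simp add: pos_le_divide_eq mult.commute)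
  qed
  have "B t5 = {}"
  proof (rule ccontr)
    assume "B t5 \<noteq> {}"
    \<comment> \<open>A single bad vertex suffices: \<open>few\<close> for a one-element set
      contradicts the last condition on \<open>q\<close>.\<close>
    then obtain x where x: "{x} \<subseteq> B t5" by auto
    have h: "real (card (V - P t5)) \<le> b4" using VP[OF pm(2)] unfolding t5_def[symmetric] b4_def .
    have "p * n * real (card {x}) < 1000 * (real (card {x}) + real (card (V - P t5)) + 1) * ln n"
      using x h b4 q(2) by (intro few pm(3)) (auto simp: n_def)
    also have "\<dots> \<le> 1000 * (2 + q) * ln n" using h b4 ln0 by (intro mult_right_mono mult_left_mono) auto
    finally show False using q(3) by (simp add: n_def)
  qed
  then have "majority_step A t5 v = 1"
    using majority_step_bad_set(3)[of A V t5, OF A V(1) pm(3) refl refl] v unfolding B_def by blast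
  then show ?thesis by (simp add: t3_def t4_def t5_def)
qed

section \<open>The six days\<close>

lemma majority_dynamics_uminus:
  "majority_dynamics A (\<lambda>x. - s x) k v = - majority_dynamics A s k v"
proof (induction k arbitrary: v)
  case (Suc k)
  have "majority_dynamics A (\<lambda>x. - s x) k = (\<lambda>v. - majority_dynamics A s k v)" using Suc by blast
  then show ?case by (simp add: majority_step_uminus)
qed simp

lemma majority_dynamics_6:
  "majority_dynamics A s 6 = majority_step A (majority_step A (majority_step A (majority_step A (maj2 A s))))"
  by (simp add: numeral_eq_Suc maj2_def)

lemma majority_dynamics_cong:
  assumes "A \<subseteq> all_pairs V" "\<And>x. x \<in> V \<Longrightarrow> s x = s' x" "v \<in> V"
  shows "majority_dynamics A s k v = majority_dynamics A s' k v"
  using assms(3)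
proof (induction k arbitrary: v)
  case (Suc k)
  have "majority_step A (majority_dynamics A s k) v = majority_step A (majority_dynamics A s' k) v"
    by (rule majority_step_cong) (use Suc neighbours_subset[OF assms(1), of v] in auto)
  then show ?case by simp
qed (use assms(2) in simp)

lemma mean_const_pos:
  assumes "1 \<le> L" "1 \<le> C" "0 < c"
  shows "0 < mean_const L C c"
proof -
  have "0 \<le> half_const L C" using assms by (simp add: half_const_def)
  then have "0 \<le> spread_const L C (edge_const L)" using assms unfolding spread_const_def edge_const_def by simp
  then show ?thesis unfolding mean_const_def gap_const_def
    using local_const_pos[of "spread_const L C (edge_const L)"] local_const_pos[of 1] assms by simp
qed

text \<open>\<open>Lo\<close> is half of the proved lower bound for the mean, so a deviation below
  \<open>Lo\<close> leaves a bias of at least \<open>Lo\<close>. Its square is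
  \<open>\<kappa>^2 * n * M^2 / 4\<close>, and dividing the variance bound by it leaves a multiple
  of \<open>1 / sqrt M\<close>.\<close>

lemma win_prob:
  fixes m L C p c M q \<kappa> :: real
  assumes reg: "regime m L C V s p" and m: "gap_min L C (edge_const L) \<le> m" "triple_min L C \<le> m" and LC: "1 \<le> L" "1 \<le> C"
    and c: "0 < c" "c * sqrt (real (card V)) \<le> real_of_int (\<Sum>x\<in>V. s x)"
    and M: "M = real (card V) * p" and \<kappa>: "\<kappa> = mean_const L C c"
    and card4: "4 \<le> card V"
    and Lo: "Lo = \<kappa> * (real (card V) * (sqrt (real (card V)) * p)) / 2" "2 \<le> Lo" "800 * real (card V) \<le> p * Lo\<^sup>2"
    and M_ge: "800 \<le> M" "2000 * ln (real (card V)) \<le> M"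
    and q: "q = 402000 * ln (real (card V)) / (p * M)" "4 * q \<le> real (card V)" "1000 * (2 + q) * ln (real (card V)) < M"
  shows "rexp (\<lambda>_. p) (all_pairs V) (\<lambda>A. of_bool (\<not> (\<forall>v\<in>V. majority_dynamics A s 6 v = 1)))
    \<le> exp (- real (card V)) + 9 / real (card V) + 12800000 / (\<kappa>\<^sup>2 * sqrt M)"
proof -
  define n where "n = real (card V)"
  have p: "0 < p" "p \<le> 1" and fV: "finite V" and sV: "\<And>x. x \<in> V \<Longrightarrow> s x = 1 \<or> s x = -1"
    using reg unfolding regime_def by auto
  have n4: "4 \<le> n" using card4 by (simp add: n_def)
  have \<kappa>0: "0 < \<kappa>" using mean_const_pos[OF LC c(1)] by (simp add: \<kappa>)
  define f where "f = (\<lambda>A. real_of_int (\<Sum>v\<in>V. maj2 A s v))"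
  let ?E = "\<lambda>g. rexp (\<lambda>_. p) (all_pairs V) g"
  have mean: "2 * Lo \<le> ?E f" using maj2_mean[OF reg m(1) LC c] unfolding Lo(1) \<kappa> f_def by simp
  have var: "?E (\<lambda>A. of_bool (Lo \<le> \<bar>f A - ?E f\<bar>)) \<le> 12800000 / (\<kappa>\<^sup>2 * sqrt M)"
  proof -
    have M0: "0 < M" using M_ge by linarith
    have "?E (\<lambda>A. of_bool (Lo \<le> \<bar>f A - ?E f\<bar>)) \<le> rvar (\<lambda>_. p) (all_pairs V) f / Lo\<^sup>2"
      using fV p Lo(2) by (intro chebyshev_rexp) auto
    also have "\<dots> \<le> 3200000 * (n * M * sqrt M) / Lo\<^sup>2"
      using maj2_variance[OF reg m(2) LC M] unfolding f_def n_def by (intro divide_right_mono) auto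
    also have "Lo\<^sup>2 = \<kappa>\<^sup>2 * n * (M * M) / 4"
      using n4 unfolding Lo(1) M n_def by (simp add: power_mult_distrib power_divide) (simp add: power2_eq_square)
    also have "3200000 * (n * M * sqrt M) / (\<kappa>\<^sup>2 * n * (M * M) / 4) = 12800000 / \<kappa>\<^sup>2 * (sqrt M / M)"
      using n4 M0 \<kappa>0 by (simp add: field_simps)
    also have "sqrt M / M = 1 / sqrt M"
      using M0 by (metis less_eq_real_def inverse_eq_divide inverse_divide real_div_sqrt)
    finally show ?thesis by simp
  qed
  have "?E (\<lambda>A. of_bool (\<not> (\<forall>v\<in>V. majority_dynamics A s 6 v = 1))) \<le>
    ?E (\<lambda>A. of_bool (sparse_fail V (dense_cond V p) A) + (of_bool (sparse_fail V (few_cond V p) A) + of_bool (Lo \<le> \<bar>f A - ?E f\<bar>)))"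
  proof (rule rexp_mono)
    fix A assume A: "A \<subseteq> all_pairs V"
    have "\<forall>v\<in>V. majority_dynamics A s 6 v = 1"
      if h: "\<not> sparse_fail V (dense_cond V p) A" "\<not> sparse_fail V (few_cond V p) A" "\<not> Lo \<le> \<bar>f A - ?E f\<bar>"
    proof
      fix v assume v: "v \<in> V"
      have "Lo \<le> real_of_int (\<Sum>x\<in>V. maj2 A s x)" using h(3) mean unfolding f_def by linarith
      then show "majority_dynamics A s 6 v = 1"
        unfolding majority_dynamics_6
        using sV M_ge q Lo p M
        by (intro unanimity[OF A fV card4 h(1,2) _ p(1,2) Lo(2) _ Lo(3) _ _ _ q(2) _ v]) (auto intro!: maj2_values simp: mult.commute)
    qed
    then show "of_bool (\<not> (\<forall>v\<in>V. majority_dynamics A s 6 v = 1)) \<le> of_bool (sparse_fail V (dense_cond V p) A) + (of_bool (sparse_fail V (few_cond V p) A) + of_bool (Lo \<le> \<bar>f A - ?E f\<bar>) :: real)"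
      by auto
  qed (use p in auto)
  also have "\<dots> \<le> exp (- n) + (9 / n + 12800000 / (\<kappa>\<^sup>2 * sqrt M))"
    unfolding rexp_add n_def using fV p card4 by (intro add_mono dense_fail_prob few_fail_prob var) auto
  finally show ?thesis by (simp add: n_def)
qed

lemma regime_uminus: "regime m L C V s p \<Longrightarrow> regime m L C V (\<lambda>x. - s x) p"
  by (auto simp: regime_def sum_negf)

lemma win_prob_sgn:
  fixes m L C p c M q \<kappa> :: real
  assumes reg: "regime m L C V s p" and m: "gap_min L C (edge_const L) \<le> m" "triple_min L C \<le> m" and LC: "1 \<le> L" "1 \<le> C"
    and c: "0 < c" "c * sqrt (real (card V)) \<le> \<bar>real_of_int (\<Sum>x\<in>V. s x)\<bar>"
    and M: "M = real (card V) * p" and \<kappa>: "\<kappa> = mean_const L C c"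
    and card4: "4 \<le> card V"
    and Lo: "Lo = \<kappa> * (real (card V) * (sqrt (real (card V)) * p)) / 2" "2 \<le> Lo" "800 * real (card V) \<le> p * Lo\<^sup>2"
    and M_ge: "800 \<le> M" "2000 * ln (real (card V)) \<le> M"
    and q: "q = 402000 * ln (real (card V)) / (p * M)" "4 * q \<le> real (card V)" "1000 * (2 + q) * ln (real (card V)) < M"
  shows "rexp (\<lambda>_. p) (all_pairs V) (\<lambda>A. of_bool (\<not> (\<forall>v\<in>V. majority_dynamics A s 6 v = sgn (\<Sum>x\<in>V. s x))))
    \<le> exp (- real (card V)) + 9 / real (card V) + 12800000 / (\<kappa>\<^sup>2 * sqrt M)"
proof -
  define S where "S = (\<Sum>x\<in>V. s x)"
  have "0 < real (card V)" using card4 by simp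
  then have "0 < c * sqrt (real (card V))" using c(1) by simp
  then have S0: "S \<noteq> 0" using c(2) unfolding S_def[symmetric] by auto
  show ?thesis
  proof (cases "0 < S")
    case True
    then have "c * sqrt (real (card V)) \<le> real_of_int (\<Sum>x\<in>V. s x)" using c(2) unfolding S_def by linarith
    from win_prob[OF reg m LC c(1) this M \<kappa> card4 Lo M_ge q] show ?thesis using True by (simp add: S_def)
  next
    case False
    then have neg: "S < 0" using S0 by simp
    then have "real_of_int S < 0" by simp
    then have "c * sqrt (real (card V)) \<le> - real_of_int S" using c(2) unfolding S_def by linarith
    also have "- real_of_int S = real_of_int (\<Sum>x\<in>V. - s x)" by (simp add: S_def sum_negf)
    finally have "c * sqrt (real (card V)) \<le> real_of_int (\<Sum>x\<in>V. - s x)" .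
    from win_prob[OF regime_uminus[OF reg] m LC c(1) this M \<kappa> card4 Lo M_ge q]
    show ?thesis using neg by (simp add: S_def majority_dynamics_uminus minus_equation_iff[of _ 1] eq_commute)
  qed
qed

section \<open>Translation from probability mass functions to weighted sums\<close>

lemma expectation_Pi_bernoulli:
  fixes q :: "'a \<Rightarrow> real" and f :: "'a set \<Rightarrow> real"
  assumes "finite I" "\<And>i. i \<in> I \<Longrightarrow> 0 \<le> q i \<and> q i \<le> 1"
  shows "measure_pmf.expectation (map_pmf (\<lambda>X. {e \<in> I. X e}) (Pi_pmf I False (\<lambda>i. bernoulli_pmf (q i)))) f = rexp q I f"
proof -
  let ?X = "\<lambda>S x. x \<in> S"
  let ?M = "Pi_pmf I False (\<lambda>i. bernoulli_pmf (q i))"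
  have "measure_pmf.expectation ?M (\<lambda>X. f {e \<in> I. X e}) = (\<Sum>X\<in>?X ` Pow I. f {e \<in> I. X e} * pmf ?M X)"
  proof (rule integral_measure_pmf_real)
    fix X assume "X \<in> set_pmf ?M"
    then have "X x = False" if "x \<notin> I" for x
      using assms(1) that by (auto simp: set_Pi_pmf PiE_dflt_def)
    then have "X = ?X {x. X x}" "{x. X x} \<subseteq> I" by auto
    then show "X \<in> ?X ` Pow I" by blast
  qed (use assms in auto)
  also have "\<dots> = (\<Sum>S\<in>Pow I. f {e \<in> I. e \<in> S} * pmf ?M (?X S))"
    by (subst sum.reindex) (auto simp: inj_on_def fun_eq_iff)
  also have "\<dots> = rexp q I f"
    unfolding rexp_def
  proof (rule sum.cong[OF refl])
    fix S assume S: "S \<in> Pow I"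
    have "pmf ?M (?X S) = (\<Prod>x\<in>I. pmf (bernoulli_pmf (q x)) (x \<in> S))"
      using assms(1) S by (subst pmf_Pi') auto
    also have "\<dots> = (\<Prod>x\<in>I - S. pmf (bernoulli_pmf (q x)) (x \<in> S)) * (\<Prod>x\<in>S. pmf (bernoulli_pmf (q x)) (x \<in> S))"
      using S assms(1) by (intro prod.subset_diff) auto
    also have "(\<Prod>x\<in>I - S. pmf (bernoulli_pmf (q x)) (x \<in> S)) = (\<Prod>x\<in>I - S. 1 - q x)"
      using assms(2) by (intro prod.cong) auto
    also have "(\<Prod>x\<in>S. pmf (bernoulli_pmf (q x)) (x \<in> S)) = (\<Prod>x\<in>S. q x)"
      using assms(2) S by (intro prod.cong) auto
    finally have "pmf ?M (?X S) = (\<Prod>x\<in>S. q x) * (\<Prod>x\<in>I - S. 1 - q x)" by (simp add: mult.commute)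
    moreover have "{e \<in> I. e \<in> S} = S" using S by auto
    ultimately show "f {e \<in> I. e \<in> S} * pmf ?M (?X S) = (\<Prod>x\<in>S. q x) * (\<Prod>x\<in>I - S. 1 - q x) * f S" by simp
  qed
  finally show ?thesis by simp
qed

lemma expectation_random_graph:
  fixes f :: "nat set set \<Rightarrow> real"
  assumes "0 \<le> p" "p \<le> 1"
  shows "measure_pmf.expectation (random_graph n p) f = rexp (\<lambda>_. p) (all_pairs {1..n}) f"
proof -
  have "vertex_pairs n = all_pairs {1..n}" by (simp add: vertex_pairs_def all_pairs_def)
  then show ?thesis unfolding random_graph_def using assms by (simp only:) (intro expectation_Pi_bernoulli, auto)
qed

text \<open>Uniform opinions amount to a random set of positive vertices with parameter 1/2. The
  dummy value 0 outside the vertex set has to be carried along.\<close>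

lemma expectation_random_opinions:
  fixes f :: "(nat \<Rightarrow> int) \<Rightarrow> real"
  shows "measure_pmf.expectation (random_opinions n) f =
    rexp (\<lambda>_. 1 / 2) {1..n} (\<lambda>P. f (\<lambda>x. if x \<in> {1..n} then spin P x else 0))"
proof -
  let ?V = "{1..n}"
  let ?X = "\<lambda>S x. if x \<in> ?V then spin S x else 0"
  have "measure_pmf.expectation (random_opinions n) f = (\<Sum>X\<in>?X ` Pow ?V. f X * pmf (random_opinions n) X)"
  proof (rule integral_measure_pmf_real)
    fix X assume X: "X \<in> set_pmf (random_opinions n)"
    have X0: "X x = 0" if "x \<notin> ?V" for x
      using X that unfolding random_opinions_def by (auto simp: set_Pi_pmf PiE_dflt_def)
    have X1: "X x = 1 \<or> X x = -1" if "x \<in> ?V" for x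
      using X that unfolding random_opinions_def by (auto simp: set_Pi_pmf PiE_dflt_def set_pmf_of_set)
    have "X = ?X {x\<in>?V. X x = 1}"
    proof
      fix x
      show "X x = ?X {x\<in>?V. X x = 1} x" using X0[of x] X1[of x] by (cases "x \<in> ?V") (auto simp: spin_def)
    qed
    then show "X \<in> ?X ` Pow ?V" by blast
  qed auto
  also have "\<dots> = (\<Sum>S\<in>Pow ?V. f (?X S) * pmf (random_opinions n) (?X S))"
  proof (subst sum.reindex)
    show "inj_on ?X (Pow ?V)"
    proof (rule inj_onI)
      fix S T assume ST: "S \<in> Pow ?V" "T \<in> Pow ?V" "?X S = ?X T"
      have "x \<in> S \<longleftrightarrow> x \<in> T" if "x \<in> ?V" for x
        using fun_cong[OF ST(3), of x] that by (auto simp: spin_def split: if_splits)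
      then show "S = T" using ST(1,2) by blast
    qed
  qed simp
  also have "\<dots> = rexp (\<lambda>_. 1 / 2) ?V (\<lambda>P. f (?X P))"
    unfolding rexp_def
  proof (rule sum.cong[OF refl])
    fix S assume S: "S \<in> Pow ?V"
    have "pmf (random_opinions n) (?X S) = (\<Prod>x\<in>?V. pmf (pmf_of_set {1, -1}) (?X S x))"
      unfolding random_opinions_def by (subst pmf_Pi') auto
    also have "\<dots> = (\<Prod>x\<in>?V. 1 / 2)"
      by (intro prod.cong) (auto simp: spin_def)
    also have "\<dots> = (\<Prod>x\<in>?V - S. 1 / 2) * (\<Prod>x\<in>S. 1 / 2)"
      using S by (intro prod.subset_diff) auto
    finally show "f (?X S) * pmf (random_opinions n) (?X S) = (\<Prod>i\<in>S. 1 / 2) * (\<Prod>i\<in>?V - S. 1 - 1 / 2) * f (?X S)"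
      by simp
  qed
  finally show ?thesis .
qed

lemma prob_pair_finite:
  fixes A :: "'a pmf" and B :: "'b pmf"
  assumes "finite (set_pmf A)" "finite (set_pmf B)"
  shows "measure_pmf.prob (pair_pmf A B) S =
    measure_pmf.expectation B (\<lambda>b. measure_pmf.expectation A (\<lambda>a. of_bool ((a, b) \<in> S)))"
proof -
  have "measure_pmf.prob (pair_pmf A B) S = measure_pmf.expectation (pair_pmf A B) (indicator S)" by simp
  also have "\<dots> = (\<Sum>x\<in>set_pmf A \<times> set_pmf B. indicator S x * pmf (pair_pmf A B) x)"
    using assms by (intro integral_measure_pmf_real) auto
  also have "\<dots> = (\<Sum>a\<in>set_pmf A. \<Sum>b\<in>set_pmf B. of_bool ((a, b) \<in> S) * (pmf A a * pmf B b))"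
    unfolding sum.cartesian_product by (intro sum.cong) (auto simp: pmf_pair indicator_def)
  also have "\<dots> = (\<Sum>b\<in>set_pmf B. (\<Sum>a\<in>set_pmf A. of_bool ((a, b) \<in> S) * pmf A a) * pmf B b)"
    by (subst sum.swap) (simp add: sum_distrib_right mult.assoc)
  also have "\<dots> = (\<Sum>b\<in>set_pmf B. measure_pmf.expectation A (\<lambda>a. of_bool ((a, b) \<in> S)) * pmf B b)"
    using assms by (intro sum.cong refl arg_cong2[where f = "(*)"] integral_measure_pmf_real[symmetric]) auto
  also have "\<dots> = measure_pmf.expectation B (\<lambda>b. measure_pmf.expectation A (\<lambda>a. of_bool ((a, b) \<in> S)))"
    using assms by (intro integral_measure_pmf_real[symmetric]) auto
  finally show ?thesis .
qed

text \<open>Anticoncentration: the imbalance determines the number of positive vertices, at most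
  \<open>c * sqrt n + 1\<close> integers are admissible, and each has probability at most
  \<open>4 / sqrt n\<close>.\<close>

lemma small_bias_prob:
  fixes c :: real
  assumes V: "finite V" "V \<noteq> {}" and c: "0 < c"
  shows "rexp (\<lambda>_. 1 / 2) V (\<lambda>P. of_bool (\<not> c * sqrt (real (card V)) \<le> \<bar>real_of_int (\<Sum>x\<in>V. spin P x)\<bar>)) \<le> 4 * c + 4 / sqrt (real (card V))"
proof -
  define n where "n = real (card V)"
  have n0: "0 < n" using V by (simp add: n_def card_gt_0_iff)
  define a b where "a = \<lceil>(n - c * sqrt n) / 2\<rceil>" and "b = \<lfloor>(n + c * sqrt n) / 2\<rfloor>"
  have "rexp (\<lambda>_. 1 / 2) V (\<lambda>P. of_bool (\<not> c * sqrt n \<le> \<bar>real_of_int (\<Sum>x\<in>V. spin P x)\<bar>)) \<le>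
    rexp (\<lambda>_. 1 / 2) V (\<lambda>P. \<Sum>k\<in>{a..b}. of_bool (int (card P) = k))"
  proof (rule rexp_mono)
    fix P assume P: "P \<subseteq> V"
    have e: "real_of_int (\<Sum>x\<in>V. spin P x) = 2 * real (card P) - n"
      unfolding spin_sum_card[OF V(1) P] n_def by simp
    have "int (card P) \<in> {a..b}" if "\<not> c * sqrt n \<le> \<bar>2 * real (card P) - n\<bar>"
    proof -
      have "(n - c * sqrt n) / 2 \<le> real (card P)" "real (card P) \<le> (n + c * sqrt n) / 2" using that by auto
      then show ?thesis unfolding a_def b_def by (simp add: ceiling_le_iff le_floor_iff)
    qed
    moreover have "(\<Sum>k\<in>{a..b}. of_bool (int (card P) = k)) = (of_bool (int (card P) \<in> {a..b}) :: real)"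
      by (simp add: of_bool_def)
    ultimately show "of_bool (\<not> c * sqrt n \<le> \<bar>real_of_int (\<Sum>x\<in>V. spin P x)\<bar>) \<le> (\<Sum>k\<in>{a..b}. of_bool (int (card P) = k) :: real)"
      unfolding e by auto
  qed auto
  also have "\<dots> = (\<Sum>k\<in>{a..b}. pcard (\<lambda>_. 1 / 2) V k)" unfolding pcard_def by (rule rexp_sum)
  also have "\<dots> \<le> (\<Sum>k\<in>{a..b}. 4 / sqrt n)"
  proof (rule sum_mono)
    fix k
    have "pcard (\<lambda>_. 1 / 2) V k \<le> 2 / sqrt (n / 4)"
      using V n0 by (intro pcard_le) (auto simp: n_def)
    then show "pcard (\<lambda>_. 1 / 2) V k \<le> 4 / sqrt n" by (simp add: real_sqrt_divide)
  qed
  also have "\<dots> = real (card {a..b}) * (4 / sqrt n)" by simp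
  also have "\<dots> \<le> (c * sqrt n + 1) * (4 / sqrt n)"
  proof (intro mult_right_mono)
    have "real_of_int b \<le> (n + c * sqrt n) / 2" "(n - c * sqrt n) / 2 \<le> real_of_int a"
      unfolding a_def b_def by (rule of_int_floor_le, rule le_of_int_ceiling)
    then have "real_of_int (b - a + 1) \<le> c * sqrt n + 1" by (simp add: field_simps)
    moreover have "0 \<le> c * sqrt n + 1" using c n0 by simp
    ultimately show "real (card {a..b}) \<le> c * sqrt n + 1" by (cases "a \<le> b + 1") auto
  qed (use n0 in auto)
  also have "\<dots> = 4 * c + 4 / sqrt n" using n0 by (simp add: field_simps)
  finally show ?thesis by (simp add: n_def)
qed

lemma large_bias_prob:
  fixes C :: real
  assumes V: "finite V" "V \<noteq> {}" and C: "0 < C"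
  shows "rexp (\<lambda>_. 1 / 2) V (\<lambda>P. of_bool (\<not> \<bar>real_of_int (\<Sum>x\<in>V. spin P x)\<bar> \<le> C * sqrt (real (card V)))) \<le> 1 / C\<^sup>2"
proof -
  define n where "n = real (card V)"
  have n0: "0 < n" using V by (simp add: n_def card_gt_0_iff)
  have mean: "rexp (\<lambda>_. 1 / 2) V (\<lambda>P. real (card P)) = n / 2" using V by (simp add: rexp_card n_def)
  have "rexp (\<lambda>_. 1 / 2) V (\<lambda>P. of_bool (\<not> \<bar>real_of_int (\<Sum>x\<in>V. spin P x)\<bar> \<le> C * sqrt n)) \<le>
    rexp (\<lambda>_. 1 / 2) V (\<lambda>P. of_bool (C * sqrt n / 2 \<le> \<bar>real (card P) - rexp (\<lambda>_. 1 / 2) V (\<lambda>P. real (card P))\<bar>))"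
  proof (rule rexp_mono)
    fix P assume P: "P \<subseteq> V"
    have e: "real_of_int (\<Sum>x\<in>V. spin P x) = 2 * real (card P) - n"
      unfolding spin_sum_card[OF V(1) P] n_def by simp
    show "of_bool (\<not> \<bar>real_of_int (\<Sum>x\<in>V. spin P x)\<bar> \<le> C * sqrt n) \<le>
      (of_bool (C * sqrt n / 2 \<le> \<bar>real (card P) - rexp (\<lambda>_. 1 / 2) V (\<lambda>P. real (card P))\<bar>) :: real)"
    proof -
      have h: "k / 2 \<le> \<bar>y - n / 2\<bar>" if "\<not> \<bar>2 * y - n\<bar> \<le> k" for y k :: real
        using that unfolding abs_le_iff by (auto simp: abs_if)
      show ?thesis unfolding e mean of_bool_less_eq_iff by (rule impI, rule h)
    qed
  qed auto
  also have "\<dots> \<le> rvar (\<lambda>_. 1 / 2) V (\<lambda>P. real (card P)) / (C * sqrt n / 2)\<^sup>2"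
    using V C n0 by (intro chebyshev_rexp) auto
  also have "\<dots> = 1 / C\<^sup>2"
    using V C n0 by (simp add: rvar_card n_def[symmetric] power_mult_distrib power_divide)
  finally show ?thesis by (simp add: n_def)
qed

text \<open>With \<open>x = n^(1/5)\<close> the lower bound on the density reads
  \<open>p \<ge> ln n / x^3\<close>, and every quantity that must be large is compared with a power
  of \<open>x\<close>.\<close>

lemma density_bounds:
  fixes x p n :: real
  assumes x: "1 \<le> x" "n = x ^ 5" "1 \<le> ln n" and p: "ln n / x ^ 3 \<le> p"
  shows "x\<^sup>2 * ln n \<le> n * p" "x \<le> n\<^sup>2 * p ^ 3" "(ln n)\<^sup>2 / x \<le> p * (n * p)" "x ^ 4 \<le> n * (sqrt n * p)"
    "x \<le> sqrt n" "x \<le> sqrt (n * p)" "x \<le> n"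
proof -
  have x0: "0 < x" using x by linarith
  have p1: "1 / x ^ 3 \<le> p" using divide_right_mono[OF x(3), of "x ^ 3"] p x0 by simp
  have p0: "0 < p" using p1 x0 by (smt (verit) divide_pos_pos zero_less_power)
  have "n * (ln n / x ^ 3) \<le> n * p" using p x x0 by (intro mult_left_mono) auto
  moreover have "n * (ln n / x ^ 3) = x\<^sup>2 * ln n" using x0 x(2) by (simp add: field_simps power_numeral_reduce)
  ultimately show np: "x\<^sup>2 * ln n \<le> n * p" by simp
  have "(1 / x ^ 3) ^ 3 \<le> p ^ 3" using p1 x0 by (intro power_mono) auto
  then have "n\<^sup>2 * (1 / x ^ 3) ^ 3 \<le> n\<^sup>2 * p ^ 3" by (intro mult_left_mono) auto
  moreover have "n\<^sup>2 * (1 / x ^ 3) ^ 3 = x" using x0 x(2) by (simp add: field_simps power_numeral_reduce)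
  ultimately show "x \<le> n\<^sup>2 * p ^ 3" by simp
  have "(ln n / x ^ 3) * (x\<^sup>2 * ln n) \<le> p * (n * p)" by (intro mult_mono p np) (use p0 x(3) in auto)
  moreover have "(ln n / x ^ 3) * (x\<^sup>2 * ln n) = (ln n)\<^sup>2 / x" using x0 by (simp add: field_simps power_numeral_reduce)
  ultimately show "(ln n)\<^sup>2 / x \<le> p * (n * p)" by simp
  have "x\<^sup>2 * x\<^sup>2 \<le> x ^ 5" using x power_increasing[of 4 5 x] by (simp add: power_numeral_reduce)
  then have s: "x\<^sup>2 \<le> sqrt n" unfolding x(2) by (intro real_le_rsqrt) (simp add: power2_eq_square)
  have xx: "x \<le> x\<^sup>2" using x(1) by (rule self_le_power) simp
  show "x \<le> sqrt n" using s xx by linarith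
  have "x\<^sup>2 * 1 \<le> x\<^sup>2 * ln n" using x(3) by (intro mult_left_mono) auto
  then have "x\<^sup>2 \<le> n * p" using np by linarith
  then show "x \<le> sqrt (n * p)" by (rule real_le_rsqrt)
  have "n * (x\<^sup>2 * (1 / x ^ 3)) \<le> n * (sqrt n * p)" using s p1 x x0 by (intro mult_left_mono mult_mono) auto
  moreover have "n * (x\<^sup>2 * (1 / x ^ 3)) = x ^ 4" using x0 x(2) by (simp add: field_simps power_numeral_reduce)
  ultimately show "x ^ 4 \<le> n * (sqrt n * p)" by simp
  show "x \<le> n" unfolding x(2) using x(1) by (rule self_le_power) simp
qed

lemma finite_set_Pi_pmf:
  assumes "finite A" "\<And>x. x \<in> A \<Longrightarrow> finite (set_pmf (f x))"
  shows "finite (set_pmf (Pi_pmf A d f))"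
  unfolding set_Pi_pmf[OF assms(1)] using assms by (intro finite_PiE_dflt) auto

theorem theorem1p2:
  fixes \<epsilon> lam :: real
  assumes "0 < \<epsilon>" and "\<epsilon> \<le> 1" and "0 < lam"
  shows "\<exists>(n0 :: nat) (lam' :: real). 0 < lam' \<and>
    (\<forall>(n :: nat) (p :: real). n \<ge> n0 \<longrightarrow> 0 \<le> p \<longrightarrow> p \<le> 1 \<longrightarrow>
       lam' * real n powr (- (3 / 5)) * ln (real n) \<le> p \<longrightarrow>
       p \<le> lam * real n powr (- (1 / 2)) \<longrightarrow>
       measure_pmf.prob (pair_pmf (random_graph n p) (random_opinions n))
         {(E, s0). \<forall>v\<in>{1..n}. majority_dynamics E s0 6 v = sgn (\<Sum>u\<in>{1..n}. s0 u)}
         \<ge> 1 - \<epsilon>)"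
proof -
  \<comment> \<open>\<open>L\<close> dominates the bound \<open>lam\<^sup>2\<close> for
    \<open>n p^2\<close> and is at least 1. \<open>C\<close> and \<open>c\<close> make an atypically
    large imbalance cost at most \<open>\<epsilon> / 16\<close> and the main term of a small one
    \<open>\<epsilon> / 8\<close>.\<close>
  define L C c where "L = 1 + lam\<^sup>2" and "C = 4 / \<epsilon>" and "c = \<epsilon> / 32"
  define \<kappa> where "\<kappa> = mean_const L C c"
  define m where "m = max 1 (max (gap_min L C (edge_const L)) (triple_min L C))"
  have LC: "1 \<le> L" "1 \<le> C" "0 < c" using assms by (auto simp: L_def C_def c_def)
  have \<kappa>: "0 < \<kappa>" unfolding \<kappa>_def by (rule mean_const_pos[OF LC])
  have m: "1 \<le> m" "gap_min L C (edge_const L) \<le> m" "triple_min L C \<le> m" by (auto simp: m_def)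
  \<comment> \<open>Each summand is one requirement on \<open>x = n^(1/5)\<close>: \<open>m\<close>
    for the mean degree, the two terms \<open>4 / \<kappa>\<close> and
    \<open>3200 / \<kappa>\<^sup>2\<close> for \<open>Lo\<close>, and the terms with
    \<open>\<epsilon>\<close> for the error probabilities. The number 500000000 outweighs the
    402000000 that stems from \<open>q\<close>.\<close>
  define X where "X = m + 500000000 + 4 / \<kappa> + 3200 / \<kappa>\<^sup>2 + 40 / \<epsilon> + 51200000 / (\<kappa>\<^sup>2 * \<epsilon>)"
  have Xpos: "0 \<le> 4 / \<kappa>" "0 \<le> 3200 / \<kappa>\<^sup>2" "0 \<le> 40 / \<epsilon>" "0 \<le> 51200000 / (\<kappa>\<^sup>2 * \<epsilon>)"
    using \<kappa> assms by auto
  have main: "1 - \<epsilon> \<le> measure_pmf.prob (pair_pmf (random_graph n p) (random_opinions n))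
         {(E, s0). \<forall>v\<in>{1..n}. majority_dynamics E s0 6 v = sgn (\<Sum>u\<in>{1..n}. s0 u)}"
    if nX: "nat \<lceil>X ^ 5\<rceil> \<le> n" and p: "0 \<le> p" "p \<le> 1" "1 * real n powr (- (3 / 5)) * ln (real n) \<le> p"
      "p \<le> lam * real n powr (- (1 / 2))" for n :: nat and p :: real
  proof -
    define V where "V = {1..n}"
    define x where "x = real n powr (1 / 5)"
    define M where "M = real n * p"
    have cV: "card V = n" and fV: "finite V" by (simp_all add: V_def)
    have X1: "1 \<le> X" "500000000 \<le> X" using m Xpos by (auto simp: X_def)
    have nX': "X ^ 5 \<le> real n" using nX by linarith
    have n1: "1 \<le> real n" using nX' one_le_power[OF X1(1), of 5] by linarith
    have pw: "x ^ k = real n powr (real k / 5)" for k :: nat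
    proof -
      have "0 < x" using n1 by (simp add: x_def)
      then have "x ^ k = x powr real k" by (simp only: powr_realpow)
      also have "\<dots> = real n powr (1 / 5 * real k)" unfolding x_def by (rule powr_powr)
      finally show ?thesis by simp
    qed
    have x5: "real n = x ^ 5" using pw[of 5] n1 by simp
    have xX: "X \<le> x"
    proof (rule ccontr)
      assume "\<not> X \<le> x"
      then have "x ^ 5 < X ^ 5" by (intro power_strict_mono) (auto simp: x_def)
      then show False using nX' x5 by simp
    qed
    have x: "1 \<le> x" "500000000 \<le> x" "m \<le> x" "4 / \<kappa> \<le> x" "3200 / \<kappa>\<^sup>2 \<le> x" "40 / \<epsilon> \<le> x" "51200000 / (\<kappa>\<^sup>2 * \<epsilon>) \<le> x"
      using xX X1 m(1) Xpos unfolding X_def by linarith+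
    have x_le_n: "x \<le> real n" unfolding x5 using x(1) by (rule self_le_power) simp
    have V_ne: "V \<noteq> {}" "4 \<le> card V" using x_le_n x(2) by (auto simp: V_def)
    have ln1: "1 \<le> ln (real n)"
    proof -
      have "exp 1 \<le> real n" using exp_le x_le_n x(2) by (smt (verit))
      then show ?thesis using n1 by (simp add: ln_ge_iff)
    qed
    have px: "ln (real n) / x ^ 3 \<le> p"
    proof -
      have x3: "x ^ 3 = real n powr (3 / 5)" using pw[of 3] by simp
      have "real n powr (- (3 / 5)) = 1 / x ^ 3" unfolding x3 by (rule powr_minus_divide)
      then have "1 * (1 / x ^ 3) * ln (real n) \<le> p" using p(3) by (simp only:)
      then show ?thesis by simp
    qed
    note d = density_bounds[OF x(1) x5 ln1 px]
    have p0: "0 < p" using px ln1 x(1) by (smt (verit) divide_pos_pos zero_less_power)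
    have np2: "real n * p\<^sup>2 \<le> L"
    proof -
      have "p\<^sup>2 \<le> (lam * real n powr (- (1 / 2)))\<^sup>2" by (rule power_mono[OF p(4) p(1)])
      also have "real n powr (- (1 / 2)) = 1 / sqrt (real n)"
        unfolding powr_minus_divide using n1 by (simp add: powr_half_sqrt)
      also have "(lam * (1 / sqrt (real n)))\<^sup>2 = lam\<^sup>2 / real n" by (simp add: power_mult_distrib power_divide)
      finally have "real n * p\<^sup>2 \<le> lam\<^sup>2" using n1 by (simp add: field_simps)
      then show ?thesis by (simp add: L_def)
    qed
    have Mx: "x \<le> sqrt M" "x \<le> M" "x\<^sup>2 * ln (real n) \<le> M"
    proof -
      show "x \<le> sqrt M" "x\<^sup>2 * ln (real n) \<le> M" using d(1,6) by (simp_all add: M_def)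
      have "x * 1 \<le> x\<^sup>2 * ln (real n)"
        using x(1) ln1 self_le_power[of x 2] by (intro mult_mono) auto
      then show "x \<le> M" using \<open>x\<^sup>2 * ln (real n) \<le> M\<close> by linarith
    qed
    have M0: "0 < M" using Mx(2) x(1) by linarith
    define Lo where "Lo = \<kappa> * (real n * (sqrt (real n) * p)) / 2"
    have Lo2: "2 \<le> Lo"
    proof -
      have "4 \<le> \<kappa> * x" using x(4) \<kappa> by (simp add: field_simps)
      also have "\<dots> \<le> \<kappa> * x ^ 4" using \<kappa> x(1) by (intro mult_left_mono self_le_power) auto
      also have "\<dots> \<le> \<kappa> * (real n * (sqrt (real n) * p))" using d(4) \<kappa> by (intro mult_left_mono) auto
      finally show ?thesis by (simp add: Lo_def)
    qed
    have Lo3: "800 * real n \<le> p * Lo\<^sup>2"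
    proof -
      have "3200 \<le> \<kappa>\<^sup>2 * x" using x(5) \<kappa> by (simp add: field_simps)
      also have "\<dots> \<le> \<kappa>\<^sup>2 * ((real n)\<^sup>2 * p ^ 3)" using d(2) by (intro mult_left_mono) auto
      finally have "3200 * (real n / 4) \<le> \<kappa>\<^sup>2 * ((real n)\<^sup>2 * p ^ 3) * (real n / 4)" by (intro mult_right_mono) auto
      moreover have "p * Lo\<^sup>2 = \<kappa>\<^sup>2 * ((real n)\<^sup>2 * p ^ 3) * (real n / 4)"
        unfolding Lo_def by (simp add: power_mult_distrib power_divide power_numeral_reduce)
      ultimately show ?thesis by simp
    qed
    define q where "q = 402000 * ln (real n) / (p * M)"
    have q: "q * ln (real n) \<le> 402000 * x" "q \<le> 402000 * x"
    proof -
      have pM: "0 < p * M" using p0 M0 by simp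
      have "(ln (real n))\<^sup>2 \<le> x * (p * M)" using d(3) x(1) by (simp add: M_def field_simps)
      then have "402000 * (ln (real n))\<^sup>2 / (p * M) \<le> 402000 * x" using pM by (simp add: field_simps)
      then show a: "q * ln (real n) \<le> 402000 * x" by (simp add: q_def power2_eq_square)
      have "0 \<le> q" using ln1 pM by (simp add: q_def)
      then have "q * 1 \<le> q * ln (real n)" using ln1 by (intro mult_left_mono)
      then show "q \<le> 402000 * x" using a by linarith
    qed
    have q4: "4 * q \<le> real n"
    proof -
      have "4 * q \<le> x * x" using q(2) mult_right_mono[OF x(2), of x] x(1) by linarith
      also have "\<dots> \<le> x ^ 5" using power_increasing[of 2 5 x] x(1) by (simp add: power2_eq_square)
      finally show ?thesis by (simp add: x5)
    qed
    \<comment> \<open>The tightest numerical comparison: \<open>q * ln n\<close> is O(x), while M is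
      at least \<open>x^2 * ln n\<close>, so one factor \<open>x\<close> decides.\<close>
    have q5: "1000 * (2 + q) * ln (real n) < M"
    proof -
      have "1000 * (2 + q) * ln (real n) = 2000 * ln (real n) + 1000 * (q * ln (real n))" by (simp add: algebra_simps)
      also have "\<dots> \<le> 2000 * ln (real n) + 402000000 * x" using q(1) by simp
      also have "402000000 * x \<le> 402000000 * x * ln (real n)" using x(1) ln1 mult_left_mono[OF ln1, of "402000000 * x"] by simp
      finally have "1000 * (2 + q) * ln (real n) \<le> (2000 + 402000000 * x) * ln (real n)" by (simp add: algebra_simps)
      also have "\<dots> < x\<^sup>2 * ln (real n)"
      proof (rule mult_strict_right_mono)
        have "500000000 * x \<le> x\<^sup>2" using mult_right_mono[OF x(2), of x] x(1) by (simp add: power2_eq_square)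
        then show "2000 + 402000000 * x < x\<^sup>2" using x(2) by linarith
      qed (use ln1 in linarith)
      finally show ?thesis using Mx(3) by linarith
    qed
    have M_ge: "800 \<le> M" "2000 * ln (real n) \<le> M"
    proof -
      show "800 \<le> M" using Mx(2) x(2) by linarith
      have "2000 \<le> x\<^sup>2" using x(2) self_le_power[OF x(1), of 2] by simp
      then have "2000 * ln (real n) \<le> x\<^sup>2 * ln (real n)" using ln1 by (intro mult_right_mono) auto
      then show "2000 * ln (real n) \<le> M" using Mx(3) by linarith
    qed
    let ?G = "\<lambda>f. rexp (\<lambda>_. p) (all_pairs V) f"
    let ?O = "\<lambda>f. rexp (\<lambda>_. 1 / 2) V f"
    have graph: "?G (\<lambda>A. of_bool (\<not> (\<forall>v\<in>V. majority_dynamics A (spin P) 6 v = sgn (\<Sum>u\<in>V. spin P u)))) \<le> \<epsilon> / 2"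
      if P: "c * sqrt (real n) \<le> \<bar>real_of_int (\<Sum>u\<in>V. spin P u)\<bar>" "\<bar>real_of_int (\<Sum>u\<in>V. spin P u)\<bar> \<le> C * sqrt (real n)" for P
    proof -
      have reg: "regime m L C V (spin P) p"
        unfolding regime_def cV using fV p0 p(2) P(2) np2 Mx(2) x(3) by (auto simp: spin_def M_def)
      have "?G (\<lambda>A. of_bool (\<not> (\<forall>v\<in>V. majority_dynamics A (spin P) 6 v = sgn (\<Sum>u\<in>V. spin P u))))
        \<le> exp (- real (card V)) + 9 / real (card V) + 12800000 / (\<kappa>\<^sup>2 * sqrt M)"
        by (rule win_prob_sgn[OF reg m(2,3) LC(1,2,3) _ _ \<kappa>_def V_ne(2) _ Lo2 _ M_ge(1)])
          (unfold cV, fact P(1), fact M_def, fact Lo_def, fact Lo3, fact M_ge(2), fact q_def, fact q4, fact q5)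
      also have "exp (- real (card V)) \<le> 1 / real (card V)"
      proof -
        have "exp (- real n) \<le> 1 / (1 + real n)" by (rule exp_minus_le) simp
        also have "\<dots> \<le> 1 / real n" using n1 by (intro divide_left_mono) auto
        finally show ?thesis by (simp add: cV)
      qed
      also have "1 / real (card V) + 9 / real (card V) \<le> \<epsilon> / 4"
      proof -
        have "40 / \<epsilon> \<le> real n" using x(6) x_le_n by linarith
        then show ?thesis using assms(1) n1 by (simp add: cV field_simps)
      qed
      also have "12800000 / (\<kappa>\<^sup>2 * sqrt M) \<le> \<epsilon> / 4"
      proof -
        have "51200000 / (\<kappa>\<^sup>2 * \<epsilon>) \<le> sqrt M" using x(7) Mx(1) by linarith
        moreover have "0 < sqrt M" "0 < \<kappa>\<^sup>2" using M0 \<kappa> by auto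
        ultimately show ?thesis using assms(1) by (simp add: field_simps)
      qed
      finally show ?thesis by simp
    qed
    have bad: "?O (\<lambda>P. ?G (\<lambda>A. of_bool (\<not> (\<forall>v\<in>V. majority_dynamics A (spin P) 6 v = sgn (\<Sum>u\<in>V. spin P u))))) \<le> \<epsilon>"
    proof -
      have "?O (\<lambda>P. ?G (\<lambda>A. of_bool (\<not> (\<forall>v\<in>V. majority_dynamics A (spin P) 6 v = sgn (\<Sum>u\<in>V. spin P u))))) \<le>
        ?O (\<lambda>P. \<epsilon> / 2 + (of_bool (\<not> c * sqrt (real (card V)) \<le> \<bar>real_of_int (\<Sum>u\<in>V. spin P u)\<bar>) +
          of_bool (\<not> \<bar>real_of_int (\<Sum>u\<in>V. spin P u)\<bar> \<le> C * sqrt (real (card V)))))"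
      proof (rule rexp_mono)
        fix P
        have "?G (\<lambda>A. of_bool (\<not> (\<forall>v\<in>V. majority_dynamics A (spin P) 6 v = sgn (\<Sum>u\<in>V. spin P u)))) \<le> 1"
          using fV p by (intro rexp_le_const) auto
        then show "?G (\<lambda>A. of_bool (\<not> (\<forall>v\<in>V. majority_dynamics A (spin P) 6 v = sgn (\<Sum>u\<in>V. spin P u)))) \<le>
          \<epsilon> / 2 + (of_bool (\<not> c * sqrt (real (card V)) \<le> \<bar>real_of_int (\<Sum>u\<in>V. spin P u)\<bar>) +
          of_bool (\<not> \<bar>real_of_int (\<Sum>u\<in>V. spin P u)\<bar> \<le> C * sqrt (real (card V))))"
          using graph[of P] assms(1) unfolding cV
          by (cases "c * sqrt (real n) \<le> \<bar>real_of_int (\<Sum>u\<in>V. spin P u)\<bar>";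
              cases "\<bar>real_of_int (\<Sum>u\<in>V. spin P u)\<bar> \<le> C * sqrt (real n)") (simp_all only: of_bool_eq simp_thms, linarith+)
      qed auto
      also have "\<dots> \<le> \<epsilon> / 2 + ((4 * c + 4 / sqrt (real (card V))) + 1 / C\<^sup>2)"
        unfolding rexp_add rexp_const[OF fV]
        using fV V_ne LC by (intro add_mono order_refl small_bias_prob large_bias_prob) auto
      \<comment> \<open>The shares are \<open>\<epsilon> / 2\<close> for the graph,
        \<open>\<epsilon> / 8 + \<epsilon> / 10\<close> for a small imbalance and
        \<open>\<epsilon> / 16\<close> for a large one.\<close>
      also have "\<dots> \<le> \<epsilon>"
      proof -
        have "4 / sqrt (real n) \<le> \<epsilon> / 10"
        proof -
          have "40 / \<epsilon> \<le> sqrt (real n)" using x(6) d(5) by linarith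
          then show ?thesis using assms(1) n1 by (simp add: field_simps)
        qed
        moreover have "1 / C\<^sup>2 \<le> \<epsilon> / 16"
        proof -
          have "1 / C\<^sup>2 = \<epsilon> * \<epsilon> / 16" by (simp add: C_def power_divide power2_eq_square)
          also have "\<dots> \<le> \<epsilon> * 1 / 16" using assms by (intro divide_right_mono mult_left_mono) auto
          finally show ?thesis by simp
        qed
        ultimately show ?thesis using assms(1) by (simp add: cV c_def)
      qed
      finally show ?thesis .
    qed
    let ?ev = "{(E, s0). \<forall>v\<in>{1..n}. majority_dynamics E s0 6 v = sgn (\<Sum>u\<in>{1..n}. s0 u)}"
    have fin: "finite (set_pmf (random_graph n p))" "finite (set_pmf (random_opinions n))"
    proof -
      have "finite (vertex_pairs n)" unfolding vertex_pairs_def by (rule finite_subset[of _ "Pow {1..n}"]) auto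
      then show "finite (set_pmf (random_graph n p))" unfolding random_graph_def
        unfolding set_map_pmf by (intro finite_imageI finite_set_Pi_pmf) auto
      show "finite (set_pmf (random_opinions n))" unfolding random_opinions_def
        by (intro finite_set_Pi_pmf) (auto simp: set_pmf_of_set)
    qed
    have "measure_pmf.prob (pair_pmf (random_graph n p) (random_opinions n)) ?ev =
      ?O (\<lambda>P. ?G (\<lambda>A. of_bool ((A, \<lambda>x. if x \<in> {1..n} then spin P x else 0) \<in> ?ev)))"
      unfolding prob_pair_finite[OF fin] expectation_random_opinions expectation_random_graph[OF p(1,2)] V_def ..
    also have "\<dots> = ?O (\<lambda>P. ?G (\<lambda>A. 1 - of_bool (\<not> (\<forall>v\<in>V. majority_dynamics A (spin P) 6 v = sgn (\<Sum>u\<in>V. spin P u)))))"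
    proof (intro rexp_cong refl)
      \<comment> \<open>All edges lie inside the vertex set, so the dummy opinions outside it
        influence neither the dynamics nor the sum.\<close>
      fix P A assume A: "A \<subseteq> all_pairs V"
      have "majority_dynamics A (\<lambda>x. if x \<in> {1..n} then spin P x else 0) 6 v = majority_dynamics A (spin P) 6 v" if "v \<in> V" for v
        by (rule majority_dynamics_cong[OF A _ that]) (simp add: V_def)
      moreover have "(\<Sum>u\<in>V. if u \<in> {1..n} then spin P u else 0) = (\<Sum>u\<in>V. spin P u)"
        by (intro sum.cong) (auto simp: V_def)
      ultimately show "of_bool ((A, \<lambda>x. if x \<in> {1..n} then spin P x else 0) \<in> ?ev) =
        1 - (of_bool (\<not> (\<forall>v\<in>V. majority_dynamics A (spin P) 6 v = sgn (\<Sum>u\<in>V. spin P u))) :: real)"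
        unfolding V_def[symmetric] by (auto simp: of_bool_def)
    qed
    also have "\<dots> = 1 - ?O (\<lambda>P. ?G (\<lambda>A. of_bool (\<not> (\<forall>v\<in>V. majority_dynamics A (spin P) 6 v = sgn (\<Sum>u\<in>V. spin P u)))))"
      using fV by (simp only: rexp_diff rexp_const finite_all_pairs)
    finally show ?thesis using bad by linarith
  qed
  show ?thesis
    by (intro exI[of _ "nat \<lceil>X ^ 5\<rceil>"] exI[of _ 1] conjI allI impI main) auto
qed

end
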